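(* Let $k\in\mathbb{Z}_{\ge0}^{S}$ have exactly one nonzero entry, $k_\sigma=k$, with $0\le k\le q^{2}/2$, and write $k=dq+r$ with $0\le r<q-d$. Let $a\in\mathcal{O}_{C}$ with $0<v_{F}(a)\le e$, and assume that either $0<v_{F}(a)\le1$ or $2v_{F}(a)-1\le r$. Then the pair $(k,a)$ is separated.
   Context: $p$ is a prime; $F$ is a finite extension of $\mathbb{Q}_{p}$ with ring of integers $\mathcal{O}_{F}$, fixed uniformizer $\varpi$, residue field $\kappa_F$ of cardinality $q$, ramification index $e$. $C$ is a finite extension of $\mathbb{Q}_{p}$ such that $S=\mathrm{Hom}_{\mathbb{Q}_p\text{-alg}}(F,C)$ has $[F:\mathbb{Q}_{p}]$ elements and $C$ contains a fixed square root of $\sigma(\varpi)$ for each $\sigma\in S$. $v_F$ is the valuation on $\overline{\mathbb{Q}}_p$ with $v_F(\varpi)=1$. In statements about $\mathcal{O}_C$-modules, $\varpi^{n}$ ($n\in\mathbb{Z}$) means $\sigma(\varpi)^{n}$ for a fixed $\sigma\in S$. $G=GL_{2}(F)$, $K=GL_{2}(\mathcal{O}_{F})$, $Z$ the center, $\alpha=\mathrm{diag}(1,\varpi)$, $\chi(g)=\varpi^{-v_{F}(\det g)}$. For $k\in\mathbb{Z}_{\ge0}^{S}$, $V_{k}=\bigotimes_{\sigma\in S}V^{\sigma}_{k_\sigma}$ with $V^{\sigma}_{k_\sigma}$ the homogeneous polynomials of degree $k_\sigma$ in $x_\sigma,y_\sigma$ over $C$, where $g=\begin{pmatrix}a&b\\c&d\end{pmatrix}$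 acts by $x_\sigma^{k_\sigma-i}y_\sigma^{i}\mapsto \sigma(\chi(g))^{k_\sigma/2}(\sigma(a)x_\sigma+\sigma(c)y_\sigma)^{k_\sigma-i}(\sigma(b)x_\sigma+\sigma(d)y_\sigma)^{i}$, diagonally (representation $\rho_k$); $V_k^0$ is the $\mathcal{O}_C$-span of tensor products of monomials. $U_k$ multiplies $\bigotimes_\sigma x_\sigma^{k_\sigma-i_\sigma}y_\sigma^{i_\sigma}$ by $\prod_\sigma\sigma(\varpi)^{k_\sigma-i_\sigma}$; $\psi$ is the unique function $G\to\mathrm{End}_C(V_k)$ supported on $KZ\alpha^{-1}KZ$ with $\psi(\kappa_1\alpha^{-1}\kappa_2)=\rho_k(\kappa_1)U_k\rho_k(\kappa_2)$ ($\kappa_i\in KZ$). $\mathrm{ind}_{KZ}^{G}W$ ($W=V_k$ or $V_k^0$) consists of $f:G\to W$ with $f(\kappa g)=\rho_k(\kappa)f(g)$ ($\kappa\in KZ$), supported on finitely many cosets $KZg$; $[g,v]$ is supported on $KZg^{-1}$ with value $v$ at $g^{-1}$. $T([g,v])=\sum_{xKZ\in G/KZ}[gx,\psi(x^{-1})v]$. Supports: $I_0=\{0\}$, $I_{n}=\{\sum_{i=0}^{n-1}\varpi^{i}[\mu_{i}]:\mu_i\in\kappa_F\}$; $g_{n,\mu}^{0}=\begin{pmatrix}\varpi^{n}&\mu\\0&1\end{pmatrix}$, $g_{n,\mu}^{1}=\begin{pmatrix}1&0\\\varpi\mu&\varpi^{n+1}\end{pmatrix}$. Every $f$ is uniquely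 a finite sum $\sum_{n,\mu}([g^0_{n,\mu},v^0_{n,\mu}]+[g^1_{n,\mu},v^1_{n,\mu}])$; $f\in B_N$ means $v^0_{n,\mu}=0$ for $n>N$ and $v^1_{n,\mu}=0$ for $n>N-1$; $f\in B^0$ means all $v^1_{n,\mu}=0$. The pair $(k,a)$ is separated if for all sufficiently large $N\in\mathbb{Z}_{>0}$ there is $\epsilon\in\mathbb{Z}_{\ge0}$ depending only on $N,k,a$ such that for all $n\in\mathbb{Z}_{\ge0}$ and all $f\in\mathrm{ind}_{KZ}^GV_k$ with $f\in B^0$: $(T-a)(f)\in B_N+\varpi^n\mathrm{ind}_{KZ}^GV_k^0$ implies $f\in B_{N-1}+\varpi^{n-\epsilon}\mathrm{ind}_{KZ}^GV_k^0$. *)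

theory Defs
  imports
    "HOL-Analysis.Analysis"
    "HOL-Computational_Algebra.Computational_Algebra"
    "HOL-Library.Function_Algebras"
begin

section \<open>Finite extensions of the p-adic numbers\<close>

definition padic_abs_rat :: "nat \<Rightarrow> rat \<Rightarrow> real" where
  "padic_abs_rat p r =
     (if r = 0 then 0
      else real p powi (int (multiplicity (int p) (snd (quotient_of r)))
                      - int (multiplicity (int p) (fst (quotient_of r)))))"

definition nonarch_abs :: "('a::field \<Rightarrow> real) \<Rightarrow> bool" where
  "nonarch_abs N \<longleftrightarrow>
     (\<forall>x. 0 \<le> N x) \<and> (\<forall>x. N x = 0 \<longleftrightarrow> x = 0) \<and>
     (\<forall>x y. N (x * y) = N x * N y) \<and> (\<forall>x y. N (x + y) \<le> max (N x) (N y))"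

text \<open>The field of p-adic numbers, as a completion of the rationals for the p-adic
  absolute value (which determines it up to unique isomorphism).\<close>

definition is_padic_field :: "nat \<Rightarrow> ('k::field_char_0 \<Rightarrow> real) \<Rightarrow> bool" where
  "is_padic_field p N \<longleftrightarrow>
     nonarch_abs N \<and>
     (\<forall>r. N (of_rat r) = padic_abs_rat p r) \<and>
     (\<forall>x. \<forall>\<epsilon>>0. \<exists>r. N (x - of_rat r) < \<epsilon>) \<and>
     Metric_space.mcomplete UNIV (\<lambda>x y. N (x - y))"

definition is_ring_hom :: "('a::field \<Rightarrow> 'b::field) \<Rightarrow> bool" where
  "is_ring_hom \<phi> \<longleftrightarrow>
     \<phi> 1 = 1 \<and> (\<forall>x y. \<phi> (x + y) = \<phi> x + \<phi> y) \<and> (\<forall>x y. \<phi> (x * y) = \<phi> x * \<phi> y)"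

definition ext_degree :: "('k::field \<Rightarrow> 'l::field) \<Rightarrow> nat" where
  "ext_degree \<iota> = vector_space.dim (\<lambda>c x. \<iota> c * x) UNIV"

text \<open>A finite extension of a valued field, given by its structure map, together with
  an absolute value extending the one of the base. Over a complete base that absolute value
  is unique, so it is not additional structure.\<close>

definition finite_valued_ext ::
  "('k::field \<Rightarrow> real) \<Rightarrow> ('k \<Rightarrow> 'l::field) \<Rightarrow> ('l \<Rightarrow> real) \<Rightarrow> bool" where
  "finite_valued_ext N \<iota> N' \<longleftrightarrow>
     is_ring_hom \<iota> \<and>
     (\<exists>B. finite B \<and> module.span (\<lambda>c x. \<iota> c * x) B = UNIV) \<and>
     nonarch_abs N' \<and> (\<forall>x. N' (\<iota> x) = N x)"

definition int_ring :: "('l::field \<Rightarrow> real) \<Rightarrow> 'l set" where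
  "int_ring N = {x. N x \<le> 1}"

definition residue_field :: "('l::field \<Rightarrow> real) \<Rightarrow> 'l set set" where
  "residue_field N =
     int_ring N // {(x, y). x \<in> int_ring N \<and> y \<in> int_ring N \<and> N (x - y) < 1}"

definition is_uniformizer :: "('l::field \<Rightarrow> real) \<Rightarrow> 'l \<Rightarrow> bool" where
  "is_uniformizer N \<pi> \<longleftrightarrow> {x. N x < 1} = (\<lambda>y. \<pi> * y) ` int_ring N"


section \<open>The setting\<close>

text \<open>Type \<open>'k\<close> carries the p-adic numbers, \<open>'f\<close> the field \<open>F\<close> and \<open>'c\<close> the coefficient
  field \<open>C\<close>. The last two components are the chosen square roots of the \<open>\<sigma>(\<pi>)\<close> and the
  embedding through which powers of the uniformizer act on modules over the integers of \<open>C\<close>.\<close>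

record ('k, 'f, 'c) padic_data =
  res_char :: nat
  absQ :: "'k \<Rightarrow> real"
  mapF :: "'k \<Rightarrow> 'f"
  absF :: "'f \<Rightarrow> real"
  mapC :: "'k \<Rightarrow> 'c"
  absC :: "'c \<Rightarrow> real"
  unif :: 'f
  root_unif :: "('f \<Rightarrow> 'c) \<Rightarrow> 'c"
  base_emb :: "'f \<Rightarrow> 'c"

definition embeddings ::
  "('k::field_char_0, 'f::field, 'c::field) padic_data \<Rightarrow> ('f \<Rightarrow> 'c) set" where
  "embeddings D = {\<sigma>. is_ring_hom \<sigma> \<and> (\<forall>x. \<sigma> (mapF D x) = mapC D x)}"

locale padic_setting =
  fixes D :: "('k::field_char_0, 'f::field, 'c::field) padic_data"
  assumes prime_res_char: "prime (res_char D)"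
    and padic_field: "is_padic_field (res_char D) (absQ D)"
    and ext_F: "finite_valued_ext (absQ D) (mapF D) (absF D)"
    and ext_C: "finite_valued_ext (absQ D) (mapC D) (absC D)"
    and card_embeddings: "card (embeddings D) = ext_degree (mapF D)"
    and uniformizer: "is_uniformizer (absF D) (unif D)"
    and root_unif: "\<And>\<sigma>. \<sigma> \<in> embeddings D \<Longrightarrow> (root_unif D \<sigma>)\<^sup>2 = \<sigma> (unif D)"
    and base_emb: "base_emb D \<in> embeddings D"

text \<open>The valuation normalised by the uniformizer of \<open>F\<close>, integer-valued on the nonzero
  elements of \<open>F\<close> and extended-real-valued on \<open>C\<close>.\<close>

definition ordF :: "('k, 'f::field, 'c) padic_data \<Rightarrow> 'f \<Rightarrow> int" where
  "ordF D x = (THE n. absF D x = absF D (unif D) powi n)"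

definition valF :: "('k, 'f, 'c::field) padic_data \<Rightarrow> 'c \<Rightarrow> ereal" where
  "valF D x = (if x = 0 then \<infinity> else ereal (log (absF D (unif D)) (absC D x)))"

definition ram_index :: "('k, 'f::field, 'c) padic_data \<Rightarrow> nat" where
  "ram_index D = nat (ordF D (of_nat (res_char D)))"

definition res_card :: "('k, 'f::field, 'c) padic_data \<Rightarrow> nat" where
  "res_card D = card (residue_field (absF D))"

definition teichmueller :: "('k, 'f::field, 'c) padic_data \<Rightarrow> 'f set \<Rightarrow> 'f" where
  "teichmueller D \<mu> = (THE t. t \<in> \<mu> \<and> t ^ res_card D = t)"


section \<open>The groups and the weights\<close>

definition mat2 :: "'a::zero \<Rightarrow> 'a \<Rightarrow> 'a \<Rightarrow> 'a \<Rightarrow> 'a^2^2" where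
  "mat2 a b c d = vector [vector [a, b], vector [c, d]]"

definition GL2 :: "('f::field^2^2) set" where
  "GL2 = {g. invertible g}"

definition centerGL2 :: "('f::field^2^2) set" where
  "centerGL2 = {z \<in> GL2. \<forall>g\<in>GL2. z ** g = g ** z}"

definition maxcompact :: "('k, 'f::field, 'c) padic_data \<Rightarrow> ('f^2^2) set" where
  "maxcompact D =
     {g. (\<forall>i j. g $ i $ j \<in> int_ring (absF D)) \<and>
         (\<exists>h. (\<forall>i j. h $ i $ j \<in> int_ring (absF D)) \<and> g ** h = mat 1 \<and> h ** g = mat 1)}"

definition KZ :: "('k, 'f::field, 'c) padic_data \<Rightarrow> ('f^2^2) set" where
  "KZ D = {g ** z | g z. g \<in> maxcompact D \<and> z \<in> centerGL2}"

definition alpha :: "('k, 'f::field, 'c) padic_data \<Rightarrow> 'f^2^2" where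
  "alpha D = mat2 1 0 0 (unif D)"

text \<open>The tensor product \<open>V\<^sub>k\<close> is represented in coordinates: \<open>i\<close> in \<open>monomials D k\<close> stands
  for the tensor product over \<open>\<sigma>\<close> of \<open>x\<^sub>\<sigma>^(k \<sigma> - i \<sigma>) y\<^sub>\<sigma>^(i \<sigma>)\<close>, and a vector is the family of
  its coefficients on these basis elements.\<close>

type_synonym ('f, 'c) weight_vec = "(('f \<Rightarrow> 'c) \<Rightarrow> nat) \<Rightarrow> 'c"

definition monomials ::
  "('k::field_char_0, 'f::field, 'c::field) padic_data \<Rightarrow> (('f \<Rightarrow> 'c) \<Rightarrow> nat) \<Rightarrow> (('f \<Rightarrow> 'c) \<Rightarrow> nat) set"
  where
  "monomials D k =
     {i. (\<forall>\<sigma>\<in>embeddings D. i \<sigma> \<le> k \<sigma>) \<and> (\<forall>\<sigma>. \<sigma> \<notin> embeddings D \<longrightarrow> i \<sigma> = 0)}"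

definition weight ::
  "('k::field_char_0, 'f::field, 'c::field) padic_data \<Rightarrow> (('f \<Rightarrow> 'c) \<Rightarrow> nat) \<Rightarrow> ('f, 'c) weight_vec set"
  where
  "weight D k = {v. \<forall>i. i \<notin> monomials D k \<longrightarrow> v i = 0}"

definition weight_lattice ::
  "('k::field_char_0, 'f::field, 'c::field) padic_data \<Rightarrow> (('f \<Rightarrow> 'c) \<Rightarrow> nat) \<Rightarrow> ('f, 'c) weight_vec set"
  where
  "weight_lattice D k = {v \<in> weight D k. \<forall>i. v i \<in> int_ring (absC D)}"

text \<open>A binary form of degree \<open>m\<close> is read as a univariate polynomial whose coefficient of
  index \<open>j\<close> is that of \<open>x^(m - j) y^j\<close>; thus \<open>[:A, B:]\<close> is \<open>A x + B y\<close>. The factor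
  \<open>\<sigma>(\<chi>(g))^(k\<^sub>\<sigma>/2)\<close> is a power of the chosen square root of \<open>\<sigma>(\<pi>)\<close>.\<close>

definition rho ::
  "('k::field_char_0, 'f::field, 'c::field) padic_data \<Rightarrow> (('f \<Rightarrow> 'c) \<Rightarrow> nat) \<Rightarrow> 'f^2^2 \<Rightarrow>
   ('f, 'c) weight_vec \<Rightarrow> ('f, 'c) weight_vec"
  where
  "rho D k g v = (\<lambda>j.
     if j \<in> monomials D k then
       \<Sum>i\<in>monomials D k. v i *
         (\<Prod>\<sigma>\<in>embeddings D.
            root_unif D \<sigma> powi (- ordF D (det g) * int (k \<sigma>)) *
            coeff ([:\<sigma> (g $ 1 $ 1), \<sigma> (g $ 2 $ 1):] ^ (k \<sigma> - i \<sigma>) *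
                   [:\<sigma> (g $ 1 $ 2), \<sigma> (g $ 2 $ 2):] ^ i \<sigma>) (j \<sigma>))
     else 0)"

definition U_op ::
  "('k::field_char_0, 'f::field, 'c::field) padic_data \<Rightarrow> (('f \<Rightarrow> 'c) \<Rightarrow> nat) \<Rightarrow>
   ('f, 'c) weight_vec \<Rightarrow> ('f, 'c) weight_vec"
  where
  "U_op D k v = (\<lambda>i. (\<Prod>\<sigma>\<in>embeddings D. \<sigma> (unif D) ^ (k \<sigma> - i \<sigma>)) * v i)"

definition psi ::
  "('k::field_char_0, 'f::field, 'c::field) padic_data \<Rightarrow> (('f \<Rightarrow> 'c) \<Rightarrow> nat) \<Rightarrow> 'f^2^2 \<Rightarrow>
   ('f, 'c) weight_vec \<Rightarrow> ('f, 'c) weight_vec"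
  where
  "psi D k = (THE \<psi>.
     (\<forall>x. x \<notin> {\<kappa>1 ** matrix_inv (alpha D) ** \<kappa>2 | \<kappa>1 \<kappa>2. \<kappa>1 \<in> KZ D \<and> \<kappa>2 \<in> KZ D}
        \<longrightarrow> \<psi> x = (\<lambda>v. 0)) \<and>
     (\<forall>\<kappa>1\<in>KZ D. \<forall>\<kappa>2\<in>KZ D.
        \<psi> (\<kappa>1 ** matrix_inv (alpha D) ** \<kappa>2) = rho D k \<kappa>1 \<circ> U_op D k \<circ> rho D k \<kappa>2))"


section \<open>Compact induction and the Hecke operator\<close>

type_synonym ('f, 'c) ind_fun = "'f^2^2 \<Rightarrow> ('f, 'c) weight_vec"

text \<open>Functions on the group are extended by zero to all matrices.\<close>

definition c_ind ::
  "('k::field_char_0, 'f::field, 'c::field) padic_data \<Rightarrow> (('f \<Rightarrow> 'c) \<Rightarrow> nat) \<Rightarrow>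
   ('f, 'c) weight_vec set \<Rightarrow> ('f, 'c) ind_fun set"
  where
  "c_ind D k W =
     {f. (\<forall>g\<in>GL2. f g \<in> W) \<and> (\<forall>g. g \<notin> GL2 \<longrightarrow> f g = 0) \<and>
         (\<forall>\<kappa>\<in>KZ D. \<forall>g\<in>GL2. f (\<kappa> ** g) = rho D k \<kappa> (f g)) \<and>
         finite {(\<lambda>\<kappa>. \<kappa> ** g) ` KZ D | g. g \<in> GL2 \<and> f g \<noteq> 0}}"

definition elem ::
  "('k::field_char_0, 'f::field, 'c::field) padic_data \<Rightarrow> (('f \<Rightarrow> 'c) \<Rightarrow> nat) \<Rightarrow> 'f^2^2 \<Rightarrow>
   ('f, 'c) weight_vec \<Rightarrow> ('f, 'c) ind_fun"
  where
  "elem D k g v = (\<lambda>h. if h ** g \<in> KZ D then rho D k (h ** g) v else 0)"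

text \<open>The sum over \<open>G/KZ\<close> has only finitely many nonzero terms and is restricted to these,
  since \<open>sum\<close> vanishes on infinite index sets. A term does not depend on the representative.\<close>

definition hecke_elem ::
  "('k::field_char_0, 'f::field, 'c::field) padic_data \<Rightarrow> (('f \<Rightarrow> 'c) \<Rightarrow> nat) \<Rightarrow> 'f^2^2 \<Rightarrow>
   ('f, 'c) weight_vec \<Rightarrow> ('f, 'c) ind_fun"
  where
  "hecke_elem D k g v =
     (let summand = (\<lambda>X. let x = (SOME x. x \<in> X) in elem D k (g ** x) (psi D k (matrix_inv x) v))
      in \<Sum>X\<in>{X \<in> {(\<lambda>\<kappa>. x ** \<kappa>) ` KZ D | x. x \<in> GL2}. summand X \<noteq> 0}. summand X)"

text \<open>Linear extension to the whole induction, through the expansion of \<open>f\<close> as the sum of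
  \<open>[y\<inverse>, f(y)]\<close> over representatives \<open>y\<close> of the cosets \<open>KZ y\<close> in its support.\<close>

definition hecke ::
  "('k::field_char_0, 'f::field, 'c::field) padic_data \<Rightarrow> (('f \<Rightarrow> 'c) \<Rightarrow> nat) \<Rightarrow>
   ('f, 'c) ind_fun \<Rightarrow> ('f, 'c) ind_fun"
  where
  "hecke D k f =
     (\<Sum>Y\<in>{(\<lambda>\<kappa>. \<kappa> ** g) ` KZ D | g. g \<in> GL2 \<and> f g \<noteq> 0}.
        let y = (SOME y. y \<in> Y) in hecke_elem D k (matrix_inv y) (f y))"


section \<open>Supports and separated pairs\<close>

definition digits :: "('k, 'f::field, 'c) padic_data \<Rightarrow> nat \<Rightarrow> 'f set" where
  "digits D n =
     {\<Sum>i<n. unif D ^ i * teichmueller D (\<mu> i) | \<mu>. \<forall>i<n. \<mu> i \<in> residue_field (absF D)}"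

definition g0 :: "('k, 'f::field, 'c) padic_data \<Rightarrow> nat \<Rightarrow> 'f \<Rightarrow> 'f^2^2" where
  "g0 D n \<mu> = mat2 (unif D ^ n) \<mu> 0 1"

definition g1 :: "('k, 'f::field, 'c) padic_data \<Rightarrow> nat \<Rightarrow> 'f \<Rightarrow> 'f^2^2" where
  "g1 D n \<mu> = mat2 1 0 (unif D * \<mu>) (unif D ^ (n + 1))"

definition is_expansion ::
  "('k::field_char_0, 'f::field, 'c::field) padic_data \<Rightarrow> (('f \<Rightarrow> 'c) \<Rightarrow> nat) \<Rightarrow> ('f, 'c) ind_fun \<Rightarrow>
   (nat \<Rightarrow> 'f \<Rightarrow> ('f, 'c) weight_vec) \<Rightarrow> (nat \<Rightarrow> 'f \<Rightarrow> ('f, 'c) weight_vec) \<Rightarrow> bool"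
  where
  "is_expansion D k f v0 v1 \<longleftrightarrow>
     (\<forall>n \<mu>. v0 n \<mu> \<in> weight D k \<and> v1 n \<mu> \<in> weight D k) \<and>
     (\<forall>n \<mu>. \<mu> \<notin> digits D n \<longrightarrow> v0 n \<mu> = 0 \<and> v1 n \<mu> = 0) \<and>
     finite {(n, \<mu>). v0 n \<mu> \<noteq> 0 \<or> v1 n \<mu> \<noteq> 0} \<and>
     f = (\<Sum>(n, \<mu>)\<in>{(n, \<mu>). v0 n \<mu> \<noteq> 0 \<or> v1 n \<mu> \<noteq> 0}.
            elem D k (g0 D n \<mu>) (v0 n \<mu>) + elem D k (g1 D n \<mu>) (v1 n \<mu>))"

definition ball_supp ::
  "('k::field_char_0, 'f::field, 'c::field) padic_data \<Rightarrow> (('f \<Rightarrow> 'c) \<Rightarrow> nat) \<Rightarrow> nat \<Rightarrow>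
   ('f, 'c) ind_fun set"
  where
  "ball_supp D k N =
     {f \<in> c_ind D k (weight D k). \<exists>v0 v1. is_expansion D k f v0 v1 \<and>
        (\<forall>n \<mu>. n > N \<longrightarrow> v0 n \<mu> = 0) \<and> (\<forall>n \<mu>. int n > int N - 1 \<longrightarrow> v1 n \<mu> = 0)}"

definition zero_supp ::
  "('k::field_char_0, 'f::field, 'c::field) padic_data \<Rightarrow> (('f \<Rightarrow> 'c) \<Rightarrow> nat) \<Rightarrow> ('f, 'c) ind_fun set"
  where
  "zero_supp D k =
     {f \<in> c_ind D k (weight D k). \<exists>v0 v1. is_expansion D k f v0 v1 \<and> (\<forall>n \<mu>. v1 n \<mu> = 0)}"

definition smul :: "'c::field \<Rightarrow> ('f, 'c) ind_fun \<Rightarrow> ('f, 'c) ind_fun" where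
  "smul c f = (\<lambda>g i. c * f g i)"

definition ball_plus_lattice ::
  "('k::field_char_0, 'f::field, 'c::field) padic_data \<Rightarrow> (('f \<Rightarrow> 'c) \<Rightarrow> nat) \<Rightarrow> nat \<Rightarrow> int \<Rightarrow>
   ('f, 'c) ind_fun set"
  where
  "ball_plus_lattice D k N m =
     {b + smul (base_emb D (unif D) powi m) h | b h.
        b \<in> ball_supp D k N \<and> h \<in> c_ind D k (weight_lattice D k)}"

definition separated ::
  "('k::field_char_0, 'f::field, 'c::field) padic_data \<Rightarrow> (('f \<Rightarrow> 'c) \<Rightarrow> nat) \<Rightarrow> 'c \<Rightarrow> bool"
  where
  "separated D k a \<longleftrightarrow>
     (\<exists>N0>0. \<forall>N\<ge>N0. \<exists>\<epsilon>::nat. \<forall>n::nat. \<forall>f\<in>zero_supp D k.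
        hecke D k f - smul a f \<in> ball_plus_lattice D k N (int n) \<longrightarrow>
        f \<in> ball_plus_lattice D k (N - 1) (int n - int \<epsilon>))"

end

theory Submission
  imports Defs
begin

text \<open>
  Words \<open>w\<close> in the Teichmueller digits address the vertices \<open>g\<^sup>0\<^bsub>n,\<mu>\<^esub>\<close> of the tree, and an \<open>f\<close> in \<open>B\<^sup>0\<close>
  becomes a finitely supported family of polynomials \<open>f\<^sub>w\<close> of degree at most \<open>k\<close>. Writing
  \<open>T\<^sup>+\<^sub>t v = v(\<omega> y - t)\<close> and \<open>T\<^sup>-\<^sub>s v = \<Sum>\<^sub>i c\<^sub>i(v) \<omega>^(k - i) (y + s)^i\<close>, the value of \<open>(T - a) f\<close> at the
  vertex \<open>t w\<close> is \<open>T\<^sup>+\<^sub>t f\<^sub>w + (\<Sum>\<^sub>s T\<^sup>-\<^sub>s f\<^bsub>s t w\<^esub>) - a f\<^bsub>t w\<^esub>\<close>. Below a vertex at distance \<open>N\<close> these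
  values are at most \<open>\<eta>\<close>, and one has to bound the \<open>f\<^sub>w\<close> by \<open>C \<eta>\<close> with \<open>C\<close> independent of the
  size of the support.

  Let \<open>A\<close> be the largest coefficient below the root and suppose \<open>\<eta> < |a|\<^sup>2 A\<close>. Consider a longest
  word \<open>z\<close> at which \<open>|\<omega>^(k - i) c\<^sub>i(f\<^sub>z)|\<close> attains its maximum \<open>m \<ge> |a| A\<close>. For all words at least as
  long the equation makes \<open>T\<^sup>+ f\<^sub>w\<close> smaller than \<open>m\<close>. As \<open>f\<^sub>w\<close> is divided successively by
  \<open>\<theta> = y^q - (\<plusminus>1) y\<close>, which vanishes at all \<open>- t\<close>, each division costs one factor \<open>\<omega>\<close>, and the
  congruence \<open>p | binom(q, i)\<close> makes the sums over \<open>s\<close> small outside the residues \<open>0, \<dots>, r\<close>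
  modulo \<open>q\<close>; together this bounds \<open>\<omega>^(k - i) c\<^sub>i(f\<^sub>z)\<close> strictly by \<open>m\<close>, a contradiction. The
  weight \<open>k = q\<close> escapes this argument and is treated by linearising the equation for the top
  coefficients around an approximate root of a quadratic polynomial.
\<close>

section \<open>Nonarchimedean absolute values\<close>

text \<open>The equation can be read in two directions, each at a price: for the child
  \<open>f (t # w)\<close> it is divided by \<open>a\<close>, for the parent \<open>f w\<close> the
  map \<open>Tp\<close> is inverted, which costs |\<omega>|^d. Sizes alone cannot close a bound,
  since every estimate may be an equality. Extremality supplies the strict inequality: beyond
  \<open>z\<close> all weighted coefficients are below \<open>m\<close>, so children contribute
  strictly less. The threshold |a|^2 A makes the error harmless: \<open>m\<close> is at least |a| A,
  and the decisive estimates compare quantities of size |a| m.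

  The root has no equation of its own and may exceed \<open>A\<close>. Hence critical words have
  length at least 2, bounds two steps up the tree are recovered from children, and the root is
  bounded last, which adds the factor |\<omega>|^-d.

  For k = q a multiple \<gamma>\<theta> at the parent feeds \<omega>\<gamma> into the equation of
  the child, which can exceed |a|^2 A when |\<omega>| > |a|^2. It is no error to be estimated but
  follows a recurrence along the tree, and has to be subtracted.\<close>

locale nonarch =
  fixes N :: "'a::field \<Rightarrow> real"
  assumes nonarch: "nonarch_abs N"
begin

lemma N_ge0 [simp]: "0 \<le> N x"
  and N_eq0 [simp]: "N x = 0 \<longleftrightarrow> x = 0"
  and N_mult: "N (x * y) = N x * N y"
  and N_ultra: "N (x + y) \<le> max (N x) (N y)"
  using nonarch unfolding nonarch_abs_def by auto

lemma N_0 [simp]: "N 0 = 0"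
  by simp

lemma N_1 [simp]: "N 1 = 1"
proof -
  have "N 1 * N 1 = N 1 * 1" using N_mult[of 1 1] by simp
  then show ?thesis by (simp only: mult_cancel_left) simp
qed

lemma N_pos_iff [simp]: "0 < N x \<longleftrightarrow> x \<noteq> 0"
  using N_ge0[of x] N_eq0[of x] by linarith

lemma N_power: "N (x ^ n) = N x ^ n"
  by (induction n) (simp_all add: N_mult)

lemma N_minus [simp]: "N (- x) = N x"
proof -
  have "N (-1) * N (-1) = 1" using N_mult[of "-1" "-1"] by simp
  then have "N (-1) = 1" using N_ge0[of "-1"]
    by (metis abs_of_nonneg power2_eq_square power2_eq_1_iff abs_1 abs_minus_cancel)
  then show ?thesis using N_mult[of "-1" x] by simp
qed

lemma N_minus_commute: "N (x - y) = N (y - x)"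
  using N_minus[of "x - y"] by simp

lemma N_inverse: "N (inverse x) = inverse (N x)"
proof (cases "x = 0")
  case False
  then have "N x * N (inverse x) = 1" using N_mult[of x "inverse x"] by simp
  then show ?thesis using False by (metis inverse_unique)
qed simp

lemma N_divide: "N (x / y) = N x / N y"
  by (simp add: divide_inverse N_mult N_inverse)

lemma N_power_int: "N (x powi n) = N x powi n"
  by (simp add: power_int_def N_power N_inverse)

lemma N_add_le: "N x \<le> B \<Longrightarrow> N y \<le> B \<Longrightarrow> N (x + y) \<le> B"
  using N_ultra[of x y] by linarith

lemma N_add_less: "N x < B \<Longrightarrow> N y < B \<Longrightarrow> N (x + y) < B"
  using N_ultra[of x y] by linarith

lemma N_diff_le: "N x \<le> B \<Longrightarrow> N y \<le> B \<Longrightarrow> N (x - y) \<le> B"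
  using N_add_le[of x B "- y"] by simp

lemma N_diff_less: "N x < B \<Longrightarrow> N y < B \<Longrightarrow> N (x - y) < B"
  using N_add_less[of x B "- y"] by simp

lemma N_sum_le:
  assumes "\<And>i. i \<in> S \<Longrightarrow> N (g i) \<le> B" "0 \<le> B"
  shows "N (sum g S) \<le> B"
  using assms
proof (induction S rule: infinite_finite_induct)
  case (insert x F)
  then show ?case by (simp add: N_add_le)
qed auto

lemma N_sum_less:
  assumes "\<And>i. i \<in> S \<Longrightarrow> N (g i) < B" "0 < B"
  shows "N (sum g S) < B"
  using assms
proof (induction S rule: infinite_finite_induct)
  case (insert x F)
  then show ?case by (simp add: N_add_less)
qed auto

lemma N_add_eq: "N y < N x \<Longrightarrow> N (x + y) = N x"
  using N_ultra[of x y] N_ultra[of "x + y" "- y"] by (simp add: max_def split: if_splits)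

lemma N_of_nat: "N (of_nat n) \<le> 1"
  by (induction n) (simp_all add: N_add_le)

lemma N_of_nat_dvd:
  assumes "m dvd n" shows "N (of_nat n) \<le> N (of_nat m)"
proof -
  obtain l where "n = m * l" using assms by blast
  then show ?thesis using mult_left_mono[OF N_of_nat[of l], of "N (of_nat m)"]
    by (simp add: N_mult)
qed

lemma N_prod_le1:
  assumes "\<And>i. i \<in> S \<Longrightarrow> N (g i) \<le> 1" shows "N (prod g S) \<le> 1"
  using assms
  by (induction S rule: infinite_finite_induct) (auto simp: N_mult mult_le_one)

lemma N_mult_le: "N x \<le> A \<Longrightarrow> N y \<le> B \<Longrightarrow> N (x * y) \<le> A * B"
  unfolding N_mult using order_trans[OF N_ge0[of x]] by (auto intro!: mult_mono)

text \<open>A finite set attains its maximum, so a strict bound is a weak bound by something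
  smaller; estimates proved with \<le> thereby yield strict ones. Inserting 0 covers the empty set
  and gives nonnegativity.\<close>

lemma strict_bound:
  assumes "finite X" "\<And>x. x \<in> X \<Longrightarrow> N (g x) < B" "0 < B"
  shows "\<exists>B'\<ge>0. B' < B \<and> (\<forall>x\<in>X. N (g x) \<le> B')"
proof (intro exI conjI ballI)
  let ?B = "Max (insert 0 ((\<lambda>x. N (g x)) ` X))"
  show "?B \<ge> 0" "?B < B" using assms by auto
  show "N (g x) \<le> ?B" if "x \<in> X" for x using assms(1) that by simp
qed

lemma strict_bound_poly:
  assumes "finite X" "\<And>x j. x \<in> X \<Longrightarrow> N (coeff (h x) j) < B" "0 < B"
  shows "\<exists>B'\<ge>0. B' < B \<and> (\<forall>x\<in>X. \<forall>j. N (coeff (h x) j) \<le> B')"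
proof -
  obtain B' where B': "B' \<ge> 0" "B' < B"
    "\<forall>z\<in>(SIGMA x:X. {..degree (h x)}). N (coeff (h (fst z)) (snd z)) \<le> B'"
    using strict_bound[of "SIGMA x:X. {..degree (h x)}" "\<lambda>z. coeff (h (fst z)) (snd z)" B] assms
    by (metis (mono_tags, lifting) finite_SigmaI finite_atMost mem_Sigma_iff prod.collapse)
  have "N (coeff (h x) j) \<le> B'" if "x \<in> X" for x j
  proof (cases "j \<le> degree (h x)")
    case True
    then show ?thesis using B'(3) that by force
  next
    case False
    then show ?thesis using B'(1) by (simp add: coeff_eq_0)
  qed
  then show ?thesis using B' by blast
qed

section \<open>Gauss norm and interpolation\<close>

lemma coeff_mult_le:
  assumes "\<And>i. N (coeff f i) \<le> A" "\<And>i. N (coeff g i) \<le> B" "0 \<le> A" "0 \<le> B"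
  shows "N (coeff (f * g) n) \<le> A * B"
  unfolding coeff_mult using assms by (intro N_sum_le N_mult_le) auto

lemma coeff_power_le:
  assumes "\<And>i. N (coeff f i) \<le> A" "0 \<le> A"
  shows "N (coeff (f ^ n) i) \<le> A ^ n"
proof (induction n arbitrary: i)
  case 0
  then show ?case by (simp add: coeff_1)
next
  case (Suc n)
  then show ?case using coeff_mult_le[of f A "f ^ n" "A ^ n"] assms by simp
qed

text \<open>Newton interpolation at points that stay distinct in the residue field.\<close>

lemma small_values_small_coeffs:
  assumes "finite S" "\<And>s t. s \<in> S \<Longrightarrow> t \<in> S \<Longrightarrow> s \<noteq> t \<Longrightarrow> N (s - t) = 1"
    and "\<And>s. s \<in> S \<Longrightarrow> N s \<le> 1" "degree g < card S"
    and "\<And>s. s \<in> S \<Longrightarrow> N (poly g s) \<le> B" "0 \<le> B"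
  shows "N (coeff g i) \<le> B"
  using assms
proof (induction "card S" arbitrary: S g i)
  case 0
  then show ?case by simp
next
  case (Suc n)
  then obtain s where s: "s \<in> S" by (metis card_gt_0_iff ex_in_conv zero_less_Suc)
  \<comment> \<open>At the remaining points the quotient takes the divided differences (g(t) - g(s))
    / (t - s), and |t - s| = 1 preserves the bound.\<close>
  let ?h = "synthetic_div g s"
  have g: "g = [:-s, 1:] * ?h + [:poly g s:]" by (rule synthetic_div_correct'[symmetric])
  have h: "N (coeff ?h i) \<le> B" for i
  proof (cases "degree g = 0")
    case True
    then show ?thesis using Suc.prems(6) by (simp add: synthetic_div_eq_0_iff[THEN iffD2])
  next
    case False
    show ?thesis
    proof (rule Suc.hyps(1)[of "S - {s}"])
      show "n = card (S - {s})" using Suc.hyps(2) s Suc.prems(1) by simp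
      show "degree ?h < card (S - {s})"
        using Suc.prems(4) False s Suc.prems(1) by (simp add: degree_synthetic_div)
      fix t assume t: "t \<in> S - {s}"
      then have "N (t - s) = 1" using Suc.prems(2) s by blast
      moreover have "poly g t = (t - s) * poly ?h t + poly g s"
        using arg_cong[OF g, of "\<lambda>p. poly p t"] by (simp add: algebra_simps)
      then have "(t - s) * poly ?h t = poly g t - poly g s" by simp
      then have "N (t - s) * N (poly ?h t) \<le> B"
        using N_diff_le Suc.prems(5) s t by (metis DiffD1 N_mult)
      ultimately show "N (poly ?h t) \<le> B" by simp
    qed (use Suc.prems in auto)
  qed
  have "N (coeff ([:-s, 1:] * ?h) i) \<le> B"
  proof (cases i)
    case 0
    then show ?thesis using N_mult_le[OF Suc.prems(3)[OF s] h[of 0]] by (simp add: N_mult)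
  next
    case (Suc j)
    have "N (s * coeff ?h (Suc j)) \<le> B" using N_mult_le[OF Suc.prems(3)[OF s] h[of "Suc j"]] by simp
    then show ?thesis using h[of j] Suc by (simp add: N_diff_le)
  qed
  moreover have "N (coeff [:poly g s:] i) \<le> B"
    using Suc.prems(5)[OF s] Suc.prems(6) by (cases i) auto
  ultimately show ?case by (subst g, subst coeff_add, intro N_add_le)
qed

text \<open>A triangular system: coefficient n of the product is coefficient n of \<open>f\<close>
  times a unit, plus lower coefficients of \<open>f\<close> times integral ones, so division by
  \<open>E\<close> loses nothing.\<close>

lemma division_by_unit_const:
  assumes "\<And>i. N (coeff (f * E) i) \<le> B" "N (coeff E 0) = 1" "\<And>i. N (coeff E i) \<le> 1"
  shows "N (coeff f n) \<le> B"
proof (induction n rule: less_induct)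
  case (less n)
  have B: "0 \<le> B" using assms(1)[of 0] N_ge0 order_trans by blast
  have "coeff (f * E) n = coeff f n * coeff E 0 + (\<Sum>i<n. coeff f i * coeff E (n - i))"
    unfolding coeff_mult lessThan_Suc_atMost[symmetric] sum.lessThan_Suc by simp
  then have "coeff f n * coeff E 0 = coeff (f * E) n - (\<Sum>i<n. coeff f i * coeff E (n - i))"
    by simp
  moreover have "N (\<Sum>i<n. coeff f i * coeff E (n - i)) \<le> B"
  proof (rule N_sum_le[OF _ B])
    fix i assume "i \<in> {..<n}"
    then show "N (coeff f i * coeff E (n - i)) \<le> B"
      using N_mult_le[OF less[of i] assms(3)[of "n - i"]] by simp
  qed
  ultimately have "N (coeff f n * coeff E 0) \<le> B" using N_diff_le[OF assms(1)] by simp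
  then show ?case by (simp add: N_mult assms(2))
qed

end

lemma pcompose_eq_sum:
  fixes v :: "'a::comm_ring_1 poly"
  assumes "degree v \<le> n"
  shows "pcompose v g = (\<Sum>i\<le>n. smult (coeff v i) (g ^ i))"
proof -
  have monom: "pcompose (monom c i) g = smult c (g ^ i)" for c :: 'a and i
    by (induction i) (auto simp: monom_0 monom_Suc pcompose_pCons algebra_simps)
  have "pcompose v g = pcompose (\<Sum>i\<le>n. monom (coeff v i) i) g"
    using assms by (simp add: poly_as_sum_of_monoms')
  then show ?thesis by (simp add: pcompose_sum monom)
qed

text \<open>A weak form of Lucas' theorem: modulo p one has (1 + y)^q = 1 + y^q, so (1 + y)^i
  contains no y^j whose residue j mod q exceeds i mod q. The number q enters only through the
  divisibility of its inner binomials.\<close>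

lemma dvd_binomial:
  fixes p q :: nat
  assumes "\<And>i. 0 < i \<Longrightarrow> i < q \<Longrightarrow> p dvd (q choose i)" "i mod q < j mod q"
  shows "p dvd (i choose j)"
proof (cases "q = 0")
  case True
  then show ?thesis using assms(2) by (simp add: binomial_eq_0)
next
  case False
  have "p dvd ((d * q + r) choose j)" if "r < j mod q" for d r
    using that
  proof (induction d arbitrary: j)
    case 0
    then have "r < j" using mod_less_eq_dividend[of j q] by linarith
    then show ?case by (simp add: binomial_eq_0)
  next
    case (Suc d)
    \<comment> \<open>In Vandermonde's sum only i = 0 and i = q survive modulo p, and j - i keeps
      the residue of j in both cases.\<close>
    have "((q + (d * q + r)) choose j) = (\<Sum>i\<le>j. (q choose i) * ((d * q + r) choose (j - i)))"
      by (rule vandermonde[symmetric])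
    moreover have "p dvd (q choose i) * ((d * q + r) choose (j - i))" if "i \<le> j" for i
    proof -
      consider "0 < i \<and> i < q" | "i = 0" | "i = q" | "i > q" by linarith
      then show ?thesis
      proof cases
        case 1
        then show ?thesis using assms(1) by auto
      next
        case 2
        then show ?thesis using Suc by simp
      next
        case 3
        then have "r < (j - i) mod q" using Suc.prems that by (metis le_mod_geq)
        then show ?thesis using Suc.IH by simp
      next
        case 4
        then show ?thesis by (simp add: binomial_eq_0)
      qed
    qed
    ultimately show ?case by (simp add: add.assoc) (rule dvd_sum, blast)
  qed
  from this[of "i mod q" "i div q"] show ?thesis using assms(2) by simp
qed

section \<open>The two halves of the Hecke operator on polynomials\<close>

lemma coeff_linear_pow:
  fixes x y :: "'a::comm_ring_1"
  shows "coeff ([:x, y:] ^ n) j = of_nat (n choose j) * y ^ j * x ^ (n - j)"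
proof (cases "j \<le> n")
  case False
  have "degree ([:x, y:] ^ n) \<le> n"
    using degree_power_le[of "[:x, y:]" n] by (simp split: if_splits)
  then show ?thesis using False by (simp add: coeff_eq_0 binomial_eq_0)
qed (rule coeff_linear_poly_power)

text \<open>The data at the vertices, detached from the group: \<omega> and \<open>L\<close> stand
  for the images under \<sigma> of the uniformizer and of the Teichmueller representatives. The
  assumption \<open>p_le_a\<close> is the form taken by v(a) \<le> e.\<close>

locale hecke_tree = nonarch N for N :: "'c::field \<Rightarrow> real" +
  fixes \<omega> a :: 'c and L :: "'c set" and p q d r k :: nat
  assumes finite_L: "finite L" and card_L: "card L = q" and q_ge2: "2 \<le> q"
    and teich: "\<And>t. t \<in> L \<Longrightarrow> t ^ q = t"
    and sep: "\<And>s t. s \<in> L \<Longrightarrow> t \<in> L \<Longrightarrow> s \<noteq> t \<Longrightarrow> N (s - t) = 1"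
    and zero_L: "0 \<in> L"
    and om_pos: "0 < N \<omega>" and om_less1: "N \<omega> < 1"
    and a_pos: "0 < N a" and a_less1: "N a < 1"
    and p_le_a: "N (of_nat p) \<le> N a" and p_le_om: "N (of_nat p) \<le> N \<omega>"
    and p_dvd_binom: "\<And>i. 0 < i \<Longrightarrow> i < q \<Longrightarrow> p dvd (q choose i)"
    and k_eq: "k = d * q + r" and rd: "r + d < q"
begin

definition Tp :: "'c \<Rightarrow> 'c poly \<Rightarrow> 'c poly" where
  "Tp t v = pcompose v [:- t, \<omega>:]"

definition Tm :: "'c \<Rightarrow> 'c poly \<Rightarrow> 'c poly" where
  "Tm s v = (\<Sum>i\<le>k. smult (coeff v i * \<omega> ^ (k - i)) ([:s, 1:] ^ i))"

lemma L_le1: "t \<in> L \<Longrightarrow> N t \<le> 1"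
proof (rule ccontr)
  assume t: "t \<in> L" and "\<not> N t \<le> 1"
  then have "N t ^ 1 < N t ^ q" using q_ge2 by (intro power_strict_increasing) auto
  then show False using arg_cong[OF teich[OF t], of N] by (simp add: N_power)
qed

lemma L_power_le1: "t \<in> L \<Longrightarrow> N (t ^ n) \<le> 1"
  using L_le1[of t] by (simp add: N_power power_le_one)

lemma coeff_Tp:
  assumes "degree v \<le> n"
  shows "coeff (Tp t v) j = \<omega> ^ j * (\<Sum>i\<le>n. coeff v i * of_nat (i choose j) * (- t) ^ (i - j))"
proof -
  have "coeff (Tp t v) j = (\<Sum>i\<le>n. coeff v i * (of_nat (i choose j) * \<omega> ^ j * (- t) ^ (i - j)))"
    unfolding Tp_def pcompose_eq_sum[OF assms] by (simp add: coeff_sum coeff_linear_pow)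
  then show ?thesis by (simp add: sum_distrib_left mult_ac)
qed

lemma coeff_Tm:
  "coeff (Tm s v) j = (\<Sum>i\<le>k. \<omega> ^ (k - i) * coeff v i * (of_nat (i choose j) * s ^ (i - j)))"
  unfolding Tm_def by (simp add: coeff_sum coeff_linear_pow mult_ac)

lemma coeff_Tp_0: "coeff (Tp t v) 0 = poly v (- t)"
  unfolding Tp_def by (simp flip: poly_0_coeff_0 add: poly_pcompose)

lemma Tp_coeff_term_le:
  assumes "t \<in> L" "N x \<le> B"
  shows "N (x * of_nat n * (- t) ^ m) \<le> B"
proof -
  have "N ((- t) ^ m) \<le> 1" using L_power_le1[OF assms(1)] by (simp add: N_power)
  then show ?thesis using N_mult_le[OF N_mult_le[OF assms(2) N_of_nat[of n]], of "(- t) ^ m" 1] by simp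
qed

lemma Tp_coeff_le:
  assumes "\<And>i. N (coeff v i) \<le> B" "t \<in> L"
  shows "N (coeff (Tp t v) j) \<le> N \<omega> ^ j * B"
proof -
  have "0 \<le> B" using assms(1)[of 0] N_ge0 order_trans by blast
  then show ?thesis
    unfolding coeff_Tp[OF order_refl] N_mult N_power
    by (intro mult_left_mono N_sum_le Tp_coeff_term_le assms) auto
qed

section \<open>Division by \<theta>\<close>

definition sgn_q :: 'c where "sgn_q = (- 1) ^ (q + 1)"

definition theta :: "'c poly" where "theta = monom 1 q - monom sgn_q 1"

lemma N_sgn_q [simp]: "N sgn_q = 1"
  by (simp add: sgn_q_def N_power)

lemma sgn_q_square [simp]: "sgn_q * sgn_q = 1"
  by (simp add: sgn_q_def flip: power_mult_distrib)

lemma coeff_theta: "coeff theta j = (if j = q then 1 else if j = 1 then - sgn_q else 0)"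
  using q_ge2 by (simp add: theta_def)

lemma degree_theta: "degree theta = q"
proof (rule antisym)
  show "degree theta \<le> q" using q_ge2 by (intro degree_le) (auto simp: coeff_theta)
  show "q \<le> degree theta" by (intro le_degree) (simp add: coeff_theta)
qed

lemma theta_nz [simp]: "theta \<noteq> 0"
  using coeff_theta[of q] by auto

lemma poly_theta: "t \<in> L \<Longrightarrow> poly theta (- t) = 0"
  using teich[of t] by (simp add: theta_def poly_monom sgn_q_def power_minus[of t])

lemma theta_decomp: "v = v mod theta + theta * (v div theta)"
  by simp

text \<open>Multiplication by \<theta> shifts indices by q and, with a sign, by 1. All later
  comparisons between a polynomial and its quotient rest on these two shifts.\<close>

lemma coeff_decomp:
  "coeff v j = coeff (v mod theta) j + (if q \<le> j then coeff (v div theta) (j - q) else 0)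
     - (if 1 \<le> j then sgn_q * coeff (v div theta) (j - 1) else 0)"
proof -
  have "coeff v j = coeff (v mod theta) j + coeff (theta * (v div theta)) j"
    by (subst theta_decomp[of v]) (simp only: coeff_add)
  moreover have "theta * (v div theta) = monom 1 q * (v div theta) - monom sgn_q 1 * (v div theta)"
    unfolding theta_def[symmetric] by (simp add: theta_def algebra_simps)
  ultimately show ?thesis by (simp add: coeff_monom_mult not_less)
qed

lemma degree_rem: "degree (v mod theta) < q"
  using degree_mod_less[of theta v] degree_theta q_ge2 by auto

lemma coeff_rem_0: "q \<le> j \<Longrightarrow> coeff (v mod theta) j = 0"
  using degree_rem[of v] by (simp add: coeff_eq_0)

lemma degree_quot:
  assumes "degree v \<le> Suc D * q + r'" shows "degree (v div theta) \<le> D * q + r'"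
proof (cases "v div theta = 0")
  case False
  then have "degree (theta * (v div theta)) = q + degree (v div theta)"
    by (simp add: degree_mult_eq degree_theta)
  moreover have "theta * (v div theta) = v - v mod theta"
    by (simp add: minus_mod_eq_mult_div)
  then have "degree (theta * (v div theta)) \<le> max (degree v) (degree (v mod theta))"
    by (simp add: degree_diff_le_max)
  ultimately show ?thesis using assms degree_rem[of v] by auto
qed simp

lemma small_values:
  assumes "degree g < q" "\<And>t. t \<in> L \<Longrightarrow> N (poly g (- t)) \<le> B"
  shows "N (coeff g i) \<le> B"
proof (rule small_values_small_coeffs[of "uminus ` L"])
  show "0 \<le> B" using assms(2)[OF zero_L] N_ge0 order_trans by blast
  show "degree g < card (uminus ` L)" using assms(1) card_L by (simp add: card_image)
  show "N (s - t) = 1" if "s \<in> uminus ` L" "t \<in> uminus ` L" "s \<noteq> t" for s t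
    using that sep N_minus_commute by fastforce
qed (use assms finite_L L_le1 in auto)

lemma small_values_less:
  assumes "degree g < q" "\<And>t. t \<in> L \<Longrightarrow> N (poly g (- t)) < B"
  shows "N (coeff g i) < B"
proof -
  have "0 < B" using assms(2)[OF zero_L] N_ge0 le_less_trans by blast
  then obtain B' where "B' < B" "\<forall>t\<in>L. N (poly g (- t)) \<le> B'"
    using strict_bound[of L "\<lambda>t. poly g (- t)" B] finite_L assms(2) by blast
  then show ?thesis using small_values[of g B' i] assms(1) by fastforce
qed

lemma poly_rem: "t \<in> L \<Longrightarrow> poly (v mod theta) (- t) = poly v (- t)"
proof -
  assume "t \<in> L"
  then have "poly (v mod theta) (- t) = poly (v mod theta + theta * (v div theta)) (- t)"
    unfolding poly_add poly_mult by (simp add: poly_theta)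
  then show ?thesis by simp
qed

text \<open>As \<theta> vanishes at -t, the remainder has the values of \<open>v\<close> there; its
  degree is below q, so interpolation at the q points recovers its coefficients.\<close>

lemma rem_le:
  assumes "\<And>t. t \<in> L \<Longrightarrow> N (poly v (- t)) \<le> B"
  shows "N (coeff (v mod theta) i) \<le> B"
  using small_values[OF degree_rem, of v B] assms poly_rem by simp

lemma rem_less:
  assumes "\<And>t. t \<in> L \<Longrightarrow> N (poly v (- t)) < B"
  shows "N (coeff (v mod theta) i) < B"
  using small_values_less[OF degree_rem, of v B] assms poly_rem by simp

lemma N_q_less1: "N (of_nat q) \<le> N \<omega>" "N (of_nat q) \<le> N a"
proof -
  have "p dvd q" using p_dvd_binom[of 1] q_ge2 by simp
  then show "N (of_nat q) \<le> N \<omega>" "N (of_nat q) \<le> N a"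
    using N_of_nat_dvd p_le_om p_le_a order_trans by blast+
qed

text \<open>On the disc around \<open>- t\<close> the polynomial \<open>\<theta>\<close> is \<open>\<omega> y\<close> times a power series with unit
  constant term, so that dividing by \<open>\<theta>\<close> costs exactly one factor \<open>\<omega>\<close>.\<close>

lemma Tp_theta:
  assumes "t \<in> L"
  obtains E where "Tp t theta = smult \<omega> (pCons 0 E)" "N (coeff E 0) = 1" "\<And>i. N (coeff E i) \<le> 1"
proof -
  define x where "x j = (\<Sum>i\<le>q. coeff theta i * of_nat (i choose j) * (- t) ^ (i - j))" for j
  define E where "E = (\<Sum>j<q. monom (\<omega> ^ j * x (Suc j)) j)"
  have c: "coeff (Tp t theta) j = \<omega> ^ j * x j" for j
    unfolding x_def by (intro coeff_Tp) (simp add: degree_theta)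
  have E: "coeff E j = (if j < q then \<omega> ^ j * x (Suc j) else 0)" for j
    unfolding E_def by (simp add: coeff_sum)
  have x0: "x j = 0" if "j > q" for j
    using that unfolding x_def by (intro sum.neutral) (auto simp: binomial_eq_0)
  \<comment> \<open>This is the derivative of \<theta> at -t, a unit because |q| < 1.\<close>
  have x1: "x 1 = of_nat q * (- t) ^ (q - 1) - sgn_q"
  proof -
    have "x 1 = (\<Sum>i\<in>{q, 1}. coeff theta i * of_nat (i choose 1) * (- t) ^ (i - 1))"
      unfolding x_def using q_ge2 by (intro sum.mono_neutral_right) (auto simp: coeff_theta)
    then show ?thesis using q_ge2 by (simp add: coeff_theta)
  qed
  have "N (of_nat q * (- t) ^ (q - 1)) < 1"
    using Tp_coeff_term_le[OF assms N_q_less1(1), of 1 "q - 1"] om_less1 by simp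
  then have "N (x 1) = 1"
    using N_add_eq[of "of_nat q * (- t) ^ (q - 1)" "- sgn_q"] unfolding x1 by simp
  moreover have xle: "N (x j) \<le> 1" for j
    unfolding x_def using assms by (intro N_sum_le Tp_coeff_term_le) (auto simp: coeff_theta)
  ultimately have "N (coeff E 0) = 1" using q_ge2 by (simp add: E)
  moreover have "N (coeff E i) \<le> 1" for i
    using xle[of "Suc i"] om_less1 om_pos
    by (auto simp: E N_mult N_power intro!: mult_le_one power_le_one)
  moreover have "Tp t theta = smult \<omega> (pCons 0 E)"
  proof (rule poly_eqI)
    fix n show "coeff (Tp t theta) n = coeff (smult \<omega> (pCons 0 E)) n"
      using c[of 0] c[of n] x0[of n] poly_theta[OF assms] coeff_Tp_0[of t theta]
      by (cases n) (auto simp: E not_less)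
  qed
  ultimately show thesis using that by blast
qed

lemma Tp_mult: "Tp t (u * v) = Tp t u * Tp t v"
  and Tp_add: "Tp t (u + v) = Tp t u + Tp t v"
  and Tp_diff: "Tp t (u - v) = Tp t u - Tp t v"
  by (simp_all add: Tp_def pcompose_mult pcompose_add pcompose_diff)

text \<open>The constant terms of the transforms control the remainder, hence also the difference
  \<open>Tp t theta\<close> times the transform of the quotient. Cancelling y and the unit series
  \<open>E\<close> is free, cancelling \<omega> costs |\<omega>|.\<close>

lemma quot_le:
  assumes B: "\<And>t j. t \<in> L \<Longrightarrow> N (coeff (Tp t v) j) \<le> B" and t: "t \<in> L"
  shows "N (coeff (Tp t (v div theta)) j) \<le> B / N \<omega>"
proof -
  have B0: "0 \<le> B" using B[OF t, of 0] N_ge0 order_trans by blast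
  obtain E where E: "Tp t theta = smult \<omega> (pCons 0 E)" "N (coeff E 0) = 1" "\<And>i. N (coeff E i) \<le> 1"
    using Tp_theta[OF t] by blast
  have u: "N (coeff (v mod theta) i) \<le> B" for i
    using rem_le B[of _ 0] by (simp add: coeff_Tp_0)
  have uT: "N (coeff (Tp t (v mod theta)) j) \<le> B" for j
  proof -
    have "N (coeff (Tp t (v mod theta)) j) \<le> N \<omega> ^ j * B" by (rule Tp_coeff_le[OF u t])
    also have "\<dots> \<le> 1 * B" using B0 om_pos om_less1 by (intro mult_right_mono power_le_one) auto
    finally show ?thesis by simp
  qed
  have "Tp t v - Tp t (v mod theta) = Tp t theta * Tp t (v div theta)"
    by (simp add: minus_mod_eq_mult_div flip: Tp_diff Tp_mult)
  also have "\<dots> = smult \<omega> (pCons 0 (Tp t (v div theta) * E))"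
    by (simp add: E(1) mult.commute)
  finally have eq: "Tp t v - Tp t (v mod theta) = smult \<omega> (pCons 0 (Tp t (v div theta) * E))" .
  have "N (coeff (Tp t (v div theta) * E) i) \<le> B / N \<omega>" for i
  proof -
    have "\<omega> * coeff (Tp t (v div theta) * E) i = coeff (Tp t v - Tp t (v mod theta)) (Suc i)"
      unfolding eq by simp
    then have "N (\<omega> * coeff (Tp t (v div theta) * E) i) \<le> B"
      using N_diff_le[OF B[OF t] uT] by simp
    then show ?thesis using om_pos by (simp add: N_mult field_simps)
  qed
  from division_by_unit_const[OF this E(2,3)] show ?thesis .
qed

text \<open>After D divisions by \<theta> the degree is below q, where interpolation is free; each
  division costs one factor |\<omega>|.\<close>

lemma Tp_inverse_le:
  assumes "degree v \<le> D * q + r'" "r' < q" "\<And>t j. t \<in> L \<Longrightarrow> N (coeff (Tp t v) j) \<le> B"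
  shows "N \<omega> ^ D * N (coeff v i) \<le> B"
  using assms
proof (induction D arbitrary: v B i)
  case 0
  then show ?case using small_values[of v B i] 0(3)[of _ 0] by (simp add: coeff_Tp_0)
next
  case (Suc D)
  have B0: "0 \<le> B" using Suc.prems(3)[OF zero_L, of 0] N_ge0 order_trans by blast
  define B' where "B' = B / N \<omega> ^ Suc D"
  have B': "B \<le> B'" "0 \<le> B'"
    unfolding B'_def using B0 om_pos om_less1 power_le_one[of "N \<omega>" "Suc D"]
    by (auto simp: le_divide_eq mult_left_le simp del: power_Suc)
  have q1: "N (coeff (v div theta) i) \<le> B'" for i
  proof -
    have "N \<omega> ^ D * N (coeff (v div theta) i) \<le> B / N \<omega>"
      using degree_quot[OF Suc.prems(1)] Suc.prems(2) quot_le[OF Suc.prems(3)] by (intro Suc.IH) auto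
    then show ?thesis unfolding B'_def using om_pos by (simp add: field_simps)
  qed
  have "N (coeff (v mod theta) i) \<le> B'"
    using rem_le[of v B i] Suc.prems(3)[of _ 0] B' by (fastforce simp: coeff_Tp_0)
  then have "N (coeff v i) \<le> B'"
    unfolding coeff_decomp[of v i] using q1 B'(2) by (auto intro!: N_add_le N_diff_le simp: N_mult)
  then show ?case unfolding B'_def using om_pos by (simp add: field_simps)
qed

section \<open>Leading coefficients at a smaller cost\<close>

lemma quot_top:
  assumes "0 < D" "degree v \<le> D * q + r" "r' \<le> r" "r + D < q"
  shows "coeff v (D * q + r') = coeff (v div theta) ((D - 1) * q + r')"
proof -
  obtain D' where D: "D = Suc D'" using assms(1) not0_implies_Suc by blast
  have "degree (v div theta) \<le> D' * q + r" using degree_quot assms(2) D by blast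
  \<comment> \<open>The shift by 1 in \<open>coeff_decomp\<close> would read the quotient beyond its
    degree, so only the shift by q contributes to the leading block.\<close>
  moreover have "D' * q + r < D * q + r' - 1" using assms D by simp
  ultimately have "coeff (v div theta) (D * q + r' - 1) = 0" by (simp add: coeff_eq_0)
  moreover have "q \<le> D * q + r'" "D * q + r' - q = D' * q + r'" using D by auto
  ultimately show ?thesis unfolding coeff_decomp[of v "D * q + r'"] using D by (simp add: coeff_rem_0)
qed

text \<open>On the diagonal of indices (D - t) q + r' + t, each entry of \<open>v\<close> is up to
  signs the difference of two neighbouring diagonal entries of the quotient. Smallness of the
  entries of \<open>v\<close> with t > l therefore propagates along the quotient, from t = D - 1
  down to t = l.\<close>

lemma quot_coeffs:
  assumes "degree v \<le> D * q + r" "r' \<le> r" "r + D < q"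
    and B: "\<And>t j. t \<in> L \<Longrightarrow> N (coeff (Tp t v) j) \<le> B"
    and hyp: "\<And>t. l < t \<Longrightarrow> t \<le> D \<Longrightarrow> N \<omega> ^ l * N (coeff v ((D - t) * q + r' + t)) \<le> B"
    and "l \<le> t" "t < D"
  shows "N \<omega> ^ l * N (coeff (v div theta) ((D - 1 - t) * q + r' + t)) \<le> B"
proof -
  have B0: "0 \<le> B" using B[OF zero_L, of 0] N_ge0 order_trans by blast
  define C where "C = B / N \<omega> ^ l"
  have iff: "N \<omega> ^ l * x \<le> B \<longleftrightarrow> x \<le> C" for x
    unfolding C_def using om_pos by (simp add: field_simps)
  have "B \<le> C"
    unfolding C_def using B0 om_pos om_less1 power_le_one[of "N \<omega>" l]
    by (auto simp: le_divide_eq mult_left_le)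
  then have u: "N (coeff (v mod theta) i) \<le> C" for i
    using rem_le[of v B i] B[of _ 0] by (fastforce simp: coeff_Tp_0)
  have "t \<le> D - 1" using assms by simp
  then have "N (coeff (v div theta) ((D - 1 - t) * q + r' + t)) \<le> C"
    using \<open>l \<le> t\<close>
  proof (induction t rule: inc_induct)
    case base
    \<comment> \<open>The diagonal ends at an index below q, where the shift by q is absent and the
      remainder takes its place.\<close>
    let ?j = "r' + D"
    have "?j < q" using assms by simp
    then have "sgn_q * coeff (v div theta) (?j - 1) = coeff (v mod theta) ?j - coeff v ?j"
      using coeff_decomp[of v ?j] assms by simp
    moreover have "N (coeff v ?j) \<le> C" using hyp[of D] base assms iff by simp
    ultimately have "N (sgn_q * coeff (v div theta) (?j - 1)) \<le> C" using N_diff_le u by metis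
    then show ?case using assms by (simp add: N_mult)
  next
    case (step t)
    let ?j = "(D - Suc t) * q + r' + Suc t"
    have D: "D - Suc t = Suc (D - 1 - Suc t)" using step by simp
    have j: "q \<le> ?j" "?j - q = (D - 1 - Suc t) * q + r' + Suc t" "?j - 1 = (D - 1 - t) * q + r' + t"
      unfolding D by auto (simp_all add: D)
    have "sgn_q * coeff (v div theta) (?j - 1) = coeff (v div theta) (?j - q) - coeff v ?j"
      using coeff_decomp[of v ?j] j(1) q_ge2 by (simp add: coeff_rem_0)
    moreover have "N (coeff v ?j) \<le> C" using hyp[of "Suc t"] step iff by simp
    moreover have "N (coeff (v div theta) (?j - q)) \<le> C" unfolding j(2) using step by simp
    ultimately have "N (sgn_q * coeff (v div theta) (?j - 1)) \<le> C" using N_diff_le by metis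
    then show ?case unfolding j(3) by (simp add: N_mult)
  qed
  then show ?thesis unfolding iff .
qed

text \<open>Compared with \<open>Tp_inverse_le\<close> the loss for a leading coefficient drops from
  |\<omega>|^D to |\<omega>|^l, provided the diagonal entries with t > l are already small. Each
  division passes to the diagonal of the quotient and uses up one power; at l = 0 the first diagonal
  entry of the quotient is itself the leading coefficient sought.\<close>

lemma top_coeff_le:
  assumes "l < D" "degree v \<le> D * q + r" "r' \<le> r" "r + D < q"
    and "\<And>t j. t \<in> L \<Longrightarrow> N (coeff (Tp t v) j) \<le> B"
    and "\<And>t. l < t \<Longrightarrow> t \<le> D \<Longrightarrow> N \<omega> ^ l * N (coeff v ((D - t) * q + r' + t)) \<le> B"
  shows "N \<omega> ^ l * N (coeff v (D * q + r')) \<le> B"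
  using assms
proof (induction l arbitrary: D v B)
  case (0 D v B)
  have "N (coeff (v div theta) ((D - 1) * q + r' + 0)) \<le> B"
    using quot_coeffs[of v D r' B 0 0] 0 by simp
  then show ?case using quot_top[of D v r'] 0 by simp
next
  case (Suc l)
  have D: "D - 1 + 1 = D" using Suc.prems(1) by simp
  have "N \<omega> ^ l * N (coeff (v div theta) ((D - 1) * q + r')) \<le> B / N \<omega>"
  proof (rule Suc.IH)
    show "l < D - 1" "r + (D - 1) < q" "r' \<le> r" using Suc.prems by auto
    show "degree (v div theta) \<le> (D - 1) * q + r"
      using degree_quot[of v "D - 1" r] Suc.prems(2) D by (simp del: mult_Suc)
    show "N (coeff (Tp t (v div theta)) j) \<le> B / N \<omega>" if "t \<in> L" for t j
      using quot_le Suc.prems(5) that by blast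
    show "N \<omega> ^ l * N (coeff (v div theta) ((D - 1 - t) * q + r' + t)) \<le> B / N \<omega>"
      if "l < t" "t \<le> D - 1" for t
    proof -
      have "N \<omega> ^ Suc l * N (coeff (v div theta) ((D - 1 - t) * q + r' + t)) \<le> B"
        using quot_coeffs[of v D r' B "Suc l" t] Suc.prems that by simp
      then show ?thesis using om_pos by (simp add: field_simps)
    qed
  qed
  moreover have "coeff v (D * q + r') = coeff (v div theta) ((D - 1) * q + r')"
    using quot_top[of D v r'] Suc.prems by simp
  ultimately show ?case using om_pos by (simp add: field_simps)
qed

text \<open>Cutting off the coefficients from q on changes the values at -t by little, and the
  truncation is determined by its values.\<close>

lemma small_values_trunc:
  assumes "\<And>t. t \<in> L \<Longrightarrow> N (poly v (- t)) < B" "\<And>j. q \<le> j \<Longrightarrow> N (coeff v j) < B"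
  shows "N (coeff v i) < B"
proof (cases "q \<le> i")
  case False
  have B: "0 < B" using assms(1)[OF zero_L] N_ge0 le_less_trans by blast
  define g where "g = poly_cutoff q v"
  have g: "coeff g j = (if j < q then coeff v j else 0)" for j
    by (simp add: g_def coeff_poly_cutoff)
  have "degree g \<le> q - 1" using q_ge2 by (intro degree_le) (auto simp: g)
  then have "degree g < q" using q_ge2 by linarith
  moreover have "N (poly g (- t)) < B" if t: "t \<in> L" for t
  proof -
    have "N (coeff (v - g) j * (- t) ^ j) < B" for j
    proof (cases "q \<le> j")
      case True
      have "N (coeff v j * of_nat 1 * (- t) ^ j) \<le> N (coeff v j)"
        by (rule Tp_coeff_term_le[OF t order_refl])
      then show ?thesis using True assms(2)[OF True] by (simp add: g)
    qed (use B in \<open>simp add: g\<close>)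
    then have "N (poly (v - g) (- t)) < B"
      unfolding poly_altdef by (intro N_sum_less B)
    moreover have "poly g (- t) = poly v (- t) - poly (v - g) (- t)" by simp
    ultimately show ?thesis using N_diff_less assms(1)[OF t] by metis
  qed
  ultimately have "N (coeff g i) < B" by (rule small_values_less)
  then show ?thesis using False by (simp add: g)
qed (rule assms(2))

lemma om_power_less: "i < j \<Longrightarrow> N \<omega> ^ j < N \<omega> ^ i"
  using om_pos om_less1 by (intro power_strict_decreasing) auto

lemma om_power_le: "i \<le> j \<Longrightarrow> N \<omega> ^ j \<le> N \<omega> ^ i"
  using om_pos om_less1 by (intro power_decreasing) auto

lemma om_power_le1: "N \<omega> ^ j \<le> 1"
  using om_power_le[of 0 j] by simp

lemma N_binom_le_a: "i mod q < j mod q \<Longrightarrow> N (of_nat (i choose j)) \<le> N a"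
  using dvd_binomial[OF p_dvd_binom, of i j] N_of_nat_dvd p_le_a order_trans by blast

lemma a_square_less: "0 < x \<Longrightarrow> N a * (N a * x) < N a * x" "0 < x \<Longrightarrow> N a * x < x"
  using a_pos a_less1 by simp_all

end

section \<open>Approximate solutions on the tree\<close>

text \<open>The head of a word is its outermost digit, so \<open>t # w\<close> is a child of
  \<open>w\<close>. The equation is imposed at nonempty words only: the empty word is the top of a
  subtree whose own parent lies outside. The depth \<open>M\<close> may be arbitrary and must not
  enter any bound.\<close>

locale hecke_solution = hecke_tree N \<omega> a L p q d r k
  for N :: "'c::field \<Rightarrow> real" and \<omega> a :: 'c and L :: "'c set" and p q d r k :: nat +
  fixes f :: "'c list \<Rightarrow> 'c poly" and M :: nat and \<eta> :: real
  assumes degree_f: "\<And>w. degree (f w) \<le> k"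
    and f_vanish: "\<And>w. M < length w \<Longrightarrow> f w = 0"
    and equation: "\<And>w t j. w \<in> lists L \<Longrightarrow> t \<in> L \<Longrightarrow>
      N (coeff (Tp t (f w) + (\<Sum>s\<in>L. Tm s (f (s # t # w))) - smult a (f (t # w))) j) \<le> \<eta>"
begin

definition Sm :: "'c list \<Rightarrow> nat \<Rightarrow> 'c" where
  "Sm z j = (\<Sum>s\<in>L. coeff (Tm s (f (s # z))) j)"

text \<open>The weight with which coefficient i enters the equation of the parent, since
  \<open>Tm\<close> multiplies it by \<omega>^(k - i).\<close>

definition um :: "'c list \<Rightarrow> nat \<Rightarrow> real" where
  "um w i = N \<omega> ^ (k - i) * N (coeff (f w) i)"

lemma eta_nonneg: "0 \<le> \<eta>"
  using equation[of "[]" 0 0] zero_L N_ge0 order_trans by (metis lists.Nil)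

lemma equation_coeff:
  assumes "w \<in> lists L" "t \<in> L"
  obtains x where "N x \<le> \<eta>" "a * coeff (f (t # w)) j = coeff (Tp t (f w)) j + Sm (t # w) j + x"
proof
  let ?x = "- coeff (Tp t (f w) + (\<Sum>s\<in>L. Tm s (f (s # t # w))) - smult a (f (t # w))) j"
  show "N ?x \<le> \<eta>" using equation[OF assms, of j] by (simp only: N_minus)
  show "a * coeff (f (t # w)) j = coeff (Tp t (f w)) j + Sm (t # w) j + ?x"
    by (simp add: Sm_def coeff_sum)
qed

lemma child_le:
  assumes "w \<in> lists L" "t \<in> L" "N (coeff (Tp t (f w)) j) \<le> B" "N (Sm (t # w) j) \<le> B" "\<eta> \<le> B"
  shows "N a * N (coeff (f (t # w)) j) \<le> B"
proof -
  obtain x where "N x \<le> \<eta>" "a * coeff (f (t # w)) j = coeff (Tp t (f w)) j + Sm (t # w) j + x"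
    using equation_coeff[OF assms(1,2), of j] .
  then show ?thesis using assms(3-) by (simp add: N_add_le flip: N_mult)
qed

lemma child_less:
  assumes "w \<in> lists L" "t \<in> L" "N (coeff (Tp t (f w)) j) < B" "N (Sm (t # w) j) < B" "\<eta> < B"
  shows "N a * N (coeff (f (t # w)) j) < B"
proof -
  obtain x where "N x \<le> \<eta>" "a * coeff (f (t # w)) j = coeff (Tp t (f w)) j + Sm (t # w) j + x"
    using equation_coeff[OF assms(1,2), of j] .
  then show ?thesis using assms(3-) by (simp add: N_add_less flip: N_mult)
qed

lemma Tp_le:
  assumes "w \<in> lists L" "t \<in> L" "N a * N (coeff (f (t # w)) j) \<le> B" "N (Sm (t # w) j) \<le> B" "\<eta> \<le> B"
  shows "N (coeff (Tp t (f w)) j) \<le> B"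
proof -
  obtain x where "N x \<le> \<eta>" "a * coeff (f (t # w)) j = coeff (Tp t (f w)) j + Sm (t # w) j + x"
    using equation_coeff[OF assms(1,2), of j] .
  then have "coeff (Tp t (f w)) j = a * coeff (f (t # w)) j - Sm (t # w) j - x" by simp
  then show ?thesis using assms(3-) \<open>N x \<le> \<eta>\<close> by (simp add: N_diff_le N_mult)
qed

lemma Tp_less:
  assumes "w \<in> lists L" "t \<in> L" "N a * N (coeff (f (t # w)) j) < B" "N (Sm (t # w) j) < B" "\<eta> < B"
  shows "N (coeff (Tp t (f w)) j) < B"
proof -
  obtain x where "N x \<le> \<eta>" "a * coeff (f (t # w)) j = coeff (Tp t (f w)) j + Sm (t # w) j + x"
    using equation_coeff[OF assms(1,2), of j] .
  then have "coeff (Tp t (f w)) j = a * coeff (f (t # w)) j - Sm (t # w) j - x" by simp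
  then show ?thesis using assms(3-) \<open>N x \<le> \<eta>\<close> by (simp add: N_diff_less N_mult)
qed

lemma Sm_term:
  assumes "s \<in> L"
  shows "N (\<omega> ^ (k - i) * coeff (f (s # z)) i * (of_nat (i choose j) * s ^ (i - j)))
    \<le> um (s # z) i * N (of_nat (i choose j))"
proof -
  have "N (s ^ (i - j)) \<le> 1" by (rule L_power_le1[OF assms])
  then show ?thesis unfolding um_def N_mult N_power[of \<omega>]
    by (intro mult_left_mono mult_left_le) auto
qed

lemma Sm_term_le:
  assumes "\<And>s i. s \<in> L \<Longrightarrow> i \<le> k \<Longrightarrow> um (s # z) i * N (of_nat (i choose j)) \<le> B" "0 \<le> B"
  shows "N (Sm z j) \<le> B"
  unfolding Sm_def coeff_Tm using assms
  by (intro N_sum_le order_trans[OF Sm_term]) auto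

lemma Sm_term_less:
  assumes "\<And>s i. s \<in> L \<Longrightarrow> i \<le> k \<Longrightarrow> um (s # z) i * N (of_nat (i choose j)) < B" "0 < B"
  shows "N (Sm z j) < B"
  unfolding Sm_def coeff_Tm using assms
  by (intro N_sum_less le_less_trans[OF Sm_term]) auto

lemma um_nonneg: "0 \<le> um w i"
  by (simp add: um_def)

lemma um_mult_binom_le: "um w i * N (of_nat n) \<le> um w i"
  using mult_left_mono[OF N_of_nat[of n] um_nonneg[of w i]] by simp

lemma Sm_le:
  assumes "\<And>s i. s \<in> L \<Longrightarrow> i \<le> k \<Longrightarrow> um (s # z) i \<le> B" "0 \<le> B"
  shows "N (Sm z j) \<le> B"
  using assms by (intro Sm_term_le order_trans[OF um_mult_binom_le]) auto

lemma Sm_less: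
  assumes "\<And>s i. s \<in> L \<Longrightarrow> i \<le> k \<Longrightarrow> um (s # z) i < B" "0 < B"
  shows "N (Sm z j) < B"
  using assms by (intro Sm_term_less le_less_trans[OF um_mult_binom_le]) auto

lemma Tp_inverse_f:
  assumes "\<And>t j. t \<in> L \<Longrightarrow> N (coeff (Tp t (f w)) j) \<le> B"
  shows "N (coeff (f w) i) \<le> B / N \<omega> ^ d"
  using Tp_inverse_le[of "f w" d r B i] degree_f[of w] rd k_eq assms om_pos
  by (simp add: field_simps)

text \<open>The substitution damps coefficient i by |\<omega>|^i, which outweighs the loss
  |\<omega>|^d of the inversion once i > d. A weak bound on all transforms so becomes strict at high
  indices.\<close>

lemma Tp_inverse_shift:
  assumes "\<And>t j. t \<in> L \<Longrightarrow> N (coeff (Tp t (f w)) j) \<le> B" "t \<in> L" "d < i" "0 < B"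
  shows "N (coeff (Tp t (f w)) i) < B"
proof -
  have "N (coeff (Tp t (f w)) i) \<le> N \<omega> ^ i * (B / N \<omega> ^ d)"
    using Tp_inverse_f[OF assms(1)] by (rule Tp_coeff_le[OF _ assms(2)])
  also have "\<dots> < B" using om_power_less[OF assms(3)] assms(4) om_pos by (simp add: field_simps)
  finally show ?thesis .
qed

end

text \<open>The number \<open>A\<close> is the largest coefficient occurring below the root, and it is assumed to be
  large compared with the error \<open>\<eta>\<close>.\<close>

locale large_solution = hecke_solution +
  fixes A :: real
  assumes A_pos: "0 < A" and f_le_A: "\<And>w j. w \<in> lists L \<Longrightarrow> w \<noteq> [] \<Longrightarrow> N (coeff (f w) j) \<le> A"
    and eta_less: "\<eta> < N a * (N a * A)" and om_q: "N \<omega> ^ q < N a"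
begin

text \<open>The disjunction guards the borderline m = |a| A: there |a| A is no longer below
  \<open>m\<close>, so the coefficients at the depth of \<open>z\<close> and beyond must be strictly
  below \<open>A\<close>. The last clause is the equation read upwards.\<close>

definition critical :: "'a list \<Rightarrow> real \<Rightarrow> bool" where
  "critical z m \<longleftrightarrow> z \<in> lists L \<and> 2 \<le> length z \<and> N a * A \<le> m \<and>
     (\<forall>w\<in>lists L. 2 \<le> length w \<longrightarrow> (\<forall>i\<le>k. um w i \<le> m)) \<and>
     (\<forall>w\<in>lists L. length z < length w \<longrightarrow> (\<forall>i\<le>k. um w i < m)) \<and>
     (N a * A < m \<or> (\<forall>w\<in>lists L. length z \<le> length w \<longrightarrow> (\<forall>j. N (coeff (f w) j) < A))) \<and>
     (\<forall>w\<in>lists L. length z \<le> length w \<longrightarrow> (\<forall>t\<in>L. \<forall>j. N (coeff (Tp t (f w)) j) < m))"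

lemma aA: "0 < N a * A" "N a * A < A" "0 < N a * (N a * A)" "N a * (N a * A) < N a * A"
  "\<eta> < N a * A" "\<eta> < A"
proof -
  show 1: "0 < N a * A" "N a * A < A" "0 < N a * (N a * A)" "N a * (N a * A) < N a * A"
    using a_pos A_pos a_square_less by auto
  show "\<eta> < N a * A" "\<eta> < A" using 1 eta_less by linarith+
qed

lemma words_ne:
  assumes "w \<in> lists L" "0 < length w"
  obtains t y where "w = t # y" "t \<in> L" "y \<in> lists L" "length y = length w - 1"
  using assms by (cases w) auto

text \<open>If no weighted coefficient reaches |a| A, the equation read upwards bounds every
  transform by |a| A < A. The values at -t control the coefficients below q; from q on,
  \<open>Tp_inverse_shift\<close> applies at the parent because q > d.\<close>

lemma all_small:
  assumes um: "\<And>w i. w \<in> lists L \<Longrightarrow> 2 \<le> length w \<Longrightarrow> i \<le> k \<Longrightarrow> um w i < N a * A"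
    and "w \<in> lists L" "w \<noteq> []"
  shows "N (coeff (f w) j) < A"
proof -
  have S: "N (Sm (t # y) j) < N a * A" if "y \<in> lists L" "t \<in> L" for t y j
    using that aA by (intro Sm_less um) auto
  \<comment> \<open>Here \<open>y\<close> may be the root, to which \<open>f_le_A\<close> does not
    apply; its transform is bounded through its children.\<close>
  have T: "N (coeff (Tp t (f y)) j) \<le> N a * A" if "y \<in> lists L" "t \<in> L" for t y j
    using that S[OF that, of j] aA(5) a_pos f_le_A[of "t # y" j] by (intro Tp_le) auto
  obtain t y where w: "w = t # y" "t \<in> L" "y \<in> lists L" 
    by (rule words_ne[OF assms(2)]) (use assms(3) in auto)
  show ?thesis
  proof (rule small_values_trunc)
    fix s assume "s \<in> L"
    then show "N (poly (f w) (- s)) < A"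
      using T[OF assms(2), of s 0] aA(2) by (simp add: coeff_Tp_0)
  next
    fix j assume "q \<le> j"
    then have "N (coeff (Tp t (f y)) j) < N a * A"
      using Tp_inverse_shift[of y "N a * A" t j] T[OF w(3)] w(2) rd aA(1) by auto
    then have "N a * N (coeff (f w) j) < N a * A"
      using w S aA(5) unfolding w(1) by (intro child_less) auto
    then show "N (coeff (f w) j) < A" using a_pos by simp
  qed
qed

text \<open>Beyond depth \<open>M\<close> everything vanishes, so the maximum is attained and a
  longest maximizer exists. Words of length 1 do not compete, because their parent is the
  root.\<close>

lemma critical_exists:
  assumes "w0 \<in> lists L" "2 \<le> length w0" "i0 \<le> k" "N a * A \<le> um w0 i0"
  obtains z m i where "critical z m" "i \<le> k" "um z i = m"
proof -
  define X where "X = {w \<in> lists L. 2 \<le> length w \<and> length w \<le> M} \<times> {..k}"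
  have "finite {w. set w \<subseteq> L \<and> length w \<le> M}" using finite_L finite_lists_length_le by blast
  then have "finite {w \<in> lists L. 2 \<le> length w \<and> length w \<le> M}"
    by (rule finite_subset[rotated]) auto
  then have finX: "finite X" unfolding X_def by simp
  have outside: "um w i = 0" if "M < length w" for w i using f_vanish[OF that] by (simp add: um_def)
  have "length w0 \<le> M" using outside[of w0 i0] assms(4) aA(1) by (metis not_le)
  then have X0: "(w0, i0) \<in> X" using assms by (auto simp: X_def)
  define m where "m = Max ((\<lambda>(w, i). um w i) ` X)"
  have mge: "um w i \<le> m" if "(w, i) \<in> X" for w i
    unfolding m_def using finX that by (intro Max_ge) auto
  have m: "N a * A \<le> m" "0 < m" using mge[OF X0] assms(4) aA(1) by auto
  have mall: "um w i \<le> m" if "w \<in> lists L" "2 \<le> length w" "i \<le> k" for w i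
    using that mge[of w i] outside[of w i] m(2) unfolding X_def
    by (cases "length w \<le> M") auto
  define Y where "Y = {length w |w i. (w, i) \<in> X \<and> um w i = m}"
  have "m \<in> (\<lambda>(w, i). um w i) ` X" unfolding m_def using finX X0 by (intro Max_in) auto
  then have "Y \<noteq> {}" unfolding Y_def by auto
  moreover have "finite Y" unfolding Y_def
    by (rule finite_subset[of _ "(\<lambda>(w, i). length w) ` X"]) (use finX in auto)
  ultimately have "Max Y \<in> Y" by (rule Max_in[rotated])
  then obtain z i where z: "(z, i) \<in> X" "um z i = m" "length z = Max Y" unfolding Y_def by auto
  have zL: "z \<in> lists L" "2 \<le> length z" "i \<le> k" using z(1) unfolding X_def by auto
  have longer: "um w i < m" if "w \<in> lists L" "length z < length w" "i \<le> k" for w i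
  proof (rule ccontr)
    assume "\<not> um w i < m"
    then have e: "um w i = m" using mall[of w i] that zL by simp
    then have "length w \<le> M" using outside[of w i] m(2) by (metis less_irrefl not_le)
    then have "(w, i) \<in> X" using that zL unfolding X_def by simp
    then have "length w \<in> Y" using e unfolding Y_def by auto
    then show False using that(2) z(3) Max_ge[OF \<open>finite Y\<close>, of "length w"] by linarith
  qed
  have S: "N (Sm y j) < m" if "y \<in> lists L" "length z \<le> length y" for y j
    using that m(2) by (intro Sm_less longer) auto
  \<comment> \<open>In the borderline case \<open>f_le_A\<close> is sharpened to a strict bound:
    below q by the values at -s, from q on by the parent, where \<open>om_q\<close> gives
    |\<omega>|^q A < |a| A.\<close>
  have small: "N (coeff (f y) j) < A" if hy: "m = N a * A" "y \<in> lists L" "length z \<le> length y" for y j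
  proof -
    obtain t w where y: "y = t # w" "t \<in> L" "w \<in> lists L" "length w = length y - 1"
      by (rule words_ne[of y]) (use hy zL(2) in auto)
    then have wne: "w \<noteq> []" using hy(3) zL(2) by auto
    show ?thesis
    proof (rule small_values_trunc)
      fix s assume s: "s \<in> L"
      have "N a * N (coeff (f (s # y)) 0) \<le> N a * A" using f_le_A[of "s # y" 0] s hy a_pos by simp
      then have "N (coeff (Tp s (f y)) 0) < A"
        using S[of "s # y" 0] s hy aA by (intro Tp_less) auto
      then show "N (poly (f y) (- s)) < A" by (simp add: coeff_Tp_0)
    next
      fix j assume "q \<le> j"
      have "N (coeff (Tp t (f w)) j) \<le> N \<omega> ^ j * A"
        using f_le_A[OF y(3) wne] y(2) by (rule Tp_coeff_le)
      also have "\<dots> \<le> N \<omega> ^ q * A" using om_power_le[OF \<open>q \<le> j\<close>] A_pos by simp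
      also have "\<dots> < N a * A" using om_q A_pos by simp
      finally have "N a * N (coeff (f y) j) < N a * A"
        using y S[of y j] hy aA unfolding y(1) by (intro child_less) auto
      then show "N (coeff (f y) j) < A" using a_pos by simp
    qed
  qed
  have T: "N (coeff (Tp t (f w)) j) < m" if "w \<in> lists L" "length z \<le> length w" "t \<in> L" for w t j
  proof (rule Tp_less[OF that(1,3)])
    show "N (Sm (t # w) j) < m" using that by (intro S) auto
    show "\<eta> < m" using m aA by linarith
    show "N a * N (coeff (f (t # w)) j) < m"
    proof (cases "m = N a * A")
      case True
      then show ?thesis using small[OF True, of "t # w" j] that a_pos by simp
    next
      case False
      have "N a * N (coeff (f (t # w)) j) \<le> N a * A" using f_le_A[of "t # w" j] that a_pos by simp
      then show ?thesis using False m by linarith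
    qed
  qed
  have "critical z m" unfolding critical_def
  proof (intro conjI ballI allI impI)
    show "N a * A < m \<or> (\<forall>w\<in>lists L. length z \<le> length w \<longrightarrow> (\<forall>j. N (coeff (f w) j) < A))"
      using m(1) small by (cases "m = N a * A") auto
  qed (use zL m mall longer T in auto)
  then show thesis using that zL z by blast
qed

lemma criticalD:
  assumes "critical z m"
  shows "z \<in> lists L" "2 \<le> length z" "N a * A \<le> m" "0 < m" "N a * (N a * A) \<le> N a * m" "\<eta> < N a * m"
    "\<And>w i. w \<in> lists L \<Longrightarrow> 2 \<le> length w \<Longrightarrow> i \<le> k \<Longrightarrow> um w i \<le> m"
    "\<And>w i. w \<in> lists L \<Longrightarrow> length z < length w \<Longrightarrow> i \<le> k \<Longrightarrow> um w i < m"
    "\<And>w t j. w \<in> lists L \<Longrightarrow> length z \<le> length w \<Longrightarrow> t \<in> L \<Longrightarrow> N (coeff (Tp t (f w)) j) < m"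
proof -
  show 1: "z \<in> lists L" "2 \<le> length z" "N a * A \<le> m"
    "\<And>w i. w \<in> lists L \<Longrightarrow> 2 \<le> length w \<Longrightarrow> i \<le> k \<Longrightarrow> um w i \<le> m"
    "\<And>w i. w \<in> lists L \<Longrightarrow> length z < length w \<Longrightarrow> i \<le> k \<Longrightarrow> um w i < m"
    "\<And>w t j. w \<in> lists L \<Longrightarrow> length z \<le> length w \<Longrightarrow> t \<in> L \<Longrightarrow> N (coeff (Tp t (f w)) j) < m"
    using assms unfolding critical_def by auto
  show "0 < m" "N a * (N a * A) \<le> N a * m" using 1(3) aA(1) a_pos by auto
  then show "\<eta> < N a * m" using eta_less by linarith
qed

lemma critical_cases:
  assumes "critical z m"
  shows "N a * A < m \<or> m = N a * A \<and> (\<forall>w\<in>lists L. length z \<le> length w \<longrightarrow> (\<forall>j. N (coeff (f w) j) < A))"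
  using assms unfolding critical_def by fastforce

lemma critical_mult_less:
  assumes "critical z m" "w \<in> lists L" "length z \<le> length w"
  shows "N a * (N a * N (coeff (f w) j)) < N a * m" "N a * N (coeff (f w) j) < m"
proof -
  have "w \<noteq> []" using criticalD(2)[OF assms(1)] assms(3) by auto
  then have le: "N a * N (coeff (f w) j) \<le> N a * A" using f_le_A[OF assms(2)] a_pos by simp
  show "N a * N (coeff (f w) j) < m"
    using critical_cases[OF assms(1)]
  proof
    assume "m = N a * A \<and> (\<forall>w\<in>lists L. length z \<le> length w \<longrightarrow> (\<forall>j. N (coeff (f w) j) < A))"
    then show ?thesis using assms(2,3) a_pos by simp
  qed (use le in linarith)
  then show "N a * (N a * N (coeff (f w) j)) < N a * m" using a_pos by simp
qed

text \<open>Here the weight |\<omega>|^(k - i) pays for the complete inversion of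
  \<open>Tp\<close>.\<close>

lemma critical_low:
  assumes "critical z m" "d \<le> k - i"
  shows "um z i < m"
proof -
  note c = criticalD[OF assms(1)]
  obtain B where B: "B < m" "\<forall>t\<in>L. \<forall>j. N (coeff (Tp t (f z)) j) \<le> B"
    using strict_bound_poly[OF finite_L, of "\<lambda>t. Tp t (f z)" m] c(9)[OF c(1)] c(4) by auto
  have "N (coeff (f z) i) \<le> B / N \<omega> ^ d" using Tp_inverse_f B(2) by blast
  then have "N \<omega> ^ d * N (coeff (f z) i) \<le> B" using om_pos by (simp add: field_simps)
  moreover have "um z i \<le> N \<omega> ^ d * N (coeff (f z) i)"
    unfolding um_def using om_power_le[OF assms(2)] by (simp add: mult_right_mono)
  ultimately show ?thesis using B(1) by linarith
qed

text \<open>For l < d the weight |\<omega>|^l does not pay for a complete inversion;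
  \<open>top_coeff_le\<close> loses only |\<omega>|^l, in exchange for information on one
  diagonal.\<close>

lemma critical_top:
  assumes "critical z m" "l < d" "l \<le> r"
    and "\<And>t. l < t \<Longrightarrow> t \<le> d \<Longrightarrow> N \<omega> ^ l * N (coeff (f z) ((d - t) * q + (r - l) + t)) < m"
  shows "um z (k - l) < m"
proof -
  note c = criticalD[OF assms(1)]
  obtain B where B: "0 \<le> B" "B < m" "\<forall>t\<in>L. \<forall>j. N (coeff (Tp t (f z)) j) \<le> B"
    using strict_bound_poly[OF finite_L, of "\<lambda>t. Tp t (f z)" m] c(9)[OF c(1)] c(4) by auto
  obtain B' where B': "B' < m"
    "\<forall>t\<in>{l<..d}. N (\<omega> ^ l * coeff (f z) ((d - t) * q + (r - l) + t)) \<le> B'"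
    using strict_bound[of "{l<..d}" "\<lambda>t. \<omega> ^ l * coeff (f z) ((d - t) * q + (r - l) + t)" m]
      assms(4) c(4) by (auto simp: N_mult N_power)
  have "N \<omega> ^ l * N (coeff (f z) (d * q + (r - l))) \<le> max B B'"
  proof (rule top_coeff_le[OF assms(2)])
    show "degree (f z) \<le> d * q + r" using degree_f k_eq by simp
    show "N (coeff (Tp t (f z)) j) \<le> max B B'" if "t \<in> L" for t j using B(3) that by (simp add: le_max_iff_disj)
    show "N \<omega> ^ l * N (coeff (f z) ((d - t) * q + (r - l) + t)) \<le> max B B'"
      if "l < t" "t \<le> d" for t using B'(2) that by (simp add: N_mult N_power le_max_iff_disj)
  qed (use rd in auto)
  moreover have "k - l = d * q + (r - l)" "k - (k - l) = l" using k_eq assms(3) by auto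
  ultimately show ?thesis unfolding um_def using B(2) B'(1) by simp
qed

section \<open>Exclusion of critical words when |\<omega>|^(r + 1) \<le> |a|^2\<close>

lemma mod_shift: "r' + t < q \<Longrightarrow> ((d - t) * q + r' + t) mod q = r' + t"
  by (metis add.assoc mod_less mod_mult_self3)

text \<open>Put l = k - i. For l \<ge> d inversion suffices, for l > r the weight is at most |a|^2.
  The rest needs the diagonal indices of \<open>critical_top\<close>, whose residues modulo q exceed
  r. At such an index the children contribute little: from i \<ge> d q the binomials are divisible
  by p, and a lower i carries |\<omega>|^(r + 1) \<le> |a|^2. The parent contributes at most
  |\<omega>|^(r + 1) A.\<close>

lemma critical_I:
  assumes cr: "critical z m" and om_r: "N \<omega> ^ Suc r \<le> N a * N a" and dr: "d = 1 \<Longrightarrow> 1 \<le> r"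
    and i: "i \<le> k"
  shows "um z i < m"
proof -
  note c = criticalD[OF cr]
  obtain t0 w0 where z: "z = t0 # w0" "t0 \<in> L" "w0 \<in> lists L" "length w0 = length z - 1"
    by (rule words_ne[OF c(1)]) (use c(2) in auto)
  have w0: "w0 \<noteq> []" using z c(2) by auto
  have far: "N \<omega> ^ j * x \<le> N a * (N a * x)" if "Suc r \<le> j" "0 \<le> x" for j x
    using mult_right_mono[OF order_trans[OF om_power_le[OF that(1)] om_r] that(2)] by (simp add: mult_ac)
  have modlt: "i' mod q < j mod q" if "d * q \<le> i'" "i' \<le> k" "r < j mod q" for i' j
  proof -
    have "i' - d * q < q" "i' - d * q \<le> r" using that k_eq rd by auto
    then have "i' mod q \<le> r" using that(1) by (metis le_add_diff_inverse mod_less mod_mult_self3)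
    then show ?thesis using that(3) by simp
  qed
  have S: "N (Sm z j) < N a * m" if j: "r < j mod q" for j
  proof (rule Sm_term_less)
    fix s i' assume s: "s \<in> L" and i': "i' \<le> k"
    have sz: "s # z \<in> lists L" using s c(1) by simp
    show "um (s # z) i' * N (of_nat (i' choose j)) < N a * m"
    proof (cases "d * q \<le> i'")
      case True
      have "um (s # z) i' * N (of_nat (i' choose j)) \<le> um (s # z) i' * N a"
        using N_binom_le_a[OF modlt[OF True i' j]] by (intro mult_left_mono um_nonneg)
      also have "\<dots> < m * N a" using c(8)[OF sz] i' a_pos by simp
      finally show ?thesis by (simp add: mult.commute)
    next
      case False
      then have "um (s # z) i' \<le> N a * (N a * N (coeff (f (s # z)) i'))"
        unfolding um_def using k_eq by (intro far) auto
      also have "\<dots> < N a * m" using critical_mult_less(1)[OF cr sz] by simp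
      finally show ?thesis using um_mult_binom_le[of "s # z" i' "i' choose j"] by linarith
    qed
  qed (use a_pos c(4) in simp)
  have Tw: "N (coeff (Tp t0 (f w0)) j) \<le> N \<omega> ^ j * A" for j
    using f_le_A[OF z(3) w0] z(2) by (rule Tp_coeff_le)
  have cle: "N (coeff (f z) j) \<le> m" if j: "r < j mod q" for j
  proof -
    have "Suc r \<le> j" using j mod_less_eq_dividend[of j q] by linarith
    then have "N (coeff (Tp t0 (f w0)) j) \<le> N a * m" using Tw[of j] far[of j A] A_pos c(5) by linarith
    then have "N a * N (coeff (f z) j) \<le> N a * m"
      unfolding z(1) using z S[OF j] c(6) by (intro child_le) auto
    then show ?thesis using a_pos by simp
  qed
  have child: "N (coeff (f z) j) < m" if "r < j mod q" "N (coeff (Tp t0 (f w0)) j) < N a * m" for j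
  proof -
    have "N a * N (coeff (f z) j) < N a * m"
      unfolding z(1) using z S[of j] c(6) that by (intro child_less) auto
    then show ?thesis using a_pos by simp
  qed
  have cless: "N (coeff (f z) j) < m" if j: "r < j mod q" and "Suc r < j \<or> N a * A < m" for j
  proof (rule child[OF j])
    have j': "Suc r \<le> j" using j mod_less_eq_dividend[of j q] by linarith
    show "N (coeff (Tp t0 (f w0)) j) < N a * m"
    proof (cases "N a * A < m")
      case True
      then have "N a * (N a * A) < N a * m" using a_pos by simp
      then show ?thesis using Tw[of j] far[OF j', of A] A_pos by linarith
    next
      case False
      then have "Suc r < j" using that by simp
      then have "N \<omega> ^ j * A < N \<omega> ^ Suc r * A"
        by (intro mult_strict_right_mono om_power_less A_pos)
      then show ?thesis using Tw[of j] far[of "Suc r" A] A_pos c(5) by linarith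
    qed
  qed
  \<comment> \<open>The one index without slack: if d = 1 and m = |a| A, the parent's bound
    |\<omega>|^(r + 1) A may equal |a| m. The strict inequality is fetched one level higher, from
    the coefficients of \<open>f w0\<close>.\<close>
  have special: "N (coeff (f z) (Suc r)) < m" if d: "d = 1"
  proof (cases "N a * A < m")
    case True
    then show ?thesis using cless[of "Suc r"] rd d by simp
  next
    case False
    then have m: "m = N a * A" using c(3) by simp
    obtain t1 w1 where w: "w0 = t1 # w1" "t1 \<in> L" "w1 \<in> lists L"
      by (rule words_ne[OF z(3)]) (use w0 in auto)
    \<comment> \<open>The word \<open>w1\<close> may be the root, hence the detour through its
      children.\<close>
    have T1: "N (coeff (Tp t (f w1)) j) \<le> N a * A" if "t \<in> L" for t j
    proof (rule Tp_le[OF w(3) that])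
      show "N a * N (coeff (f (t # w1)) j) \<le> N a * A" using f_le_A[of "t # w1" j] that w a_pos by simp
      show "N (Sm (t # w1) j) \<le> N a * A"
        using that w aA(1) c(7) unfolding m by (intro Sm_le) auto
    qed (use aA in simp)
    \<comment> \<open>This is where r \<ge> 1 enters: the index is at least 2 > d, so the transform
      of \<open>f w1\<close> is strictly below |a| A.\<close>
    have c0: "N (coeff (f w0) i') < A" if i': "Suc r \<le> i'" "i' < q" for i'
    proof -
      have "N a * N (coeff (f w0) i') < N a * A"
        unfolding w(1)
      proof (rule child_less[OF w(3,2)])
        show "N (coeff (Tp t1 (f w1)) i') < N a * A"
          using T1 w(2) d dr i' aA(1) by (intro Tp_inverse_shift) auto
        show "N (Sm (t1 # w1) i') < N a * A"
        proof (rule Sm_term_less)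
          fix s j assume s: "s \<in> L" and j: "j \<le> k"
          let ?y = "s # t1 # w1"
          have y: "?y \<in> lists L" "2 \<le> length ?y" using s w by auto
          show "um ?y j * N (of_nat (j choose i')) < N a * A"
          proof (cases "d * q \<le> j")
            case True
            have "um ?y j * N (of_nat (j choose i')) \<le> um ?y j * N a"
              using N_binom_le_a[OF modlt[OF True j, of i']] i' by (intro mult_left_mono um_nonneg) auto
            also have "\<dots> \<le> m * N a" using c(7)[OF y j] by (simp add: mult_right_mono)
            also have "\<dots> < N a * A" using aA(4) unfolding m by (simp add: mult_ac)
            finally show ?thesis .
          next
            case False
            then have "um ?y j \<le> N a * (N a * N (coeff (f ?y) j))"
              unfolding um_def using k_eq by (intro far) auto
            also have "\<dots> \<le> N a * (N a * A)" using f_le_A[OF y(1), of j] by (simp add: mult_left_mono)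
            finally show ?thesis using um_mult_binom_le[of ?y j "j choose i'"] aA(4) by linarith
          qed
        qed (rule aA)
        show "\<eta> < N a * A" by (rule aA)
      qed
      then show ?thesis using a_pos by simp
    qed
    have "N (coeff (f w0) i' * of_nat (i' choose Suc r) * (- t0) ^ (i' - Suc r)) < A" for i'
    proof -
      consider "i' < Suc r" | "Suc r \<le> i'" "i' < q" | "q \<le> i'" "i' \<le> k" | "k < i'" by linarith
      then show ?thesis
      proof cases
        case 2
        then show ?thesis using c0 Tp_coeff_term_le[OF z(2) order_refl] by (meson le_less_trans)
      next
        case 3
        then have "N (of_nat (i' choose Suc r)) \<le> N a"
          using d rd by (intro N_binom_le_a modlt) auto
        then have "N (coeff (f w0) i' * of_nat (i' choose Suc r)) \<le> A * N a"
          using f_le_A[OF z(3) w0] by (intro N_mult_le)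
        then have "N (coeff (f w0) i' * of_nat (i' choose Suc r) * of_nat 1 * (- t0) ^ (i' - Suc r)) \<le> A * N a"
          by (intro Tp_coeff_term_le[OF z(2)]) simp
        then show ?thesis using aA(2) by (simp add: mult.commute)
      next
        case 4
        then show ?thesis using degree_f[of w0] A_pos by (simp add: coeff_eq_0)
      qed (use A_pos in \<open>simp add: binomial_eq_0\<close>)
    qed
    then have "N (\<Sum>i\<le>k. coeff (f w0) i * of_nat (i choose Suc r) * (- t0) ^ (i - Suc r)) < A"
      using A_pos by (intro N_sum_less)
    then have "N (coeff (Tp t0 (f w0)) (Suc r)) < N \<omega> ^ Suc r * A"
      unfolding coeff_Tp[OF degree_f] N_mult N_power using om_pos by simp
    also have "\<dots> \<le> N a * m" using far[of "Suc r" A] A_pos unfolding m by simp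
    finally show ?thesis using rd d by (intro child) auto
  qed
  show ?thesis
  proof -
    define l where "l = k - i"
    have il: "i = k - l" "l \<le> k" using i by (auto simp: l_def)
    consider "d \<le> l" | "r < l" | "l < d" "l \<le> r" by linarith
    then show ?thesis
    proof cases
      case 1
      then show ?thesis using critical_low[OF cr] l_def by blast
    next
      case 2
      then have "um z i \<le> N a * (N a * N (coeff (f z) i))"
        unfolding um_def using l_def by (intro far) auto
      also have "\<dots> < N a * m" using critical_mult_less(1)[OF cr c(1)] by simp
      finally show ?thesis using a_square_less(2)[OF c(4)] by linarith
    next
      case 3
      show ?thesis unfolding il(1)
      proof (rule critical_top[OF cr 3])
        fix t assume t: "l < t" "t \<le> d"
        let ?j = "(d - t) * q + (r - l) + t"
        have "?j mod q = r - l + t" using t rd 3 by (intro mod_shift) auto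
        then have jm: "r < ?j mod q" using t 3 by simp
        show "N \<omega> ^ l * N (coeff (f z) ?j) < m"
        \<comment> \<open>For l > 0 the factor |\<omega>|^l turns the weak bound \<open>cle\<close>
          into a strict one; for l = 0 the coefficient itself has to be strictly below
          \<open>m\<close>.\<close>
        proof (cases "l = 0")
          case True
          show ?thesis
          proof (cases "d = 1")
            case d1: True
            then have "t = 1" using t by simp
            then show ?thesis using special d1 \<open>l = 0\<close> by simp
          next
            case False
            have "Suc r < ?j"
            proof (cases "t = d")
              case True
              then show ?thesis using \<open>l = 0\<close> \<open>d \<noteq> 1\<close> t by simp
            next
              case False
              then have "1 * q \<le> (d - t) * q" using t by (intro mult_right_mono) auto
              then show ?thesis using q_ge2 \<open>l = 0\<close> t by linarith
            qed
            then show ?thesis using cless[OF jm] True by simp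
          qed
        next
          case False
          then have "N \<omega> ^ l < 1" using om_power_less[of 0 l] by simp
          then have "N \<omega> ^ l * m < m" using c(4) by simp
          moreover have "N \<omega> ^ l * N (coeff (f z) ?j) \<le> N \<omega> ^ l * m"
            using cle[OF jm] by (simp add: mult_left_mono)
          ultimately show ?thesis by linarith
        qed
      qed
    qed
  qed
qed


section \<open>Exclusion of critical words for k = d q with d different from 1\<close>

lemma coeff_rem_2:
  assumes "degree v \<le> 2 * q" "2 < q"
  shows "coeff (v mod theta) 2 = coeff v 2 + sgn_q * coeff v (q + 1) + coeff v (2 * q)"
proof -
  \<comment> \<open>Modulo \<theta> the power y^q equals \<open>sgn_q\<close> times y, so y^(q + 1)
    and y^(2 q) both reduce to multiples of y^2; the sign squares to 1 in the second case.\<close>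
  have "degree (v div theta) \<le> q" using degree_quot[of v 1 0] assms(1) by simp
  then have "coeff (v div theta) (2 * q - 1) = 0" using assms(2) by (intro coeff_eq_0) linarith
  then have "coeff v (2 * q) = coeff (v div theta) q"
    using coeff_decomp[of v "2 * q"] assms(2) by (simp add: coeff_rem_0)
  moreover have "coeff v (q + 1) = coeff (v div theta) 1 - sgn_q * coeff (v div theta) q"
    using coeff_decomp[of v "q + 1"] by (simp add: coeff_rem_0)
  moreover have "coeff v 2 = coeff (v mod theta) 2 - sgn_q * coeff (v div theta) 1"
    using coeff_decomp[of v 2] assms(2) by simp
  moreover have "sgn_q * (x - sgn_q * y) = sgn_q * x - y" for x y
    by (simp add: right_diff_distrib flip: mult.assoc)
  ultimately show ?thesis by simp
qed

text \<open>With r = 0 only |\<omega>|^2 \<le> |a|^2 is available instead of |\<omega>|^(r + 1)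
  \<le> |a|^2. Two places need more: coefficient k - 1 of the children, whose weight is a single
  |\<omega>|, and index 2, which lies on the diagonal when d = 2.\<close>

lemma critical_II:
  assumes cr: "critical z m" and r0: "r = 0" and d1: "d \<noteq> 1" and om_a: "N \<omega> \<le> N a"
    and i: "i \<le> k"
  shows "um z i < m"
proof (cases "d = 0")
  case True
  then show ?thesis using critical_low[OF cr] by simp
next
  case False
  note c = criticalD[OF cr]
  have d2: "2 \<le> d" "2 < q" using False d1 rd by auto
  have kq: "k = d * q" using k_eq r0 by simp
  have k6: "6 \<le> k" using mult_le_mono[OF d2(1), of 3 q] d2 kq by simp
  obtain t0 w0 where z: "z = t0 # w0" "t0 \<in> L" "w0 \<in> lists L" "length w0 = length z - 1"
    by (rule words_ne[OF c(1)]) (use c(2) in auto)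
  have w0: "w0 \<noteq> []" using z c(2) by auto
  have om2: "N \<omega> ^ j * x \<le> N a * (N a * x)" if "2 \<le> j" "0 \<le> x" for j x
  proof -
    have "N \<omega> ^ j \<le> N \<omega> ^ 2" by (rule om_power_le[OF that(1)])
    also have "\<dots> \<le> N a * N a" unfolding power2_eq_square using om_a by (intro mult_mono) auto
    finally have "N \<omega> ^ j \<le> N a * N a" .
    from mult_right_mono[OF this that(2)] show ?thesis by (simp add: mult.assoc)
  qed
  have om3: "N \<omega> ^ j * A < N a * m" if "3 \<le> j" for j
  proof -
    have "N \<omega> ^ j * A < N \<omega> ^ 2 * A" using that by (intro mult_strict_right_mono om_power_less A_pos) auto
    then show ?thesis using om2[OF order_refl less_imp_le[OF A_pos]] c(5) by linarith
  qed
  have modk: "N (of_nat (k choose j)) \<le> N a" if "0 < j mod q" for j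
    using that kq by (intro N_binom_le_a) simp
  have am: "0 < N a * m" using a_pos c(4) by simp
  have q1: "0 < (q + 1) mod q" unfolding mod_add_self1 using d2 by simp
  \<comment> \<open>Induction from the leaves: of the children only the coefficients k and k - 1
    matter. The former comes with the binomial k, a multiple of q, the latter with |\<omega>| \<le>
    |a| and the induction hypothesis.\<close>
  have top1: "N (coeff (f w) (k - 1)) < m" if "w \<in> lists L" "length z < length w" for w
    using that
  proof (induction "Suc M - length w" arbitrary: w rule: less_induct)
    case less
    show ?case
    proof (cases "M < length w")
      case True
      then show ?thesis using f_vanish c(4) by simp
    next
      case False
      obtain t y where w: "w = t # y" "t \<in> L" "y \<in> lists L" "length y = length w - 1"
        by (rule words_ne[OF less.prems(1)]) (use less.prems(2) in auto)
      have "y \<noteq> []" using w less.prems(2) c(2) by auto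
      then have "N (coeff (Tp t (f y)) (k - 1)) \<le> N \<omega> ^ (k - 1) * A"
        using f_le_A[OF w(3)] w(2) by (intro Tp_coeff_le)
      then have T: "N (coeff (Tp t (f y)) (k - 1)) < N a * m" using om3[of "k - 1"] k6 by linarith
      have "N (Sm w (k - 1)) < N a * m"
      proof (rule Sm_term_less[OF _ am])
        fix s j assume s: "s \<in> L" and j: "j \<le> k"
        have sw: "s # w \<in> lists L" "length z < length (s # w)" using s less.prems by auto
        consider "j = k" | "j = k - 1" "j \<noteq> k" | "j < k - 1" using j by linarith
        then show "um (s # w) j * N (of_nat (j choose (k - 1))) < N a * m"
        proof cases
          case 1
          have "k choose (k - 1) = k" using binomial_symmetric[of 1 k] k6 by simp
          then have "N (of_nat (j choose (k - 1))) \<le> N (of_nat q)"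
            unfolding 1 using kq by (intro N_of_nat_dvd) simp
          then have "um (s # w) j * N (of_nat (j choose (k - 1))) \<le> um (s # w) j * N a"
            using N_q_less1(2) by (intro mult_left_mono um_nonneg) linarith
          also have "\<dots> < m * N a" using c(8)[OF sw] j a_pos by simp
          finally show ?thesis by (simp add: mult.commute)
        next
          case 2
          have "N (coeff (f (s # w)) (k - 1)) < m" using False sw by (intro less.hyps) auto
          moreover have "um (s # w) j = N \<omega> * N (coeff (f (s # w)) (k - 1))"
            unfolding um_def 2(1) using k6 by simp
          ultimately have "um (s # w) j < N \<omega> * m" using om_pos by simp
          also have "\<dots> \<le> N a * m" using om_a c(4) by simp
          finally show ?thesis using um_mult_binom_le[of "s # w" j "j choose (k - 1)"] by linarith
        next
          case 3
          then show ?thesis using am by (simp add: binomial_eq_0)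
        qed
      qed
      then have "N a * N (coeff (f w) (k - 1)) < N a * m"
        unfolding w(1) using w T c(6) by (intro child_less) auto
      then show ?thesis using a_pos by simp
    qed
  qed
  have S: "N (Sm y j) < N a * m" if y: "y \<in> lists L" "length z \<le> length y" and j: "0 < j mod q" for y j
  proof (rule Sm_term_less[OF _ am])
    fix s i' assume s: "s \<in> L" and i': "i' \<le> k"
    have sy: "s # y \<in> lists L" "length z < length (s # y)" using s y by auto
    consider "i' = k" | "i' = k - 1" | "i' \<le> k - 2" using i' by linarith
    then show "um (s # y) i' * N (of_nat (i' choose j)) < N a * m"
    proof cases
      case 1
      have "um (s # y) i' * N (of_nat (i' choose j)) \<le> um (s # y) i' * N a"
        unfolding 1 using modk[OF j] by (intro mult_left_mono um_nonneg)
      also have "\<dots> < m * N a" using c(8)[OF sy i'] a_pos by simp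
      finally show ?thesis by (simp add: mult.commute)
    next
      case 2
      have "um (s # y) i' = N \<omega> * N (coeff (f (s # y)) (k - 1))" unfolding um_def 2 using k6 by simp
      also have "\<dots> < N \<omega> * m" using top1[OF sy] om_pos by simp
      also have "\<dots> \<le> N a * m" using om_a c(4) by simp
      finally show ?thesis using um_mult_binom_le[of "s # y" i' "i' choose j"] by linarith
    next
      case 3
      then have "um (s # y) i' \<le> N a * (N a * N (coeff (f (s # y)) i'))"
        unfolding um_def using k6 by (intro om2) auto
      also have "\<dots> < N a * m" using critical_mult_less(1)[OF cr sy(1)] sy(2) by simp
      finally show ?thesis using um_mult_binom_le[of "s # y" i' "i' choose j"] by linarith
    qed
  qed
  have child: "N (coeff (f (t # y)) j) < m"
    if "y \<in> lists L" "t \<in> L" "length z \<le> Suc (length y)" "0 < j mod q"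
      "N (coeff (Tp t (f y)) j) < N a * m" for t y j
  proof -
    have "N a * N (coeff (f (t # y)) j) < N a * m"
      using S[of "t # y" j] c(6) that by (intro child_less) auto
    then show ?thesis using a_pos by simp
  qed
  have Tw: "N (coeff (Tp t (f w0)) j) \<le> N \<omega> ^ j * A" if "t \<in> L" for t j
    using f_le_A[OF z(3) w0] that by (rule Tp_coeff_le)
  have c3: "N (coeff (f (t # w0)) j) < m" if "t \<in> L" "0 < j mod q" "3 \<le> j" for t j
    using that z Tw[of t j] om3[of j] by (intro child) auto
  have c2: "N (coeff (f z) 2) < m" if deq: "d = 2"
  proof (cases "N a * A < m \<or> N \<omega> < N a")
    case True
    then have "N \<omega> ^ 2 * A < N a * m"
    proof
      assume "N a * A < m"
      then have "N a * (N a * A) < N a * m" using a_pos by simp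
      then show ?thesis using om2[OF order_refl less_imp_le[OF A_pos]] by linarith
    next
      assume "N \<omega> < N a"
      then have "N \<omega> ^ 2 < N a * N a" unfolding power2_eq_square by (metis mult_strict_mono a_pos N_ge0)
      from mult_strict_right_mono[OF this A_pos] have "N \<omega> ^ 2 * A < N a * (N a * A)" by (simp add: mult.assoc)
      then show ?thesis using c(5) by linarith
    qed
    then show ?thesis unfolding z(1) using z Tw[OF z(2), of 2] d2 by (intro child) auto
  next
    case False
    \<comment> \<open>Now |\<omega>|^2 A = |a| m, so the parent's term at index 2 has no slack. It
      is gained from the siblings \<open>t # w0\<close>: their coefficients 2 have a small sum,
      hence so do their coefficients k, which bounds coefficient k of \<open>f w0\<close>, then its
      coefficient 2, and finally the parent's term.\<close>
    then have m: "m = N a * A" and oma: "N \<omega> = N a" using c(3) om_a by auto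
    have k2: "k = 2 * q" using kq deq by simp
    have fA: "N (coeff (f w) j) < A" if "w \<in> lists L" "length z \<le> length w" for w j
      using critical_cases[OF cr] False that by blast
    obtain t1 w1 where w: "w0 = t1 # w1" "t1 \<in> L" "w1 \<in> lists L"
      by (rule words_ne[OF z(3)]) (use w0 in auto)
    have T1: "N (coeff (Tp t (f w1)) j) \<le> N a * A" if "t \<in> L" for t j
    proof (rule Tp_le[OF w(3) that])
      show "N a * N (coeff (f (t # w1)) j) \<le> N a * A" using f_le_A[of "t # w1" j] that w a_pos by simp
      show "N (Sm (t # w1) j) \<le> N a * A"
        using that w aA(1) c(7) unfolding m by (intro Sm_le) auto
    qed (use aA in simp)
    have T1s: "N (coeff (Tp t1 (f w1)) j) < N a * A" if "3 \<le> j" for j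
      using T1 w(2) deq that aA(1) by (intro Tp_inverse_shift) auto
    have E1: "N (coeff (f w0) j) < A" if j: "3 \<le> j" "0 < j mod q" for j
    proof -
      have "N (Sm w0 j) < N a * A"
      proof (rule Sm_term_less[OF _ aA(1)])
        fix s i' assume s: "s \<in> L" and i': "i' \<le> k"
        let ?y = "s # w0"
        have y: "?y \<in> lists L" "length z \<le> length ?y" using s z by auto
        consider "i' = k" | "i' = k - 1" | "i' \<le> k - 2" using i' by linarith
        then show "um ?y i' * N (of_nat (i' choose j)) < N a * A"
        proof cases
          case 1
          have "um ?y i' * N (of_nat (i' choose j)) \<le> um ?y i' * N a"
            unfolding 1 using modk[OF j(2)] by (intro mult_left_mono um_nonneg)
          also have "\<dots> \<le> m * N a" using c(7)[OF y(1) _ i'] y(2) c(2) by (simp add: mult_right_mono)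
          also have "\<dots> < N a * A" using aA(4) unfolding m by (simp add: mult_ac)
          finally show ?thesis .
        next
          case 2
          have "um ?y i' = N \<omega> * N (coeff (f ?y) (k - 1))" unfolding um_def 2 using k6 by simp
          also have "\<dots> < N a * A" using fA[OF y] om_pos oma by simp
          finally show ?thesis using um_mult_binom_le[of ?y i' "i' choose j"] by linarith
        next
          case 3
          then have "um ?y i' \<le> N a * (N a * N (coeff (f ?y) i'))"
            unfolding um_def using k6 by (intro om2) auto
          also have "\<dots> \<le> N a * (N a * A)" using f_le_A[OF y(1), of i'] by (simp add: mult_left_mono)
          finally show ?thesis using um_mult_binom_le[of ?y i' "i' choose j"] aA(4) by linarith
        qed
      qed
      then have "N a * N (coeff (f w0) j) < N a * A"
        unfolding w(1) using w T1s[OF j(1)] aA(5) by (intro child_less) auto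
      then show ?thesis using a_pos by simp
    qed
    have trm: "N (coeff (f w0) j * of_nat (j choose 2) * x) < A"
      if x: "N x \<le> 1" and j2: "j = 2 \<Longrightarrow> N (coeff (f w0) j * of_nat (j choose 2) * x) < A" for j x
    proof -
      consider "j < 2" | "j = 2" | "3 \<le> j" "0 < j mod q" | "3 \<le> j" "j mod q = 0" by linarith
      then show ?thesis
      proof cases
        case 3
        have "N (coeff (f w0) j * of_nat (j choose 2) * x) \<le> N (coeff (f w0) j) * 1 * 1"
          by (intro N_mult_le N_of_nat x order_refl)
        then show ?thesis using E1[OF 3] by simp
      next
        case 4
        have "N (of_nat (j choose 2)) \<le> N a" using 4 d2 by (intro N_binom_le_a) simp
        then have "N (coeff (f w0) j * of_nat (j choose 2) * x) \<le> A * N a * 1"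
          using f_le_A[OF z(3) w0] x by (intro N_mult_le)
        then show ?thesis using aA(2) by (simp add: mult.commute)
      qed (use j2 A_pos in \<open>auto simp: binomial_eq_0\<close>)
    qed
    have om_sq: "N \<omega> ^ 2 * A = N a * m" unfolding m oma by (simp add: power2_eq_square)
    have sumc2: "N (\<Sum>t\<in>L. coeff (f (t # w0)) 2) < m"
    proof -
      define err where "err t = a * coeff (f (t # w0)) 2 - coeff (Tp t (f w0)) 2 - Sm (t # w0) 2" for t
      have err: "N (err t) \<le> \<eta>" if t: "t \<in> L" for t
      proof -
        obtain x where "N x \<le> \<eta>" "a * coeff (f (t # w0)) 2 = coeff (Tp t (f w0)) 2 + Sm (t # w0) 2 + x"
          using equation_coeff[OF z(3) t, of 2] .
        then show ?thesis unfolding err_def by simp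
      qed
      have "(\<Sum>t\<in>L. coeff (Tp t (f w0)) 2)
          = (\<Sum>t\<in>L. \<Sum>j\<le>k. \<omega> ^ 2 * (coeff (f w0) j * of_nat (j choose 2) * (- t) ^ (j - 2)))"
        unfolding coeff_Tp[OF degree_f] by (simp add: sum_distrib_left)
      also have "\<dots> = (\<Sum>j\<le>k. \<omega> ^ 2 * (coeff (f w0) j * of_nat (j choose 2) * (\<Sum>t\<in>L. (- t) ^ (j - 2))))"
        by (subst sum.swap) (simp add: sum_distrib_left)
      also have "\<dots> = \<omega> ^ 2 * (\<Sum>j\<le>k. coeff (f w0) j * of_nat (j choose 2) * (\<Sum>t\<in>L. (- t) ^ (j - 2)))"
        by (simp add: sum_distrib_left)
      finally have eq: "(\<Sum>t\<in>L. coeff (Tp t (f w0)) 2)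
        = \<omega> ^ 2 * (\<Sum>j\<le>k. coeff (f w0) j * of_nat (j choose 2) * (\<Sum>t\<in>L. (- t) ^ (j - 2)))" .
      \<comment> \<open>For j = 2 the inner sum is q, and |q| \<le> |a| < 1; for every other j the
        term is below A already.\<close>
      have "N (\<Sum>j\<le>k. coeff (f w0) j * of_nat (j choose 2) * (\<Sum>t\<in>L. (- t) ^ (j - 2))) < A"
      proof (rule N_sum_less[OF trm A_pos])
        fix j
        show "N (\<Sum>t\<in>L. (- t) ^ (j - 2)) \<le> 1"
          using L_power_le1 by (intro N_sum_le) (auto simp: N_power)
        assume "j = 2"
        then have "N (coeff (f w0) j * of_nat (j choose 2) * (\<Sum>t\<in>L. (- t) ^ (j - 2)))
            \<le> A * 1 * N a"
          using f_le_A[OF z(3) w0] N_q_less1(2) card_L by (intro N_mult_le N_of_nat) auto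
        then show "N (coeff (f w0) j * of_nat (j choose 2) * (\<Sum>t\<in>L. (- t) ^ (j - 2))) < A"
          using aA(2) by (simp add: mult.commute)
      qed
      then have Ts: "N (\<Sum>t\<in>L. coeff (Tp t (f w0)) 2) < N a * m"
        unfolding eq N_mult N_power om_sq[symmetric] using om_pos by simp
      have "a * (\<Sum>t\<in>L. coeff (f (t # w0)) 2)
          = (\<Sum>t\<in>L. coeff (Tp t (f w0)) 2) + (\<Sum>t\<in>L. Sm (t # w0) 2) + (\<Sum>t\<in>L. err t)"
        unfolding err_def by (simp add: sum_distrib_left sum_subtractf)
      moreover have "N (\<Sum>t\<in>L. Sm (t # w0) 2) < N a * m"
        using z d2 by (intro N_sum_less S am) auto
      moreover have "N (\<Sum>t\<in>L. err t) < N a * m"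
        using err c(6) by (intro N_sum_less am) (meson le_less_trans)
      ultimately have "N (a * (\<Sum>t\<in>L. coeff (f (t # w0)) 2)) < N a * m"
        using Ts by (simp add: N_add_less)
      then show ?thesis using a_pos by (simp add: N_mult)
    qed
    \<comment> \<open>The folding of \<open>coeff_rem_2\<close>: the remainder is small because its
      values are, and index q + 1 is covered by \<open>c3\<close>.\<close>
    have ck: "N (coeff (f (t # w0)) k + coeff (f (t # w0)) 2) < m" if t: "t \<in> L" for t
    proof -
      let ?v = "f (t # w0)"
      have "N (coeff (?v mod theta) 2) < m"
      proof (rule rem_less)
        fix s assume "s \<in> L"
        then show "N (poly ?v (- s)) < m"
          using c(9)[of "t # w0" s 0] z(3,4) t by (simp add: coeff_Tp_0)
      qed
      moreover have "N (sgn_q * coeff ?v (q + 1)) < m"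
        using c3[OF t q1] d2 by (simp add: N_mult)
      moreover have "coeff ?v k + coeff ?v 2 = coeff (?v mod theta) 2 - sgn_q * coeff ?v (q + 1)"
        using coeff_rem_2[of ?v] degree_f[of "t # w0"] k2 d2 by simp
      ultimately show ?thesis by (simp add: N_diff_less)
    qed
    have "(\<Sum>t\<in>L. coeff (f (t # w0)) k)
        = (\<Sum>t\<in>L. coeff (f (t # w0)) k + coeff (f (t # w0)) 2) - (\<Sum>t\<in>L. coeff (f (t # w0)) 2)"
      by (simp add: sum.distrib)
    moreover have "N (\<Sum>t\<in>L. coeff (f (t # w0)) k + coeff (f (t # w0)) 2) < m"
      by (intro N_sum_less ck c(4))
    ultimately have sumk: "N (\<Sum>t\<in>L. coeff (f (t # w0)) k) < m" using sumc2 by (simp only: N_diff_less)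
    \<comment> \<open>Each child passes its leading coefficient on unchanged, so the sum over the
      siblings is exactly what coefficient k at \<open>w0\<close> receives from below.\<close>
    have "coeff (Tm s (f (s # w0))) k = coeff (f (s # w0)) k" for s
    proof -
      have "coeff (Tm s (f (s # w0))) k
          = (\<Sum>i\<in>{k}. \<omega> ^ (k - i) * coeff (f (s # w0)) i * (of_nat (i choose k) * s ^ (i - k)))"
        unfolding coeff_Tm by (intro sum.mono_neutral_right) (auto simp: binomial_eq_0)
      then show ?thesis by simp
    qed
    then have "N (Sm w0 k) < N a * A" using sumk unfolding Sm_def m by simp
    then have "N a * N (coeff (f w0) k) < N a * A"
      unfolding w(1) using w T1s[of k] k6 aA(5) by (intro child_less) auto
    then have E5: "N (coeff (f w0) k) < A" using a_pos by simp
    have "N (coeff (f w0 mod theta) 2) < A"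
    proof (rule rem_less)
      fix t assume t: "t \<in> L"
      have "N (coeff (Tp t (f w0)) 0) < A"
      proof (rule Tp_less[OF z(3) t])
        have "N a * N (coeff (f (t # w0)) 0) \<le> N a * A" using f_le_A[of "t # w0" 0] t z a_pos by simp
        then show "N a * N (coeff (f (t # w0)) 0) < A" using aA(2) by linarith
        have "N (Sm (t # w0) 0) < m" using t z c(2) by (intro Sm_less c(8) c(4)) auto
        then show "N (Sm (t # w0) 0) < A" using aA(2) m by linarith
      qed (rule aA)
      then show "N (poly (f w0) (- t)) < A" by (simp add: coeff_Tp_0)
    qed
    moreover have "N (sgn_q * coeff (f w0) (q + 1)) < A" using E1[OF _ q1] d2 by (simp add: N_mult)
    moreover have "coeff (f w0) 2 = coeff (f w0 mod theta) 2 - sgn_q * coeff (f w0) (q + 1) - coeff (f w0) k"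
      using coeff_rem_2[of "f w0"] degree_f[of w0] k2 d2 by simp
    ultimately have E6: "N (coeff (f w0) 2) < A" using E5 by (simp add: N_diff_less)
    have "N (\<Sum>j\<le>k. coeff (f w0) j * of_nat (j choose 2) * (- t0) ^ (j - 2)) < A"
    proof (rule N_sum_less[OF trm A_pos])
      show "N ((- t0) ^ (j - 2)) \<le> 1" for j using L_power_le1[OF z(2)] by (simp add: N_power)
      show "N (coeff (f w0) j * of_nat (j choose 2) * (- t0) ^ (j - 2)) < A" if "j = 2" for j
        using that E6 by simp
    qed
    then have "N (coeff (Tp t0 (f w0)) 2) < N a * m"
      unfolding coeff_Tp[OF degree_f] N_mult N_power om_sq[symmetric] using om_pos by simp
    then show ?thesis unfolding z(1) using z d2 by (intro child) auto
  qed
  show ?thesis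
  proof (cases "i = k")
    case True
    have "um z (k - 0) < m"
    proof (rule critical_top[OF cr])
      fix t assume t: "0 < t" "t \<le> d"
      let ?j = "(d - t) * q + (r - 0) + t"
      have jm: "?j mod q = t" using mod_shift[of 0 t] t rd r0 by simp
      have "N (coeff (f z) ?j) < m"
      proof (cases "3 \<le> ?j")
        case True
        then show ?thesis unfolding z(1) using c3[OF z(2) _ True] jm t by simp
      next
        case False
        have "t = d"
        proof (rule ccontr)
          assume "t \<noteq> d"
          then have "1 * q \<le> (d - t) * q" using t by (intro mult_right_mono) auto
          then show False using False d2 t by linarith
        qed
        moreover have "d = 2" using False d2(1) \<open>t = d\<close> by simp
        ultimately show ?thesis using c2 r0 by (simp add: numeral_2_eq_2)
      qed
      then show "N \<omega> ^ 0 * N (coeff (f z) ?j) < m" by simp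
    qed (use d2 in auto)
    then show ?thesis using True by simp
  next
    case False
    then have "um z i \<le> N \<omega> ^ 1 * N (coeff (f z) i)"
      unfolding um_def using i by (intro mult_right_mono om_power_le) auto
    also have "\<dots> \<le> N a * N (coeff (f z) i)" using om_a by (simp add: mult_right_mono)
    also have "\<dots> < m" using critical_mult_less(2)[OF cr c(1)] by simp
    finally show ?thesis .
  qed
qed

end

section \<open>The quadratic equation for the ratio of parent and child\<close>

context hecke_tree begin

lemma coeff_Tp_zero: "coeff (Tp 0 v) j = \<omega> ^ j * coeff v j"
proof -
  define n where "n = max j (degree v)"
  have "(\<Sum>i\<le>n. coeff v i * of_nat (i choose j) * (- 0) ^ (i - j))
      = (\<Sum>i\<in>{j}. coeff v i * of_nat (i choose j) * (- 0) ^ (i - j))"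
    by (intro sum.mono_neutral_right) (auto simp: n_def binomial_eq_0 power_0_left)
  then show ?thesis by (subst coeff_Tp[of v n]) (simp_all add: n_def)
qed

text \<open>Fixed-point iteration of x -> (\<omega> + Q x^2) / a' from \<omega> / a', contracting
  with ratio \<rho> = |\<omega>| / |a|. It stops once the defect is at most |\<omega>|^2, the
  precision that \<open>equation_gg\<close> asks for.\<close>

lemma approx_root:
  assumes "N a' = N a" "N Q \<le> N \<omega>" "N \<omega> < N a"
  shows "\<exists>x. N x = N \<omega> / N a \<and> N (a' * x - \<omega> - Q * x\<^sup>2) \<le> N \<omega> * N \<omega>"
proof -
  define \<rho> where "\<rho> = N \<omega> / N a"
  have rho: "0 \<le> \<rho>" "\<rho> < 1" using assms a_pos om_pos by (auto simp: \<rho>_def)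
  have a': "a' \<noteq> 0" using assms(1) a_pos by (metis N_eq0 less_irrefl)
  have quad: "N (Q * x\<^sup>2) \<le> N \<omega> * \<rho> ^ 2" if "N x = \<rho>" for x
    using that assms(2) by (simp add: N_mult N_power mult_right_mono)
  have "\<rho>\<^sup>2 \<le> \<rho>" using rho by (simp add: power2_eq_square mult_left_le)
  then have "\<rho>\<^sup>2 < 1" using rho by linarith
  from mult_strict_left_mono[OF this om_pos] have rho2: "N \<omega> * \<rho>\<^sup>2 < N \<omega>" by simp
  have "\<exists>x. N x = \<rho> \<and> N (a' * x - \<omega> - Q * x\<^sup>2) \<le> N \<omega> * \<rho> ^ n" for n
  proof (induction n)
    case 0
    have "N (\<omega> / a') = \<rho>" using assms by (simp add: N_divide \<rho>_def)
    moreover have "a' * (\<omega> / a') - \<omega> - Q * (\<omega> / a')\<^sup>2 = - (Q * (\<omega> / a')\<^sup>2)" using a' by simp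
    ultimately show ?case using quad[of "\<omega> / a'"] rho2 by (intro exI[of _ "\<omega> / a'"]) simp
  next
    case (Suc n)
    then obtain x where x: "N x = \<rho>" "N (a' * x - \<omega> - Q * x\<^sup>2) \<le> N \<omega> * \<rho> ^ n" by blast
    define y where "y = (\<omega> + Q * x\<^sup>2) / a'"
    have "N (Q * x\<^sup>2) < N \<omega>" using quad[OF x(1)] rho2 by linarith
    then have y1: "N y = \<rho>" by (simp add: y_def N_divide \<rho>_def N_add_eq assms(1))
    \<comment> \<open>The new defect contains the factor x - y, which is the old defect divided by
      a'; this is the contraction.\<close>
    have "a' * y - \<omega> - Q * y\<^sup>2 = Q * (x - y) * (x + y)"
      using a' by (simp add: y_def field_simps power2_eq_square)
    moreover have "N (x - y) \<le> N \<omega> * \<rho> ^ n / N a"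
    proof -
      have "x - y = (a' * x - \<omega> - Q * x\<^sup>2) / a'" using a' by (simp add: y_def field_simps)
      then show ?thesis using x(2) assms(1) a_pos by (simp add: N_divide divide_right_mono)
    qed
    moreover have "N (x + y) \<le> 1" using x(1) y1 rho by (simp add: N_add_le)
    ultimately have "N (a' * y - \<omega> - Q * y\<^sup>2) \<le> N \<omega> * (N \<omega> * \<rho> ^ n / N a) * 1"
      using assms(2) by (simp only:) (intro N_mult_le)
    also have "\<dots> = N \<omega> * \<rho> ^ Suc n" by (simp add: \<rho>_def)
    finally show ?case using y1 by blast
  qed
  moreover obtain n where "\<rho> ^ n < N \<omega>" using real_arch_pow_inv[OF om_pos rho(2)] by blast
  moreover have "N \<omega> * \<rho> ^ n \<le> N \<omega> * N \<omega>" if "\<rho> ^ n < N \<omega>" for n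
    using that by (intro mult_left_mono) auto
  ultimately show ?thesis unfolding \<rho>_def[symmetric] by (meson order_trans)
qed

end

section \<open>From extremality to explicit bounds; k = q with |a| \<le> |\<omega>|\<close>

context hecke_solution begin

lemma finite_words: "finite {w \<in> lists L. length w \<le> n}"
proof -
  have "finite {w. set w \<subseteq> L \<and> length w \<le> n}" using finite_L finite_lists_length_le by blast
  then show ?thesis by (rule finite_subset[rotated]) auto
qed

lemma max_attained:
  obtains A where "0 \<le> A" "\<And>w j. w \<in> lists L \<Longrightarrow> w \<noteq> [] \<Longrightarrow> N (coeff (f w) j) \<le> A"
    "A = 0 \<or> (\<exists>w j. w \<in> lists L \<and> w \<noteq> [] \<and> N (coeff (f w) j) = A)"
proof -
  define X where "X = insert 0 ((\<lambda>(w, j). N (coeff (f w) j)) ` ({w \<in> lists L. length w \<le> M \<and> w \<noteq> []} \<times> {..k}))"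
  have "finite {w \<in> lists L. length w \<le> M \<and> w \<noteq> []}"
    by (rule finite_subset[OF _ finite_words[of M]]) auto
  then have fin: "finite X" unfolding X_def by simp
  have le: "N (coeff (f w) j) \<le> Max X" if "w \<in> lists L" "w \<noteq> []" for w j
  proof (cases "length w \<le> M \<and> j \<le> k")
    case True
    then show ?thesis using that fin by (intro Max_ge) (auto simp: X_def)
  next
    case False
    then have "coeff (f w) j = 0" using f_vanish[of w] degree_f[of w] by (auto simp: coeff_eq_0)
    moreover have "0 \<le> Max X" using fin by (intro Max_ge) (auto simp: X_def)
    ultimately show ?thesis by simp
  qed
  have mem: "x = 0 \<or> (\<exists>w j. w \<in> lists L \<and> w \<noteq> [] \<and> N (coeff (f w) j) = x)" if xX: "x \<in> X" for x
  proof -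
    consider "x = 0" | w j where "w \<in> lists L" "w \<noteq> []" "x = N (coeff (f w) j)"
      using xX unfolding X_def by auto
    then show ?thesis by cases auto
  qed
  have "Max X \<in> X" using fin by (intro Max_in) (auto simp: X_def)
  then have "Max X = 0 \<or> (\<exists>w j. w \<in> lists L \<and> w \<noteq> [] \<and> N (coeff (f w) j) = Max X)"
    by (rule mem)
  moreover have "0 \<le> Max X" using fin by (intro Max_ge) (auto simp: X_def)
  ultimately show thesis using that le by blast
qed

text \<open>The maximum \<open>A\<close> is attained, so it cannot bound all coefficients strictly;
  hence it is not large compared with \<eta>, and |a|^2 A \<le> \<eta>.\<close>

lemma bound_of_large:
  assumes "\<And>A. large_solution N \<omega> a L p q d r k f M \<eta> A \<Longrightarrow>
      \<forall>w\<in>lists L. w \<noteq> [] \<longrightarrow> (\<forall>j. N (coeff (f w) j) < A)"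
    and "N \<omega> ^ q < N a" "w \<in> lists L" "w \<noteq> []"
  shows "N (coeff (f w) j) \<le> \<eta> / (N a * N a)"
proof -
  obtain A where A: "0 \<le> A" "\<And>w j. w \<in> lists L \<Longrightarrow> w \<noteq> [] \<Longrightarrow> N (coeff (f w) j) \<le> A"
    "A = 0 \<or> (\<exists>w j. w \<in> lists L \<and> w \<noteq> [] \<and> N (coeff (f w) j) = A)"
    using max_attained by blast
  have "A \<le> \<eta> / (N a * N a)"
  proof (rule ccontr)
    assume "\<not> A \<le> \<eta> / (N a * N a)"
    then have less: "\<eta> < N a * (N a * A)" using a_pos by (simp add: field_simps)
    then have "0 < A" using A(1) eta_nonneg by (cases "A = 0") auto
    then have "large_solution N \<omega> a L p q d r k f M \<eta> A"
      using A(2) less assms(2) by unfold_locales auto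
    from assms(1)[OF this] show False using A(3) \<open>0 < A\<close> by (metis less_irrefl)
  qed
  then show ?thesis using A(2)[OF assms(3,4), of j] by linarith
qed

text \<open>The root occurs in the equations only as a parent. Reading those upwards bounds its
  transforms, and inverting \<open>Tp\<close> costs |\<omega>|^d.\<close>

lemma root_le:
  assumes "\<And>w j. w \<in> lists L \<Longrightarrow> w \<noteq> [] \<Longrightarrow> N (coeff (f w) j) \<le> B" "\<eta> \<le> B"
  shows "N (coeff (f []) j) \<le> B / N \<omega> ^ d"
proof (rule Tp_inverse_f)
  fix t j assume t: "t \<in> L"
  have B: "0 \<le> B" using assms(2) eta_nonneg by linarith
  show "N (coeff (Tp t (f [])) j) \<le> B"
  proof (rule Tp_le[OF _ t])
    have "N a * N (coeff (f [t]) j) \<le> 1 * B" using assms(1)[of "[t]" j] t a_less1 by (intro mult_mono) auto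
    then show "N a * N (coeff (f [t]) j) \<le> B" by simp
    show "N (Sm [t] j) \<le> B"
    proof (rule Sm_le[OF _ B])
      fix s i assume "s \<in> L"
      then have "um [s, t] i \<le> 1 * B"
        unfolding um_def using assms(1)[of "[s, t]" i] t om_power_le1 by (intro mult_mono) auto
      then show "um [s, t] i \<le> B" by simp
    qed
  qed (use assms in auto)
qed

text \<open>For |a| \<le> |\<omega>| the child's term is at most |\<omega>| R, so one and the same
  bound R = \<eta> / |\<omega>| travels from the leaves to the root. The remainder modulo \<theta>
  is read from the values; the quotient is a constant and is read from coefficient 1 at the digit 0,
  where \<open>Tp\<close> merely scales by \<omega>.\<close>

lemma bound_k_eq_q_small:
  assumes "d = 1" "r = 0" "N a \<le> N \<omega>" "w \<in> lists L"
  shows "N (coeff (f w) j) \<le> \<eta> / N \<omega>"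
  using assms(4)
proof (induction "Suc M - length w" arbitrary: w j rule: less_induct)
  case less
  define R where "R = \<eta> / N \<omega>"
  have kq: "k = q" using k_eq assms(1,2) by simp
  have eta: "\<eta> = N \<omega> * R" using om_pos by (simp add: R_def)
  have R: "0 \<le> R" "\<eta> \<le> R" "N \<omega> * R \<le> R" using eta_nonneg om_pos om_less1
    by (auto simp: R_def le_divide_eq mult_left_le)
  show ?case
  proof (cases "M < length w")
    case True
    then show ?thesis using f_vanish eta_nonneg by simp
  next
    case False
    have IH: "N (coeff (f y) j) \<le> R" if "y \<in> lists L" "length w < length y" for y j
      unfolding R_def using that False by (intro less.hyps) auto
    have aR: "N a * N (coeff (f (t # w)) j) \<le> N \<omega> * R" if "t \<in> L" for t j
      using IH[of "t # w" j] that less.prems assms(3) by (intro mult_mono) auto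
    have um: "um (s # t # w) i \<le> N \<omega> ^ (k - i) * R" if "t \<in> L" "s \<in> L" for s t i
      unfolding um_def using IH[of "s # t # w" i] that less.prems by (intro mult_left_mono) auto
    have "N (poly (f w) (- t)) \<le> R" if t: "t \<in> L" for t
    proof -
      have "um (s # t # w) i \<le> R" if "s \<in> L" for s i
      proof -
        have "N \<omega> ^ (k - i) * R \<le> 1 * R" using om_power_le1 R(1) by (rule mult_right_mono)
        then show ?thesis using um[OF t that, of i] by simp
      qed
      then have "N (Sm (t # w) 0) \<le> R" using R(1) by (intro Sm_le) auto
      then have "N (coeff (Tp t (f w)) 0) \<le> R"
        using aR[OF t, of 0] R t less.prems by (intro Tp_le) auto
      then show ?thesis by (simp add: coeff_Tp_0)
    qed
    then have u: "N (coeff (f w mod theta) i) \<le> R" for i by (rule rem_le)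
    have "N (Sm (0 # w) 1) \<le> N \<omega> * R"
    proof (rule Sm_term_le)
      fix s i assume s: "s \<in> L" and i: "i \<le> k"
      show "um (s # 0 # w) i * N (of_nat (i choose 1)) \<le> N \<omega> * R"
      proof (cases "i = k")
        case True
        have "um (s # 0 # w) i * N (of_nat (i choose 1)) \<le> R * N \<omega>"
          using um[OF zero_L s, of i] True kq N_q_less1(1) R(1) by (intro mult_mono) auto
        then show ?thesis by (simp add: mult.commute)
      next
        case False
        then have "N \<omega> ^ (k - i) * R \<le> N \<omega> ^ 1 * R"
          using i R(1) by (intro mult_right_mono om_power_le) auto
        then show ?thesis using um[OF zero_L s, of i] um_mult_binom_le[of "s # 0 # w" i "i choose 1"] by simp
      qed
    qed (use om_pos R in simp)
    then have "N (coeff (Tp 0 (f w)) 1) \<le> N \<omega> * R"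
      using aR[OF zero_L, of 1] eta zero_L less.prems by (intro Tp_le) auto
    then have c1: "N (coeff (f w) 1) \<le> R" using om_pos by (simp add: coeff_Tp_zero N_mult)
    let ?v1 = "f w div theta"
    have "degree ?v1 \<le> 0 * q + 0" using degree_f[of w] kq by (intro degree_quot) simp
    then have v1: "coeff ?v1 i = 0" if "0 < i" for i using that by (simp add: coeff_eq_0)
    have "sgn_q * coeff ?v1 0 = coeff (f w mod theta) 1 - coeff (f w) 1"
      using coeff_decomp[of "f w" 1] q_ge2 by simp
    then have "N (sgn_q * coeff ?v1 0) \<le> R" using N_diff_le[OF u c1] by simp
    then have "N (coeff ?v1 0) \<le> R" by (simp add: N_mult)
    then have "N (coeff ?v1 i) \<le> R" for i using v1[of i] R(1) by (cases "i = 0") auto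
    then have "N (coeff (f w) j) \<le> R"
      unfolding coeff_decomp[of "f w" j] using u R(1) by (auto intro!: N_add_le N_diff_le simp: N_mult)
    then show ?thesis unfolding R_def .
  qed
qed

end

section \<open>The weight \<open>k = q\<close>\<close>

text \<open>Elimination of the sum G over the children between the equations for coefficient 1
  (\<open>h1\<close>) and coefficient q (\<open>h2\<close>). In the application e is the sign in
  \<theta>, g, gw and g0 are the leading coefficients at z, at its parent and at its child with
  digit 0, and u is coefficient 1 of the remainder at z.\<close>

lemma identity_gam:
  fixes e u g X gw g0 G Y er1 erq b om qq tt o1 oq :: "'a::field"
  assumes e: "e * e = 1"
    and h1: "b * (u - e * g) = X + gw * om * (qq * tt - e) + qq * (G - g0) - o1 * e * G + Y + er1"
    and h2: "b * g = oq * gw + G + erq"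
  shows "b * (1 + e * qq - o1) * g - om * gw - e * qq * g0
    = e * (b * u - X - gw * om * qq * tt - Y - er1 + qq * (oq * gw + erq)) - o1 * (oq * gw + erq)"
proof -
  have e': "e * (e * x) = x" for x using e by (simp flip: mult.assoc)
  have G: "G = b * g - oq * gw - erq" using h2 by simp
  have "e * (b * (u - e * g))
      = e * (X + gw * om * (qq * tt - e) + qq * (G - g0) - o1 * e * G + Y + er1)"
    using h1 by simp
  then have "b * g = e * b * u - e * X - gw * om * e * qq * tt + om * gw - e * qq * G + e * qq * g0
      + o1 * G - e * Y - e * er1"
    by (simp add: algebra_simps e')
  then show ?thesis unfolding G by (simp add: algebra_simps)
qed

locale weight_q = large_solution +
  assumes d_1: "d = 1" and r_0: "r = 0" and om_a: "N \<omega> < N a"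
begin

text \<open>For k = q the quotient of \<open>f w\<close> by \<theta> is a constant, namely the
  leading coefficient.\<close>

definition gam :: "'a list \<Rightarrow> 'a" where "gam w = coeff (f w) q"

definition uu :: "'a list \<Rightarrow> 'a poly" where "uu w = f w mod theta"

lemma k_q: "k = q"
  using k_eq d_1 r_0 by simp

lemma f_decomp: "f w = uu w + smult (gam w) theta"
proof -
  have "degree (f w div theta) \<le> 0 * q + 0"
    using degree_f[of w] k_q by (intro degree_quot) simp
  then obtain c where c: "f w div theta = [:c:]" by (auto elim: degree_eq_zeroE)
  have e: "f w = uu w + smult c theta"
    using theta_decomp[of "f w"] unfolding c uu_def by simp
  have "coeff (f w) q = coeff (uu w + smult c theta) q" by (rule arg_cong[OF e])
  also have "\<dots> = c" by (simp add: uu_def coeff_rem_0 coeff_theta)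
  finally have "gam w = c" unfolding gam_def .
  then show ?thesis using e by simp
qed

lemma coeff_f: "coeff (f w) i = coeff (uu w) i + gam w * coeff theta i"
  by (subst f_decomp) simp

lemma coeff_Tm_f:
  "coeff (Tm s (f y)) j = gam y * (of_nat (q choose j) * s ^ (q - j))
     - \<omega> ^ (q - 1) * sgn_q * gam y * (of_nat (1 choose j) * s ^ (1 - j))
     + (\<Sum>i<q. \<omega> ^ (q - i) * coeff (uu y) i * (of_nat (i choose j) * s ^ (i - j)))"
proof -
  define b where "b i = (of_nat (i choose j) * s ^ (i - j) :: 'a)" for i
  have "coeff (Tm s (f y)) j = (\<Sum>i<Suc q. \<omega> ^ (q - i) * coeff (f y) i * b i)"
    using coeff_Tm[of s "f y" j] unfolding b_def lessThan_Suc_atMost k_q .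
  also have "\<dots> = gam y * b q + (\<Sum>i<q. \<omega> ^ (q - i) * coeff (f y) i * b i)"
    by (simp add: gam_def)
  also have "(\<Sum>i<q. \<omega> ^ (q - i) * coeff (f y) i * b i)
      = (\<Sum>i<q. \<omega> ^ (q - i) * coeff (uu y) i * b i) + (\<Sum>i<q. \<omega> ^ (q - i) * (gam y * coeff theta i) * b i)"
    by (simp add: coeff_f algebra_simps sum.distrib)
  also have "(\<Sum>i<q. \<omega> ^ (q - i) * (gam y * coeff theta i) * b i)
      = (\<Sum>i\<in>{1}. \<omega> ^ (q - i) * (gam y * coeff theta i) * b i)"
    using q_ge2 by (intro sum.mono_neutral_right) (auto simp: coeff_theta)
  finally show ?thesis using q_ge2 unfolding b_def[symmetric] by (simp add: coeff_theta)
qed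

definition er :: "'a \<Rightarrow> 'a list \<Rightarrow> nat \<Rightarrow> 'a" where
  "er t w j = a * coeff (f (t # w)) j - coeff (Tp t (f w)) j - Sm (t # w) j"

lemma er_le: "w \<in> lists L \<Longrightarrow> t \<in> L \<Longrightarrow> N (er t w j) \<le> \<eta>"
proof -
  assume wt: "w \<in> lists L" "t \<in> L"
  obtain x where "N x \<le> \<eta>" "a * coeff (f (t # w)) j = coeff (Tp t (f w)) j + Sm (t # w) j + x"
    using equation_coeff[OF wt, of j] .
  then show ?thesis unfolding er_def by simp
qed

lemma equation_q: "a * gam (t # w) = \<omega> ^ q * gam w + (\<Sum>s\<in>L. gam (s # t # w)) + er t w q"
proof -
  have "coeff (Tp t (f w)) q = \<omega> ^ q * (\<Sum>i\<in>{q}. coeff (f w) i * of_nat (i choose q) * (- t) ^ (i - q))"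
    unfolding coeff_Tp[OF degree_f] k_q
    by (intro arg_cong2[of _ _ _ _ "(*)"] refl sum.mono_neutral_right) (auto simp: binomial_eq_0)
  moreover have "coeff (Tm s (f y)) q = gam y" for s y
    unfolding coeff_Tm_f using q_ge2 by (simp add: binomial_eq_0)
  ultimately show ?thesis unfolding er_def Sm_def by (simp add: gam_def)
qed

lemma N_pow_le: "N (\<omega> ^ n) \<le> 1" "0 < n \<Longrightarrow> N (\<omega> ^ n) \<le> N \<omega>"
  using om_power_le1[of n] om_power_le[of 1 n] by (simp_all add: N_power)

lemma binom_pow_le1: "s \<in> L \<Longrightarrow> N (of_nat n * s ^ m) \<le> 1"
  using N_mult_le[OF N_of_nat L_power_le1] by simp

definition Q :: 'a where "Q = sgn_q * of_nat q"

text \<open>The factor of the leading coefficient at z once the sum over the children has been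
  eliminated; it differs from \<open>a\<close> by a factor close to 1.\<close>

definition a' :: 'a where "a' = a * (1 + Q - \<omega> ^ (q - 1))"

lemma N_Q: "N Q \<le> N \<omega>"
  using N_q_less1(1) by (simp add: Q_def N_mult)

lemma N_a': "N a' = N a"
proof -
  have "N (Q - \<omega> ^ (q - 1)) < 1"
    using N_diff_le[OF N_Q N_pow_le(2)[of "q - 1"]] q_ge2 om_less1 by linarith
  then have "N (1 + (Q - \<omega> ^ (q - 1))) = N 1" by (intro N_add_eq) simp
  then show ?thesis unfolding a'_def N_mult by (simp add: add_diff_eq)
qed

text \<open>The leading coefficients satisfy a' \<gamma>(z) = \<omega> \<gamma>(w) + Q \<gamma>(0 #
  z) up to \<open>B\<close>. The digit 0 is singled out because s^(q - 1) is 1 for every other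
  digit: the children contribute q times the sum of their leading coefficients without that of
  \<open>0 # z\<close>, and the complete sum is eliminated by the equation for coefficient
  q.\<close>

lemma equation_gam:
  assumes w: "w \<in> lists L" and t: "t \<in> L" and z: "z = t # w"
    and B1: "N \<omega> * N \<omega> * N (gam w) \<le> B" and B2: "N a * N (coeff (uu z) 1) \<le> B"
    and B3: "\<And>i. 0 < i \<Longrightarrow> N \<omega> * N (coeff (uu w) i) \<le> B"
    and B4: "\<And>s i. s \<in> L \<Longrightarrow> 0 < i \<Longrightarrow> N \<omega> * N (coeff (uu (s # z)) i) \<le> B"
    and eta: "\<eta> \<le> B"
  shows "N (a' * gam z - \<omega> * gam w - Q * gam (0 # z)) \<le> B"
proof -
  have B0: "0 \<le> B" using eta eta_nonneg by linarith
  define X where "X = coeff (Tp t (uu w)) 1"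
  define G where "G = (\<Sum>s\<in>L. gam (s # z))"
  define Y where "Y = (\<Sum>s\<in>L. \<Sum>i<q. \<omega> ^ (q - i) * coeff (uu (s # z)) i * (of_nat (i choose 1) * s ^ (i - 1)))"
  have Tth: "coeff (Tp t theta) 1 = \<omega> * (of_nat q * (- t) ^ (q - 1) - sgn_q)"
  proof -
    have "(\<Sum>i\<le>q. coeff theta i * of_nat (i choose 1) * (- t) ^ (i - 1))
        = (\<Sum>i\<in>{q, 1}. coeff theta i * of_nat (i choose 1) * (- t) ^ (i - 1))"
      using q_ge2 by (intro sum.mono_neutral_right) (auto simp: coeff_theta)
    then show ?thesis
      using q_ge2 by (subst coeff_Tp[of theta q]) (auto simp: degree_theta coeff_theta)
  qed
  have T1: "coeff (Tp t (f w)) 1 = X + gam w * \<omega> * (of_nat q * (- t) ^ (q - 1) - sgn_q)"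
  proof -
    have "Tp t (f w) = Tp t (uu w) + smult (gam w) (Tp t theta)"
      by (subst f_decomp) (simp add: Tp_def pcompose_add pcompose_smult)
    then show ?thesis by (simp only: coeff_add coeff_smult Tth X_def mult.assoc)
  qed
  have sp: "s ^ (q - 1) = (if s = 0 then 0 else 1)" if "s \<in> L" for s
  proof -
    have "s ^ (q - 1) * s = 1 * s"
      using teich[OF that] q_ge2 by (metis Suc_diff_1 mult_1 not_less_zero not_gr_zero numeral_2_eq_2 power_Suc2 less_eq_Suc_le)
    then show ?thesis using q_ge2 by (auto simp: power_0_left)
  qed
  have G1: "(\<Sum>s\<in>L. gam (s # z) * s ^ (q - 1)) = G - gam (0 # z)"
  proof -
    have "(\<Sum>s\<in>L. gam (s # z) * s ^ (q - 1)) = (\<Sum>s\<in>L. gam (s # z) - (if s = 0 then gam (s # z) else 0))"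
    proof (intro sum.cong refl)
      fix s assume "s \<in> L"
      then show "gam (s # z) * s ^ (q - 1) = gam (s # z) - (if s = 0 then gam (s # z) else 0)"
        unfolding sp[OF \<open>s \<in> L\<close>] by simp
    qed
    then show ?thesis using finite_L zero_L by (simp add: sum_subtractf G_def)
  qed
  have S1: "Sm z 1 = of_nat q * (G - gam (0 # z)) - \<omega> ^ (q - 1) * sgn_q * G + Y"
  proof -
    have "Sm z 1 = (\<Sum>s\<in>L. of_nat q * (gam (s # z) * s ^ (q - 1))) - (\<Sum>s\<in>L. \<omega> ^ (q - 1) * sgn_q * gam (s # z)) + Y"
      unfolding Sm_def coeff_Tm_f Y_def by (simp add: sum.distrib sum_subtractf mult_ac)
    then show ?thesis unfolding sum_distrib_left[symmetric] G1 G_def[symmetric] .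
  qed
  have "a * (coeff (uu z) 1 - sgn_q * gam z) = a * coeff (f z) 1"
    unfolding coeff_f[of z 1] using q_ge2 by (simp add: coeff_theta mult.commute)
  also have "\<dots> = X + gam w * \<omega> * (of_nat q * (- t) ^ (q - 1) - sgn_q) + of_nat q * (G - gam (0 # z))
      - \<omega> ^ (q - 1) * sgn_q * G + Y + er t w 1"
    unfolding er_def z[symmetric] T1 S1 by simp
  finally have h1: "a * (coeff (uu z) 1 - sgn_q * gam z)
      = X + gam w * \<omega> * (of_nat q * (- t) ^ (q - 1) - sgn_q) + of_nat q * (G - gam (0 # z))
      - \<omega> ^ (q - 1) * sgn_q * G + Y + er t w 1" .
  have h2: "a * gam z = \<omega> ^ q * gam w + G + er t w q"
    using equation_q[of t w] unfolding G_def z .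
  have id: "a' * gam z - \<omega> * gam w - Q * gam (0 # z)
    = sgn_q * (a * coeff (uu z) 1 - X - gam w * \<omega> * of_nat q * (- t) ^ (q - 1) - Y - er t w 1
        + of_nat q * (\<omega> ^ q * gam w + er t w q)) - \<omega> ^ (q - 1) * (\<omega> ^ q * gam w + er t w q)"
    using identity_gam[OF sgn_q_square h1 h2] unfolding a'_def Q_def .
  have er: "N (er t w j) \<le> B" for j using er_le[OF w t] eta order_trans by blast
  have X: "N X \<le> B"
  proof -
    have "degree (uu w) \<le> q" unfolding uu_def using degree_rem[of "f w"] by simp
    then have "X = (\<Sum>i\<le>q. \<omega> * coeff (uu w) i * of_nat (i choose 1) * (- t) ^ (i - 1))"
      unfolding X_def by (subst coeff_Tp) (auto simp: sum_distrib_left mult_ac)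
    also have "N \<dots> \<le> B"
    proof (rule N_sum_le[OF _ B0])
      fix i show "N (\<omega> * coeff (uu w) i * of_nat (i choose 1) * (- t) ^ (i - 1)) \<le> B"
        using B3[of i] B0 by (cases "i = 0") (simp, intro Tp_coeff_term_le[OF t], simp add: N_mult)
    qed
    finally show ?thesis .
  qed
  have Y: "N Y \<le> B" unfolding Y_def
  proof (intro N_sum_le B0)
    fix s i assume s: "s \<in> L" and i: "i \<in> {..<q}"
    show "N (\<omega> ^ (q - i) * coeff (uu (s # z)) i * (of_nat (i choose 1) * s ^ (i - 1))) \<le> B"
    proof (cases "i = 0")
      case False
      have "N (\<omega> ^ (q - i) * coeff (uu (s # z)) i * (of_nat (i choose 1) * s ^ (i - 1)))
          \<le> N \<omega> * N (coeff (uu (s # z)) i) * 1"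
        using i by (intro N_mult_le binom_pow_le1 s N_pow_le) auto
      then show ?thesis using B4[OF s, of i] False by simp
    qed (use B0 in simp)
  qed
  have gq: "N (gam w * \<omega> * of_nat q * (- t) ^ (q - 1)) \<le> B"
  proof -
    have "N (gam w * \<omega> * of_nat q) \<le> N (gam w) * N \<omega> * N \<omega>"
      using N_q_less1(1) by (intro N_mult_le order_refl)
    then have "N (gam w * \<omega> * of_nat q) \<le> B" using B1 by (simp add: mult_ac)
    from Tp_coeff_term_le[OF t this, of 1 "q - 1"] show ?thesis by simp
  qed
  have oq: "N (\<omega> * (\<omega> ^ q * gam w)) \<le> B"
  proof -
    have "N (\<omega> * (\<omega> ^ q * gam w)) \<le> N \<omega> * (N \<omega> * N (gam w))"
      using q_ge2 by (intro N_mult_le N_pow_le order_refl) auto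
    then show ?thesis using B1 by (simp add: mult_ac)
  qed
  have small: "N (y * (\<omega> ^ q * gam w + er t w q)) \<le> B" if "N y \<le> N \<omega>" for y
  proof -
    have "N (y * (\<omega> ^ q * gam w)) \<le> B"
      using oq that mult_right_mono[OF that, of "N (\<omega> ^ q * gam w)"] by (simp add: N_mult)
    moreover have "N (y * er t w q) \<le> 1 * B"
      using that om_less1 er by (intro N_mult_le) auto
    ultimately show ?thesis by (simp add: distrib_left N_add_le)
  qed
  have "N (a * coeff (uu z) 1 - X - gam w * \<omega> * of_nat q * (- t) ^ (q - 1) - Y - er t w 1
        + of_nat q * (\<omega> ^ q * gam w + er t w q)) \<le> B"
    using B2 by (intro N_add_le N_diff_le X Y er gq small N_q_less1) (simp add: N_mult)
  moreover have "N (\<omega> ^ (q - 1) * (\<omega> ^ q * gam w + er t w q)) \<le> B"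
    using q_ge2 by (intro small N_pow_le) simp
  ultimately show ?thesis unfolding id by (intro N_diff_le) (simp_all add: N_mult)
qed


end

text \<open>After every leading coefficient is written as a deviation plus x times that of the
  parent, the terms in \<gamma>w collect to y (1 - b x + oq qq x^2) - c1 x^2 \<sigma>1, which the
  choice of y annihilates.\<close>

lemma identity_u:
  fixes b u0z uw c1 S1 V0 oq y G er0 SG1 SG x \<sigma>1 gz \<gamma>z \<gamma>w qq Uw U0z :: "'a::field"
  assumes "b * u0z = uw + c1 * S1 + V0 - oq * y * G + er0"
    and "S1 = SG1 + x * \<sigma>1 * \<gamma>z" "G = SG + qq * x * \<gamma>z" "\<gamma>z = gz + x * \<gamma>w"
    and "u0z = U0z - y * \<gamma>z" "uw = Uw - y * \<gamma>w"
    and y: "y * (1 - b * x + oq * qq * x\<^sup>2) = c1 * x\<^sup>2 * \<sigma>1"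
  shows "Uw = b * U0z - b * y * gz - c1 * SG1 - c1 * x * \<sigma>1 * gz - V0 + oq * y * SG + oq * y * qq * x * gz - er0"
proof -
  have "Uw = b * U0z - b * y * gz - c1 * SG1 - c1 * x * \<sigma>1 * gz - V0 + oq * y * SG + oq * y * qq * x * gz - er0
      + \<gamma>w * (y * (1 - b * x + oq * qq * x\<^sup>2) - c1 * x\<^sup>2 * \<sigma>1)"
    using assms(1) unfolding assms(2-6) by (simp add: algebra_simps power2_eq_square)
  then show ?thesis unfolding y by simp
qed

section \<open>Linearised unknowns for k = q\<close>

context weight_q begin

text \<open>The approximate root is chosen so that the differences \<open>gg\<close> satisfy an equation without a
  main term from the parent.\<close>

definition xx :: 'a where
  "xx = (SOME x. N x = N \<omega> / N a \<and> N (a' * x - \<omega> - Q * x\<^sup>2) \<le> N \<omega> * N \<omega>)"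

lemma xx: "N xx = N \<omega> / N a" "N (a' * xx - \<omega> - Q * xx\<^sup>2) \<le> N \<omega> * N \<omega>"
  using someI_ex[OF approx_root[OF N_a' N_Q om_a]] unfolding xx_def by auto

lemma N_xx_less1: "N xx < 1"
  using om_a a_pos by (simp add: xx(1))

text \<open>The deviation from the geometric solution, in which the leading coefficient is
  multiplied by \<open>xx\<close> at every step away from the root.\<close>

definition gg :: "'a list \<Rightarrow> 'a" where "gg z = gam z - xx * gam (tl z)"

definition yden :: 'a where "yden = 1 - a * xx + \<omega> ^ q * of_nat q * xx\<^sup>2"

text \<open>Along the geometric solution the children of \<open>t # w\<close> carry xx^2 times the
  leading coefficient at w, and they enter the constant coefficient weighted by their digits;
  \<open>yy\<close> compensates this. For q > 2 the elements of \<open>L\<close>, being all the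
  roots of y^q - y, have sum 0 and \<open>yy\<close> vanishes: the correction is felt for q =
  2.\<close>

definition yy :: 'a where
  "yy = (1 - sgn_q * \<omega> ^ (q - 1)) * xx\<^sup>2 * (\<Sum>s\<in>L. s) / yden"

lemma N_yden: "N yden = 1"
proof -
  have "N (\<omega> ^ q * of_nat q * xx\<^sup>2) \<le> 1 * 1 * N xx"
    using N_pow_le(1) N_of_nat N_xx_less1
    by (intro N_mult_le) (auto simp: N_mult power2_eq_square mult_left_le)
  moreover have "N (a * xx) \<le> 1 * N xx" using a_less1 by (intro N_mult_le) auto
  ultimately have "N (\<omega> ^ q * of_nat q * xx\<^sup>2 - a * xx) < 1"
    using N_xx_less1 by (intro N_diff_less) auto
  then have "N (1 + (\<omega> ^ q * of_nat q * xx\<^sup>2 - a * xx)) = N 1" by (intro N_add_eq) simp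
  then show ?thesis unfolding yden_def by (simp add: algebra_simps)
qed

lemma N_c1: "N (1 - sgn_q * \<omega> ^ (q - 1)) \<le> 1"
  using N_pow_le(1)[of "q - 1"] by (intro N_diff_le) (auto simp: N_mult)

lemma N_sum_L: "N (\<Sum>s\<in>L. s) \<le> 1"
  using L_le1 by (intro N_sum_le) auto

lemma N_yy: "N yy \<le> 1"
proof -
  have "N ((1 - sgn_q * \<omega> ^ (q - 1)) * xx\<^sup>2 * (\<Sum>s\<in>L. s)) \<le> 1 * 1 * 1"
    using N_xx_less1 by (intro N_mult_le N_c1 N_sum_L) (simp add: N_power power_le_one)
  then show ?thesis by (simp add: yy_def N_divide N_yden)
qed

definition UU :: "'a list \<Rightarrow> 'a poly" where "UU w = uu w + [:yy * gam w:]"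

lemma coeff_UU: "coeff (UU w) i = coeff (uu w) i + (if i = 0 then yy * gam w else 0)"
  by (simp add: UU_def coeff_pCons split: nat.split)

lemma degree_UU: "degree (UU w) < q"
  unfolding UU_def uu_def using degree_rem[of "f w"] q_ge2
  by (intro le_less_trans[OF degree_add_le_max]) auto

text \<open>The constant coefficient of the equation read upwards. Since \<theta> vanishes at -t,
  the leading coefficient at w returns only through the descendants, and \<open>UU\<close> is
  corrected so that it cancels; deviations remain.\<close>

lemma equation_UU:
  assumes w: "w \<in> lists L" and t: "t \<in> L" and z: "z = t # w"
    and B1: "N a * N (coeff (UU z) 0) \<le> B" and B2: "N (gg z) \<le> B"
    and B3: "\<And>s. s \<in> L \<Longrightarrow> N (gg (s # z)) \<le> B"
    and B4: "\<And>s i. s \<in> L \<Longrightarrow> N \<omega> * N (coeff (UU (s # z)) i) \<le> B"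
    and eta: "\<eta> \<le> B"
  shows "N (poly (UU w) (- t)) \<le> B"
proof -
  have B0: "0 \<le> B" using eta eta_nonneg by linarith
  define G where "G = (\<Sum>s\<in>L. gam (s # z))"
  define S1 where "S1 = (\<Sum>s\<in>L. s * gam (s # z))"
  define SG where "SG = (\<Sum>s\<in>L. gg (s # z))"
  define SG1 where "SG1 = (\<Sum>s\<in>L. s * gg (s # z))"
  define V0 where "V0 = (\<Sum>s\<in>L. \<Sum>i<q. \<omega> ^ (q - i) * coeff (UU (s # z)) i * s ^ i)"
  have gamc: "gam (s # z) = gg (s # z) + xx * gam z" for s by (simp add: gg_def)
  have eS1: "S1 = SG1 + xx * (\<Sum>s\<in>L. s) * gam z"
    unfolding S1_def SG1_def gamc by (simp add: algebra_simps sum.distrib sum_distrib_left sum_distrib_right)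
  have eG: "G = SG + of_nat q * xx * gam z"
    unfolding G_def SG_def gamc by (simp add: sum.distrib card_L)
  have V: "(\<Sum>i<q. \<omega> ^ (q - i) * coeff (UU y) i * s ^ i)
      = (\<Sum>i<q. \<omega> ^ (q - i) * coeff (uu y) i * s ^ i) + \<omega> ^ q * yy * gam y" for y s
  proof -
    have "(\<Sum>i<q. \<omega> ^ (q - i) * coeff (UU y) i * s ^ i)
        = (\<Sum>i<q. \<omega> ^ (q - i) * coeff (uu y) i * s ^ i)
          + (\<Sum>i<q. if i = 0 then \<omega> ^ q * yy * gam y else 0)"
      unfolding sum.distrib[symmetric] by (intro sum.cong) (auto simp: coeff_UU algebra_simps)
    then show ?thesis using q_ge2 by (simp add: sum.delta)
  qed
  have "Sm z 0 = (\<Sum>s\<in>L. gam (s # z) * s - \<omega> ^ (q - 1) * sgn_q * gam (s # z) * s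
      + ((\<Sum>i<q. \<omega> ^ (q - i) * coeff (UU (s # z)) i * s ^ i) - \<omega> ^ q * yy * gam (s # z)))"
    unfolding Sm_def coeff_Tm_f V by (intro sum.cong) (auto simp: teich)
  also have "\<dots> = (1 - sgn_q * \<omega> ^ (q - 1)) * S1 + V0 - \<omega> ^ q * yy * G"
    unfolding S1_def V0_def G_def
    by (simp add: sum.distrib sum_subtractf sum_distrib_left algebra_simps)
  finally have S: "Sm z 0 = (1 - sgn_q * \<omega> ^ (q - 1)) * S1 + V0 - \<omega> ^ q * yy * G" .
  have "a * coeff (uu z) 0 = a * coeff (f z) 0"
    using q_ge2 by (simp add: coeff_f coeff_theta)
  also have "\<dots> = poly (uu w) (- t) + (1 - sgn_q * \<omega> ^ (q - 1)) * S1 + V0 - \<omega> ^ q * yy * G + er t w 0"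
    unfolding er_def z[symmetric] S coeff_Tp_0 uu_def poly_rem[OF t] by simp
  finally have h0: "a * coeff (uu z) 0
    = poly (uu w) (- t) + (1 - sgn_q * \<omega> ^ (q - 1)) * S1 + V0 - \<omega> ^ q * yy * G + er t w 0" .
  have hy: "yy * (1 - a * xx + \<omega> ^ q * of_nat q * xx\<^sup>2) = (1 - sgn_q * \<omega> ^ (q - 1)) * xx\<^sup>2 * (\<Sum>s\<in>L. s)"
    using N_yden unfolding yden_def[symmetric] yy_def by (cases "yden = 0") auto
  have id: "poly (UU w) (- t) = a * coeff (UU z) 0 - a * yy * gg z - (1 - sgn_q * \<omega> ^ (q - 1)) * SG1
      - (1 - sgn_q * \<omega> ^ (q - 1)) * xx * (\<Sum>s\<in>L. s) * gg z - V0 + \<omega> ^ q * yy * SG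
      + \<omega> ^ q * yy * of_nat q * xx * gg z - er t w 0"
    by (rule identity_u[where \<gamma>w = "gam w", OF h0 eS1 eG _ _ _ hy]) (simp_all add: gg_def z coeff_UU UU_def)
  have unit: "N (c * y) \<le> B" if "N c \<le> 1" "N y \<le> B" for c y
    using N_mult_le[OF that] by simp
  have n1: "N SG1 \<le> B" unfolding SG1_def using L_le1 B3 by (intro N_sum_le unit B0) auto
  have n2: "N SG \<le> B" unfolding SG_def using B3 by (intro N_sum_le B0) auto
  have n3: "N V0 \<le> B" unfolding V0_def
  proof (intro N_sum_le B0)
    fix s i assume s: "s \<in> L" and i: "i \<in> {..<q}"
    have "N (\<omega> ^ (q - i) * coeff (UU (s # z)) i * s ^ i) \<le> N \<omega> * N (coeff (UU (s # z)) i) * 1"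
      using i by (intro N_mult_le L_power_le1 s N_pow_le) auto
    then show "N (\<omega> ^ (q - i) * coeff (UU (s # z)) i * s ^ i) \<le> B" using B4[OF s, of i] by simp
  qed
  have n4: "N (er t w 0) \<le> B" using er_le[OF w t] eta order_trans by blast
  have n5: "N (a * yy) \<le> 1" "N (\<omega> ^ q * yy) \<le> 1"
    "N ((1 - sgn_q * \<omega> ^ (q - 1)) * xx * (\<Sum>s\<in>L. s)) \<le> 1" "N (\<omega> ^ q * yy * of_nat q * xx) \<le> 1"
    using N_mult_le[OF less_imp_le[OF a_less1] N_yy] N_mult_le[OF N_pow_le(1)[of q] N_yy]
      N_mult_le[OF N_mult_le[OF N_c1 less_imp_le[OF N_xx_less1]] N_sum_L]
      N_mult_le[OF N_mult_le[OF N_mult_le[OF N_pow_le(1)[of q] N_yy] N_of_nat[of q]] less_imp_le[OF N_xx_less1]]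
    by simp_all
  have "N (a * coeff (UU z) 0) \<le> B" using B1 by (simp add: N_mult)
  then show ?thesis unfolding id
    by (intro N_add_le N_diff_le n3 n4 unit[OF n5(1) B2] unit[OF N_c1 n1] unit[OF n5(3) B2]
        unit[OF n5(2) n2] unit[OF n5(4) B2])
qed

text \<open>Writing \<gamma>(0 # z) and \<gamma>(z) through deviations in
  \<open>equation_gam\<close> leaves \<gamma>(w) multiplied by the defect of \<open>xx\<close>,
  which is at most |\<omega>|^2, and the unknown multiplied by a' - Q xx, of absolute value
  |a|.\<close>

lemma equation_gg:
  assumes w: "w \<in> lists L" and t: "t \<in> L" and z: "z = t # w"
    and B0: "N \<omega> * N (gg (0 # z)) \<le> B"
    and B1: "N \<omega> * N \<omega> * N (gam w) \<le> B" and B2: "N a * N (coeff (UU z) 1) \<le> B"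
    and B3: "\<And>i. N \<omega> * N (coeff (UU w) i) \<le> B"
    and B4: "\<And>s i. s \<in> L \<Longrightarrow> N \<omega> * N (coeff (UU (s # z)) i) \<le> B"
    and eta: "\<eta> \<le> B"
  shows "N a * N (gg z) \<le> B"
proof -
  have eq: "coeff (uu y) i = coeff (UU y) i" if "0 < i" for y i using that by (simp add: coeff_UU)
  have T: "N (a' * gam z - \<omega> * gam w - Q * gam (0 # z)) \<le> B"
    using B2 B3 B4 by (intro equation_gam[OF w t z B1 _ _ _ eta]) (simp_all add: eq)
  have "(a' - Q * xx) * gg z = (a' * gam z - \<omega> * gam w - Q * gam (0 # z)) + Q * gg (0 # z)
      - (a' * xx - \<omega> - Q * xx\<^sup>2) * gam w"
    by (simp add: gg_def z algebra_simps power2_eq_square)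
  moreover have "N (Q * gg (0 # z)) \<le> B"
    using mult_right_mono[OF N_Q, of "N (gg (0 # z))"] B0 by (simp add: N_mult)
  moreover have "N ((a' * xx - \<omega> - Q * xx\<^sup>2) * gam w) \<le> B"
    using mult_right_mono[OF xx(2), of "N (gam w)"] B1 by (simp add: N_mult)
  ultimately have "N ((a' - Q * xx) * gg z) \<le> B" using T by (simp add: N_add_le N_diff_le)
  moreover have "N (a' - Q * xx) = N a"
  proof -
    have "N (Q * xx) \<le> N \<omega> * 1" using N_Q N_xx_less1 by (intro N_mult_le) auto
    then have "N (- (Q * xx)) < N a'" using om_a N_a' by simp
    from N_add_eq[OF this] show ?thesis using N_a' by simp
  qed
  ultimately show ?thesis by (simp add: N_mult)
qed


text \<open>The level that the linearised recurrence reaches: the contribution |\<omega>|^2 A of the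
  defect and the error \<eta>, each divided by |a|. From |\<omega>| < |a| and \<eta> < |a|^2 A it
  lies below |a| A.\<close>

definition RR :: real where "RR = max (N \<omega> * N \<omega> * A / N a) (\<eta> / N a)"

lemma RR: "0 \<le> RR" "\<eta> \<le> RR" "\<eta> \<le> N a * RR" "N \<omega> * N \<omega> * A \<le> N a * RR" "RR < N a * A" "RR < A"
  "x \<le> RR \<Longrightarrow> N a * x \<le> N a * RR" "0 \<le> x \<Longrightarrow> x \<le> RR \<Longrightarrow> N \<omega> * x \<le> N a * RR"
  "0 \<le> x \<Longrightarrow> x \<le> RR \<Longrightarrow> N a * x \<le> RR" "0 \<le> x \<Longrightarrow> x \<le> RR \<Longrightarrow> N \<omega> * x \<le> RR"
proof -
  have e: "N a * (\<eta> / N a) = \<eta>" "N a * (N \<omega> * N \<omega> * A / N a) = N \<omega> * N \<omega> * A" using a_pos by auto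
  show "0 \<le> RR" unfolding RR_def using eta_nonneg by (simp add: le_max_iff_disj)
  show 1: "\<eta> \<le> N a * RR" "N \<omega> * N \<omega> * A \<le> N a * RR"
    using mult_left_mono[of "\<eta> / N a" RR "N a"] mult_left_mono[of "N \<omega> * N \<omega> * A / N a" RR "N a"]
    unfolding e by (auto simp: RR_def)
  have "N a * RR \<le> RR" using \<open>0 \<le> RR\<close> a_less1 by (simp add: mult_left_le_one_le)
  then show "\<eta> \<le> RR" using 1 by linarith
  have "N \<omega> * N \<omega> < N a * N a" using om_a om_pos by (metis N_ge0 a_pos mult_strict_mono)
  from mult_strict_right_mono[OF this A_pos] have "N \<omega> * N \<omega> * A < N a * (N a * A)" by (simp add: mult.assoc)
  then show "RR < N a * A" unfolding RR_def using eta_less a_pos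
    by (simp add: divide_less_eq mult_ac)
  then show "RR < A" using aA by linarith
  show "x \<le> RR \<Longrightarrow> N a * x \<le> N a * RR" using a_pos by simp
  show om: "N \<omega> * x \<le> N a * RR" if "0 \<le> x" "x \<le> RR" for x
    using that om_a by (intro mult_mono) auto
  then show "0 \<le> x \<Longrightarrow> x \<le> RR \<Longrightarrow> N \<omega> * x \<le> RR" using \<open>N a * RR \<le> RR\<close> by fastforce
  show "0 \<le> x \<Longrightarrow> x \<le> RR \<Longrightarrow> N a * x \<le> RR" using a_less1 by (metis N_ge0 less_imp_le mult_left_le_one_le order_trans)
qed

lemma gam_le: "w \<in> lists L \<Longrightarrow> w \<noteq> [] \<Longrightarrow> N (gam w) \<le> A"
  unfolding gam_def by (rule f_le_A)

lemma UU_le: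
  assumes w: "w \<in> lists L" and "RR \<le> H"
    and "\<And>t. t \<in> L \<Longrightarrow> N (gg (t # w)) \<le> H"
    and "\<And>z. z \<in> lists L \<Longrightarrow> length w + 2 \<le> length z \<Longrightarrow> N (gg z) \<le> RR"
    and "\<And>z i. z \<in> lists L \<Longrightarrow> length w < length z \<Longrightarrow> N (coeff (UU z) i) \<le> RR"
  shows "N (coeff (UU w) i) \<le> H"
proof (rule small_values[OF degree_UU])
  fix t assume t: "t \<in> L"
  show "N (poly (UU w) (- t)) \<le> H"
  proof (rule equation_UU[OF w t refl])
    show "N a * N (coeff (UU (t # w)) 0) \<le> H"
      using RR(9)[of "N (coeff (UU (t # w)) 0)"] assms(5)[of "t # w" 0] w t assms(2) by auto
    show "N (gg (t # w)) \<le> H" by (rule assms(3)[OF t])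
    show "N (gg (s # t # w)) \<le> H" if "s \<in> L" for s
      using assms(4)[of "s # t # w"] that t w assms(2) by auto
    show "N \<omega> * N (coeff (UU (s # t # w)) i) \<le> H" if "s \<in> L" for s i
      using RR(10)[of "N (coeff (UU (s # t # w)) i)"] assms(5)[of "s # t # w" i] that w t assms(2) by auto
    show "\<eta> \<le> H" using RR(2) assms(2) by linarith
  qed
qed

text \<open>Induction from the deepest level towards the root. Let H be the maximum of the
  deviations on level n. It also bounds \<open>UU\<close> one level up, but from there returns with
  a factor |\<omega>|; so |a| H is at most the larger of |a| RR and |\<omega>| H, and |\<omega>| <
  |a| forces H \<le> RR.\<close>

lemma levels:
  assumes "2 \<le> n" "z \<in> lists L" "n \<le> length z"
  shows "N (gg z) \<le> RR \<and> (\<forall>i. N (coeff (UU z) i) \<le> RR)"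
  using assms
proof (induction "M + 2 - n" arbitrary: n z rule: less_induct)
  case less
  show ?case
  proof (cases "M + 1 < n")
    case True
    \<comment> \<open>The deviation looks one level up, so vanishing is certain only from length M +
      2 on.\<close>
    then have "f z = 0" "f (tl z) = 0" using less.prems by (auto intro!: f_vanish)
    then show ?thesis using RR(1) by (simp add: gg_def gam_def coeff_UU uu_def)
  next
    case False
    have IH0: "N (gg y) \<le> RR \<and> (\<forall>i. N (coeff (UU y) i) \<le> RR)" if "y \<in> lists L" "n < length y" for y
      using that False less.prems(1) by (intro less.hyps[of "Suc n"]) auto
    have IH: "N (gg y) \<le> RR" "\<And>i. N (coeff (UU y) i) \<le> RR" if "y \<in> lists L" "n < length y" for y
      using IH0[OF that] by auto
    have U: "N (coeff (UU y) i) \<le> RR" if y: "y \<in> lists L" "length y = n" for y i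
    proof (rule UU_le[OF y(1) order_refl])
      show "N (gg (t # y)) \<le> RR" if "t \<in> L" for t using that y by (intro IH) auto
      show "N (gg z) \<le> RR" if "z \<in> lists L" "length y + 2 \<le> length z" for z
        using that y by (intro IH) auto
      show "N (coeff (UU z) i) \<le> RR" if "z \<in> lists L" "length y < length z" for z i
        using that y by (intro IH) auto
    qed
    define X where "X = {y \<in> lists L. length y = n}"
    have finX: "finite X" unfolding X_def by (rule finite_subset[OF _ finite_words[of n]]) auto
    define H where "H = Max (insert RR ((\<lambda>y. N (gg y)) ` X))"
    have H: "RR \<le> H" "\<And>y. y \<in> X \<Longrightarrow> N (gg y) \<le> H" unfolding H_def using finX by auto
    have "H \<in> insert RR ((\<lambda>y. N (gg y)) ` X)" unfolding H_def using finX by (intro Max_in) auto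
    have "H \<le> RR"
    proof (rule ccontr)
      assume HR: "\<not> H \<le> RR"
      then obtain y where y: "y \<in> X" "H = N (gg y)"
        using \<open>H \<in> insert RR ((\<lambda>y. N (gg y)) ` X)\<close> by auto
      have yL: "y \<in> lists L" "length y = n" using y(1) by (auto simp: X_def)
      obtain t w where w: "y = t # w" "t \<in> L" "w \<in> lists L" "length w = length y - 1"
        by (rule words_ne[OF yL(1)]) (use yL less.prems(1) in auto)
      have wne: "w \<noteq> []" using w yL less.prems(1) by auto
      have lw: "Suc (length w) = n" using w(1) yL(2) by simp
      have Uw: "N (coeff (UU w) i) \<le> H" for i
      proof (rule UU_le[OF w(3) H(1)])
        show "N (gg (s # w)) \<le> H" if "s \<in> L" for s
          using that w(3) lw by (intro H(2)) (simp add: X_def)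
        show "N (gg z) \<le> RR" if "z \<in> lists L" "length w + 2 \<le> length z" for z
          using that(2) lw by (intro IH(1)[OF that(1)]) simp
        show "N (coeff (UU z) i) \<le> RR" if "z \<in> lists L" "length w < length z" for z i
        proof (cases "length z = n")
          case True
          then show ?thesis using that(1) by (intro U)
        next
          case False
          then show ?thesis using that(2) lw by (intro IH(2)[OF that(1)]) simp
        qed
      qed
      define B where "B = max (N a * RR) (N \<omega> * H)"
      have B: "N a * RR \<le> B" "N \<omega> * H \<le> B" by (auto simp: B_def)
      have "N a * N (gg y) \<le> B"
      proof (rule equation_gg[OF w(3,2,1)])
        show "N \<omega> * N (gg (0 # y)) \<le> B"
          using order_trans[OF RR(8)[OF _ IH(1)[of "0 # y"]] B(1)] yL zero_L by simp
        have "N \<omega> * N \<omega> * N (gam w) \<le> N \<omega> * N \<omega> * A"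
          using gam_le[OF w(3) wne] by (intro mult_left_mono) auto
        then show "N \<omega> * N \<omega> * N (gam w) \<le> B" using RR(4) B(1) by linarith
        show "N a * N (coeff (UU y) 1) \<le> B" using RR(7)[OF U[OF yL]] B(1) by (rule order_trans)
        show "N \<omega> * N (coeff (UU w) i) \<le> B" for i
          using order_trans[OF mult_left_mono[OF Uw[of i]] B(2)] by simp
        show "N \<omega> * N (coeff (UU (s # y)) i) \<le> B" if "s \<in> L" for s i
          using order_trans[OF RR(8)[OF _ IH(2)[of "s # y" i]] B(1)] yL that by simp
        show "\<eta> \<le> B" using RR(3) B(1) by linarith
      qed
      moreover have "N a * RR < N a * H" "N \<omega> * H < N a * H"
        using HR a_pos om_a RR(1) by simp_all
      ultimately show False using y(2) unfolding B_def by (simp add: max_def split: if_splits)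
    qed
    have "N (gg z) \<le> RR" "\<And>i. N (coeff (UU z) i) \<le> RR"
    proof -
      show "N (gg z) \<le> RR"
      proof (cases "length z = n")
        case True
        then show ?thesis using H(2)[of z] \<open>H \<le> RR\<close> less.prems by (simp add: X_def)
      next
        case False
        then show ?thesis using less.prems by (intro IH) simp_all
      qed
      show "N (coeff (UU z) i) \<le> RR" for i
      proof (cases "length z = n")
        case True
        then show ?thesis using less.prems by (intro U)
      next
        case False
        then show ?thesis using less.prems by (intro IH) simp_all
      qed
    qed
    then show ?thesis by blast
  qed
qed

lemma UU_small: "w \<in> lists L \<Longrightarrow> w \<noteq> [] \<Longrightarrow> N (coeff (UU w) i) \<le> RR"
proof -
  assume w: "w \<in> lists L" "w \<noteq> []"
  have lw: "1 \<le> length w" using w(2) by (simp add: Suc_le_eq)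
  show ?thesis
  proof (rule UU_le[OF w(1) order_refl])
    show "N (gg (t # w)) \<le> RR" if "t \<in> L" for t using levels[of 2 "t # w"] that w lw by simp
    show "N (gg z) \<le> RR" if "z \<in> lists L" "length w + 2 \<le> length z" for z
      using levels[of 2 z] that by simp
    show "N (coeff (UU z) i) \<le> RR" if "z \<in> lists L" "length w < length z" for z i
      using levels[of 2 z] that lw by simp
  qed
qed

text \<open>Nothing bounds the root by \<open>A\<close>. However, if |\<omega>| times its leading
  coefficient exceeded |a| A, all other terms of \<open>equation_gam\<close> at the word [0] would
  be strictly smaller than that one.\<close>

lemma gam_root: "N \<omega> * N (gam []) \<le> N a * A"
proof (rule ccontr)
  define c where "c = N (gam [])"
  assume "\<not> N \<omega> * N (gam []) \<le> N a * A"
  then have big: "N a * A < N \<omega> * c" by (simp add: c_def)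
  have c: "0 < c"
  proof (rule ccontr)
    assume "\<not> 0 < c"
    then have "N \<omega> * c = 0" by (simp add: c_def)
    then show False using big aA(1) by linarith
  qed
  have omA: "N \<omega> * A \<le> N a * A" using om_a A_pos by simp
  have rc: "N xx * c < c" "N \<omega> * c < c" using N_xx_less1 om_less1 c by simp_all
  \<comment> \<open>The deviations of words of length 1 involve the root itself, which accounts for
    the second entry.\<close>
  define H where "H = max A (N xx * c)"
  have U0: "N (coeff (UU []) i) \<le> H" for i
  proof (rule UU_le)
    show "RR \<le> H" using RR(6) by (simp add: H_def)
    show "N (gg [t]) \<le> H" if "t \<in> L" for t
      unfolding gg_def H_def using gam_le[of "[t]"] that
      by (intro N_diff_le) (auto simp: c_def N_mult le_max_iff_disj)
    show "N (gg z) \<le> RR" if "z \<in> lists L" "length [] + 2 \<le> length z" for z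
      using levels[of 2 z] that by auto
    show "N (coeff (UU z) i) \<le> RR" if "z \<in> lists L" "length [] < length z" for z i
      using UU_small that by auto
  qed simp
  define B where "B = max (N a * A) (max (N \<omega> * H) (N \<omega> * (N \<omega> * c)))"
  have B: "N a * A \<le> B" "N \<omega> * H \<le> B" "N \<omega> * (N \<omega> * c) \<le> B" by (auto simp: B_def)
  have Blt: "B < N \<omega> * c"
    unfolding B_def H_def using big omA rc om_pos by (auto simp: max_def)
  have aRR: "N a * RR \<le> N a * A" using RR(6) a_pos by simp
  have "N (a' * gam [0] - \<omega> * gam [] - Q * gam (0 # [0])) \<le> B"
  proof (rule equation_gam[OF _ zero_L refl])
    show "N \<omega> * N \<omega> * N (gam []) \<le> B" using B(3) by (simp add: c_def mult.assoc)
    have "N (coeff (UU [0]) 1) \<le> RR" using UU_small zero_L by simp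
    then show "N a * N (coeff (uu [0]) 1) \<le> B" using RR(7) aRR B(1) by (fastforce simp: coeff_UU)
    show "N \<omega> * N (coeff (uu []) i) \<le> B" if "0 < i" for i
      using mult_left_mono[OF U0[of i], of "N \<omega>"] B(2) that by (simp add: coeff_UU)
    show "N \<omega> * N (coeff (uu (s # [0])) i) \<le> B" if "s \<in> L" "0 < i" for s i
      using RR(8)[of "N (coeff (UU [s, 0]) i)"] UU_small[of "[s, 0]" i] that zero_L aRR B(1)
      by (auto simp: coeff_UU)
    show "\<eta> \<le> B" using aA(5) B(1) by linarith
  qed simp
  then have T: "N (a' * gam [0] - \<omega> * gam [] - Q * gam (0 # [0])) < N \<omega> * c" using Blt by linarith
  have "N (a' * gam [0]) \<le> N a * A" using gam_le[of "[0]"] zero_L a_pos by (simp add: N_mult N_a')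
  then have T1: "N (a' * gam [0]) < N \<omega> * c" using big by linarith
  have "N (Q * gam (0 # [0])) \<le> N \<omega> * A"
    using gam_le[of "[0, 0]"] zero_L N_Q by (intro N_mult_le) auto
  then have T2: "N (Q * gam (0 # [0])) < N \<omega> * c" using omA big by linarith
  have "\<omega> * gam [] = a' * gam [0] - (a' * gam [0] - \<omega> * gam [] - Q * gam (0 # [0])) - Q * gam (0 # [0])"
    by simp
  then have "N (\<omega> * gam []) < N \<omega> * c" using N_diff_less[OF N_diff_less[OF T1 T] T2] by simp
  then show False by (simp add: N_mult c_def)
qed

text \<open>Expressing the children by deviations turns \<open>equation_q\<close> into (a - q xx)
  \<gamma>(w) = \<omega>^q \<gamma>(parent) + deviations + error. Every term on the right is
  strictly below |a| A; if the parent is the root this is \<open>gam_root\<close>.\<close>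

lemma gam_small:
  assumes "w \<in> lists L" "w \<noteq> []"
  shows "N (gam w) < A"
proof -
  obtain t y where w: "w = t # y" "t \<in> L" "y \<in> lists L"
    by (rule words_ne[OF assms(1)]) (use assms(2) in auto)
  have "(\<Sum>s\<in>L. gam (s # w)) = (\<Sum>s\<in>L. gg (s # w)) + of_nat q * xx * gam w"
    by (simp add: gg_def sum_subtractf card_L)
  then have "(a - of_nat q * xx) * gam w = \<omega> ^ q * gam y + (\<Sum>s\<in>L. gg (s # w)) + er t y q"
    using equation_q[of t y] w(1) by (simp add: algebra_simps)
  moreover have "N (\<omega> ^ q * gam y) < N a * A"
  proof (cases "y = []")
    case True
    have "N (\<omega> ^ q * gam y) = N \<omega> ^ (q - 1) * (N \<omega> * N (gam y))"
      using power_minus_mult[of q "N \<omega>"] q_ge2 by (simp add: N_mult N_power mult.assoc[symmetric])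
    also have "\<dots> \<le> N \<omega> ^ (q - 1) * (N a * A)"
      unfolding True using gam_root by (intro mult_left_mono) auto
    also have "\<dots> < N \<omega> ^ 0 * (N a * A)"
      using q_ge2 aA(1) by (intro mult_strict_right_mono om_power_less) auto
    finally show ?thesis by simp
  next
    case False
    have "N (\<omega> ^ q * gam y) \<le> N \<omega> ^ q * A"
      using gam_le[OF w(3) False] by (intro N_mult_le) (auto simp: N_power)
    also have "\<dots> < N a * A" using om_q A_pos by simp
    finally show ?thesis .
  qed
  moreover have "N (\<Sum>s\<in>L. gg (s # w)) < N a * A"
  proof (intro N_sum_less aA)
    fix s assume "s \<in> L"
    then have "N (gg (s # w)) \<le> RR" using levels[of 2 "s # w"] assms w by auto
    then show "N (gg (s # w)) < N a * A" using RR(5) by linarith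
  qed
  moreover have "N (er t y q) < N a * A" using er_le[OF w(3,2), of q] aA(5) by linarith
  ultimately have "N ((a - of_nat q * xx) * gam w) < N a * A" by (simp add: N_add_less)
  moreover have "N (a - of_nat q * xx) = N a"
  proof -
    have "N (of_nat q * xx) \<le> N \<omega> * 1" using N_q_less1(1) N_xx_less1 by (intro N_mult_le) auto
    then have "N (- (of_nat q * xx)) < N a" using om_a by simp
    from N_add_eq[OF this] show ?thesis by simp
  qed
  ultimately show ?thesis using a_pos by (simp add: N_mult)
qed

lemma f_small:
  assumes "w \<in> lists L" "w \<noteq> []"
  shows "N (coeff (f w) j) < A"
proof -
  have "N (coeff (UU w) j) < A" using UU_small[OF assms, of j] RR(6) by linarith
  moreover have "N (yy * gam w) < A"
  proof -
    have "N (yy * gam w) \<le> 1 * N (gam w)" by (intro N_mult_le N_yy order_refl)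
    then show ?thesis using gam_small[OF assms] by simp
  qed
  moreover have "coeff (uu w) j = coeff (UU w) j - (if j = 0 then yy * gam w else 0)"
    by (simp add: coeff_UU)
  ultimately have "N (coeff (uu w) j) < A" using A_pos by (auto intro!: N_diff_less)
  moreover have "N (gam w * coeff theta j) < A"
    using gam_small[OF assms] A_pos by (simp add: coeff_theta N_mult)
  ultimately show ?thesis unfolding coeff_f by (rule N_add_less)
qed

end

section \<open>The uniform bound\<close>

context hecke_tree begin

text \<open>If |\<omega>| \<le> |a| and r \<ge> 1 then |\<omega>|^(r + 1) \<le> |a|^2 holds anyway.
  So when \<open>critical_I\<close> does not apply, r = 0; the weight k = q is split according to
  whether |\<omega>| < |a|.\<close>

theorem tree_bound:
  assumes cond: "N \<omega> \<le> N a \<or> N \<omega> ^ Suc r \<le> N a * N a"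
  shows "\<exists>C>0. \<forall>f M \<eta>. hecke_solution N \<omega> a L p q d r k f M \<eta> \<longrightarrow>
    (\<forall>w\<in>lists L. \<forall>j. N (coeff (f w) j) \<le> C * \<eta>)"
proof (cases "d = 1 \<and> r = 0 \<and> N a \<le> N \<omega>")
  case True
  have "\<forall>f M \<eta>. hecke_solution N \<omega> a L p q d r k f M \<eta> \<longrightarrow>
    (\<forall>w\<in>lists L. \<forall>j. N (coeff (f w) j) \<le> 1 / N \<omega> * \<eta>)"
    using hecke_solution.bound_k_eq_q_small[of N \<omega> a L p q d r k] True by fastforce
  then show ?thesis using om_pos by (intro exI[of _ "1 / N \<omega>"]) simp
next
  case False
  have a2: "N a * N a < N a" using a_pos a_less1 by simp
  have om_q: "N \<omega> ^ q < N a"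
    using cond
  proof
    assume "N \<omega> \<le> N a"
    moreover have "N \<omega> ^ q < N \<omega> ^ 1" using q_ge2 by (intro om_power_less) simp
    ultimately show ?thesis by simp
  next
    assume "N \<omega> ^ Suc r \<le> N a * N a"
    moreover have "N \<omega> ^ q \<le> N \<omega> ^ Suc r" using rd by (intro om_power_le) simp
    ultimately show ?thesis using a2 by linarith
  qed
  \<comment> \<open>The factor |a|^-2 is the bound at nonempty words, the factor |\<omega>|^-d the
    price of the root.\<close>
  define C where "C = 1 / (N a * N a) / N \<omega> ^ d"
  have "N (coeff (f w) j) \<le> C * \<eta>"
    if sol: "hecke_solution N \<omega> a L p q d r k f M \<eta>" and w: "w \<in> lists L" for f M \<eta> w j
  proof -
    interpret hecke_solution N \<omega> a L p q d r k f M \<eta> by (rule sol)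
    have ne: "N (coeff (f w) j) \<le> \<eta> / (N a * N a)" if w: "w \<in> lists L" "w \<noteq> []" for w j
    proof (rule bound_of_large[OF _ om_q w])
      fix A assume "large_solution N \<omega> a L p q d r k f M \<eta> A"
      then interpret large_solution N \<omega> a L p q d r k f M \<eta> A .
      have star: "\<forall>w\<in>lists L. w \<noteq> [] \<longrightarrow> (\<forall>j. N (coeff (f w) j) < A)"
        if "\<And>z m i. critical z m \<Longrightarrow> i \<le> k \<Longrightarrow> um z i < m"
      proof -
        have "um w i < N a * A" if wi: "w \<in> lists L" "2 \<le> length w" "i \<le> k" for w i
        proof (rule ccontr)
          assume "\<not> um w i < N a * A"
          then have ge: "N a * A \<le> um w i" by simp
          obtain z m i where "critical z m" "i \<le> k" "um z i = m"
            by (rule critical_exists[OF wi ge])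
          then show False using \<open>\<And>z m i. critical z m \<Longrightarrow> i \<le> k \<Longrightarrow> um z i < m\<close> by fastforce
        qed
        then show ?thesis using all_small by blast
      qed
      show "\<forall>w\<in>lists L. w \<noteq> [] \<longrightarrow> (\<forall>j. N (coeff (f w) j) < A)"
      proof (cases "d = 1 \<and> r = 0")
        case dr: True
        then have "N \<omega> < N a" using False by auto
        then interpret weight_q N \<omega> a L p q d r k f M \<eta> A using dr by unfold_locales auto
        show ?thesis using f_small by blast
      next
        case dr: False
        show ?thesis
        proof (cases "N \<omega> ^ Suc r \<le> N a * N a")
          case True
          show ?thesis using critical_I[OF _ True] dr by (intro star) fastforce
        next
          case notI: False
          then have om_a: "N \<omega> \<le> N a" using cond by simp
          have "r = 0"
          proof (rule ccontr)
            assume "r \<noteq> 0"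
            then have "N \<omega> ^ Suc r \<le> N \<omega> ^ 2" by (intro om_power_le) simp
            also have "\<dots> \<le> N a * N a" unfolding power2_eq_square using om_a by (intro mult_mono) auto
            finally show False using notI by simp
          qed
          then show ?thesis using critical_II[OF _ _ _ om_a] dr by (intro star) auto
        qed
      qed
    qed
    have div: "x \<le> x / y" if "0 \<le> x" "0 < y" "y \<le> 1" for x y :: real
      using that by (simp add: le_divide_eq mult_left_le)
    have "N a * N a \<le> 1" using a2 a_less1 by linarith
    then have eta: "\<eta> \<le> \<eta> / (N a * N a)" using eta_nonneg a_pos by (intro div) simp_all
    have C: "C * \<eta> = \<eta> / (N a * N a) / N \<omega> ^ d" by (simp add: C_def)
    have "0 \<le> \<eta> / (N a * N a)" using eta_nonneg by (intro divide_nonneg_nonneg) simp_all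
    then have le: "\<eta> / (N a * N a) \<le> C * \<eta>"
      unfolding C using om_power_le1[of d] om_pos by (intro div) simp_all
    show ?thesis
    proof (cases "w = []")
      case True
      then show ?thesis using root_le[OF ne eta] C by simp
    next
      case False
      then show ?thesis using ne[OF w False, of j] le by linarith
    qed
  qed
  moreover have "0 < C" using a_pos om_pos by (simp add: C_def)
  ultimately show ?thesis by blast
qed

end

section \<open>Finite extensions of complete fields and Teichmueller representatives\<close>

definition abs_cauchy :: "('a::field \<Rightarrow> real) \<Rightarrow> (nat \<Rightarrow> 'a) \<Rightarrow> bool" where
  "abs_cauchy N X \<longleftrightarrow> (\<forall>e>0. \<exists>n0. \<forall>m\<ge>n0. \<forall>n\<ge>n0. N (X m - X n) < e)"

definition abs_lim :: "('a::field \<Rightarrow> real) \<Rightarrow> (nat \<Rightarrow> 'a) \<Rightarrow> 'a \<Rightarrow> bool" where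
  "abs_lim N X l \<longleftrightarrow> (\<forall>e>0. \<exists>n0. \<forall>n\<ge>n0. N (X n - l) < e)"

lemma (in nonarch) complete_of_mcomplete:
  assumes "Metric_space.mcomplete UNIV (\<lambda>x y. N (x - y))" "abs_cauchy N X"
  shows "\<exists>l. abs_lim N X l"
proof -
  interpret Metric_space UNIV "\<lambda>x y. N (x - y)"
  proof
    fix x y z
    show "N (x - y) = N (y - x)" by (rule N_minus_commute)
    have "N ((x - y) + (y - z)) \<le> max (N (x - y)) (N (y - z))" by (rule N_ultra)
    then show "N (x - z) \<le> N (x - y) + N (y - z)"
      using N_ge0[of "x - y"] N_ge0[of "y - z"] by (simp add: max_def del: N_ge0 split: if_splits)
  qed auto
  have "MCauchy X" using assms(2) unfolding MCauchy_def abs_cauchy_def by auto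
  then obtain l where "limitin mtopology X l sequentially" using assms(1) mcomplete_def by blast
  then show ?thesis unfolding limitin_metric eventually_sequentially abs_lim_def by auto
qed

lemma (in nonarch) abs_lim_cauchy:
  assumes "abs_lim N X l" shows "abs_cauchy N X"
  unfolding abs_cauchy_def
proof (intro allI impI)
  fix e :: real assume "0 < e"
  then obtain n0 where n0: "\<forall>n\<ge>n0. N (X n - l) < e" using assms unfolding abs_lim_def by blast
  have "N (X m - X n) < e" if "m \<ge> n0" "n \<ge> n0" for m n
    using N_diff_less[of "X m - l" e "X n - l"] n0 that by simp
  then show "\<exists>n0. \<forall>m\<ge>n0. \<forall>n\<ge>n0. N (X m - X n) < e" by blast
qed

lemma (in nonarch) abs_lim_unique:
  assumes "abs_lim N X l" "abs_lim N X l'" shows "l = l'"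
proof (rule ccontr)
  assume "l \<noteq> l'"
  then have e: "0 < N (l - l')" by simp
  obtain n0 n1 where "\<forall>n\<ge>n0. N (X n - l) < N (l - l')" "\<forall>n\<ge>n1. N (X n - l') < N (l - l')"
    using assms e unfolding abs_lim_def by metis
  then have "N (X (max n0 n1) - l') < N (l - l')" "N (X (max n0 n1) - l) < N (l - l')" by auto
  from N_diff_less[OF this] show False by simp
qed

locale valued_ext = base: nonarch N0 + nonarch N
  for N0 :: "'k::field \<Rightarrow> real" and N :: "'l::field \<Rightarrow> real" +
  fixes \<iota> :: "'k \<Rightarrow> 'l"
  assumes hom: "is_ring_hom \<iota>" and N_hom: "\<And>x. N (\<iota> x) = N0 x"
    and complete0: "\<And>X. abs_cauchy N0 X \<Longrightarrow> \<exists>l. abs_lim N0 X l"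
begin

lemma hom_add: "\<iota> (x + y) = \<iota> x + \<iota> y" and hom_mult: "\<iota> (x * y) = \<iota> x * \<iota> y" and hom_1: "\<iota> 1 = 1"
  using hom unfolding is_ring_hom_def by auto

lemma hom_0: "\<iota> 0 = 0"
proof -
  have "\<iota> 0 + \<iota> 0 = \<iota> 0 + 0" using hom_add[of 0 0] by (simp only: add_0_left add_0_right)
  then show ?thesis by (simp only: add_left_cancel)
qed

lemma hom_minus: "\<iota> (- x) = - \<iota> x"
  using hom_add[of x "- x"] hom_0 by (simp add: eq_neg_iff_add_eq_0 add.commute)

lemma hom_diff: "\<iota> (x - y) = \<iota> x - \<iota> y"
  using hom_add[of x "- y"] hom_minus by simp

definition combs :: "'l set \<Rightarrow> 'l set" where
  "combs B = range (\<lambda>c. \<Sum>b\<in>B. \<iota> (c b) * b)"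

lemma combs_scale: "x \<in> combs B \<Longrightarrow> \<iota> c * x \<in> combs B"
proof -
  assume "x \<in> combs B"
  then obtain g where "x = (\<Sum>b\<in>B. \<iota> (g b) * b)" unfolding combs_def by blast
  then have "\<iota> c * x = (\<Sum>b\<in>B. \<iota> (c * g b) * b)" by (simp add: hom_mult sum_distrib_left mult.assoc)
  then show ?thesis unfolding combs_def by (intro image_eqI[of _ _ "\<lambda>b. c * g b"]) auto
qed

lemma combs_diff: "x \<in> combs B \<Longrightarrow> y \<in> combs B \<Longrightarrow> x - y \<in> combs B"
proof -
  assume "x \<in> combs B" "y \<in> combs B"
  then obtain g h where "x = (\<Sum>b\<in>B. \<iota> (g b) * b)" "y = (\<Sum>b\<in>B. \<iota> (h b) * b)"
    unfolding combs_def by blast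
  then have "x - y = (\<Sum>b\<in>B. \<iota> (g b - h b) * b)" by (simp add: hom_diff left_diff_distrib sum_subtractf)
  then show ?thesis unfolding combs_def by (intro image_eqI) auto
qed

lemma combs_0: "0 \<in> combs B"
  unfolding combs_def by (rule image_eqI[of _ _ "\<lambda>_. 0"]) (simp_all add: hom_0)

lemma combs_insert:
  assumes "finite B" "b \<notin> B"
  shows "x \<in> combs (insert b B) \<longleftrightarrow> (\<exists>c. \<exists>s\<in>combs B. x = \<iota> c * b + s)"
proof
  assume "x \<in> combs (insert b B)"
  then obtain g where "x = (\<Sum>b\<in>insert b B. \<iota> (g b) * b)" unfolding combs_def by blast
  then have "x = \<iota> (g b) * b + (\<Sum>b\<in>B. \<iota> (g b) * b)" using assms by simp
  then show "\<exists>c. \<exists>s\<in>combs B. x = \<iota> c * b + s" unfolding combs_def by blast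
next
  assume "\<exists>c. \<exists>s\<in>combs B. x = \<iota> c * b + s"
  then obtain c g where x: "x = \<iota> c * b + (\<Sum>b\<in>B. \<iota> (g b) * b)" unfolding combs_def by blast
  have "(\<Sum>b'\<in>B. \<iota> (g b') * b') = (\<Sum>b'\<in>B. \<iota> ((g(b := c)) b') * b')"
    using assms by (intro sum.cong) auto
  then have "x = (\<Sum>b'\<in>insert b B. \<iota> ((g(b := c)) b') * b')" using assms x by simp
  then show "x \<in> combs (insert b B)" unfolding combs_def by blast
qed

text \<open>Boundedness of coordinates and completeness are proved together by adding one generator:
  completeness of the old span keeps a new vector \<open>b\<close> at a positive distance \<delta>
  from it, and \<delta> bounds the coordinate at \<open>b\<close>. A dependent generator gets
  coordinate 0.\<close>

lemma finite_dim:
  assumes "finite B"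
  shows "(\<exists>K>0. \<forall>x\<in>combs B. \<exists>c. x = (\<Sum>b\<in>B. \<iota> (c b) * b) \<and> (\<forall>b\<in>B. N0 (c b) \<le> K * N x)) \<and>
    (\<forall>X. (\<forall>n. X n \<in> combs B) \<longrightarrow> abs_cauchy N X \<longrightarrow> (\<exists>l\<in>combs B. abs_lim N X l))"
  using assms
proof (induction B rule: finite_induct)
  case empty
  have "combs {} = {0}" by (auto simp: combs_def)
  moreover have "abs_lim N X 0" if "\<forall>n. X n = 0" for X using that by (simp add: abs_lim_def)
  ultimately show ?case by (auto intro!: exI[of _ 1])
next
  case (insert b B)
  obtain K where K: "K > 0"
    "\<And>x. x \<in> combs B \<Longrightarrow> \<exists>c. x = (\<Sum>b\<in>B. \<iota> (c b) * b) \<and> (\<forall>b\<in>B. N0 (c b) \<le> K * N x)"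
    using insert.IH by blast
  have comp: "\<exists>l\<in>combs B. abs_lim N X l" if "\<And>n. X n \<in> combs B" "abs_cauchy N X" for X
    using insert.IH that by blast
  show ?case
  proof (cases "b \<in> combs B")
    case True
    have eq: "combs (insert b B) = combs B"
    proof (rule set_eqI)
      fix x
      have "\<iota> c * b + s \<in> combs B" if "s \<in> combs B" for c s
      proof -
        have "s - \<iota> (- c) * b \<in> combs B" using that True by (intro combs_diff combs_scale)
        then show ?thesis by (simp add: hom_minus add.commute)
      qed
      moreover have "\<exists>c. \<exists>s\<in>combs B. x = \<iota> c * b + s" if "x \<in> combs B"
        using that by (intro exI[of _ 0] bexI[of _ x]) (simp_all add: hom_0)
      ultimately show "x \<in> combs (insert b B) \<longleftrightarrow> x \<in> combs B"
        unfolding combs_insert[OF insert.hyps(1,2)] by blast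
    qed
    have "\<exists>c. x = (\<Sum>b\<in>insert b B. \<iota> (c b) * b) \<and> (\<forall>b\<in>insert b B. N0 (c b) \<le> K * N x)"
      if xB: "x \<in> combs B" for x
    proof -
      obtain c where c: "x = (\<Sum>b\<in>B. \<iota> (c b) * b)" "\<forall>b\<in>B. N0 (c b) \<le> K * N x" using K(2)[OF xB] by blast
      have "(\<Sum>b'\<in>B. \<iota> (c b') * b') = (\<Sum>b'\<in>B. \<iota> ((c(b := 0)) b') * b')"
        using insert.hyps by (intro sum.cong) auto
      then have "x = (\<Sum>b'\<in>insert b B. \<iota> ((c(b := 0)) b') * b')" using insert.hyps c(1) by (simp add: hom_0)
      moreover have "\<forall>b'\<in>insert b B. N0 ((c(b := 0)) b') \<le> K * N x"
        using c(2) K(1) by auto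
      ultimately show ?thesis by blast
    qed
    then show ?thesis unfolding eq using K(1) comp by blast
  next
    case False
    \<comment> \<open>Otherwise \<open>b\<close> is a limit of elements of the old span, which is
      complete and so contains its limits.\<close>
    have "\<exists>\<delta>>0. \<forall>s\<in>combs B. \<delta> \<le> N (b - s)"
    proof (rule ccontr)
      assume "\<not> ?thesis"
      then have "\<forall>n. \<exists>s\<in>combs B. N (s - b) < 1 / real (Suc n)"
        using N_minus_commute by (metis not_le of_nat_0_less_iff zero_less_Suc zero_less_divide_1_iff)
      then obtain X where X: "\<And>n. X n \<in> combs B" "\<And>n. N (X n - b) < 1 / real (Suc n)" by metis
      have lim: "abs_lim N X b" unfolding abs_lim_def
      proof (intro allI impI)
        fix e :: real assume "0 < e"
        then obtain n0 where n0: "1 / real (Suc n0) < e" using nat_approx_posE by blast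
        have "N (X n - b) < e" if "n \<ge> n0" for n
        proof -
          have "1 / real (Suc n) \<le> 1 / real (Suc n0)" using that by (intro divide_left_mono) auto
          then show ?thesis using X(2)[of n] n0 by linarith
        qed
        then show "\<exists>n0. \<forall>n\<ge>n0. N (X n - b) < e" by blast
      qed
      obtain l where "l \<in> combs B" "abs_lim N X l" using comp[OF X(1) abs_lim_cauchy[OF lim]] by blast
      then show False using abs_lim_unique[OF lim] False by blast
    qed
    then obtain \<delta> where \<delta>: "\<delta> > 0" "\<And>s. s \<in> combs B \<Longrightarrow> \<delta> \<le> N (b - s)" by blast
    have coef: "\<delta> * N0 c \<le> N (\<iota> c * b + s)" if s: "s \<in> combs B" for c s
    proof (cases "c = 0")
      case False
      have c: "\<iota> c * \<iota> (inverse c) = 1" using False hom_mult[of c "inverse c"] hom_1 by simp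
      have "0 - \<iota> (inverse c) * s \<in> combs B" by (intro combs_diff combs_0 combs_scale s)
      then have h: "\<delta> \<le> N (b - (0 - \<iota> (inverse c) * s))" by (rule \<delta>(2))
      have "\<iota> c * b + s = \<iota> c * (b - (0 - \<iota> (inverse c) * s))"
        using c by (simp add: distrib_left flip: mult.assoc)
      then have e: "N (\<iota> c * b + s) = N0 c * N (b - (0 - \<iota> (inverse c) * s))" by (simp only: N_mult N_hom)
      show ?thesis unfolding e mult.commute[of \<delta>] by (rule mult_left_mono[OF h base.N_ge0])
    qed simp
    define K1 where "K1 = 1 / \<delta>"
    define K2 where "K2 = max 1 (K1 * N b)"
    have K12: "0 < K1" "1 \<le> K2" using \<delta>(1) by (auto simp: K1_def K2_def)
    have part: "N0 c \<le> K1 * N (\<iota> c * b + s)" "N s \<le> K2 * N (\<iota> c * b + s)" if s: "s \<in> combs B" for c s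
    proof -
      let ?x = "\<iota> c * b + s"
      show 1: "N0 c \<le> K1 * N ?x" using coef[OF s, of c] \<delta>(1) by (simp add: K1_def field_simps)
      have "N (\<iota> c * b) \<le> K1 * N ?x * N b" using 1 by (simp add: N_mult N_hom mult_right_mono)
      also have "\<dots> = (K1 * N b) * N ?x" by simp
      also have "\<dots> \<le> K2 * N ?x" by (intro mult_right_mono) (auto simp: K2_def)
      finally have "N (\<iota> c * b) \<le> K2 * N ?x" .
      moreover have "N ?x \<le> K2 * N ?x" using K12 mult_right_mono[of 1 K2 "N ?x"] by simp
      ultimately have "N (?x - \<iota> c * b) \<le> K2 * N ?x" by (intro N_diff_le)
      then show "N s \<le> K2 * N ?x" by simp
    qed
    define K' where "K' = max K1 (K * K2)"
    have "\<exists>c. x = (\<Sum>b\<in>insert b B. \<iota> (c b) * b) \<and> (\<forall>b\<in>insert b B. N0 (c b) \<le> K' * N x)"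
      if xB: "x \<in> combs (insert b B)" for x
    proof -
      obtain c s where x: "s \<in> combs B" "x = \<iota> c * b + s" using xB combs_insert[OF insert.hyps(1,2)] by blast
      obtain g where g: "s = (\<Sum>b\<in>B. \<iota> (g b) * b)" "\<forall>b\<in>B. N0 (g b) \<le> K * N s" using K(2)[OF x(1)] by blast
      have "(\<Sum>b'\<in>B. \<iota> (g b') * b') = (\<Sum>b'\<in>B. \<iota> ((g(b := c)) b') * b')"
        using insert.hyps by (intro sum.cong) auto
      then have "x = (\<Sum>b'\<in>insert b B. \<iota> ((g(b := c)) b') * b')" using insert.hyps x(2) g(1) by simp
      moreover have "N0 ((g(b := c)) b') \<le> K' * N x" if "b' \<in> insert b B" for b'
      proof (cases "b' = b")
        case True
        have "K1 * N x \<le> K' * N x" by (intro mult_right_mono) (auto simp: K'_def)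
        then show ?thesis using part(1)[OF x(1), of c] True x(2) by simp
      next
        case False
        have "N0 (g b') \<le> K * N s" using g(2) that False by auto
        also have "\<dots> \<le> K * (K2 * N x)" using part(2)[OF x(1), of c] x(2) K(1) by simp
        also have "\<dots> = (K * K2) * N x" by simp
        also have "\<dots> \<le> K' * N x" by (intro mult_right_mono) (auto simp: K'_def)
        finally show ?thesis using False by simp
      qed
      ultimately show ?thesis by blast
    qed
    moreover have "0 < K'" using K12 by (simp add: K'_def less_max_iff_disj)
    moreover have "\<exists>l\<in>combs (insert b B). abs_lim N X l"
      if X: "\<And>n. X n \<in> combs (insert b B)" and cauchy: "abs_cauchy N X" for X
    proof -
      have "\<forall>n. \<exists>c s. s \<in> combs B \<and> X n = \<iota> c * b + s" using X combs_insert[OF insert.hyps(1,2)] by blast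
      then obtain c s where cs: "\<And>n. s n \<in> combs B" "\<And>n. X n = \<iota> (c n) * b + s n" by metis
      have diff: "X m - X n = \<iota> (c m - c n) * b + (s m - s n)" for m n
        by (simp add: cs(2) hom_diff left_diff_distrib)
      have "N0 (c m - c n) \<le> K1 * N (X m - X n)" "N (s m - s n) \<le> K2 * N (X m - X n)" for m n
        unfolding diff by (intro part combs_diff cs(1))+
      note bd = this
      have "abs_cauchy N0 c" unfolding abs_cauchy_def
      proof (intro allI impI)
        fix e :: real assume "0 < e"
        then have "0 < e / K1" using K12 by simp
        then obtain n0 where "\<forall>m\<ge>n0. \<forall>n\<ge>n0. N (X m - X n) < e / K1"
          using cauchy unfolding abs_cauchy_def by blast
        then have "\<forall>m\<ge>n0. \<forall>n\<ge>n0. K1 * N (X m - X n) < e" using K12 by (simp add: field_simps)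
        then show "\<exists>n0. \<forall>m\<ge>n0. \<forall>n\<ge>n0. N0 (c m - c n) < e" using bd(1) le_less_trans by blast
      qed
      then obtain lc where lc: "abs_lim N0 c lc" using complete0 by blast
      have "abs_cauchy N s" unfolding abs_cauchy_def
      proof (intro allI impI)
        fix e :: real assume "0 < e"
        then have "0 < e / K2" using K12 by simp
        then obtain n0 where "\<forall>m\<ge>n0. \<forall>n\<ge>n0. N (X m - X n) < e / K2"
          using cauchy unfolding abs_cauchy_def by blast
        then have "\<forall>m\<ge>n0. \<forall>n\<ge>n0. K2 * N (X m - X n) < e" using K12 by (simp add: field_simps)
        then show "\<exists>n0. \<forall>m\<ge>n0. \<forall>n\<ge>n0. N (s m - s n) < e" using bd(2) le_less_trans by blast
      qed
      then obtain ls where ls: "ls \<in> combs B" "abs_lim N s ls" using comp cs(1) by blast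
      have "abs_lim N X (\<iota> lc * b + ls)" unfolding abs_lim_def
      proof (intro allI impI)
        fix e :: real assume e: "0 < e"
        define e' where "e' = e / (N b + 1)"
        have e': "0 < e'" unfolding e'_def using e by (intro divide_pos_pos) (auto intro: add_nonneg_pos)
        obtain n0 n1 where n: "\<forall>n\<ge>n0. N0 (c n - lc) < e'" "\<forall>n\<ge>n1. N (s n - ls) < e"
          using lc ls(2) e e' unfolding abs_lim_def by metis
        have "N (X n - (\<iota> lc * b + ls)) < e" if "n \<ge> max n0 n1" for n
        proof -
          have "N (\<iota> (c n - lc) * b) \<le> e' * N b"
            unfolding N_mult N_hom using n(1) that by (intro mult_right_mono) auto
          also have "\<dots> < e' * (N b + 1)" using e' by simp
          also have "\<dots> = e" unfolding e'_def by (simp add: add_nonneg_eq_0_iff)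
          finally have "N (\<iota> (c n - lc) * b) < e" .
          moreover have "N (s n - ls) < e" using n(2) that by simp
          ultimately have "N (\<iota> (c n - lc) * b + (s n - ls)) < e" by (rule N_add_less)
          then show ?thesis by (simp add: cs(2) hom_diff left_diff_distrib algebra_simps)
        qed
        then show "\<exists>n0. \<forall>n\<ge>n0. N (X n - (\<iota> lc * b + ls)) < e" by blast
      qed
      moreover have "\<iota> lc * b + ls \<in> combs (insert b B)"
        unfolding combs_insert[OF insert.hyps(1,2)] using ls(1) by blast
      ultimately show ?thesis by blast
    qed
    ultimately show ?thesis by blast
  qed
qed

end

section \<open>Differences of products and powers; residue classes\<close>

context nonarch begin

lemma N_prod: "N (prod g S) = (\<Prod>i\<in>S. N (g i))"
  by (induction S rule: infinite_finite_induct) (simp_all add: N_mult)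

lemma N_prod_diff_less1:
  assumes "finite S" "\<And>i. i \<in> S \<Longrightarrow> N (g i) \<le> 1" "\<And>i. i \<in> S \<Longrightarrow> N (h i) \<le> 1"
    and "\<And>i. i \<in> S \<Longrightarrow> N (g i - h i) < 1"
  shows "N (prod g S - prod h S) < 1"
  using assms
proof (induction S rule: finite_induct)
  case (insert x F)
  have "N (g x * (prod g F - prod h F)) < 1"
    using insert N_mult_le[of "g x" 1 "prod g F - prod h F" "N (prod g F - prod h F)"] by simp
  moreover have "N ((g x - h x) * prod h F) < 1"
    using insert.prems(3)[of x] insert.prems(2)
      N_mult_le[of "g x - h x" "N (g x - h x)" "prod h F" 1] N_prod_le1[of F h] by fastforce
  moreover have "prod g (insert x F) - prod h (insert x F)
      = g x * (prod g F - prod h F) + (g x - h x) * prod h F"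
    using insert.hyps by (simp add: algebra_simps)
  ultimately show ?case using N_add_less by metis
qed simp

text \<open>In u^n - v^n = (u - v) * sum, replacing u by v inside the sum gives n v^(n - 1) with an
  error of at most |u - v|. For n = q the q-th power map contracts each residue class.\<close>

lemma N_power_diff:
  assumes "N u \<le> 1" "N v \<le> 1"
  shows "N (u ^ n - v ^ n) \<le> N (u - v) * max (N (of_nat n)) (N (u - v))"
proof -
  have p1: "N (x ^ i) \<le> 1" if "N x \<le> 1" for x and i :: nat using that by (simp add: N_power power_le_one)
  have simple: "N (u ^ i - v ^ i) \<le> N (u - v)" for i
  proof -
    have "N (\<Sum>j<i. v ^ (i - Suc j) * u ^ j) \<le> 1"
      using N_mult_le[OF p1[OF assms(2)] p1[OF assms(1)]] by (intro N_sum_le) simp_all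
    then show ?thesis unfolding power_diff_sumr2 N_mult by (simp add: mult_left_le)
  qed
  let ?S = "\<Sum>i<n. v ^ (n - Suc i) * u ^ i"
  have "?S = (\<Sum>i<n. v ^ (n - Suc i) * (u ^ i - v ^ i)) + (\<Sum>i<n. v ^ (n - Suc i) * v ^ i)"
    by (simp add: algebra_simps flip: sum.distrib)
  also have "(\<Sum>i<n. v ^ (n - Suc i) * v ^ i) = (\<Sum>i<n. v ^ (n - 1))"
    by (intro sum.cong) (auto simp flip: power_add)
  finally have eq: "?S = (\<Sum>i<n. v ^ (n - Suc i) * (u ^ i - v ^ i)) + of_nat n * v ^ (n - 1)" by simp
  have "N ?S \<le> max (N (of_nat n)) (N (u - v))" unfolding eq
  proof (rule N_add_le)
    show "N (\<Sum>i<n. v ^ (n - Suc i) * (u ^ i - v ^ i)) \<le> max (N (of_nat n)) (N (u - v))"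
    proof (rule N_sum_le)
      fix i show "N (v ^ (n - Suc i) * (u ^ i - v ^ i)) \<le> max (N (of_nat n)) (N (u - v))"
        using N_mult_le[OF p1[OF assms(2)] simple, of "n - Suc i" i] by simp
    qed (simp add: le_max_iff_disj)
    have "N (of_nat n * v ^ (n - 1)) \<le> N (of_nat n) * 1" by (intro N_mult_le p1 assms order_refl)
    then show "N (of_nat n * v ^ (n - 1)) \<le> max (N (of_nat n)) (N (u - v))" by simp
  qed
  then show ?thesis unfolding power_diff_sumr2[of u n v] N_mult by (intro mult_left_mono) auto
qed

definition res_rel :: "('a \<times> 'a) set" where
  "res_rel = {(x, y). x \<in> int_ring N \<and> y \<in> int_ring N \<and> N (x - y) < 1}"

lemma residue_field_eq: "residue_field N = int_ring N // res_rel"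
  by (simp add: residue_field_def res_rel_def)

lemma equiv_res_rel: "equiv (int_ring N) res_rel"
proof (rule equivI)
  show "trans res_rel"
  proof (rule transI)
    fix x y z assume "(x, y) \<in> res_rel" "(y, z) \<in> res_rel"
    then show "(x, z) \<in> res_rel" using N_add_less[of "x - y" 1 "y - z"] by (simp add: res_rel_def)
  qed
qed (auto simp: res_rel_def refl_on_def sym_def N_minus_commute)

end

section \<open>Teichmueller representatives\<close>

locale residual = nonarch N for N :: "'a::field \<Rightarrow> real" +
  fixes q :: nat
  assumes card_res: "card (residue_field N) = q" and q_pos: "0 < q"
    and complete: "\<And>X. abs_cauchy N X \<Longrightarrow> \<exists>l. abs_lim N X l"
begin

lemma finite_res: "finite (residue_field N)"
  using card_res q_pos card_gt_0_iff by blast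

text \<open>A representative chosen from the class as a set, hence equal for congruent
  elements.\<close>

definition rp :: "'a \<Rightarrow> 'a" where "rp x = (SOME y. y \<in> res_rel `` {x})"

lemma rp_in: "N x \<le> 1 \<Longrightarrow> (x, rp x) \<in> res_rel"
proof -
  assume "N x \<le> 1"
  then have "x \<in> res_rel `` {x}" by (simp add: res_rel_def int_ring_def)
  then have "rp x \<in> res_rel `` {x}" unfolding rp_def by (rule someI)
  then show ?thesis by simp
qed

lemma rp: assumes "N x \<le> 1" shows "N (rp x) \<le> 1" "N (x - rp x) < 1" "N (rp x - x) < 1"
proof -
  show 1: "N (rp x) \<le> 1" "N (x - rp x) < 1" using rp_in[OF assms] by (auto simp: res_rel_def int_ring_def)
  show "N (rp x - x) < 1" using 1(2) N_minus_commute[of x "rp x"] by simp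
qed

lemma rp_eq: "N x \<le> 1 \<Longrightarrow> N y \<le> 1 \<Longrightarrow> rp x = rp y \<longleftrightarrow> N (x - y) < 1"
proof
  assume xy: "N x \<le> 1" "N y \<le> 1"
  { assume "rp x = rp y"
    from N_diff_less[OF rp(2)[OF xy(1)] rp(2)[OF xy(2)]] have "N ((x - rp x) - (y - rp y)) < 1" .
    then show "N (x - y) < 1" using \<open>rp x = rp y\<close> by simp }
  { assume "N (x - y) < 1"
    then have "(x, y) \<in> res_rel" using xy by (simp add: res_rel_def int_ring_def)
    then have "res_rel `` {x} = res_rel `` {y}" using equiv_class_eq[OF equiv_res_rel] by blast
    then show "rp x = rp y" by (simp add: rp_def) }
qed

definition S :: "'a set" where "S = rp ` int_ring N"

lemma S_le1: "s \<in> S \<Longrightarrow> N s \<le> 1"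
  using rp(1) by (auto simp: S_def int_ring_def)

lemma rp_S: "N x \<le> 1 \<Longrightarrow> rp x \<in> S"
  by (simp add: S_def int_ring_def)

lemma rp_rp: "s \<in> S \<Longrightarrow> rp s = s"
proof -
  assume "s \<in> S"
  then obtain x where x: "N x \<le> 1" "s = rp x" by (auto simp: S_def int_ring_def)
  then show ?thesis using rp_eq[of s x] rp[OF x(1)] by simp
qed

lemma S_sep: "s \<in> S \<Longrightarrow> t \<in> S \<Longrightarrow> N (s - t) < 1 \<Longrightarrow> s = t"
  using rp_eq[of s t] S_le1 rp_rp by metis

lemma bij_classes: "bij_betw (\<lambda>s. res_rel `` {s}) S (residue_field N)"
  unfolding bij_betw_def residue_field_eq
proof
  show "inj_on (\<lambda>s. res_rel `` {s}) S"
  proof (rule inj_onI)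
    fix s t assume st: "s \<in> S" "t \<in> S" "res_rel `` {s} = res_rel `` {t}"
    then have "rp s = rp t" by (simp add: rp_def)
    then show "s = t" using st rp_rp by simp
  qed
  show "(\<lambda>s. res_rel `` {s}) ` S = int_ring N // res_rel"
  proof
    show "(\<lambda>s. res_rel `` {s}) ` S \<subseteq> int_ring N // res_rel"
      using S_le1 by (auto simp: quotient_def int_ring_def)
    show "int_ring N // res_rel \<subseteq> (\<lambda>s. res_rel `` {s}) ` S"
    proof
      fix X assume "X \<in> int_ring N // res_rel"
      then obtain x where x: "N x \<le> 1" "X = res_rel `` {x}" by (auto simp: quotient_def int_ring_def)
      then have "X = res_rel `` {rp x}" using equiv_class_eq[OF equiv_res_rel rp_in] by simp
      then show "X \<in> (\<lambda>s. res_rel `` {s}) ` S" using rp_S[OF x(1)] by blast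
    qed
  qed
qed

lemma finite_S: "finite S" and card_S: "card S = q"
  using bij_betw_finite[OF bij_classes] finite_res bij_betw_same_card[OF bij_classes] card_res by auto

lemma q_ge2: "2 \<le> q"
proof -
  have "rp 0 \<noteq> rp 1" using rp_eq[of 0 1] by simp
  moreover have "{rp 0, rp 1} \<subseteq> S" using rp_S by simp
  ultimately show ?thesis using card_mono[OF finite_S, of "{rp 0, rp 1}"] card_S by simp
qed

text \<open>Translation by 1 permutes the residue classes; comparing the sums of the representatives
  before and after gives q = 0 in the residue field.\<close>

lemma N_q: "N (of_nat q) < 1"
proof -
  define h where "h s = rp (s + 1)" for s
  have le: "N (s + 1) \<le> 1" if "s \<in> S" for s using S_le1[OF that] by (simp add: N_add_le)
  have "inj_on h S"
  proof (rule inj_onI)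
    fix s t assume st: "s \<in> S" "t \<in> S" "h s = h t"
    then have "N ((s + 1) - (t + 1)) < 1" using rp_eq[OF le[OF st(1)] le[OF st(2)]] by (simp add: h_def)
    then show "s = t" using S_sep[OF st(1,2)] by simp
  qed
  moreover have "h ` S \<subseteq> S" using le rp_S by (auto simp: h_def)
  ultimately have "bij_betw h S S" unfolding bij_betw_def using endo_inj_surj[OF finite_S] by blast
  then have "(\<Sum>s\<in>S. h s) = (\<Sum>s\<in>S. s)" by (rule sum.reindex_bij_betw)
  then have "of_nat q = - (\<Sum>s\<in>S. h s - (s + 1))" by (simp add: sum.distrib sum_subtractf card_S)
  moreover have "N (\<Sum>s\<in>S. h s - (s + 1)) < 1"
    using rp(3)[OF le] by (intro N_sum_less) (simp_all add: h_def)
  ultimately show ?thesis by (simp only: N_minus)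
qed

text \<open>Multiplication by a unit permutes the q - 1 unit classes; comparing the products of the
  representatives gives x^(q - 1) = 1 in the residue field.\<close>

lemma fermat: assumes "N x \<le> 1" shows "N (x ^ q - x) < 1"
proof (cases "N x < 1")
  case True
  have "N (x ^ q) \<le> N x" using power_decreasing[of 1 q "N x"] assms q_pos by (simp add: N_power)
  then show ?thesis using True by (intro N_diff_less) auto
next
  case False
  then have x: "N x = 1" using assms by simp
  define U where "U = {s \<in> S. N s = 1}"
  define h where "h s = rp (x * s)" for s
  have finU: "finite U" using finite_S by (simp add: U_def)
  have xs: "N (x * s) = 1" if "s \<in> U" for s using that x by (simp add: U_def N_mult)
  have h: "h s \<in> U" if "s \<in> U" for s
  proof -
    have "N (rp (x * s) - x * s) < N (x * s)" using rp(3)[of "x * s"] xs[OF that] by simp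
    from N_add_eq[OF this] have "N (h s) = 1" using xs[OF that] by (simp add: h_def)
    then show ?thesis using rp_S[of "x * s"] xs[OF that] by (simp add: U_def h_def)
  qed
  have "inj_on h U"
  proof (rule inj_onI)
    fix s t assume st: "s \<in> U" "t \<in> U" "h s = h t"
    then have "N (x * s - x * t) < 1" using rp_eq[of "x * s" "x * t"] xs by (simp add: h_def)
    then have "N (s - t) < 1" using x by (metis N_mult mult_1 right_diff_distrib)
    then show "s = t" using S_sep st by (simp add: U_def)
  qed
  moreover have "h ` U \<subseteq> U" using h by auto
  ultimately have "bij_betw h U U" unfolding bij_betw_def using endo_inj_surj[OF finU] by blast
  then have ph: "(\<Prod>s\<in>U. h s) = (\<Prod>s\<in>U. s)" by (rule prod.reindex_bij_betw)
  have "S = insert (rp 0) U"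
  proof
    show "S \<subseteq> insert (rp 0) U"
    proof
      fix s assume s: "s \<in> S"
      show "s \<in> insert (rp 0) U"
      proof (cases "N s = 1")
        case False
        then have "N (s - 0) < 1" using S_le1[OF s] by simp
        then have "rp s = rp 0" using rp_eq[of s 0] S_le1[OF s] by simp
        then show ?thesis using rp_rp[OF s] by simp
      qed (use s in \<open>simp add: U_def\<close>)
    qed
    show "insert (rp 0) U \<subseteq> S" using rp_S by (auto simp: U_def)
  qed
  moreover have "rp 0 \<notin> U" using rp(3)[of 0] by (simp add: U_def)
  ultimately have cU: "card U = q - 1" using card_S finU by (metis card_insert_disjoint diff_Suc_1)
  have "N ((\<Prod>s\<in>U. h s) - (\<Prod>s\<in>U. x * s)) < 1"
  proof (rule N_prod_diff_less1[OF finU])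
    fix s assume s: "s \<in> U"
    show "N (h s) \<le> 1" using h[OF s] by (simp add: U_def)
    show "N (x * s) \<le> 1" using xs[OF s] by simp
    show "N (h s - x * s) < 1" unfolding h_def using xs[OF s] by (intro rp) simp
  qed
  moreover have "(\<Prod>s\<in>U. x * s) = x ^ (q - 1) * (\<Prod>s\<in>U. s)" by (simp add: prod.distrib cU)
  ultimately have "N ((1 - x ^ (q - 1)) * (\<Prod>s\<in>U. s)) < 1" by (simp add: ph left_diff_distrib)
  moreover have "N (\<Prod>s\<in>U. s) = 1" by (simp add: N_prod U_def)
  ultimately have "N (1 - x ^ (q - 1)) < 1" by (simp add: N_mult)
  then have "N (x * (x ^ (q - 1) - 1)) < 1" using x by (simp add: N_mult N_minus_commute)
  moreover have "x * (x ^ (q - 1) - 1) = x ^ q - x"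
    using power_minus_mult[OF q_pos, of x] by (simp add: right_diff_distrib mult.commute)
  ultimately show ?thesis by simp
qed

text \<open>Within one residue class the q-th power map strictly contracts, so it has at most one
  fixed point.\<close>

lemma teich_unique:
  assumes "N s \<le> 1" "N t \<le> 1" "s ^ q = s" "t ^ q = t" "N (s - t) < 1"
  shows "s = t"
proof (rule ccontr)
  assume "s \<noteq> t"
  then have pos: "0 < N (s - t)" by simp
  have "N (s - t) \<le> N (s - t) * max (N (of_nat q)) (N (s - t))"
    using N_power_diff[OF assms(1,2), of q] assms(3,4) by simp
  also have "\<dots> < N (s - t) * 1" using pos assms(5) N_q by (intro mult_strict_left_mono) auto
  finally show False by simp
qed

text \<open>The fixed point is the limit of x^(q^n): \<open>fermat\<close> makes the first step
  smaller than 1, and each further step shrinks by the factor \<open>c\<close>.\<close>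

lemma teich_exists:
  assumes "N x \<le> 1"
  shows "\<exists>t. N t \<le> 1 \<and> t ^ q = t \<and> N (x - t) < 1"
proof -
  define X where "X n = x ^ (q ^ n)" for n
  define c where "c = max (N (of_nat q)) (N (x ^ q - x))"
  have c: "0 \<le> c" "c < 1" using N_q fermat[OF assms] by (auto simp: c_def le_max_iff_disj)
  have X1: "N (X n) \<le> 1" for n using assms by (simp add: X_def N_power power_le_one)
  have Xq: "X n ^ q = X (Suc n)" for n by (simp add: X_def mult.commute flip: power_mult)
  have step: "N (X (Suc n) - X n) \<le> c ^ Suc n" for n
  proof (induction n)
    case 0
    then show ?case by (simp add: X_def c_def)
  next
    case (Suc n)
    have "c ^ Suc n \<le> c" using c power_decreasing[of 1 "Suc n" c] by simp
    then have m: "max (N (of_nat q)) (N (X (Suc n) - X n)) \<le> c" using Suc by (simp add: c_def)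
    have "N (X (Suc (Suc n)) - X (Suc n)) = N (X (Suc n) ^ q - X n ^ q)" by (simp add: Xq)
    also have "\<dots> \<le> N (X (Suc n) - X n) * max (N (of_nat q)) (N (X (Suc n) - X n))"
      by (intro N_power_diff X1)
    also have "\<dots> \<le> c ^ Suc n * c" using Suc m c by (intro mult_mono) (auto simp: le_max_iff_disj)
    finally show ?case by (simp add: mult_ac)
  qed
  have far: "N (X (n + m) - X n) \<le> c ^ Suc n" for n m
  proof (induction m)
    case (Suc m)
    have "N (X (Suc (n + m)) - X (n + m)) \<le> c ^ Suc n"
      using step[of "n + m"] power_decreasing[of "Suc n" "Suc (n + m)" c] c by simp
    then have "N ((X (Suc (n + m)) - X (n + m)) + (X (n + m) - X n)) \<le> c ^ Suc n" using Suc by (intro N_add_le)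
    then show ?case by simp
  qed (use c in simp)
  have "abs_cauchy N X" unfolding abs_cauchy_def
  proof (intro allI impI)
    fix e :: real assume "0 < e"
    then obtain n0 where n0: "c ^ n0 < e" using real_arch_pow_inv c(2) by blast
    have le: "N (X n - X n0) < e" if "n \<ge> n0" for n
    proof -
      have "N (X n - X n0) \<le> c ^ Suc n0" using far[of n0 "n - n0"] that by simp
      also have "\<dots> \<le> c ^ n0" using c by (intro power_decreasing) auto
      finally show ?thesis using n0 by linarith
    qed
    have "N (X m - X n) < e" if "m \<ge> n0" "n \<ge> n0" for m n
      using N_diff_less[OF le[OF that(1)] le[OF that(2)]] by simp
    then show "\<exists>n0. \<forall>m\<ge>n0. \<forall>n\<ge>n0. N (X m - X n) < e" by blast
  qed
  then obtain t where t: "abs_lim N X t" using complete by blast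
  have t1: "N t \<le> 1"
  proof -
    obtain n where "N (X n - t) < 1" using t unfolding abs_lim_def by (metis order_refl zero_less_one)
    from N_diff_le[OF X1[of n] less_imp_le[OF this]] show ?thesis by simp
  qed
  have "t ^ q = t"
  proof (rule ccontr)
    assume "t ^ q \<noteq> t"
    then have e: "0 < N (t ^ q - t)" by simp
    obtain n0 where n0: "\<forall>n\<ge>n0. N (X n - t) < N (t ^ q - t)" using t e unfolding abs_lim_def by blast
    have "N (X n0 ^ q - t ^ q) \<le> N (X n0 - t) * max (N (of_nat q)) (N (X n0 - t))"
      by (rule N_power_diff[OF X1 t1])
    also have "\<dots> \<le> N (X n0 - t) * 1"
      using N_of_nat N_diff_le[OF X1 t1] by (intro mult_left_mono) auto
    also have "\<dots> < N (t ^ q - t)" using n0 by simp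
    finally have 1: "N (X (Suc n0) - t ^ q) < N (t ^ q - t)" by (simp add: Xq)
    have "N (X (Suc n0) - t) < N (t ^ q - t)" using n0 by simp
    from N_diff_less[OF this 1] show False by simp
  qed
  moreover have "N (x - t) < 1"
  proof -
    obtain n where n: "N (X n - t) < 1" using t unfolding abs_lim_def by (metis order_refl zero_less_one)
    have "N (X (0 + n) - X 0) \<le> c ^ Suc 0" by (rule far)
    then have "N (X n - x) < 1" using c by (simp add: X_def)
    from N_diff_less[OF n this] show ?thesis by simp
  qed
  ultimately show ?thesis using t1 by blast
qed

definition TT :: "'a set" where "TT = {t. t ^ q = t}"

lemma TT_le1: "t \<in> TT \<Longrightarrow> N t \<le> 1"
proof (rule ccontr)
  assume t: "t \<in> TT" and "\<not> N t \<le> 1"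
  then have "N t ^ 1 < N t ^ q" using q_ge2 by (intro power_strict_increasing) auto
  then show False using t N_power[of t q] by (simp add: TT_def)
qed

lemma TT_sep: "s \<in> TT \<Longrightarrow> t \<in> TT \<Longrightarrow> s \<noteq> t \<Longrightarrow> N (s - t) = 1"
  using teich_unique[of s t] TT_le1[of s] TT_le1[of t] N_diff_le[of s 1 t] by (force simp: TT_def)

lemma TT_0: "0 \<in> TT"
  using q_pos by (simp add: TT_def power_0_left)

lemma TT_ex: "N x \<le> 1 \<Longrightarrow> \<exists>t\<in>TT. N (x - t) < 1"
  using teich_exists[of x] by (auto simp: TT_def)

lemma bij_TT: "bij_betw rp TT S"
  unfolding bij_betw_def
proof
  show "inj_on rp TT"
  proof (rule inj_onI)
    fix s t assume st: "s \<in> TT" "t \<in> TT" "rp s = rp t"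
    then have "N (s - t) < 1" using rp_eq[of s t] TT_le1 by simp
    then show "s = t" using TT_sep[OF st(1,2)] by fastforce
  qed
  show "rp ` TT = S"
  proof
    show "rp ` TT \<subseteq> S" using rp_S TT_le1 by auto
    show "S \<subseteq> rp ` TT"
    proof
      fix s assume s: "s \<in> S"
      obtain t where t: "t \<in> TT" "N (s - t) < 1" using TT_ex[OF S_le1[OF s]] by blast
      then have "rp s = rp t" using rp_eq[of s t] S_le1[OF s] TT_le1 by simp
      then show "s \<in> rp ` TT" using rp_rp[OF s] t(1) by auto
    qed
  qed
qed

lemma finite_TT: "finite TT" and card_TT: "card TT = q"
  using bij_betw_finite[OF bij_TT] finite_S bij_betw_same_card[OF bij_TT] card_S by auto

text \<open>Existence and uniqueness together justify the definite description in
  \<open>teichmueller\<close>.\<close>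

lemma teich_class:
  assumes "\<mu> \<in> residue_field N"
  shows "(THE t. t \<in> \<mu> \<and> t ^ q = t) \<in> \<mu> \<inter> TT"
proof -
  obtain x where x: "N x \<le> 1" "\<mu> = res_rel `` {x}"
    using assms by (auto simp: residue_field_eq quotient_def int_ring_def)
  have mem: "y \<in> \<mu> \<longleftrightarrow> N y \<le> 1 \<and> N (x - y) < 1" for y using x by (auto simp: res_rel_def int_ring_def)
  obtain t where t: "t \<in> TT" "N (x - t) < 1" using TT_ex[OF x(1)] by blast
  have "\<exists>!t. t \<in> \<mu> \<and> t ^ q = t"
  proof
    show "t \<in> \<mu> \<and> t ^ q = t" using t mem TT_le1 by (simp add: TT_def)
    fix s assume s: "s \<in> \<mu> \<and> s ^ q = s"
    then have "N (x - s) < 1" using mem by simp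
    from N_diff_less[OF this t(2)] have "N (t - s) < 1" by simp
    then show "s = t" using teich_unique[of t s] s t(1) mem TT_le1 by (simp add: TT_def)
  qed
  from theI'[OF this] show ?thesis by (simp add: TT_def)
qed

lemma teich_image: "(\<lambda>\<mu>. THE t. t \<in> \<mu> \<and> t ^ q = t) ` residue_field N = TT"
proof
  show "(\<lambda>\<mu>. THE t. t \<in> \<mu> \<and> t ^ q = t) ` residue_field N \<subseteq> TT" using teich_class by auto
  show "TT \<subseteq> (\<lambda>\<mu>. THE t. t \<in> \<mu> \<and> t ^ q = t) ` residue_field N"
  proof
    fix t assume t: "t \<in> TT"
    let ?\<mu> = "res_rel `` {t}"
    have mu: "?\<mu> \<in> residue_field N" using TT_le1[OF t] by (auto simp: residue_field_eq quotient_def int_ring_def)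
    have "(THE t. t \<in> ?\<mu> \<and> t ^ q = t) \<in> ?\<mu> \<inter> TT" by (rule teich_class[OF mu])
    then have "t = (THE t. t \<in> ?\<mu> \<and> t ^ q = t)" using TT_sep[OF t] by (fastforce simp: res_rel_def)
    then show "t \<in> (\<lambda>\<mu>. THE t. t \<in> \<mu> \<and> t ^ q = t) ` residue_field N" using mu by blast
  qed
qed

text \<open>By \<open>fermat\<close>, (1 + t)^q - 1 - t^q is small at all q Teichmueller points; as
  a polynomial in t it has degree below q, so interpolation makes its coefficients small. This
  stands in for the knowledge that q is a power of p.\<close>

lemma N_binom_q:
  assumes "0 < i" "i < q" shows "N (of_nat (q choose i)) < 1"
proof -
  define g :: "'a poly" where "g = (\<Sum>j\<in>{0<..<q}. monom (of_nat (q choose j)) j)"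
  have cg: "coeff g j = (if 0 < j \<and> j < q then of_nat (q choose j) else 0)" for j
    unfolding g_def by (simp add: coeff_sum)
  have "degree g \<le> q - 1" by (intro degree_le) (auto simp: cg)
  then have deg: "degree g < card TT" using card_TT q_pos by linarith
  have val: "N (poly g t) < 1" if t: "t \<in> TT" for t
  proof -
    have set: "{..q} = insert 0 (insert q {0<..<q})" using q_pos by auto
    have "(t + 1) ^ q = (\<Sum>j\<le>q. of_nat (q choose j) * t ^ j)" by (simp add: binomial_ring)
    also have "\<dots> = 1 + t ^ q + poly g t" unfolding set g_def using q_pos by (simp add: poly_sum poly_monom)
    finally have "poly g t = (t + 1) ^ q - (t + 1)" using t by (simp add: TT_def)
    then show ?thesis using fermat[of "t + 1"] TT_le1[OF t] by (simp add: N_add_le)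
  qed
  obtain B where B: "0 \<le> B" "B < 1" "\<forall>t\<in>TT. N (poly g t) \<le> B"
    using strict_bound[OF finite_TT, of "poly g" 1] val by auto
  have "N (coeff g i) \<le> B"
    by (rule small_values_small_coeffs[OF finite_TT TT_sep TT_le1 deg]) (use B in auto)
  then show ?thesis using B(2) assms by (simp add: cg)
qed

end

section \<open>Finite extensions of the p-adic numbers\<close>

lemma padic_abs_rat_of_nat:
  assumes "0 < n"
  shows "padic_abs_rat p (of_nat n) = real p powi (- int (multiplicity (int p) (int n)))"
  using assms quotient_of_int[of "int n"] by (simp add: padic_abs_rat_def)

locale ring_hom_fields =
  fixes \<phi> :: "'a::field \<Rightarrow> 'b::field"
  assumes hom: "is_ring_hom \<phi>"
begin

lemma add: "\<phi> (x + y) = \<phi> x + \<phi> y" and mult: "\<phi> (x * y) = \<phi> x * \<phi> y" and one: "\<phi> 1 = 1"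
  using hom unfolding is_ring_hom_def by auto

lemma zero: "\<phi> 0 = 0"
proof -
  have "\<phi> 0 + \<phi> 0 = \<phi> 0 + 0" using add[of 0 0] by (simp only: add_0_left add_0_right)
  then show ?thesis by (simp only: add_left_cancel)
qed

lemma minus: "\<phi> (- x) = - \<phi> x"
  using add[of x "- x"] zero by (simp add: eq_neg_iff_add_eq_0 add.commute)

lemma diff: "\<phi> (x - y) = \<phi> x - \<phi> y"
  using add[of x "- y"] minus by simp

lemma power: "\<phi> (x ^ n) = \<phi> x ^ n"
  by (induction n) (simp_all add: one mult)

lemma sum: "\<phi> (\<Sum>i\<in>S. g i) = (\<Sum>i\<in>S. \<phi> (g i))"
  by (induction S rule: infinite_finite_induct) (simp_all add: zero add)

lemma of_nat: "\<phi> (of_nat n) = of_nat n"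
  by (induction n) (simp_all add: zero one add)

lemma nonzero: "x \<noteq> 0 \<Longrightarrow> \<phi> x \<noteq> 0"
proof
  assume "x \<noteq> 0" "\<phi> x = 0"
  then have "\<phi> (x * inverse x) = 0" by (simp only: mult) simp
  then show False using \<open>x \<noteq> 0\<close> by (simp add: one)
qed

lemma inverse: "\<phi> (inverse x) = inverse (\<phi> x)"
proof (cases "x = 0")
  case False
  then have "\<phi> x * \<phi> (inverse x) = 1" by (simp add: one flip: mult)
  then show ?thesis by (metis inverse_unique)
qed (simp add: zero)

lemma power_int: "\<phi> (x powi n) = \<phi> x powi n"
  by (simp add: power_int_def power inverse)

lemma eq_iff: "\<phi> x = \<phi> y \<longleftrightarrow> x = y"
  using nonzero[of "x - y"] diff[of x y] by auto

end

text \<open>The constant disappears on taking n-th roots: otherwise (x / y)^n would be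
  unbounded.\<close>

lemma real_le_of_power_le:
  fixes x y K :: real
  assumes "0 \<le> x" "0 \<le> y" "\<And>n::nat. x ^ n \<le> K * y ^ n"
  shows "x \<le> y"
proof (rule ccontr)
  assume "\<not> x \<le> y"
  show False
  proof (cases "y = 0")
    case True
    then show ?thesis using assms(3)[of 1] \<open>\<not> x \<le> y\<close> by simp
  next
    case False
    then have "1 < x / y" using assms(2) \<open>\<not> x \<le> y\<close> by simp
    then obtain n where "K < (x / y) ^ n" using real_arch_pow by blast
    then show ?thesis using assms(3)[of n] False assms(2) by (simp add: power_divide field_simps)
  qed
qed

context padic_setting
begin

abbreviation "NQ \<equiv> absQ D"
abbreviation "NF \<equiv> absF D"
abbreviation "NC \<equiv> absC D"
abbreviation "\<pi> \<equiv> unif D"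
abbreviation "p \<equiv> res_char D"

sublocale Q: nonarch NQ
  using padic_field unfolding is_padic_field_def by unfold_locales auto
sublocale F: nonarch NF
  using ext_F unfolding finite_valued_ext_def by unfold_locales auto
sublocale C: nonarch NC
  using ext_C unfolding finite_valued_ext_def by unfold_locales auto

sublocale FQ: valued_ext NQ NF "mapF D"
proof
  show "is_ring_hom (mapF D)" "\<And>x. NF (mapF D x) = NQ x"
    using ext_F unfolding finite_valued_ext_def by auto
  show "\<And>X. abs_cauchy NQ X \<Longrightarrow> \<exists>l. abs_lim NQ X l"
    using Q.complete_of_mcomplete padic_field unfolding is_padic_field_def by blast
qed

lemma vector_space_F: "vector_space (\<lambda>c x. mapF D c * x)"
  by unfold_locales (simp_all add: FQ.hom_add FQ.hom_mult FQ.hom_1 algebra_simps)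

lemma basis_F:
  obtains B where "finite B" "FQ.combs B = UNIV" "module.span (\<lambda>c x. mapF D c * x) B = UNIV"
proof -
  obtain B where B: "finite B" "module.span (\<lambda>c x. mapF D c * x) B = UNIV"
    using ext_F unfolding finite_valued_ext_def by blast
  interpret vector_space "\<lambda>c x. mapF D c * x" by (rule vector_space_F)
  have "FQ.combs B = UNIV" unfolding FQ.combs_def using span_finite[OF B(1)] B(2) by simp
  then show thesis using that B by blast
qed

lemma complete_F: "abs_cauchy NF X \<Longrightarrow> \<exists>l. abs_lim NF X l"
proof -
  assume X: "abs_cauchy NF X"
  obtain B where B: "finite B" "FQ.combs B = UNIV" "module.span (\<lambda>c x. mapF D c * x) B = UNIV"
    by (rule basis_F)
  from FQ.finite_dim[OF B(1)] X show ?thesis unfolding B(2) by blast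
qed

text \<open>An infinite set has \<open>card\<close> 0, but the degree is positive since 1 is not in
  the span of the empty set.\<close>

lemma finite_embeddings: "finite (embeddings D)"
proof (rule ccontr)
  assume "infinite (embeddings D)"
  then have d0: "ext_degree (mapF D) = 0" using card_embeddings by simp
  interpret vector_space "\<lambda>c x. mapF D c * x" by (rule vector_space_F)
  obtain B0 where B0: "finite B0" "FQ.combs B0 = UNIV" "span B0 = UNIV" by (rule basis_F)
  obtain B where "B \<subseteq> UNIV" and B: "independent B" "UNIV \<subseteq> span B" "card B = dim UNIV"
    by (rule basis_exists[of UNIV])
  have "finite B" using independent_span_bound[OF B0(1) B(1)] B0(3) by simp
  moreover have "card B = 0" using B(3) d0 by (simp add: ext_degree_def)
  ultimately have "B = {}" by simp
  then have "(1 :: 'f) \<in> span {}" using B(2) by blast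
  then show False by simp
qed

lemma embD: assumes "\<sigma> \<in> embeddings D" shows "is_ring_hom \<sigma>" "\<And>x. \<sigma> (mapF D x) = mapC D x"
  using assms by (auto simp: embeddings_def)

text \<open>Bounded coordinates make \<sigma> a bounded map; multiplicativity removes the constant
  by passing to powers, and applying the result to the inverse gives the reverse inequality.\<close>

lemma absC_emb:
  assumes s: "\<sigma> \<in> embeddings D"
  shows "NC (\<sigma> x) = NF x"
proof -
  interpret ring_hom_fields \<sigma> using embD[OF s] by unfold_locales
  have NCQ: "NC (mapC D x) = NQ x" for x using ext_C unfolding finite_valued_ext_def by blast
  obtain B where B: "finite B" "FQ.combs B = UNIV" "module.span (\<lambda>c x. mapF D c * x) B = UNIV"
    by (rule basis_F)
  obtain K where K: "0 < K"
    "\<And>x. \<exists>c. x = (\<Sum>b\<in>B. mapF D (c b) * b) \<and> (\<forall>b\<in>B. NQ (c b) \<le> K * NF x)"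
    using FQ.finite_dim[OF B(1)] B(2) by auto
  define m where "m = Max (insert 0 ((\<lambda>b. NC (\<sigma> b)) ` B))"
  have m: "0 \<le> m" "\<And>b. b \<in> B \<Longrightarrow> NC (\<sigma> b) \<le> m" unfolding m_def using B(1) by auto
  have bound: "NC (\<sigma> x) \<le> (K * m) * NF x" for x
  proof -
    obtain c where c: "x = (\<Sum>b\<in>B. mapF D (c b) * b)" "\<forall>b\<in>B. NQ (c b) \<le> K * NF x" using K(2) by blast
    have "\<sigma> x = (\<Sum>b\<in>B. mapC D (c b) * \<sigma> b)"
      by (subst c(1)) (simp add: sum mult embD(2)[OF s])
    also have "NC \<dots> \<le> (K * NF x) * m"
    proof (rule C.N_sum_le)
      show "NC (mapC D (c b) * \<sigma> b) \<le> (K * NF x) * m" if "b \<in> B" for b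
        using c(2) m(2)[OF that] that by (intro C.N_mult_le) (auto simp: NCQ)
    qed (use K(1) m(1) in simp)
    finally show ?thesis by (simp add: mult_ac)
  qed
  have le: "NC (\<sigma> x) \<le> NF x" for x
  proof (rule real_le_of_power_le)
    fix n show "NC (\<sigma> x) ^ n \<le> K * m * NF x ^ n"
      using bound[of "x ^ n"] by (simp add: power C.N_power F.N_power)
  qed auto
  show ?thesis
  proof (cases "x = 0")
    case False
    have "inverse (NC (\<sigma> x)) \<le> inverse (NF x)" using le[of "inverse x"] by (simp add: inverse C.N_inverse F.N_inverse)
    then have "NF x \<le> NC (\<sigma> x)" using False nonzero[OF False] by (simp add: inverse_le_iff_le)
    then show ?thesis using le[of x] by simp
  qed (simp add: zero)
qed

lemma absF_of_nat: "0 < n \<Longrightarrow> NF (of_nat n) = real p powi (- int (multiplicity (int p) (int n)))"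
proof -
  assume n: "0 < n"
  interpret ring_hom_fields "mapF D" using ext_F unfolding finite_valued_ext_def by unfold_locales auto
  have "NF (of_nat n) = NQ (of_nat n)" using FQ.N_hom[of "of_nat n"] by (simp add: of_nat)
  also have "\<dots> = padic_abs_rat p (of_nat n)"
    using padic_field unfolding is_padic_field_def by (metis of_rat_of_nat_eq)
  finally show ?thesis using padic_abs_rat_of_nat[OF n] by simp
qed

lemma p_gt1: "1 < p"
  using prime_res_char prime_gt_1_nat by blast

lemma absF_p: "NF (of_nat p) < 1" "of_nat p \<noteq> (0 :: 'f)"
proof -
  have "\<not> is_unit (int p)" "int p \<noteq> 0" using p_gt1 by auto
  then have "multiplicity (int p) (int p) = 1" using multiplicity_self by blast
  then have "NF (of_nat p) = real p powi (- 1)" using absF_of_nat[of p] p_gt1 by simp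
  then have e: "NF (of_nat p) = inverse (real p)" by (simp add: power_int_minus)
  then show "NF (of_nat p) < 1" using p_gt1 by (simp add: inverse_less_1_iff)
  have "0 < NF (of_nat p)" unfolding e using p_gt1 by simp
  then show "of_nat p \<noteq> (0 :: 'f)" by simp
qed

lemma dvd_of_absF_less1: "NF (of_nat n) < 1 \<Longrightarrow> p dvd n"
proof (cases "n = 0")
  case False
  assume less: "NF (of_nat n) < 1"
  have m: "multiplicity (int p) (int n) \<noteq> 0"
  proof
    assume "multiplicity (int p) (int n) = 0"
    then show False using absF_of_nat[of n] False less by simp
  qed
  have "int p dvd int n"
  proof (rule ccontr)
    assume "\<not> int p dvd int n"
    from not_dvd_imp_multiplicity_0[OF this] m show False by contradiction
  qed
  then show ?thesis by simp
qed simp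

section \<open>The value group of F\<close>

lemma unif_pos: "0 < NF \<pi>" and unif_less1: "NF \<pi> < 1"
proof -
  have u: "{x. NF x < 1} = (\<lambda>y. \<pi> * y) ` int_ring NF" using uniformizer unfolding is_uniformizer_def .
  have "\<pi> \<in> {x. NF x < 1}" unfolding u by (rule image_eqI[of _ _ 1]) (simp_all add: int_ring_def)
  then show "NF \<pi> < 1" by simp
  have "of_nat p \<in> {x. NF x < 1}" using absF_p by simp
  then have "\<pi> \<noteq> 0" using absF_p(2) unfolding u by auto
  then show "0 < NF \<pi>" by simp
qed

lemma unif_nz: "\<pi> \<noteq> 0"
  using unif_pos by auto

lemma unif_divide: "NF x < 1 \<Longrightarrow> \<exists>y. x = \<pi> * y \<and> NF y \<le> 1"
  using uniformizer unfolding is_uniformizer_def by (auto simp: int_ring_def set_eq_iff)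

text \<open>The uniformizer is divided out as long as the absolute value is below 1; a power
  |\<pi>|^n < |x| bounds the number of divisions.\<close>

lemma value_group_nat:
  assumes "x \<noteq> 0" "NF x \<le> 1" shows "\<exists>n. NF x = NF \<pi> ^ n"
proof -
  have "\<exists>m. NF x = NF \<pi> ^ m" if "x \<noteq> 0" "NF x \<le> 1" "NF \<pi> ^ n < NF x" for n x
    using that
  proof (induction n arbitrary: x)
    case (Suc n)
    show ?case
    proof (cases "NF x = 1")
      case True
      then show ?thesis by (intro exI[of _ 0]) simp
    next
      case False
      then obtain y where y: "x = \<pi> * y" "NF y \<le> 1" using unif_divide[of x] Suc.prems by auto
      have "y \<noteq> 0" using y Suc.prems by auto
      moreover have "NF \<pi> ^ n < NF y" using Suc.prems(3) unif_pos by (simp add: y(1) F.N_mult)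
      ultimately obtain m where "NF y = NF \<pi> ^ m" using Suc.IH y(2) by blast
      then show ?thesis by (intro exI[of _ "Suc m"]) (simp add: y(1) F.N_mult)
    qed
  qed simp
  moreover obtain n where "NF \<pi> ^ n < NF x" using real_arch_pow_inv[of "NF x" "NF \<pi>"] assms unif_less1 by auto
  ultimately show ?thesis using assms by blast
qed

lemma powi_inj: "NF \<pi> powi m = NF \<pi> powi n \<longleftrightarrow> m = n"
proof -
  have "NF \<pi> powi n < NF \<pi> powi m" if "m < n" for m n
    using power_int_strict_decreasing[OF that unif_pos unif_less1] .
  then show ?thesis by (metis less_irrefl linorder_less_linear)
qed

lemma ordF: "x \<noteq> 0 \<Longrightarrow> NF x = NF \<pi> powi ordF D x"
proof -
  assume x: "x \<noteq> 0"
  have "\<exists>n. NF x = NF \<pi> powi n"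
  proof (cases "NF x \<le> 1")
    case True
    then obtain n where "NF x = NF \<pi> ^ n" using value_group_nat[OF x] by blast
    then show ?thesis by (intro exI[of _ "int n"]) simp
  next
    case False
    then have "NF (inverse x) \<le> 1" by (simp add: F.N_inverse inverse_le_1_iff)
    then obtain n where "NF (inverse x) = NF \<pi> ^ n" using value_group_nat[of "inverse x"] x by auto
    then have "NF x = inverse (NF \<pi> ^ n)" by (metis F.N_inverse inverse_inverse_eq)
    then show ?thesis by (intro exI[of _ "- int n"]) (simp add: power_int_minus)
  qed
  then have "\<exists>!n. NF x = NF \<pi> powi n" using powi_inj by auto
  from theI'[OF this] show ?thesis unfolding ordF_def .
qed

lemma ordF_eqI: "NF x = NF \<pi> powi n \<Longrightarrow> ordF D x = n"
  using ordF[of x] powi_inj unif_pos by (cases "x = 0") auto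

lemma ordF_mult: "x \<noteq> 0 \<Longrightarrow> y \<noteq> 0 \<Longrightarrow> ordF D (x * y) = ordF D x + ordF D y"
  using ordF[of x] ordF[of y] unif_nz unif_pos by (intro ordF_eqI) (simp add: F.N_mult power_int_add)

lemma ordF_unit: "NF x = 1 \<Longrightarrow> ordF D x = 0"
  by (intro ordF_eqI) simp

lemma absF_ram: "NF (of_nat p) = NF \<pi> ^ ram_index D"
proof -
  obtain n where n: "NF (of_nat p) = NF \<pi> ^ n" using value_group_nat absF_p by (metis less_imp_le)
  then have "ordF D (of_nat p) = int n" by (intro ordF_eqI) simp
  then show ?thesis using n by (simp add: ram_index_def)
qed

text \<open>The logarithm has base |\<pi>| < 1, so every inequality of valuations is reversed; 2
  v(a) - 1 \<le> r becomes |\<pi>|^(r + 1) \<le> |a|^2.\<close>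

lemma valF_facts:
  assumes "0 < valF D a" "valF D a \<le> ereal (real (ram_index D))"
  shows "a \<noteq> 0" "NC a < 1" "NF (of_nat p) \<le> NC a"
    and "valF D a \<le> 1 \<Longrightarrow> NF \<pi> \<le> NC a"
    and "2 * valF D a - 1 \<le> ereal (real r) \<Longrightarrow> NF \<pi> ^ Suc r \<le> NC a * NC a"
proof -
  show a: "a \<noteq> 0" using assms(2) by (auto simp: valF_def)
  then have v: "valF D a = ereal (log (NF \<pi>) (NC a))" and Na: "0 < NC a" by (auto simp: valF_def)
  define l where "l = log (NF \<pi>) (NC a)"
  have Nal: "NC a = NF \<pi> powr l" unfolding l_def using unif_pos unif_less1 Na by simp
  have l: "0 < l" "l \<le> real (ram_index D)" using assms v by (auto simp: l_def)
  have mono: "NF \<pi> powr y \<le> NF \<pi> powr x" if "x \<le> y" for x y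
    using unif_pos unif_less1 that by (simp add: powr_mono')
  show "NC a < 1" unfolding Nal using l(1) unif_pos unif_less1 powr_less_mono'[of "NF \<pi>" 0 l] by simp
  show "NF (of_nat p) \<le> NC a" using mono[OF l(2)] unif_pos unfolding Nal absF_ram by (simp add: powr_realpow)
  show "NF \<pi> \<le> NC a" if "valF D a \<le> 1"
  proof -
    have "l \<le> 1" using that v by (simp add: l_def one_ereal_def)
    then show ?thesis using mono[of l 1] unif_pos unfolding Nal by simp
  qed
  show "NF \<pi> ^ Suc r \<le> NC a * NC a" if "2 * valF D a - 1 \<le> ereal (real r)"
  proof -
    have "2 * valF D a - 1 = ereal (2 * l - 1)" unfolding v l_def by (simp add: one_ereal_def numeral_eq_ereal)
    then have "l + l \<le> real (Suc r)" using that by simp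
    then have "NF \<pi> powr real (Suc r) \<le> NF \<pi> powr (l + l)" by (rule mono)
    then show ?thesis using unif_pos unfolding Nal by (simp only: powr_realpow powr_add)
  qed
qed

end

section \<open>Double cosets in \<open>GL\<^sub>2\<close>\<close>

text \<open>With both meanings of \<open>$\<close> in scope, the parse trees of matrix entries multiply exponentially.\<close>

no_notation fps_nth (infixl "$" 75)

lemma mat2_nth [simp]: "mat2 a b c d $ 1 $ 1 = a" "mat2 a b c d $ 1 $ 2 = b"
  "mat2 a b c d $ 2 $ 1 = c" "mat2 a b c d $ 2 $ 2 = d"
  by (simp_all add: mat2_def)

lemma mat2_eqI: "A $ 1 $ 1 = B $ 1 $ 1 \<Longrightarrow> A $ 1 $ 2 = B $ 1 $ 2 \<Longrightarrow> A $ 2 $ 1 = B $ 2 $ 1 \<Longrightarrow>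
    A $ 2 $ 2 = B $ 2 $ 2 \<Longrightarrow> A = (B :: 'a^2^2)"
  by (simp add: vec_eq_iff forall_2)

lemma mult_nth2: "((A :: 'a::semiring_1^2^2) ** B) $ i $ j = A $ i $ 1 * B $ 1 $ j + A $ i $ 2 * B $ 2 $ j"
  by (simp add: matrix_matrix_mult_def sum_2)

lemma mat1_nth2: "(mat 1 :: 'a::semiring_1^2^2) $ 1 $ 1 = 1" "(mat 1 :: 'a^2^2) $ 1 $ 2 = 0"
  "(mat 1 :: 'a^2^2) $ 2 $ 1 = 0" "(mat 1 :: 'a^2^2) $ 2 $ 2 = 1"
  by (simp_all add: mat_def)

lemma mat2_mult: "mat2 a b c d ** mat2 a' b' c' d'
    = mat2 (a * a' + b * c') (a * b' + b * d') (c * a' + d * c') (c * b' + d * (d' :: 'a::semiring_1))"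
  by (intro mat2_eqI) (simp_all add: mult_nth2)

lemma det_mat2 [simp]: "det (mat2 a b c d) = a * d - b * (c :: 'a::comm_ring_1)"
  by (simp add: det_2)

lemma GL2_det: "g \<in> GL2 \<longleftrightarrow> det g \<noteq> (0 :: 'a::field)"
  by (simp add: GL2_def invertible_det_nz)

lemma matrix_inv_GL2:
  assumes "g \<in> GL2" shows "g ** matrix_inv g = mat 1" "matrix_inv g ** g = mat 1" "matrix_inv g \<in> GL2"
proof -
  obtain h where "g ** h = mat 1" "h ** g = mat 1" using assms unfolding GL2_def invertible_def by blast
  then have "\<exists>h. g ** h = mat 1 \<and> h ** g = mat 1" by blast
  from someI_ex[OF this] show 1: "g ** matrix_inv g = mat 1" "matrix_inv g ** g = mat 1"
    unfolding matrix_inv_def by auto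
  then show "matrix_inv g \<in> GL2" unfolding GL2_def invertible_def by blast
qed

lemma GL2_mult: "g \<in> GL2 \<Longrightarrow> h \<in> GL2 \<Longrightarrow> g ** h \<in> (GL2 :: ('a::field^2^2) set)"
  by (simp add: GL2_det det_mul)

lemma matrix_inv_unique2: "g ** h = mat 1 \<Longrightarrow> matrix_inv g = (h :: 'a::field^2^2)"
proof -
  assume gh: "g ** h = mat 1"
  then have "det g * det h = 1" by (metis det_I det_mul)
  then have g: "g \<in> GL2" by (auto simp: GL2_det)
  have "matrix_inv g = matrix_inv g ** (g ** h)" by (simp add: gh)
  also have "\<dots> = h" by (simp add: matrix_mul_assoc matrix_inv_GL2[OF g])
  finally show ?thesis .
qed

lemma matrix_inv_mult2:
  assumes "g \<in> GL2" "h \<in> GL2" shows "matrix_inv (g ** h) = matrix_inv h ** matrix_inv (g :: 'a::field^2^2)"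
proof (rule matrix_inv_unique2)
  have "g ** h ** (matrix_inv h ** matrix_inv g) = g ** (h ** matrix_inv h) ** matrix_inv g"
    by (simp add: matrix_mul_assoc)
  then show "g ** h ** (matrix_inv h ** matrix_inv g) = mat 1"
    by (simp add: matrix_inv_GL2 assms)
qed

lemma matrix_inv_inv2: "g \<in> GL2 \<Longrightarrow> matrix_inv (matrix_inv g) = (g :: 'a::field^2^2)"
  by (intro matrix_inv_unique2) (simp add: matrix_inv_GL2)

lemma det_matrix_inv: "g \<in> GL2 \<Longrightarrow> det (matrix_inv g) = inverse (det (g :: 'a::field^2^2))"
proof -
  assume "g \<in> GL2"
  then have "det g * det (matrix_inv g) = 1" by (metis det_I det_mul matrix_inv_GL2(1))
  then show ?thesis by (metis inverse_unique)
qed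

lemma matrix_inv_entries:
  assumes "det g \<noteq> (0 :: 'a::field)"
  shows "matrix_inv g = mat2 (g $ 2 $ 2 / det g) (- (g $ 1 $ 2) / det g) (- (g $ 2 $ 1) / det g) (g $ 1 $ 1 / det g)"
    (is "_ = ?h")
proof (rule matrix_inv_unique2)
  have "g ** ?h = mat2 (det g / det g) 0 0 (det g / det g)"
    by (intro mat2_eqI) (simp_all only: mult_nth2 mat2_nth times_divide_eq_right add_divide_distrib[symmetric] det_2,
      simp_all add: mult.commute)
  also have "\<dots> = mat 1" using assms by (intro mat2_eqI) (simp_all add: mat1_nth2)
  finally show "g ** ?h = mat 1" .
qed

lemma center_iff: "z \<in> centerGL2 \<longleftrightarrow> (\<exists>c. c \<noteq> 0 \<and> z = mat2 c 0 0 (c :: 'a::field))"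
proof
  assume z: "z \<in> centerGL2"
  have "mat2 1 1 0 1 \<in> (GL2 :: ('a^2^2) set)" "mat2 1 0 1 1 \<in> (GL2 :: ('a^2^2) set)"
    by (simp_all add: GL2_det)
  then have e: "z ** mat2 1 1 0 1 = mat2 1 1 0 1 ** z" "z ** mat2 1 0 1 1 = mat2 1 0 1 1 ** z"
    using z unfolding centerGL2_def by blast+
  have "z $ 2 $ 1 = 0" using arg_cong[OF e(1), of "\<lambda>A. A $ 1 $ 1"] by (simp add: mult_nth2)
  moreover have "z $ 1 $ 2 = 0" using arg_cong[OF e(2), of "\<lambda>A. A $ 1 $ 1"] by (simp add: mult_nth2)
  moreover have "z $ 1 $ 1 = z $ 2 $ 2" using arg_cong[OF e(1), of "\<lambda>A. A $ 1 $ 2"] by (simp add: mult_nth2 add.commute)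
  ultimately have "z = mat2 (z $ 1 $ 1) 0 0 (z $ 1 $ 1)" by (intro mat2_eqI) simp_all
  moreover have "det z \<noteq> 0" using z unfolding centerGL2_def by (simp add: GL2_det)
  ultimately have "z $ 1 $ 1 \<noteq> 0" by (metis det_mat2 diff_zero mult_zero_left)
  then show "\<exists>c. c \<noteq> 0 \<and> z = mat2 c 0 0 c" using \<open>z = mat2 _ 0 0 _\<close> by blast
next
  assume "\<exists>c. c \<noteq> 0 \<and> z = mat2 c 0 0 c"
  then obtain c where c: "c \<noteq> 0" "z = mat2 c 0 0 c" by blast
  then have "z ** g = g ** z" for g by (intro mat2_eqI) (simp_all add: mult_nth2 mult.commute)
  then show "z \<in> centerGL2" using c by (simp add: centerGL2_def GL2_det)
qed

context padic_setting
begin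

definition bounded_by :: "real \<Rightarrow> 'f^2^2 \<Rightarrow> bool" where
  "bounded_by B g \<longleftrightarrow> NF (g $ 1 $ 1) \<le> B \<and> NF (g $ 1 $ 2) \<le> B \<and> NF (g $ 2 $ 1) \<le> B \<and> NF (g $ 2 $ 2) \<le> B"

lemma bounded_by_mult: "bounded_by A g \<Longrightarrow> bounded_by B h \<Longrightarrow> bounded_by (A * B) (g ** h)"
  unfolding bounded_by_def mult_nth2 by (intro conjI F.N_add_le F.N_mult_le) auto

lemma det_bounded: "bounded_by A g \<Longrightarrow> NF (det g) \<le> A * A"
  unfolding bounded_by_def det_2 by (intro F.N_diff_le F.N_mult_le) auto

lemma maxcompact_iff: "g \<in> maxcompact D \<longleftrightarrow> bounded_by 1 g \<and> NF (det g) = 1"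
proof
  assume "g \<in> maxcompact D"
  then obtain h where h: "bounded_by 1 g" "bounded_by 1 h" "g ** h = mat 1"
    unfolding maxcompact_def bounded_by_def int_ring_def mem_Collect_eq by metis
  have "NF (det g) * NF (det h) = 1" by (metis F.N_1 F.N_mult det_I det_mul h(3))
  moreover have "NF (det g) \<le> 1" "NF (det h) \<le> 1" using det_bounded[OF h(1)] det_bounded[OF h(2)] by auto
  ultimately have "NF (det g) = 1"
    by (metis F.N_ge0 antisym mult_left_le mult.commute)
  then show "bounded_by 1 g \<and> NF (det g) = 1" using h(1) by simp
next
  assume g: "bounded_by 1 g \<and> NF (det g) = 1"
  then have nz: "det g \<noteq> 0" by auto
  define h where "h = matrix_inv g"
  have gh: "g ** h = mat 1" "h ** g = mat 1" unfolding h_def using nz by (simp_all add: matrix_inv_GL2 GL2_det)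
  have "bounded_by 1 h" using g unfolding h_def matrix_inv_entries[OF nz]
    by (simp add: bounded_by_def F.N_divide)
  then have "\<forall>i j. h $ i $ j \<in> int_ring NF" "\<forall>i j. g $ i $ j \<in> int_ring NF"
    using g by (auto simp: forall_2 bounded_by_def int_ring_def)
  then show "g \<in> maxcompact D" unfolding maxcompact_def using gh by blast
qed

text \<open>Here c is the central factor, of which only the absolute value matters. Membership thus
  becomes a condition on entries and determinant.\<close>

lemma KZ_iff: "g \<in> KZ D \<longleftrightarrow> (\<exists>c. c \<noteq> 0 \<and> bounded_by (NF c) g \<and> NF (det g) = NF c * NF c)"
proof
  assume "g \<in> KZ D"
  then obtain h c where h: "bounded_by 1 h" "NF (det h) = 1" "c \<noteq> 0" "g = h ** mat2 c 0 0 c"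
    unfolding KZ_def center_iff maxcompact_iff by auto
  have "bounded_by (1 * NF c) g" unfolding h(4) by (intro bounded_by_mult h) (simp add: bounded_by_def)
  moreover have "NF (det g) = NF c * NF c" unfolding h(4) det_mul by (simp add: F.N_mult h(2))
  ultimately show "\<exists>c. c \<noteq> 0 \<and> bounded_by (NF c) g \<and> NF (det g) = NF c * NF c" using h(3) by auto
next
  assume "\<exists>c. c \<noteq> 0 \<and> bounded_by (NF c) g \<and> NF (det g) = NF c * NF c"
  then obtain c where c: "c \<noteq> 0" "bounded_by (NF c) g" "NF (det g) = NF c * NF c" by blast
  define h where "h = g ** mat2 (1 / c) 0 0 (1 / c)"
  have "bounded_by (NF c * NF (1 / c)) h" unfolding h_def by (intro bounded_by_mult c) (simp add: bounded_by_def)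
  then have "bounded_by 1 h" using c(1) by (simp add: F.N_divide)
  moreover have "NF (det h) = 1" unfolding h_def det_mul using c by (simp add: F.N_mult F.N_divide)
  moreover have "g = h ** mat2 c 0 0 c" unfolding h_def
    using c(1) by (intro mat2_eqI) (simp_all add: mult_nth2)
  ultimately show "g \<in> KZ D" unfolding KZ_def center_iff maxcompact_iff using c(1) by blast
qed

lemma KZ_GL2: "g \<in> KZ D \<Longrightarrow> g \<in> GL2"
proof -
  assume "g \<in> KZ D"
  then obtain c where "c \<noteq> 0" "NF (det g) = NF c * NF c" unfolding KZ_iff by blast
  then have "NF (det g) \<noteq> 0" by simp
  then show ?thesis by (simp add: GL2_det)
qed

lemma KZ_mult: "g \<in> KZ D \<Longrightarrow> h \<in> KZ D \<Longrightarrow> g ** h \<in> KZ D"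
proof -
  assume "g \<in> KZ D" "h \<in> KZ D"
  then obtain c e where c: "c \<noteq> 0" "bounded_by (NF c) g" "NF (det g) = NF c * NF c"
    and e: "e \<noteq> 0" "bounded_by (NF e) h" "NF (det h) = NF e * NF e" unfolding KZ_iff by blast
  have "bounded_by (NF (c * e)) (g ** h)" unfolding F.N_mult by (intro bounded_by_mult c e)
  moreover have "NF (det (g ** h)) = NF (c * e) * NF (c * e)" by (simp add: det_mul F.N_mult c e)
  ultimately show ?thesis unfolding KZ_iff using c(1) e(1) by (intro exI[of _ "c * e"]) simp
qed

lemma KZ_inv: "g \<in> KZ D \<Longrightarrow> matrix_inv g \<in> KZ D"
proof -
  assume g: "g \<in> KZ D"
  then obtain c where c: "c \<noteq> 0" "bounded_by (NF c) g" "NF (det g) = NF c * NF c" unfolding KZ_iff by blast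
  have nz: "det g \<noteq> 0" using KZ_GL2[OF g] by (simp add: GL2_det)
  note inv = matrix_inv_entries[OF nz]
  have "x / (NF c * NF c) \<le> NF (1 / c)" if "x \<le> NF c" for x
    using that c(1) by (simp add: F.N_divide field_simps)
  then have "bounded_by (NF (1 / c)) (matrix_inv g)"
    using c(2) unfolding inv bounded_by_def by (simp add: F.N_divide c(3))
  moreover have "NF (det (matrix_inv g)) = NF (1 / c) * NF (1 / c)"
    using det_matrix_inv[OF KZ_GL2[OF g]] c(3) by (simp add: F.N_inverse F.N_divide divide_inverse)
  ultimately show ?thesis unfolding KZ_iff using c(1) by (intro exI[of _ "1 / c"]) simp
qed

lemma KZ_1: "mat 1 \<in> KZ D"
  unfolding KZ_iff by (intro exI[of _ 1]) (simp add: bounded_by_def mat1_nth2)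

lemma KZ_cancel_left: "\<kappa> \<in> KZ D \<Longrightarrow> \<kappa> ** g \<in> KZ D \<longleftrightarrow> g \<in> KZ D"
proof
  assume k: "\<kappa> \<in> KZ D" and kg: "\<kappa> ** g \<in> KZ D"
  from KZ_mult[OF KZ_inv[OF k] kg] show "g \<in> KZ D" by (simp add: matrix_mul_assoc matrix_inv_GL2 KZ_GL2[OF k])
qed (rule KZ_mult)

section \<open>The double coset of the Hecke operator\<close>

definition DC :: "('f^2^2) set" where
  "DC = {\<kappa>1 ** matrix_inv (alpha D) ** \<kappa>2 | \<kappa>1 \<kappa>2. \<kappa>1 \<in> KZ D \<and> \<kappa>2 \<in> KZ D}"

lemma alpha_inv: "matrix_inv (alpha D) = mat2 1 0 0 (1 / \<pi>)"
  unfolding alpha_def using unif_nz by (subst matrix_inv_entries) simp_all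

lemma alpha_inv_GL2: "matrix_inv (alpha D) \<in> GL2"
  unfolding alpha_inv using unif_nz by (simp add: GL2_det)

lemma DC_mult_left: "\<kappa> \<in> KZ D \<Longrightarrow> x \<in> DC \<Longrightarrow> \<kappa> ** x \<in> DC"
proof -
  assume k: "\<kappa> \<in> KZ D" and "x \<in> DC"
  then obtain k1 k2 where x: "k1 \<in> KZ D" "k2 \<in> KZ D" "x = k1 ** matrix_inv (alpha D) ** k2" unfolding DC_def by blast
  have "\<kappa> ** x = (\<kappa> ** k1) ** matrix_inv (alpha D) ** k2" unfolding x(3) by (simp add: matrix_mul_assoc)
  then show ?thesis unfolding DC_def using x KZ_mult[OF k x(1)] by blast
qed

lemma DC_mult_right: "\<kappa> \<in> KZ D \<Longrightarrow> x \<in> DC \<Longrightarrow> x ** \<kappa> \<in> DC"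
proof -
  assume k: "\<kappa> \<in> KZ D" and "x \<in> DC"
  then obtain k1 k2 where x: "k1 \<in> KZ D" "k2 \<in> KZ D" "x = k1 ** matrix_inv (alpha D) ** k2" unfolding DC_def by blast
  have "x ** \<kappa> = k1 ** matrix_inv (alpha D) ** (k2 ** \<kappa>)" unfolding x(3) by (simp add: matrix_mul_assoc)
  then show ?thesis unfolding DC_def using x KZ_mult[OF x(2) k] by blast
qed

lemma DC_cancel_left: "\<kappa> \<in> KZ D \<Longrightarrow> \<kappa> ** x \<in> DC \<longleftrightarrow> x \<in> DC"
proof
  assume k: "\<kappa> \<in> KZ D" and kx: "\<kappa> ** x \<in> DC"
  from DC_mult_left[OF KZ_inv[OF k] kx] show "x \<in> DC" by (simp add: matrix_mul_assoc matrix_inv_GL2 KZ_GL2[OF k])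
qed (rule DC_mult_left)

lemma DC_cancel_right: "\<kappa> \<in> KZ D \<Longrightarrow> x ** \<kappa> \<in> DC \<longleftrightarrow> x \<in> DC"
proof
  assume k: "\<kappa> \<in> KZ D" and xk: "x ** \<kappa> \<in> DC"
  from DC_mult_right[OF KZ_inv[OF k] xk] show "x \<in> DC" by (simp add: matrix_inv_GL2 KZ_GL2[OF k] flip: matrix_mul_assoc)
qed (rule DC_mult_right)

text \<open>The central factor 1/\<pi> is absorbed into c: scaled by \<pi>, the inverse of \<alpha>
  has integral entries and determinant of order 1, whence the single |\<pi>|.\<close>

lemma DC_shape: "x \<in> DC \<Longrightarrow> \<exists>c. c \<noteq> 0 \<and> bounded_by (NF c) x \<and> NF (det x) = NF c * NF c * NF \<pi>"
proof -
  assume "x \<in> DC"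
  then obtain k1 k2 where k: "k1 \<in> KZ D" "k2 \<in> KZ D" and x: "x = k1 ** matrix_inv (alpha D) ** k2" unfolding DC_def by blast
  obtain c e where c: "c \<noteq> 0" "bounded_by (NF c) k1" "NF (det k1) = NF c * NF c"
    and e: "e \<noteq> 0" "bounded_by (NF e) k2" "NF (det k2) = NF e * NF e" using k unfolding KZ_iff by blast
  have "bounded_by (NF (1 / \<pi>)) (matrix_inv (alpha D))"
    unfolding alpha_inv bounded_by_def using unif_pos unif_less1 by (simp add: F.N_divide)
  then have "bounded_by (NF (c * (1 / \<pi>) * e)) x" unfolding x F.N_mult by (intro bounded_by_mult c e)
  moreover have "NF (det x) = NF (c * (1 / \<pi>) * e) * NF (c * (1 / \<pi>) * e) * NF \<pi>"
    unfolding x det_mul alpha_inv using unif_pos by (simp add: F.N_mult F.N_divide c e)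
  ultimately show ?thesis using c(1) e(1) unif_nz by (intro exI[of _ "c * (1 / \<pi>) * e"]) simp
qed

lemma upper_mem:
  "NF x \<le> 1 \<Longrightarrow> mat2 1 x 0 1 \<in> KZ D" "mat2 0 1 1 0 \<in> KZ D" "c \<noteq> 0 \<Longrightarrow> mat2 c 0 0 c \<in> KZ D"
  unfolding KZ_iff
  by (rule exI[of _ 1], simp add: bounded_by_def) (rule exI[of _ 1], simp add: bounded_by_def,
      rule exI[of _ c], simp add: bounded_by_def F.N_mult)

lemma DC_up: "NF s \<le> 1 \<Longrightarrow> mat2 \<pi> s 0 1 \<in> DC"
proof -
  assume s: "NF s \<le> 1"
  have "mat2 1 s 0 1 ** mat2 \<pi> 0 0 \<pi> \<in> KZ D" using s unif_nz by (intro KZ_mult upper_mem)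
  moreover have "mat2 \<pi> s 0 1 = (mat2 1 s 0 1 ** mat2 \<pi> 0 0 \<pi>) ** matrix_inv (alpha D) ** mat 1"
    unfolding alpha_inv using unif_nz by (simp add: mat2_mult)
  ultimately show ?thesis unfolding DC_def using KZ_1 by blast
qed

lemma DC_down: "NF t \<le> 1 \<Longrightarrow> mat2 (1 / \<pi>) (- t / \<pi>) 0 1 \<in> DC"
proof -
  assume t: "NF t \<le> 1"
  have "mat2 0 1 1 0 ** mat2 1 (- t) 0 1 \<in> KZ D" using t by (intro KZ_mult upper_mem) simp
  moreover have "mat2 (1 / \<pi>) (- t / \<pi>) 0 1 = mat2 0 1 1 0 ** matrix_inv (alpha D) ** (mat2 0 1 1 0 ** mat2 1 (- t) 0 1)"
    unfolding alpha_inv using unif_nz by (simp add: mat2_mult)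
  ultimately show ?thesis unfolding DC_def using upper_mem(2) by blast
qed

lemma powi_le_iff: "NF \<pi> powi m \<le> NF \<pi> powi n \<longleftrightarrow> n \<le> m"
proof -
  have "NF \<pi> powi n < NF \<pi> powi m" if "m < n" for m n
    using power_int_strict_decreasing[OF that unif_pos unif_less1] .
  then show ?thesis by (metis less_le not_le powi_inj)
qed

lemma powi_double: "NF \<pi> powi (m + m) = NF \<pi> powi m * NF \<pi> powi m"
    "NF \<pi> powi (m + m + 1) = NF \<pi> powi m * NF \<pi> powi m * NF \<pi>"
proof -
  show 1: "NF \<pi> powi (m + m) = NF \<pi> powi m * NF \<pi> powi m" by (rule power_int_add) (simp add: unif_nz)
  show "NF \<pi> powi (m + m + 1) = NF \<pi> powi m * NF \<pi> powi m * NF \<pi>"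
    by (subst power_int_add) (simp_all only: 1 power_int_1_right, simp add: unif_nz)
qed

text \<open>With m the order of c, the determinant gives s = 2 m + 1, and the entries \<pi>^s and 1
  leave m = 0 or m = -1: a step away from the root or towards it.\<close>

lemma upper_DC:
  assumes "mat2 (\<pi> powi s) \<beta> 0 1 \<in> DC"
  shows "s = 1 \<and> NF \<beta> \<le> 1 \<or> s = -1 \<and> NF \<beta> \<le> inverse (NF \<pi>)"
proof -
  obtain c where c: "c \<noteq> 0" "bounded_by (NF c) (mat2 (\<pi> powi s) \<beta> 0 1)"
    "NF (det (mat2 (\<pi> powi s) \<beta> 0 1)) = NF c * NF c * NF \<pi>" using DC_shape[OF assms] by blast
  define m where "m = ordF D c"
  have cm: "NF c = NF \<pi> powi m" unfolding m_def by (rule ordF[OF c(1)])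
  have b: "NF \<pi> powi s \<le> NF \<pi> powi m" "NF \<beta> \<le> NF \<pi> powi m" "NF \<pi> powi 0 \<le> NF \<pi> powi m"
    using c(2) by (simp_all add: bounded_by_def F.N_power_int cm)
  have "NF \<pi> powi s = NF \<pi> powi (m + m + 1)"
    unfolding powi_double using c(3) by (simp add: F.N_power_int cm)
  then have s: "s = m + m + 1" by (simp only: powi_inj)
  then have "m = 0 \<or> m = -1" using b(1,3) unfolding powi_le_iff by auto
  then show ?thesis using s b(2) by (auto simp: power_int_minus)
qed

lemma upper_KZ:
  assumes "mat2 (\<pi> powi s) \<beta> 0 1 \<in> KZ D"
  shows "s = 0 \<and> NF \<beta> \<le> 1"
proof -
  obtain c where c: "c \<noteq> 0" "bounded_by (NF c) (mat2 (\<pi> powi s) \<beta> 0 1)"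
    "NF (det (mat2 (\<pi> powi s) \<beta> 0 1)) = NF c * NF c" using assms unfolding KZ_iff by blast
  define m where "m = ordF D c"
  have cm: "NF c = NF \<pi> powi m" unfolding m_def by (rule ordF[OF c(1)])
  have b: "NF \<pi> powi s \<le> NF \<pi> powi m" "NF \<beta> \<le> NF \<pi> powi m" "NF \<pi> powi 0 \<le> NF \<pi> powi m"
    using c(2) by (simp_all add: bounded_by_def F.N_power_int cm)
  have "NF \<pi> powi s = NF \<pi> powi (m + m)"
    unfolding powi_double using c(3) by (simp add: F.N_power_int cm)
  then have s: "s = m + m" by (simp only: powi_inj)
  then have "m = 0" using b(1,3) unfolding powi_le_iff by auto
  then show ?thesis using s b(2) by simp
qed

lemma g0_GL2: "g0 D n \<mu> \<in> GL2"
  using unif_nz by (simp add: g0_def GL2_det)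

lemma g0_inv: "matrix_inv (g0 D n \<mu>) = mat2 (1 / \<pi> ^ n) (- \<mu> / \<pi> ^ n) 0 1"
  unfolding g0_def using unif_nz by (subst matrix_inv_entries) simp_all

lemma g0_inv_g0: "matrix_inv (g0 D n \<mu>) ** g0 D m \<nu> = mat2 (\<pi> powi (int m - int n)) ((\<nu> - \<mu>) / \<pi> ^ n) 0 1"
  unfolding g0_inv unfolding g0_def
  by (simp add: mat2_mult power_int_diff unif_nz diff_divide_distrib)

text \<open>The upper left entry has order exactly -n, so a central factor of order l needs l \<le>
  -n, whereas the determinant gives 2 l = m + 1 - n. These are incompatible.\<close>

lemma g0_inv_g1: "NF \<mu> \<le> 1 \<Longrightarrow> NF \<nu> \<le> 1 \<Longrightarrow> matrix_inv (g0 D n \<mu>) ** g1 D m \<nu> \<notin> KZ D"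
proof
  assume mu: "NF \<mu> \<le> 1" "NF \<nu> \<le> 1" and "matrix_inv (g0 D n \<mu>) ** g1 D m \<nu> \<in> KZ D"
  then obtain c where c: "c \<noteq> 0" "bounded_by (NF c) (matrix_inv (g0 D n \<mu>) ** g1 D m \<nu>)"
    "NF (det (matrix_inv (g0 D n \<mu>) ** g1 D m \<nu>)) = NF c * NF c" unfolding KZ_iff by blast
  define l where "l = ordF D c"
  have cl: "NF c = NF \<pi> powi l" unfolding l_def by (rule ordF[OF c(1)])
  have "NF (\<pi> * (\<mu> * \<nu>)) \<le> NF \<pi> * (1 * 1)" by (intro F.N_mult_le mu order_refl)
  then have "NF (- (\<mu> * (\<pi> * \<nu>))) < NF 1" using unif_less1 by (simp add: mult_ac)
  from F.N_add_eq[OF this] have u: "NF (1 - \<mu> * (\<pi> * \<nu>)) = 1" by simp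
  have "(matrix_inv (g0 D n \<mu>) ** g1 D m \<nu>) $ 1 $ 1 = (1 - \<mu> * (\<pi> * \<nu>)) / \<pi> ^ n"
    unfolding g0_inv g1_def by (simp add: mat2_mult diff_divide_distrib)
  then have "NF ((1 - \<mu> * (\<pi> * \<nu>)) / \<pi> ^ n) \<le> NF c" using c(2) unfolding bounded_by_def by simp
  then have "NF \<pi> powi (- int n) \<le> NF \<pi> powi l"
    unfolding F.N_divide u cl by (simp add: F.N_power power_int_minus divide_inverse)
  then have l: "l \<le> - int n" unfolding powi_le_iff .
  have "det (matrix_inv (g0 D n \<mu>) ** g1 D m \<nu>) = \<pi> ^ (m + 1) / \<pi> ^ n"
    unfolding det_mul det_matrix_inv[OF g0_GL2] by (simp add: g0_def g1_def divide_inverse)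
  then have dt: "NF (det (matrix_inv (g0 D n \<mu>) ** g1 D m \<nu>)) = NF \<pi> ^ (m + 1) / NF \<pi> ^ n"
    by (simp only: F.N_divide F.N_power)
  have "NF \<pi> powi (int (m + 1) - int n) = NF \<pi> powi int (m + 1) / NF \<pi> powi int n"
    by (rule power_int_diff) (simp add: unif_nz)
  also have "\<dots> = NF \<pi> powi (l + l)"
    unfolding powi_double cl[symmetric] c(3)[symmetric] dt by (simp only: power_int_of_nat)
  finally have "NF \<pi> powi (int (m + 1) - int n) = NF \<pi> powi (l + l)" .
  then have "int (m + 1) - int n = l + l" by (simp only: powi_inj)
  then show False using l by simp
qed

end

section \<open>The weight representation and the Hecke operator\<close>

text \<open>Substitution of (X, Y) for the two variables in the form of degree n whose
  dehomogenisation is P.\<close>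

definition hom_form :: "nat \<Rightarrow> 'a::comm_ring_1 poly \<Rightarrow> 'a poly \<Rightarrow> 'a poly \<Rightarrow> 'a poly" where
  "hom_form n P X Y = (\<Sum>j\<le>n. smult (coeff P j) (X ^ (n - j) * Y ^ j))"

lemma smult_sum_right: "smult c (\<Sum>i\<in>S. P i) = (\<Sum>i\<in>S. smult c (P i))"
  by (induction S rule: infinite_finite_induct) (simp_all add: smult_add_right)

lemma hom_form_sum: "hom_form n (\<Sum>i\<in>S. smult (c i) (P i)) X Y = (\<Sum>i\<in>S. smult (c i) (hom_form n (P i) X Y))"
proof -
  have "hom_form n (\<Sum>i\<in>S. smult (c i) (P i)) X Y
      = (\<Sum>j\<le>n. \<Sum>i\<in>S. smult (c i) (smult (coeff (P i) j) (X ^ (n - j) * Y ^ j)))"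
    unfolding hom_form_def by (intro sum.cong refl) (simp add: coeff_sum smult_sum)
  also have "\<dots> = (\<Sum>i\<in>S. \<Sum>j\<le>n. smult (c i) (smult (coeff (P i) j) (X ^ (n - j) * Y ^ j)))"
    by (rule sum.swap)
  finally show ?thesis by (simp add: hom_form_def smult_sum_right)
qed

lemma hom_form_linear_mult:
  assumes "degree P \<le> n"
  shows "hom_form (Suc n) ([:x, y:] * P) X Y = (smult x X + smult y Y) * hom_form n P X Y"
proof -
  have c: "coeff ([:x, y:] * P) j = x * coeff P j + (case j of 0 \<Rightarrow> 0 | Suc i \<Rightarrow> y * coeff P i)" for j
    by (cases j) simp_all
  have "hom_form (Suc n) ([:x, y:] * P) X Y
      = (\<Sum>j\<le>Suc n. smult (x * coeff P j) (X ^ (Suc n - j) * Y ^ j))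
        + (\<Sum>j\<le>Suc n. smult (case j of 0 \<Rightarrow> 0 | Suc i \<Rightarrow> y * coeff P i) (X ^ (Suc n - j) * Y ^ j))"
    unfolding hom_form_def c by (simp only: smult_add_left sum.distrib)
  also have "(\<Sum>j\<le>Suc n. smult (x * coeff P j) (X ^ (Suc n - j) * Y ^ j)) = smult x X * hom_form n P X Y"
  proof -
    have "coeff P (Suc n) = 0" using assms by (simp add: coeff_eq_0)
    then have "(\<Sum>j\<le>Suc n. smult (x * coeff P j) (X ^ (Suc n - j) * Y ^ j))
        = (\<Sum>j\<le>n. smult (x * coeff P j) (X ^ (Suc n - j) * Y ^ j))" by simp
    also have "\<dots> = (\<Sum>j\<le>n. smult x X * smult (coeff P j) (X ^ (n - j) * Y ^ j))"
      by (intro sum.cong refl) (simp add: Suc_diff_le mult.assoc mult.commute[of x])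
    finally show ?thesis by (simp add: hom_form_def sum_distrib_left)
  qed
  also have "(\<Sum>j\<le>Suc n. smult (case j of 0 \<Rightarrow> 0 | Suc i \<Rightarrow> y * coeff P i) (X ^ (Suc n - j) * Y ^ j))
      = (\<Sum>j\<le>n. smult (y * coeff P j) (X ^ (n - j) * Y ^ Suc j))"
    by (subst sum.atMost_Suc_shift) simp
  also have "\<dots> = smult y Y * hom_form n P X Y"
    unfolding hom_form_def sum_distrib_left by (intro sum.cong refl) (simp add: mult_ac)
  finally show ?thesis by (simp add: distrib_right)
qed

lemma degree_linear_power: "degree ([:x, y:] ^ n) \<le> (n :: nat)"
  using degree_power_le[of "[:x, y:]" n] by (simp split: if_splits)

text \<open>Substitution respects products of linear forms; this is what makes \<open>act\<close>
  multiplicative in the matrix.\<close>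

lemma hom_form_linear_powers:
  "hom_form (m + n) ([:x, y:] ^ m * [:u, v:] ^ n) X Y
    = (smult x X + smult y Y) ^ m * (smult u X + smult v (Y :: 'a::comm_ring_1 poly)) ^ n"
proof (induction m)
  case 0
  show ?case
  proof (induction n)
    case 0
    show ?case by (simp add: hom_form_def)
  next
    case (Suc n)
    have "hom_form (Suc n) ([:u, v:] * [:u, v:] ^ n) X Y = (smult u X + smult v Y) * hom_form n ([:u, v:] ^ n) X Y"
      by (rule hom_form_linear_mult) (rule degree_linear_power)
    then show ?case using Suc by simp
  qed
next
  case (Suc m)
  have "degree ([:x, y:] ^ m * [:u, v:] ^ n) \<le> m + n"
    using degree_mult_le[of "[:x, y:] ^ m" "[:u, v:] ^ n"] degree_linear_power[of x y m] degree_linear_power[of u v n]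
    by linarith
  from hom_form_linear_mult[OF this, of x y X Y] Suc show ?case
    by (simp only: power_Suc mult.assoc add_Suc)
qed

lemma degree_hom_form:
  assumes "degree X \<le> 1" "degree Y \<le> 1" shows "degree (hom_form n P X Y) \<le> n"
  unfolding hom_form_def
proof (rule degree_sum_le)
  fix j assume j: "j \<in> {..n}"
  have "degree (X ^ (n - j) * Y ^ j) \<le> degree X * (n - j) + degree Y * j"
    using degree_mult_le[of "X ^ (n - j)" "Y ^ j"] degree_power_le[of X "n - j"] degree_power_le[of Y j] by linarith
  also have "\<dots> \<le> 1 * (n - j) + 1 * j" by (intro add_mono mult_right_mono assms) auto
  finally show "degree (smult (coeff P j) (X ^ (n - j) * Y ^ j)) \<le> n"
    using j degree_smult_le[of "coeff P j"] order_trans by fastforce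
qed simp

text \<open>Since k vanishes off \<sigma>, the tensor product reduces to one space of binary forms.
  The assumption \<open>q_pos\<close> says that the residue field is finite, as an infinite set has
  \<open>card\<close> 0.\<close>

locale weight_setting = padic_setting D
  for D :: "('k::field_char_0, 'f::field, 'c::field) padic_data" +
  fixes k :: "('f \<Rightarrow> 'c) \<Rightarrow> nat" and \<sigma> :: "'f \<Rightarrow> 'c"
  assumes sig: "\<sigma> \<in> embeddings D" and k_other: "\<And>\<tau>. \<tau> \<in> embeddings D \<Longrightarrow> \<tau> \<noteq> \<sigma> \<Longrightarrow> k \<tau> = 0"
    and q_pos: "0 < res_card D"
begin

sublocale R: residual NF "res_card D"
  using q_pos complete_F by unfold_locales (auto simp: res_card_def)

sublocale S: ring_hom_fields \<sigma>
  using embD[OF sig] by unfold_locales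

abbreviation "kk \<equiv> k \<sigma>"
abbreviation "rt \<equiv> root_unif D \<sigma>"

definition ee :: "nat \<Rightarrow> ('f \<Rightarrow> 'c) \<Rightarrow> nat" where "ee m = (\<lambda>\<tau>. if \<tau> = \<sigma> then m else 0)"

lemma ee_inj: "inj ee"
  by (rule injI) (auto simp: ee_def fun_eq_iff split: if_splits)

lemma monomials_eq: "monomials D k = ee ` {..kk}"
proof (intro set_eqI iffI)
  fix i assume i: "i \<in> monomials D k"
  have "i = ee (i \<sigma>)"
  proof
    fix \<tau> show "i \<tau> = ee (i \<sigma>) \<tau>"
      using i k_other[of \<tau>] by (cases "\<tau> \<in> embeddings D") (auto simp: monomials_def ee_def)
  qed
  moreover have "i \<sigma> \<le> kk" using i sig by (auto simp: monomials_def)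
  ultimately show "i \<in> ee ` {..kk}" by blast
next
  fix i assume "i \<in> ee ` {..kk}"
  then show "i \<in> monomials D k" using sig by (auto simp: monomials_def ee_def)
qed

definition toP :: "('f, 'c) weight_vec \<Rightarrow> 'c poly" where
  "toP v = (\<Sum>m\<le>kk. monom (v (ee m)) m)"

lemma coeff_toP: "coeff (toP v) m = (if m \<le> kk then v (ee m) else 0)"
  by (simp add: toP_def coeff_sum)

lemma degree_toP: "degree (toP v) \<le> kk"
  by (intro degree_le) (simp add: coeff_toP)

lemma weight_eqI: "v \<in> weight D k \<Longrightarrow> v' \<in> weight D k \<Longrightarrow> toP v = toP v' \<Longrightarrow> v = v'"
proof
  fix i assume v: "v \<in> weight D k" "v' \<in> weight D k" "toP v = toP v'"
  show "v i = v' i"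
  proof (cases "i \<in> monomials D k")
    case True
    then obtain m where m: "m \<le> kk" "i = ee m" unfolding monomials_eq by auto
    then show ?thesis using arg_cong[OF v(3), of "\<lambda>P. coeff P m"] by (simp add: coeff_toP)
  qed (use v in \<open>simp add: weight_def\<close>)
qed

definition act :: "'f^2^2 \<Rightarrow> 'c poly \<Rightarrow> 'c poly" where
  "act g P = hom_form kk P [:\<sigma> (g $ 1 $ 1), \<sigma> (g $ 2 $ 1):] [:\<sigma> (g $ 1 $ 2), \<sigma> (g $ 2 $ 2):]"

lemma degree_act: "degree (act g P) \<le> kk"
  unfolding act_def by (rule degree_hom_form) simp_all

lemma rho_ee:
  assumes "j \<le> kk"
  shows "rho D k g v (ee j) = rt powi (- ordF D (det g) * int kk) * coeff (act g (toP v)) j"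
proof -
  let ?t = "rt powi (- ordF D (det g) * int kk)"
  let ?X = "[:\<sigma> (g $ 1 $ 1), \<sigma> (g $ 2 $ 1):]" and ?Y = "[:\<sigma> (g $ 1 $ 2), \<sigma> (g $ 2 $ 2):]"
  have prod: "(\<Prod>\<tau>\<in>embeddings D. root_unif D \<tau> powi (- ordF D (det g) * int (k \<tau>)) *
            coeff ([:\<tau> (g $ 1 $ 1), \<tau> (g $ 2 $ 1):] ^ (k \<tau> - ee m \<tau>) *
                   [:\<tau> (g $ 1 $ 2), \<tau> (g $ 2 $ 2):] ^ ee m \<tau>) (ee j \<tau>))
      = ?t * coeff (?X ^ (kk - m) * ?Y ^ m) j" for m
    by (subst prod.remove[OF finite_embeddings sig], subst prod.neutral) (auto simp: ee_def k_other)
  have "rho D k g v (ee j) = (\<Sum>m\<le>kk. v (ee m) * (?t * coeff (?X ^ (kk - m) * ?Y ^ m) j))"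
  proof -
    have mem: "ee j \<in> ee ` {..kk}" using assms by simp
    have inj: "inj_on ee {..kk}" using ee_inj by (rule inj_on_subset) simp
    show ?thesis
      unfolding rho_def monomials_eq if_P[OF mem] sum.reindex[OF inj] o_def prod ..
  qed
  also have "\<dots> = ?t * (\<Sum>m\<le>kk. coeff (toP v) m * coeff (?X ^ (kk - m) * ?Y ^ m) j)"
    unfolding sum_distrib_left by (intro sum.cong refl) (simp add: coeff_toP mult_ac)
  also have "(\<Sum>m\<le>kk. coeff (toP v) m * coeff (?X ^ (kk - m) * ?Y ^ m) j) = coeff (act g (toP v)) j"
    unfolding act_def hom_form_def by (simp add: coeff_sum)
  finally show ?thesis .
qed

lemma toP_rho: "toP (rho D k g v) = smult (rt powi (- ordF D (det g) * int kk)) (act g (toP v))"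
proof (rule poly_eqI)
  fix j show "coeff (toP (rho D k g v)) j = coeff (smult (rt powi (- ordF D (det g) * int kk)) (act g (toP v))) j"
    using degree_act[of g "toP v"] by (cases "j \<le> kk") (auto simp: coeff_toP rho_ee coeff_eq_0)
qed

lemma rho_weight: "rho D k g v \<in> weight D k"
  by (simp add: weight_def rho_def)

lemma act_mult:
  assumes "degree P \<le> kk" shows "act (g ** h) P = act g (act h P)"
proof -
  let ?X = "[:\<sigma> (g $ 1 $ 1), \<sigma> (g $ 2 $ 1):]" and ?Y = "[:\<sigma> (g $ 1 $ 2), \<sigma> (g $ 2 $ 2):]"
  let ?A = "[:\<sigma> (h $ 1 $ 1), \<sigma> (h $ 2 $ 1):]" and ?B = "[:\<sigma> (h $ 1 $ 2), \<sigma> (h $ 2 $ 2):]"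
  have "act g (act h P) = (\<Sum>m\<le>kk. smult (coeff P m) (hom_form kk (?A ^ (kk - m) * ?B ^ m) ?X ?Y))"
    unfolding act_def hom_form_def[of kk P] by (rule hom_form_sum)
  also have "\<dots> = (\<Sum>m\<le>kk. smult (coeff P m) ((smult (\<sigma> (h $ 1 $ 1)) ?X + smult (\<sigma> (h $ 2 $ 1)) ?Y) ^ (kk - m)
      * (smult (\<sigma> (h $ 1 $ 2)) ?X + smult (\<sigma> (h $ 2 $ 2)) ?Y) ^ m))"
  proof (intro sum.cong refl)
    fix m assume "m \<in> {..kk}"
    then have m: "kk - m + m = kk" by simp
    show "smult (coeff P m) (hom_form kk (?A ^ (kk - m) * ?B ^ m) ?X ?Y)
      = smult (coeff P m) ((smult (\<sigma> (h $ 1 $ 1)) ?X + smult (\<sigma> (h $ 2 $ 1)) ?Y) ^ (kk - m)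
      * (smult (\<sigma> (h $ 1 $ 2)) ?X + smult (\<sigma> (h $ 2 $ 2)) ?Y) ^ m)"
      using hom_form_linear_powers[of "kk - m" m "\<sigma> (h $ 1 $ 1)" "\<sigma> (h $ 2 $ 1)" "\<sigma> (h $ 1 $ 2)" "\<sigma> (h $ 2 $ 2)" ?X ?Y]
      unfolding m by simp
  qed
  also have "\<dots> = act (g ** h) P"
    unfolding act_def hom_form_def by (simp add: mult_nth2 S.add S.mult mult.commute)
  finally show ?thesis by simp
qed

lemma rt: "rt * rt = \<sigma> \<pi>" "rt \<noteq> 0"
  using root_unif[OF sig] S.nonzero[OF unif_nz] by (auto simp: power2_eq_square)

lemma toP_scale: "toP (\<lambda>i. c * v i) = smult c (toP v)"
  by (rule poly_eqI) (simp add: coeff_toP)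

lemma act_smult: "act g (smult c P) = smult c (act g P)"
  unfolding act_def hom_form_def by (simp add: smult_sum_right)

lemma rho_mult:
  assumes "g \<in> GL2" "h \<in> GL2" shows "rho D k (g ** h) v = rho D k g (rho D k h v)"
proof (rule weight_eqI[OF rho_weight rho_weight])
  have "- ordF D (det (g ** h)) * int kk = - ordF D (det g) * int kk + - ordF D (det h) * int kk"
    using assms by (simp add: det_mul ordF_mult GL2_det algebra_simps)
  then have e: "rt powi (- ordF D (det (g ** h)) * int kk)
      = rt powi (- ordF D (det g) * int kk) * rt powi (- ordF D (det h) * int kk)"
    by (simp only:) (rule power_int_add, simp add: rt(2))
  show "toP (rho D k (g ** h) v) = toP (rho D k g (rho D k h v))"
    unfolding toP_rho e act_mult[OF degree_toP] act_smult by simp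
qed

lemma rho_scale: "rho D k g (\<lambda>i. c * v i) = (\<lambda>i. c * rho D k g v i)"
  by (rule weight_eqI[OF rho_weight])
    (simp_all add: toP_rho toP_scale act_smult mult.commute, use rho_weight in \<open>simp add: weight_def\<close>)

lemma rho_zero: "rho D k g 0 = 0"
  by (rule ext) (simp add: rho_def zero_fun_def)

lemma rho_1: "v \<in> weight D k \<Longrightarrow> rho D k (mat 1) v = v"
proof (rule weight_eqI[OF rho_weight])
  have "act (mat 1) (toP v) = (\<Sum>m\<le>kk. smult (coeff (toP v) m) ([:1:] ^ (kk - m) * [:0, 1:] ^ m))"
    unfolding act_def hom_form_def by (simp add: mat1_nth2 S.one S.zero)
  also have "\<dots> = (\<Sum>m\<le>kk. monom (coeff (toP v) m) m)"
    by (intro sum.cong refl) (simp add: monom_altdef one_pCons[symmetric])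
  also have "\<dots> = toP v" by (rule poly_as_sum_of_monoms'[OF degree_toP])
  finally show "toP (rho D k (mat 1) v) = toP v"
    unfolding toP_rho by (simp add: ordF_unit)
qed

text \<open>A closed form of \<psi>: on the double coset it is \<rho> itself up to the scalar rt^k,
  so that independence of the decomposition is visible.\<close>

definition psi0 :: "'f^2^2 \<Rightarrow> ('f, 'c) weight_vec \<Rightarrow> ('f, 'c) weight_vec" where
  "psi0 x v = (if x \<in> DC then (\<lambda>i. rt ^ kk * rho D k x v i) else 0)"

lemma U_op_eq:
  assumes "u \<in> weight D k"
  shows "U_op D k u = (\<lambda>i. rt ^ kk * rho D k (matrix_inv (alpha D)) u i)"
proof (rule weight_eqI)
  show "U_op D k u \<in> weight D k" using assms by (simp add: U_op_def weight_def)
  show "(\<lambda>i. rt ^ kk * rho D k (matrix_inv (alpha D)) u i) \<in> weight D k"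
    using rho_weight by (simp add: weight_def)
  have "NF (det (matrix_inv (alpha D))) = NF \<pi> powi (-1)"
    unfolding alpha_inv by (simp add: F.N_inverse power_int_minus divide_inverse)
  then have o: "ordF D (det (matrix_inv (alpha D))) = -1" by (rule ordF_eqI)
  have U: "coeff (toP (U_op D k u)) m = (if m \<le> kk then \<sigma> \<pi> ^ (kk - m) * u (ee m) else 0)" for m
  proof -
    have "(\<Prod>\<tau>\<in>embeddings D. \<tau> \<pi> ^ (k \<tau> - ee m \<tau>)) = \<sigma> \<pi> ^ (kk - m)"
      by (subst prod.remove[OF finite_embeddings sig], subst prod.neutral) (auto simp: ee_def k_other)
    then show ?thesis by (simp add: coeff_toP U_op_def)
  qed
  have a: "act (matrix_inv (alpha D)) (toP u) = (\<Sum>m\<le>kk. monom (coeff (toP u) m * inverse (\<sigma> \<pi>) ^ m) m)"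
    unfolding act_def hom_form_def alpha_inv
  proof (intro sum.cong refl)
    fix m
    have "[:0, inverse (\<sigma> \<pi>):] ^ m = monom (inverse (\<sigma> \<pi>) ^ m) m"
      by (simp add: monom_altdef flip: smult_power)
    then show "smult (coeff (toP u) m) ([:\<sigma> (mat2 1 0 0 (1 / \<pi>) $ 1 $ 1), \<sigma> (mat2 1 0 0 (1 / \<pi>) $ 2 $ 1):] ^ (kk - m) *
        [:\<sigma> (mat2 1 0 0 (1 / \<pi>) $ 1 $ 2), \<sigma> (mat2 1 0 0 (1 / \<pi>) $ 2 $ 2):] ^ m)
      = monom (coeff (toP u) m * inverse (\<sigma> \<pi>) ^ m) m"
      by (simp add: S.one S.zero S.inverse divide_inverse one_pCons[symmetric] smult_monom)
  qed
  show "toP (U_op D k u) = toP (\<lambda>i. rt ^ kk * rho D k (matrix_inv (alpha D)) u i)"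
  proof (rule poly_eqI)
    fix m
    \<comment> \<open>One factor rt^k is the twist of \<rho> at a determinant of order -1, the other
      is the prefactor; together they turn \<pi>^(-m) into \<pi>^(k - m).\<close>
    have "rt ^ kk * rt ^ kk = \<sigma> \<pi> ^ kk" by (simp add: rt(1) flip: power_mult_distrib)
    moreover have "\<sigma> \<pi> ^ kk * inverse (\<sigma> \<pi>) ^ m = \<sigma> \<pi> ^ (kk - m)" if "m \<le> kk"
      using that S.nonzero[OF unif_nz] by (simp add: power_diff divide_inverse power_inverse)
    ultimately show "coeff (toP (U_op D k u)) m = coeff (toP (\<lambda>i. rt ^ kk * rho D k (matrix_inv (alpha D)) u i)) m"
      unfolding U toP_scale toP_rho o a
      by (auto simp: coeff_sum coeff_toP mult_ac)
  qed
qed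

lemma psi_eq: "psi D k = psi0"
  unfolding psi_def DC_def[symmetric]
proof (rule the_equality)
  have ok: "psi0 (\<kappa>1 ** matrix_inv (alpha D) ** \<kappa>2) = rho D k \<kappa>1 \<circ> U_op D k \<circ> rho D k \<kappa>2"
    if k: "\<kappa>1 \<in> KZ D" "\<kappa>2 \<in> KZ D" for \<kappa>1 \<kappa>2
  proof
    fix v
    have m: "\<kappa>1 ** matrix_inv (alpha D) ** \<kappa>2 \<in> DC" using k unfolding DC_def by blast
    have "rho D k (\<kappa>1 ** matrix_inv (alpha D) ** \<kappa>2) v
        = rho D k \<kappa>1 (rho D k (matrix_inv (alpha D)) (rho D k \<kappa>2 v))"
      using k by (simp add: rho_mult KZ_GL2 alpha_inv_GL2 GL2_mult)
    then show "psi0 (\<kappa>1 ** matrix_inv (alpha D) ** \<kappa>2) v = (rho D k \<kappa>1 \<circ> U_op D k \<circ> rho D k \<kappa>2) v"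
      using m by (simp add: psi0_def U_op_eq[OF rho_weight] rho_scale)
  qed
  show "(\<forall>x. x \<notin> DC \<longrightarrow> psi0 x = (\<lambda>v. 0)) \<and> (\<forall>\<kappa>1\<in>KZ D. \<forall>\<kappa>2\<in>KZ D.
      psi0 (\<kappa>1 ** matrix_inv (alpha D) ** \<kappa>2) = rho D k \<kappa>1 \<circ> U_op D k \<circ> rho D k \<kappa>2)"
    using ok by (auto simp: psi0_def fun_eq_iff)
  fix \<psi> assume \<psi>: "(\<forall>x. x \<notin> DC \<longrightarrow> \<psi> x = (\<lambda>v. 0)) \<and> (\<forall>\<kappa>1\<in>KZ D. \<forall>\<kappa>2\<in>KZ D.
      \<psi> (\<kappa>1 ** matrix_inv (alpha D) ** \<kappa>2) = rho D k \<kappa>1 \<circ> U_op D k \<circ> rho D k \<kappa>2)"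
  show "\<psi> = psi0"
  proof
    fix x show "\<psi> x = psi0 x"
    proof (cases "x \<in> DC")
      case True
      then obtain k1 k2 where "k1 \<in> KZ D" "k2 \<in> KZ D" "x = k1 ** matrix_inv (alpha D) ** k2" unfolding DC_def by blast
      then show ?thesis using \<psi> ok by simp
    next
      case False
      then show ?thesis using \<psi> by (auto simp: psi0_def fun_eq_iff)
    qed
  qed
qed

end

lemma sum_fun_apply: "(\<Sum>i\<in>S. F i) h = (\<Sum>i\<in>S. F i h)" for F :: "'i \<Rightarrow> 'a \<Rightarrow> 'b::comm_monoid_add"
  by (induction S rule: infinite_finite_induct) simp_all

section \<open>Cosets, and the Hecke operator at a point of the group\<close>

context weight_setting
begin

definition LC :: "'f^2^2 \<Rightarrow> ('f^2^2) set" where "LC x = (\<lambda>\<kappa>. x ** \<kappa>) ` KZ D"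
definition RC :: "'f^2^2 \<Rightarrow> ('f^2^2) set" where "RC y = (\<lambda>\<kappa>. \<kappa> ** y) ` KZ D"

lemma LC_eq: "\<kappa> \<in> KZ D \<Longrightarrow> LC (x ** \<kappa>) = LC x"
proof (intro set_eqI iffI)
  fix y assume k: "\<kappa> \<in> KZ D"
  { assume "y \<in> LC (x ** \<kappa>)"
    then obtain l where "l \<in> KZ D" "y = x ** (\<kappa> ** l)" unfolding LC_def by (auto simp: matrix_mul_assoc)
    then show "y \<in> LC x" unfolding LC_def using KZ_mult[OF k] by blast }
  { assume "y \<in> LC x"
    then obtain l where l: "l \<in> KZ D" "y = x ** l" unfolding LC_def by blast
    have "y = x ** \<kappa> ** (matrix_inv \<kappa> ** l)"
      unfolding l(2) by (simp add: matrix_inv_GL2 KZ_GL2[OF k] matrix_mul_assoc[symmetric])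
        (simp add: matrix_mul_assoc matrix_inv_GL2 KZ_GL2[OF k])
    then show "y \<in> LC (x ** \<kappa>)" unfolding LC_def using KZ_mult[OF KZ_inv[OF k] l(1)] by blast }
qed

lemma RC_eq: "\<kappa> \<in> KZ D \<Longrightarrow> RC (\<kappa> ** y) = RC y"
proof (intro set_eqI iffI)
  fix x assume k: "\<kappa> \<in> KZ D"
  { assume "x \<in> RC (\<kappa> ** y)"
    then obtain l where "l \<in> KZ D" "x = (l ** \<kappa>) ** y" unfolding RC_def by (auto simp: matrix_mul_assoc)
    then show "x \<in> RC y" unfolding RC_def using KZ_mult[OF _ k] by blast }
  { assume "x \<in> RC y"
    then obtain l where l: "l \<in> KZ D" "x = l ** y" unfolding RC_def by blast
    have "(l ** matrix_inv \<kappa>) ** (\<kappa> ** y) = l ** (matrix_inv \<kappa> ** \<kappa>) ** y" by (simp add: matrix_mul_assoc)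
    then have "x = (l ** matrix_inv \<kappa>) ** (\<kappa> ** y)" unfolding l(2) by (simp add: matrix_inv_GL2 KZ_GL2[OF k])
    then show "x \<in> RC (\<kappa> ** y)" unfolding RC_def using KZ_mult[OF l(1) KZ_inv[OF k]] by blast }
qed

lemma RC_self: "y \<in> RC y"
  unfolding RC_def using KZ_1 by (intro image_eqI[of _ _ "mat 1"]) simp_all

lemma LC_self: "y \<in> LC y"
  unfolding LC_def using KZ_1 by (intro image_eqI[of _ _ "mat 1"]) simp_all

lemma NF_less1: "NF x < 1 \<Longrightarrow> NF x \<le> NF \<pi>"
  using unif_divide[of x] mult_left_le[of "NF _" "NF \<pi>"] by (auto simp: F.N_mult)

text \<open>A coset \<open>\<kappa>\<alpha>KZ\<close> only depends on the reduction of \<open>\<kappa>\<close> modulo the uniformizer.\<close>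

lemma finite_cosets: "finite {LC (\<kappa> ** alpha D) | \<kappa>. \<kappa> \<in> maxcompact D}"
proof -
  define red where "red \<kappa> = (R.rp (\<kappa> $ 1 $ 1), R.rp (\<kappa> $ 1 $ 2), R.rp (\<kappa> $ 2 $ 1), R.rp (\<kappa> $ 2 $ 2))" for \<kappa> :: "'f^2^2"
  define A where "A = {LC (\<kappa> ** alpha D) | \<kappa>. \<kappa> \<in> maxcompact D}"
  have "\<forall>X\<in>A. \<exists>\<kappa>. \<kappa> \<in> maxcompact D \<and> X = LC (\<kappa> ** alpha D)" unfolding A_def by blast
  then obtain c where c: "\<And>X. X \<in> A \<Longrightarrow> c X \<in> maxcompact D" "\<And>X. X \<in> A \<Longrightarrow> X = LC (c X ** alpha D)" by metis
  have eq: "LC (\<kappa> ** alpha D) = LC (\<kappa>' ** alpha D)"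
    if k: "\<kappa> \<in> maxcompact D" "\<kappa>' \<in> maxcompact D" and r: "red \<kappa> = red \<kappa>'" for \<kappa> \<kappa>'
  proof -
    have b: "bounded_by 1 \<kappa>" "NF (det \<kappa>) = 1" "bounded_by 1 \<kappa>'" "NF (det \<kappa>') = 1"
      using k unfolding maxcompact_iff by auto
    have kz: "\<kappa> \<in> KZ D" unfolding KZ_iff using b by (intro exI[of _ 1]) simp
    have inv: "matrix_inv \<kappa> = mat2 (\<kappa> $ 2 $ 2 / det \<kappa>) (- (\<kappa> $ 1 $ 2) / det \<kappa>) (- (\<kappa> $ 2 $ 1) / det \<kappa>) (\<kappa> $ 1 $ 1 / det \<kappa>)"
      using KZ_GL2[OF kz] by (intro matrix_inv_entries) (simp add: GL2_det)
    have binv: "bounded_by 1 (matrix_inv \<kappa>)" using b unfolding inv by (simp add: bounded_by_def F.N_divide)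
    define dl where "dl = matrix_inv \<kappa> ** \<kappa>'"
    have bdl: "bounded_by (1 * 1) dl" unfolding dl_def by (rule bounded_by_mult[OF binv b(3)])
    have small: "NF (\<kappa>' $ 1 $ 1 - \<kappa> $ 1 $ 1) < 1" "NF (\<kappa>' $ 2 $ 1 - \<kappa> $ 2 $ 1) < 1"
      using r b R.rp_eq[of "\<kappa>' $ 1 $ 1" "\<kappa> $ 1 $ 1"] R.rp_eq[of "\<kappa>' $ 2 $ 1" "\<kappa> $ 2 $ 1"]
      by (simp_all add: red_def bounded_by_def)
    have "dl $ 2 $ 1 = matrix_inv \<kappa> $ 2 $ 1 * (\<kappa>' $ 1 $ 1 - \<kappa> $ 1 $ 1) + matrix_inv \<kappa> $ 2 $ 2 * (\<kappa>' $ 2 $ 1 - \<kappa> $ 2 $ 1)"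
      unfolding dl_def mult_nth2 inv by (simp add: algebra_simps)
    moreover have "NF (matrix_inv \<kappa> $ 2 $ 1 * (\<kappa>' $ 1 $ 1 - \<kappa> $ 1 $ 1)) \<le> 1 * NF \<pi>"
      "NF (matrix_inv \<kappa> $ 2 $ 2 * (\<kappa>' $ 2 $ 1 - \<kappa> $ 2 $ 1)) \<le> 1 * NF \<pi>"
      using binv by (intro F.N_mult_le NF_less1 small; simp add: bounded_by_def)+
    ultimately have d21: "NF (dl $ 2 $ 1) \<le> NF \<pi>" by (simp add: F.N_add_le)
    define m where "m = mat2 (dl $ 1 $ 1) (\<pi> * dl $ 1 $ 2) (dl $ 2 $ 1 / \<pi>) (dl $ 2 $ 2)"
    have "NF (\<pi> * dl $ 1 $ 2) \<le> 1 * 1"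
      using bdl unif_less1 by (intro F.N_mult_le) (auto simp: bounded_by_def)
    then have "bounded_by 1 m" using bdl d21 unif_pos by (simp add: m_def bounded_by_def F.N_divide)
    moreover have "det m = det dl" unfolding m_def det_2 using unif_nz by simp
    then have "NF (det m) = 1"
      using b KZ_GL2[OF kz] by (simp add: dl_def det_mul F.N_mult det_matrix_inv F.N_inverse)
    ultimately have mk: "m \<in> KZ D" unfolding KZ_iff by (intro exI[of _ 1]) simp
    have "alpha D ** m = dl ** alpha D"
      unfolding m_def alpha_def using unif_nz by (intro mat2_eqI) (simp_all add: mult_nth2 mult.commute)
    then have "\<kappa> ** alpha D ** m = \<kappa> ** dl ** alpha D" by (metis matrix_mul_assoc)
    also have "\<kappa> ** dl = \<kappa>'" unfolding dl_def by (simp add: matrix_mul_assoc matrix_inv_GL2 KZ_GL2[OF kz])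
    finally show ?thesis using LC_eq[OF mk, of "\<kappa> ** alpha D"] by simp
  qed
  have "inj_on (\<lambda>X. red (c X)) A"
  proof (rule inj_onI)
    fix X Y assume XY: "X \<in> A" "Y \<in> A" "red (c X) = red (c Y)"
    then show "X = Y" using eq[OF c(1)[OF XY(1)] c(1)[OF XY(2)] XY(3)] c(2) by metis
  qed
  moreover have "(\<lambda>X. red (c X)) ` A \<subseteq> R.S \<times> R.S \<times> R.S \<times> R.S"
  proof
    fix y assume "y \<in> (\<lambda>X. red (c X)) ` A"
    then obtain X where X: "X \<in> A" "y = red (c X)" by blast
    have "bounded_by 1 (c X)" using c(1)[OF X(1)] unfolding maxcompact_iff by simp
    then show "y \<in> R.S \<times> R.S \<times> R.S \<times> R.S" unfolding X(2) red_def bounded_by_def by (simp add: R.rp_S)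
  qed
  ultimately have "finite A" by (rule inj_on_finite) (simp add: R.finite_S)
  then show ?thesis unfolding A_def .
qed

text \<open>Inverting puts x into KZ \<alpha> KZ; the central part commutes past \<alpha> and is
  swallowed by the right coset.\<close>

lemma DC_inv_coset:
  assumes "x \<in> GL2" "matrix_inv x \<in> DC"
  shows "\<exists>\<kappa>\<in>maxcompact D. LC x = LC (\<kappa> ** alpha D)"
proof -
  have al: "alpha D \<in> GL2" using unif_nz by (simp add: alpha_def GL2_det)
  obtain k1 k2 where k: "k1 \<in> KZ D" "k2 \<in> KZ D" "matrix_inv x = k1 ** matrix_inv (alpha D) ** k2"
    using assms(2) unfolding DC_def by blast
  have "x = matrix_inv (k1 ** matrix_inv (alpha D) ** k2)" using k(3) matrix_inv_inv2[OF assms(1)] by simp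
  also have "\<dots> = matrix_inv k2 ** (alpha D ** matrix_inv k1)"
    using k(1,2) by (simp add: matrix_inv_mult2 matrix_inv_inv2 GL2_mult KZ_GL2 alpha_inv_GL2 al)
  finally have x: "x = matrix_inv k2 ** alpha D ** matrix_inv k1" by (simp add: matrix_mul_assoc)
  obtain g z where gz: "g \<in> maxcompact D" "z \<in> centerGL2" "matrix_inv k2 = g ** z"
    using KZ_inv[OF k(2)] unfolding KZ_def by blast
  obtain c where cz: "c \<noteq> 0" "z = mat2 c 0 0 c" using gz(2) unfolding center_iff by blast
  have zk: "z \<in> KZ D" unfolding cz(2) by (rule upper_mem(3)[OF cz(1)])
  have "z ** alpha D = alpha D ** z" using gz(2) al unfolding centerGL2_def by blast
  then have "x = g ** alpha D ** (z ** matrix_inv k1)" unfolding x gz(3) by (metis matrix_mul_assoc)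
  then have "LC x = LC (g ** alpha D)" using LC_eq[OF KZ_mult[OF zk KZ_inv[OF k(1)]]] by simp
  then show ?thesis using gz(1) by blast
qed

lemma psi0_left: "\<kappa> \<in> KZ D \<Longrightarrow> x \<in> GL2 \<Longrightarrow> rho D k \<kappa> (psi0 x v) = psi0 (\<kappa> ** x) v"
  by (simp add: psi0_def DC_cancel_left rho_scale rho_mult KZ_GL2 rho_zero)

lemma psi0_right: "\<kappa> \<in> KZ D \<Longrightarrow> x \<in> GL2 \<Longrightarrow> psi0 x (rho D k \<kappa> v) = psi0 (x ** \<kappa>) v"
  by (simp add: psi0_def DC_cancel_right rho_mult KZ_GL2)

lemma elem_zero: "elem D k g 0 = 0"
  by (rule ext) (simp add: elem_def rho_zero)

lemma elem_outside: "g \<in> GL2 \<Longrightarrow> h \<notin> GL2 \<Longrightarrow> elem D k g v h = 0"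
proof -
  assume g: "g \<in> GL2" "h \<notin> GL2"
  then have "h ** g \<notin> KZ D" using KZ_GL2[of "h ** g"] by (auto simp: GL2_det det_mul)
  then show ?thesis by (simp add: elem_def)
qed

text \<open>At h only the coset of the inverse of h g contributes, and equivariance of
  \<open>psi0\<close> cancels the chosen representative. Finiteness of the index set is essential,
  because \<open>sum\<close> over an infinite set is 0.\<close>

lemma hecke_elem_apply:
  assumes g: "g \<in> GL2" and h: "h \<in> GL2"
  shows "hecke_elem D k g v h = psi0 (h ** g) v"
proof -
  define summand where "summand X = (let x = (SOME x. x \<in> X) in elem D k (g ** x) (psi D k (matrix_inv x) v))" for X
  define T where "T = {X \<in> {(\<lambda>\<kappa>. x ** \<kappa>) ` KZ D | x. x \<in> GL2}. summand X \<noteq> 0}"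
  have cs: "{(\<lambda>\<kappa>. x ** \<kappa>) ` KZ D | x. x \<in> GL2} = {LC x | x. x \<in> GL2}" by (simp add: LC_def)
  have rep: "\<exists>\<kappa>\<in>KZ D. (SOME x. x \<in> LC y) = y ** \<kappa>" for y
    using someI[of "\<lambda>x. x \<in> LC y", OF LC_self] unfolding LC_def by blast
  have T_sub: "T \<subseteq> {LC (\<kappa> ** alpha D) | \<kappa>. \<kappa> \<in> maxcompact D}"
  proof
    fix X assume X: "X \<in> T"
    then obtain y where y: "y \<in> GL2" "X = LC y" "summand X \<noteq> 0" unfolding T_def cs by blast
    obtain \<kappa> where kp: "\<kappa> \<in> KZ D" "(SOME x. x \<in> X) = y ** \<kappa>" using rep[of y] y(2) by blast
    have "psi D k (matrix_inv (y ** \<kappa>)) v \<noteq> 0"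
      using y(3) unfolding summand_def kp(2) Let_def using elem_zero by metis
    then have "matrix_inv (y ** \<kappa>) \<in> DC" unfolding psi_eq psi0_def by (auto split: if_splits)
    then obtain \<kappa>' where "\<kappa>' \<in> maxcompact D" "LC (y ** \<kappa>) = LC (\<kappa>' ** alpha D)"
      using DC_inv_coset[OF GL2_mult[OF y(1) KZ_GL2[OF kp(1)]]] by blast
    then show "X \<in> {LC (\<kappa> ** alpha D) | \<kappa>. \<kappa> \<in> maxcompact D}" using LC_eq[OF kp(1)] y(2) by auto
  qed
  have finT: "finite T" by (rule finite_subset[OF T_sub finite_cosets])
  define X0 where "X0 = LC (matrix_inv (h ** g))"
  have hg: "h ** g \<in> GL2" by (rule GL2_mult[OF h g])
  have other: "summand X h = 0" if X: "X \<in> T" "X \<noteq> X0" for X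
  proof -
    obtain y where y: "y \<in> GL2" "X = LC y" using X(1) unfolding T_def cs by blast
    obtain \<kappa> where kp: "\<kappa> \<in> KZ D" "(SOME x. x \<in> X) = y ** \<kappa>" using rep[of y] y(2) by blast
    have "h ** (g ** (y ** \<kappa>)) \<notin> KZ D"
    proof
      assume m: "h ** (g ** (y ** \<kappa>)) \<in> KZ D"
      have "matrix_inv (h ** g) ** (h ** (g ** (y ** \<kappa>))) = (matrix_inv (h ** g) ** (h ** g)) ** (y ** \<kappa>)"
        by (simp only: matrix_mul_assoc)
      also have "\<dots> = y ** \<kappa>" by (simp add: matrix_inv_GL2(2)[OF hg])
      finally have "LC (y ** \<kappa>) = X0" unfolding X0_def using LC_eq[OF m, of "matrix_inv (h ** g)"] by simp
      then show False using X(2) y(2) LC_eq[OF kp(1)] by simp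
    qed
    then show ?thesis unfolding summand_def kp(2) Let_def elem_def by simp
  qed
  have "hecke_elem D k g v h = (\<Sum>X\<in>T. summand X h)"
    unfolding hecke_elem_def Let_def summand_def[unfolded Let_def, symmetric] T_def[symmetric] sum_fun_apply ..
  also have "\<dots> = summand X0 h"
  proof (cases "X0 \<in> T")
    case True
    then have "(\<Sum>X\<in>T. summand X h) = (\<Sum>X\<in>{X0}. summand X h)"
      using other finT by (intro sum.mono_neutral_right) auto
    then show ?thesis by simp
  next
    case False
    then have "summand X0 = 0" using matrix_inv_GL2(3)[OF hg] unfolding T_def cs X0_def by blast
    moreover have "(\<Sum>X\<in>T. summand X h) = 0" using other False by (intro sum.neutral) auto
    ultimately show ?thesis by simp
  qed
  also have "\<dots> = psi0 (h ** g) v"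
  proof -
    obtain \<kappa> where kp: "\<kappa> \<in> KZ D" "(SOME x. x \<in> X0) = matrix_inv (h ** g) ** \<kappa>" using rep unfolding X0_def by blast
    have 1: "h ** (g ** (matrix_inv (h ** g) ** \<kappa>)) = \<kappa>"
      by (simp add: matrix_mul_assoc matrix_inv_GL2[OF hg])
    have 2: "matrix_inv (matrix_inv (h ** g) ** \<kappa>) = matrix_inv \<kappa> ** (h ** g)"
      using matrix_inv_GL2(3)[OF hg] KZ_GL2[OF kp(1)] by (simp add: matrix_inv_mult2 matrix_inv_inv2[OF hg])
    have 3: "\<kappa> ** (matrix_inv \<kappa> ** (h ** g)) = h ** g"
      by (simp add: matrix_mul_assoc matrix_inv_GL2[OF KZ_GL2[OF kp(1)]])
    have "summand X0 h = rho D k \<kappa> (psi0 (matrix_inv \<kappa> ** (h ** g)) v)"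
      unfolding summand_def kp(2) Let_def elem_def 1 2 psi_eq using kp(1) by simp
    also have "\<dots> = psi0 (h ** g) v"
      using psi0_left[OF kp(1) GL2_mult[OF matrix_inv_GL2(3)[OF KZ_GL2[OF kp(1)]] hg], of v] 3 by simp
    finally show ?thesis .
  qed
  finally show ?thesis .
qed


text \<open>Entries bounded by |c| contribute at most |c|^k, which the twist by the determinant, of
  absolute value |c|^2, cancels exactly.\<close>

lemma lattice_rho:
  assumes "\<kappa> \<in> KZ D" "v \<in> weight_lattice D k"
  shows "rho D k \<kappa> v \<in> weight_lattice D k"
proof -
  obtain c where c: "c \<noteq> 0" "bounded_by (NF c) \<kappa>" "NF (det \<kappa>) = NF c * NF c" using assms(1) unfolding KZ_iff by blast
  have vle: "NC (v i) \<le> 1" for i using assms(2) by (simp add: weight_lattice_def int_ring_def)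
  have nz: "det \<kappa> \<noteq> 0" using KZ_GL2[OF assms(1)] by (simp add: GL2_det)
  have Nrt: "NC rt * NC rt = NF \<pi>" using arg_cong[OF rt(1), of NC] absC_emb[OF sig] by (simp add: C.N_mult)
  define o1 where "o1 = ordF D c"
  have od: "ordF D (det \<kappa>) = o1 + o1"
  proof (rule ordF_eqI)
    show "NF (det \<kappa>) = NF \<pi> powi (o1 + o1)" unfolding powi_double c(3) o1_def using ordF[OF c(1)] by simp
  qed
  have "- (o1 + o1) * int kk = - (o1 * int kk) + - (o1 * int kk)" by (simp add: algebra_simps)
  then have "rt powi (- ordF D (det \<kappa>) * int kk) = rt powi (- (o1 * int kk)) * rt powi (- (o1 * int kk))"
    unfolding od by (simp only:) (rule power_int_add, simp add: rt(2))
  also have "\<dots> = \<sigma> \<pi> powi (- (o1 * int kk))" unfolding rt(1)[symmetric] by (simp add: power_int_mult_distrib)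
  also have "NC \<dots> = NF \<pi> powi (- (o1 * int kk))" by (simp add: C.N_power_int absC_emb[OF sig])
  also have "\<dots> = inverse (NF c ^ kk)"
    unfolding ordF[OF c(1), folded o1_def] by (simp add: power_int_minus power_int_mult)
  finally have Nt: "NC (rt powi (- ordF D (det \<kappa>) * int kk)) = inverse (NF c ^ kk)" .
  have lin: "NC (coeff [:\<sigma> x, \<sigma> y:] i) \<le> NF c" if "NF x \<le> NF c" "NF y \<le> NF c" for x y i
    using that by (auto simp: coeff_pCons absC_emb[OF sig] split: nat.split)
  have coeffs: "NC (coeff (act \<kappa> (toP v)) j) \<le> NF c ^ kk" for j
    unfolding act_def hom_form_def coeff_sum
  proof (rule C.N_sum_le)
    fix m assume m: "m \<in> {..kk}"
    let ?X = "[:\<sigma> (\<kappa> $ 1 $ 1), \<sigma> (\<kappa> $ 2 $ 1):]" and ?Y = "[:\<sigma> (\<kappa> $ 1 $ 2), \<sigma> (\<kappa> $ 2 $ 2):]"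
    have "NC (coeff (?X ^ (kk - m) * ?Y ^ m) j) \<le> NF c ^ (kk - m) * NF c ^ m"
      using c(2) by (intro C.coeff_mult_le C.coeff_power_le lin) (auto simp: bounded_by_def)
    then have "NC (coeff (toP v) m * coeff (?X ^ (kk - m) * ?Y ^ m) j) \<le> 1 * (NF c ^ (kk - m) * NF c ^ m)"
      using vle by (intro C.N_mult_le) (auto simp: coeff_toP)
    then show "NC (coeff (smult (coeff (toP v) m) (?X ^ (kk - m) * ?Y ^ m)) j) \<le> NF c ^ kk"
      using m by (simp flip: power_add)
  qed simp
  have "NC (rho D k \<kappa> v i) \<le> 1" for i
  proof (cases "i \<in> monomials D k")
    case True
    then obtain j where j: "j \<le> kk" "i = ee j" unfolding monomials_eq by auto
    have "NC (rho D k \<kappa> v i) \<le> inverse (NF c ^ kk) * NF c ^ kk"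
      unfolding j(2) rho_ee[OF j(1)] by (intro C.N_mult_le coeffs) (simp only: Nt)
    then show ?thesis using c(1) by simp
  next
    case False
    then show ?thesis using rho_weight[of \<kappa> v] by (simp add: weight_def)
  qed
  then show ?thesis using rho_weight by (simp add: weight_lattice_def int_ring_def)
qed

text \<open>The closure properties shared by the weight and its lattice, so that membership in the
  compact induction is proved once for both.\<close>

definition KZ_stable :: "('f, 'c) weight_vec set \<Rightarrow> bool" where
  "KZ_stable W \<longleftrightarrow> W \<subseteq> weight D k \<and> 0 \<in> W \<and> (\<forall>u\<in>W. \<forall>v\<in>W. u + v \<in> W) \<and> (\<forall>\<kappa>\<in>KZ D. \<forall>v\<in>W. rho D k \<kappa> v \<in> W)"

lemma KZ_stable_weight: "KZ_stable (weight D k)"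
  using rho_weight by (auto simp: KZ_stable_def weight_def)

lemma KZ_stable_lattice: "KZ_stable (weight_lattice D k)"
  using lattice_rho C.N_add_le by (auto simp: KZ_stable_def weight_lattice_def weight_def int_ring_def)

lemma KZ_stable_sum: "KZ_stable W \<Longrightarrow> (\<And>i. i \<in> I \<Longrightarrow> F i \<in> W) \<Longrightarrow> (\<Sum>i\<in>I. F i) \<in> W"
  by (induction I rule: infinite_finite_induct) (auto simp: KZ_stable_def)

lemma rho_add: "rho D k g (u + v) = rho D k g u + rho D k g v"
  by (rule ext) (simp add: rho_def distrib_right sum.distrib)

lemma rho_sum: "rho D k g (\<Sum>i\<in>I. F i) = (\<Sum>i\<in>I. rho D k g (F i))"
  by (induction I rule: infinite_finite_induct) (simp_all only: sum.infinite sum.empty sum.insert rho_zero rho_add simp_thms not_False_eq_True)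

lemma elem_sum_c_ind:
  assumes W: "KZ_stable W" and fin: "finite I" and G: "\<And>i. i \<in> I \<Longrightarrow> G i \<in> GL2" and V: "\<And>i. i \<in> I \<Longrightarrow> V i \<in> W"
  shows "(\<Sum>i\<in>I. elem D k (G i) (V i)) \<in> c_ind D k W"
proof -
  define f where "f = (\<Sum>i\<in>I. elem D k (G i) (V i))"
  have f: "f h = (\<Sum>i\<in>I. elem D k (G i) (V i) h)" for h unfolding f_def by (rule sum_fun_apply)
  have "f h \<in> W" for h unfolding f using W V by (intro KZ_stable_sum) (auto simp: elem_def KZ_stable_def)
  moreover have "f h = 0" if "h \<notin> GL2" for h
    unfolding f using elem_outside[OF G that] by (intro sum.neutral) auto
  moreover have "f (\<kappa> ** h) = rho D k \<kappa> (f h)" if "\<kappa> \<in> KZ D" "h \<in> GL2" for \<kappa> h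
  proof -
    have "elem D k (G i) (V i) (\<kappa> ** h) = rho D k \<kappa> (elem D k (G i) (V i) h)" if "i \<in> I" for i
    proof -
      have "\<kappa> ** h ** G i = \<kappa> ** (h ** G i)" by (simp only: matrix_mul_assoc)
      then show ?thesis using \<open>\<kappa> \<in> KZ D\<close> \<open>h \<in> GL2\<close> G[OF that]
        by (simp add: elem_def KZ_cancel_left rho_zero rho_mult KZ_GL2 GL2_mult)
    qed
    then show ?thesis unfolding f rho_sum by (intro sum.cong) auto
  qed
  moreover have "finite {(\<lambda>\<kappa>. \<kappa> ** g) ` KZ D | g. g \<in> GL2 \<and> f g \<noteq> 0}"
  proof (rule finite_subset)
    show "finite ((\<lambda>i. RC (matrix_inv (G i))) ` I)" using fin by simp
    show "{(\<lambda>\<kappa>. \<kappa> ** g) ` KZ D | g. g \<in> GL2 \<and> f g \<noteq> 0} \<subseteq> (\<lambda>i. RC (matrix_inv (G i))) ` I"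
    proof
      fix Y assume "Y \<in> {(\<lambda>\<kappa>. \<kappa> ** g) ` KZ D | g. g \<in> GL2 \<and> f g \<noteq> 0}"
      then obtain g where g: "Y = RC g" "f g \<noteq> 0" by (auto simp: RC_def)
      obtain i where i: "i \<in> I" "elem D k (G i) (V i) g \<noteq> 0" using sum.not_neutral_contains_not_neutral[OF g(2)[unfolded f]] by blast
      then have "g ** G i \<in> KZ D" by (auto simp: elem_def split: if_splits)
      moreover have "(g ** G i) ** matrix_inv (G i) = g"
        by (simp add: matrix_inv_GL2(1)[OF G[OF i(1)]] matrix_mul_assoc[symmetric])
      ultimately have "Y = RC (matrix_inv (G i))" unfolding g(1) using RC_eq[of "g ** G i" "matrix_inv (G i)"] by simp
      then show "Y \<in> (\<lambda>i. RC (matrix_inv (G i))) ` I" using i(1) by blast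
    qed
  qed
  ultimately show ?thesis unfolding f_def[symmetric] c_ind_def by simp
qed

lemma elem_sum_value:
  assumes fin: "finite I" and G: "\<And>i. i \<in> I \<Longrightarrow> G i \<in> GL2" and V: "\<And>i. i \<in> I \<Longrightarrow> V i \<in> weight D k"
    and dis: "\<And>i j. i \<in> I \<Longrightarrow> j \<in> I \<Longrightarrow> matrix_inv (G i) ** G j \<in> KZ D \<Longrightarrow> i = j"
    and i: "i \<in> I" and kp: "\<kappa> \<in> KZ D"
  shows "(\<Sum>i\<in>I. elem D k (G i) (V i)) (\<kappa> ** matrix_inv (G i)) = rho D k \<kappa> (V i)"
proof -
  let ?h = "\<kappa> ** matrix_inv (G i)"
  have "(\<Sum>i\<in>I. elem D k (G i) (V i)) ?h = (\<Sum>j\<in>I. elem D k (G j) (V j) ?h)" by (rule sum_fun_apply)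
  also have "\<dots> = (\<Sum>j\<in>{i}. elem D k (G j) (V j) ?h)"
  proof (rule sum.mono_neutral_right)
    show "\<forall>j\<in>I - {i}. elem D k (G j) (V j) ?h = 0"
    proof
      fix j assume j: "j \<in> I - {i}"
      have "?h ** G j = \<kappa> ** (matrix_inv (G i) ** G j)" by (simp only: matrix_mul_assoc)
      then have "?h ** G j \<notin> KZ D" using dis[OF i, of j] j KZ_cancel_left[OF kp] by auto
      then show "elem D k (G j) (V j) ?h = 0" by (simp add: elem_def)
    qed
  qed (use fin i in auto)
  also have "\<dots> = rho D k \<kappa> (V i)"
  proof -
    have "?h ** G i = \<kappa> ** (matrix_inv (G i) ** G i)" by (simp only: matrix_mul_assoc)
    then have "?h ** G i = \<kappa>" by (simp add: matrix_inv_GL2(2)[OF G[OF i]])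
    then show ?thesis using kp by (simp add: elem_def)
  qed
  finally show ?thesis .
qed

text \<open>Distinct cosets and nonzero values identify the support of the sum with I, so that the
  sum in \<open>hecke\<close> can be reindexed by I; the representatives chosen there cancel by
  \<open>psi0_right\<close>.\<close>

lemma hecke_elem_sum:
  assumes fin: "finite I" and G: "\<And>i. i \<in> I \<Longrightarrow> G i \<in> GL2" and V: "\<And>i. i \<in> I \<Longrightarrow> V i \<in> weight D k"
    and V0: "\<And>i. i \<in> I \<Longrightarrow> V i \<noteq> 0"
    and dis: "\<And>i j. i \<in> I \<Longrightarrow> j \<in> I \<Longrightarrow> matrix_inv (G i) ** G j \<in> KZ D \<Longrightarrow> i = j"
    and h: "h \<in> GL2"
  shows "hecke D k (\<Sum>i\<in>I. elem D k (G i) (V i)) h = (\<Sum>i\<in>I. psi0 (h ** G i) (V i))"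
proof -
  define f where "f = (\<Sum>i\<in>I. elem D k (G i) (V i))"
  have val: "f (\<kappa> ** matrix_inv (G i)) = rho D k \<kappa> (V i)" if "i \<in> I" "\<kappa> \<in> KZ D" for i \<kappa>
    unfolding f_def by (rule elem_sum_value[OF fin G V dis that])
  have val1: "f (matrix_inv (G i)) = V i" if "i \<in> I" for i
    using val[OF that KZ_1] rho_1[OF V[OF that]] by simp
  define YY where "YY i = RC (matrix_inv (G i))" for i
  have supp: "{(\<lambda>\<kappa>. \<kappa> ** g) ` KZ D | g. g \<in> GL2 \<and> f g \<noteq> 0} = YY ` I"
  proof (intro set_eqI iffI)
    fix Y assume "Y \<in> {(\<lambda>\<kappa>. \<kappa> ** g) ` KZ D | g. g \<in> GL2 \<and> f g \<noteq> 0}"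
    then obtain g where g: "Y = RC g" "f g \<noteq> 0" by (auto simp: RC_def)
    have "(\<Sum>i\<in>I. elem D k (G i) (V i) g) \<noteq> 0" using g(2) unfolding f_def sum_fun_apply .
    then obtain i where i: "i \<in> I" "elem D k (G i) (V i) g \<noteq> 0"
      using sum.not_neutral_contains_not_neutral by blast
    then have "g ** G i \<in> KZ D" by (auto simp: elem_def split: if_splits)
    moreover have "(g ** G i) ** matrix_inv (G i) = g"
      by (simp add: matrix_inv_GL2(1)[OF G[OF i(1)]] matrix_mul_assoc[symmetric])
    ultimately have "Y = YY i" unfolding g(1) YY_def using RC_eq[of "g ** G i" "matrix_inv (G i)"] by simp
    then show "Y \<in> YY ` I" using i(1) by blast
  next
    fix Y assume "Y \<in> YY ` I"
    then obtain i where i: "i \<in> I" "Y = RC (matrix_inv (G i))" by (auto simp: YY_def)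
    then show "Y \<in> {(\<lambda>\<kappa>. \<kappa> ** g) ` KZ D | g. g \<in> GL2 \<and> f g \<noteq> 0}"
      using val1[OF i(1)] V0[OF i(1)] matrix_inv_GL2(3)[OF G[OF i(1)]] by (auto simp: RC_def)
  qed
  have inj: "inj_on YY I"
  proof (rule inj_onI)
    fix i j assume ij: "i \<in> I" "j \<in> I" "YY i = YY j"
    then have "matrix_inv (G i) \<in> RC (matrix_inv (G j))" using RC_self unfolding YY_def by blast
    then obtain \<kappa> where kp: "\<kappa> \<in> KZ D" "matrix_inv (G i) = \<kappa> ** matrix_inv (G j)" unfolding RC_def by blast
    have "matrix_inv (G i) ** G j = \<kappa>"
      unfolding kp(2) by (simp add: matrix_inv_GL2(2)[OF G[OF ij(2)]] matrix_mul_assoc[symmetric])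
    then show "i = j" using dis[OF ij(1,2)] kp(1) by simp
  qed
  have each: "hecke_elem D k (matrix_inv (SOME y. y \<in> YY i)) (f (SOME y. y \<in> YY i)) h = psi0 (h ** G i) (V i)"
    if i: "i \<in> I" for i
  proof -
    have "(SOME y. y \<in> YY i) \<in> YY i" unfolding YY_def by (rule someI[where P = "\<lambda>y. y \<in> RC (matrix_inv (G i))", OF RC_self])
    then obtain \<kappa> where kp: "\<kappa> \<in> KZ D" "(SOME y. y \<in> YY i) = \<kappa> ** matrix_inv (G i)" unfolding YY_def RC_def by blast
    have inv: "matrix_inv (\<kappa> ** matrix_inv (G i)) = G i ** matrix_inv \<kappa>"
      using KZ_GL2[OF kp(1)] matrix_inv_GL2(3)[OF G[OF i]] by (simp add: matrix_inv_mult2 matrix_inv_inv2[OF G[OF i]])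
    have g2: "G i ** matrix_inv \<kappa> \<in> GL2" by (intro GL2_mult G[OF i] matrix_inv_GL2(3) KZ_GL2 kp(1))
    have e: "h ** (G i ** matrix_inv \<kappa>) ** \<kappa> = h ** G i ** (matrix_inv \<kappa> ** \<kappa>)" by (simp only: matrix_mul_assoc)
    have "hecke_elem D k (matrix_inv (SOME y. y \<in> YY i)) (f (SOME y. y \<in> YY i)) h
        = psi0 (h ** (G i ** matrix_inv \<kappa>)) (rho D k \<kappa> (V i))"
      unfolding kp(2) inv val[OF i kp(1)] by (rule hecke_elem_apply[OF g2 h])
    also have "\<dots> = psi0 (h ** G i) (V i)"
      unfolding psi0_right[OF kp(1) GL2_mult[OF h g2]] e by (simp add: matrix_inv_GL2(2)[OF KZ_GL2[OF kp(1)]])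
    finally show ?thesis .
  qed
  have "hecke D k f h = (\<Sum>i\<in>I. hecke_elem D k (matrix_inv (SOME y. y \<in> YY i)) (f (SOME y. y \<in> YY i)) h)"
    unfolding hecke_def supp Let_def sum_fun_apply sum.reindex[OF inj] o_def ..
  also have "\<dots> = (\<Sum>i\<in>I. psi0 (h ** G i) (V i))" using each by (intro sum.cong) auto
  finally show ?thesis unfolding f_def .
qed

end

section \<open>From the tree to the compact induction\<close>

context weight_setting
begin

lemma teich_range: "teichmueller D ` residue_field NF = R.TT"
  using R.teich_image by (simp add: teichmueller_def)

text \<open>A vertex is addressed by the word of its Teichmueller digits, the most significant power of
  the uniformizer first, so that the neighbours of \<open>w\<close> further out are the words \<open>s # w\<close>.\<close>

primrec digit_sum :: "'f list \<Rightarrow> 'f" where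
  "digit_sum [] = 0"
| "digit_sum (t # w) = digit_sum w + \<pi> ^ length w * t"

lemma digit_sum_rev_upt: "digit_sum (map g (rev [0..<n])) = (\<Sum>i<n. \<pi> ^ i * g i)"
  by (induction n) simp_all

lemma digits_eq: "digits D n = digit_sum ` {w \<in> lists R.TT. length w = n}"
proof (intro set_eqI iffI)
  fix x assume "x \<in> digits D n"
  then obtain \<mu> where mu: "x = (\<Sum>i<n. \<pi> ^ i * teichmueller D (\<mu> i))" "\<forall>i<n. \<mu> i \<in> residue_field NF"
    unfolding digits_def by blast
  let ?w = "map (\<lambda>i. teichmueller D (\<mu> i)) (rev [0..<n])"
  have "set ?w \<subseteq> R.TT" using mu(2) teich_range by auto
  then have "?w \<in> {w \<in> lists R.TT. length w = n}" by (simp add: in_lists_conv_set subset_iff)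
  moreover have "x = digit_sum ?w" unfolding mu(1) digit_sum_rev_upt ..
  ultimately show "x \<in> digit_sum ` {w \<in> lists R.TT. length w = n}" by (rule rev_image_eqI)
next
  fix x assume "x \<in> digit_sum ` {w \<in> lists R.TT. length w = n}"
  then obtain w where w: "w \<in> lists R.TT" "length w = n" "x = digit_sum w" by blast
  have "\<forall>i. \<exists>m. i < n \<longrightarrow> m \<in> residue_field NF \<and> teichmueller D m = rev w ! i"
  proof
    fix i
    have "rev w ! i \<in> R.TT" if "i < n" using that w(1,2) nth_mem[of i "rev w"] by (auto simp: in_lists_conv_set)
    then show "\<exists>m. i < n \<longrightarrow> m \<in> residue_field NF \<and> teichmueller D m = rev w ! i"
      unfolding teich_range[symmetric] by (metis imageE)
  qed
  then obtain \<mu> where mu: "\<forall>i. i < n \<longrightarrow> \<mu> i \<in> residue_field NF \<and> teichmueller D (\<mu> i) = rev w ! i"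
    using choice[of "\<lambda>i m. i < n \<longrightarrow> m \<in> residue_field NF \<and> teichmueller D m = rev w ! i"] by blast
  have "map ((!) (rev w)) [0..<n] = rev w" using map_nth[of "rev w"] w(2) by simp
  then have "w = map ((!) (rev w)) (rev [0..<n])" by (metis rev_map rev_rev_ident)
  then have "x = (\<Sum>i<n. \<pi> ^ i * rev w ! i)" unfolding w(3) using digit_sum_rev_upt[of "(!) (rev w)" n] by simp
  also have "\<dots> = (\<Sum>i<n. \<pi> ^ i * teichmueller D (\<mu> i))" using mu by (intro sum.cong) simp_all
  finally show "x \<in> digits D n" unfolding digits_def using mu by blast
qed

lemma digit_sum_le1: "w \<in> lists R.TT \<Longrightarrow> NF (digit_sum w) \<le> 1"
proof (induction w)
  case (Cons t w)
  have "NF (\<pi> ^ length w * t) \<le> 1 * 1"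
    using Cons.prems R.TT_le1[of t] unif_less1 by (intro F.N_mult_le) (auto simp: F.N_power power_le_one)
  then show ?case using Cons by (simp add: F.N_add_le)
qed simp

lemma digit_sum_append: "u @ w \<in> lists R.TT \<Longrightarrow> NF (digit_sum (u @ w) - digit_sum w) \<le> NF \<pi> ^ length w"
proof (induction u)
  case (Cons t u)
  have "NF (\<pi> ^ length (u @ w) * t) \<le> NF \<pi> ^ length w * 1"
    using Cons.prems R.TT_le1[of t] unif_less1 unif_pos
    by (intro F.N_mult_le) (auto simp: F.N_power intro!: power_decreasing)
  moreover have "NF (digit_sum (u @ w) - digit_sum w) \<le> NF \<pi> ^ length w" using Cons by simp
  moreover have "digit_sum ((t # u) @ w) - digit_sum w = (digit_sum (u @ w) - digit_sum w) + \<pi> ^ length (u @ w) * t" by simp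
  ultimately show ?case by (simp only: mult_1_right F.N_add_le)
qed simp

lemma digit_sum_inj:
  assumes "length w = length w'" "w \<in> lists R.TT" "w' \<in> lists R.TT" "NF (digit_sum w' - digit_sum w) \<le> NF \<pi> ^ length w"
  shows "w = w'"
  using assms
proof (induction w w' rule: list_induct2)
  case (Cons t w t' w')
  have e: "digit_sum (t' # w') - digit_sum (t # w) = (digit_sum w' - digit_sum w) + \<pi> ^ length w * (t' - t)"
    using Cons.hyps by (simp add: algebra_simps)
  have T: "t \<in> R.TT" "t' \<in> R.TT" using Cons.prems by auto
  have small: "NF (digit_sum (t' # w') - digit_sum (t # w)) \<le> NF \<pi> * NF \<pi> ^ length w" using Cons.prems by simp
  also have le: "\<dots> \<le> NF \<pi> ^ length w" using unif_less1 by (simp add: mult_left_le_one_le)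
  finally have s1: "NF (digit_sum (t' # w') - digit_sum (t # w)) \<le> NF \<pi> ^ length w" .
  have "NF (\<pi> ^ length w * (t' - t)) \<le> NF \<pi> ^ length w * 1"
    using T by (intro F.N_mult_le F.N_diff_le R.TT_le1) (simp_all add: F.N_power)
  then have "NF ((digit_sum (t' # w') - digit_sum (t # w)) - \<pi> ^ length w * (t' - t)) \<le> NF \<pi> ^ length w"
    using s1 by (intro F.N_diff_le[OF s1]) simp
  then have "NF (digit_sum w' - digit_sum w) \<le> NF \<pi> ^ length w" unfolding e by simp
  then have ww: "w = w'" using Cons by auto
  then have "NF \<pi> ^ length w * NF (t' - t) \<le> NF \<pi> ^ length w * NF \<pi>"
    using small unfolding e by (simp add: F.N_mult F.N_power mult.commute)
  then have "NF (t' - t) < 1" using unif_pos unif_less1 by simp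
  then have "t' = t" using R.TT_sep[OF T(2,1)] by fastforce
  then show ?case using ww by simp
qed simp

text \<open>Digit sums that agree modulo \<pi>^(length w) share their low digits, and these sit at
  the end of the list.\<close>

lemma digit_sum_suffix:
  assumes "w \<in> lists R.TT" "w' \<in> lists R.TT" "length w \<le> length w'" "NF (digit_sum w' - digit_sum w) \<le> NF \<pi> ^ length w"
  shows "w' = take (length w' - length w) w' @ w"
proof -
  define u z where "u = take (length w' - length w) w'" and "z = drop (length w' - length w) w'"
  have uz: "w' = u @ z" "length z = length w" using assms(3) by (simp_all add: u_def z_def)
  have zT: "z \<in> lists R.TT" using assms(2) unfolding uz(1) by simp
  have "NF (digit_sum w' - digit_sum z) \<le> NF \<pi> ^ length w" using digit_sum_append[of u z] assms(2) uz by simp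
  from F.N_diff_le[OF assms(4) this] have "NF (digit_sum z - digit_sum w) \<le> NF \<pi> ^ length w" by simp
  then have "w = z" using uz(2) assms(1) zT by (intro digit_sum_inj) simp_all
  then show ?thesis using uz(1) by (simp add: u_def)
qed

section \<open>Vertices and adjacency\<close>

definition vertex :: "'f list \<Rightarrow> 'f^2^2" where
  "vertex w = g0 D (length w) (digit_sum w)"

lemma vertex_GL2: "vertex w \<in> GL2"
  unfolding vertex_def by (rule g0_GL2)

lemma vertex_inv: "matrix_inv (vertex w) ** vertex w'
    = mat2 (\<pi> powi (int (length w') - int (length w))) ((digit_sum w' - digit_sum w) / \<pi> ^ length w) 0 1"
  unfolding vertex_def by (rule g0_inv_g0)

lemma vertex_distinct:
  assumes w: "w \<in> lists R.TT" "w' \<in> lists R.TT" and "matrix_inv (vertex w) ** vertex w' \<in> KZ D"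
  shows "w = w'"
proof -
  have "length w = length w'" "NF ((digit_sum w' - digit_sum w) / \<pi> ^ length w) \<le> 1"
    using upper_KZ[OF assms(3)[unfolded vertex_inv]] by auto
  then show ?thesis using w unif_pos by (intro digit_sum_inj) (simp_all add: F.N_divide F.N_power)
qed

text \<open>By \<open>upper_DC\<close> the lengths differ by one and the digit sums agree to the
  smaller length, so the shorter word is a suffix of the longer.\<close>

lemma vertex_neighbour:
  assumes w: "w \<in> lists R.TT" "w' \<in> lists R.TT" and "matrix_inv (vertex w) ** vertex w' \<in> DC"
  shows "(\<exists>s\<in>R.TT. w' = s # w) \<or> (\<exists>t. w = t # w')"
proof -
  have one: "\<exists>s. u = [s]" if "length u = 1" for u :: "'f list" using that by (cases u) auto
  from upper_DC[OF assms(3)[unfolded vertex_inv]] show ?thesis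
  proof
    assume a: "int (length w') - int (length w) = 1 \<and> NF ((digit_sum w' - digit_sum w) / \<pi> ^ length w) \<le> 1"
    then have l: "length w' = Suc (length w)" by linarith
    have "NF (digit_sum w' - digit_sum w) \<le> NF \<pi> ^ length w" using a unif_pos by (simp add: F.N_divide F.N_power)
    then have e: "w' = take (length w' - length w) w' @ w" using l by (intro digit_sum_suffix w) simp_all
    obtain s where "take (length w' - length w) w' = [s]" using one[of "take (length w' - length w) w'"] l by auto
    then have "w' = s # w" using e by simp
    then show ?thesis using w(2) by auto
  next
    assume a: "int (length w') - int (length w) = -1 \<and> NF ((digit_sum w' - digit_sum w) / \<pi> ^ length w) \<le> inverse (NF \<pi>)"
    then have l: "length w = Suc (length w')" by linarith
    have "NF (digit_sum w' - digit_sum w) \<le> inverse (NF \<pi>) * NF \<pi> ^ length w"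
      using a unif_pos by (simp add: F.N_divide F.N_power divide_le_eq)
    then have "NF (digit_sum w - digit_sum w') \<le> NF \<pi> ^ length w'"
      using unif_pos unif_nz l F.N_minus_commute[of "digit_sum w" "digit_sum w'"] by (simp flip: mult.assoc)
    then have e: "w = take (length w - length w') w @ w'" using l by (intro digit_sum_suffix w) simp_all
    obtain s where "take (length w - length w') w = [s]" using one[of "take (length w - length w') w"] l by auto
    then have "w = s # w'" using e by simp
    then show ?thesis by blast
  qed
qed

lemma vertex_up: "matrix_inv (vertex w) ** vertex (s # w) = mat2 \<pi> s 0 1"
  unfolding vertex_inv using unif_nz by simp

lemma vertex_down: "matrix_inv (vertex (t # w)) ** vertex w = mat2 (1 / \<pi>) (- t / \<pi>) 0 1"
  unfolding vertex_inv using unif_nz by (simp add: power_int_minus inverse_eq_divide)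

section \<open>The Hecke kernel between neighbouring vertices\<close>

lemma toP_add: "toP (u + v) = toP u + toP v"
  by (rule poly_eqI) (simp add: coeff_toP)

lemma toP_zero: "toP 0 = 0"
  by (rule poly_eqI) (simp add: coeff_toP)

lemma toP_sum: "toP (\<Sum>i\<in>I. F i) = (\<Sum>i\<in>I. toP (F i))"
  by (induction I rule: infinite_finite_induct)
    (simp_all only: sum.infinite sum.empty sum.insert toP_zero toP_add simp_thms not_False_eq_True)

lemma psi0_zero: "psi0 x 0 = 0"
  by (rule ext) (simp add: psi0_def rho_zero)

text \<open>The determinant has order 1, so the twist cancels the scalar of \<open>psi0\<close>; the
  remaining substitution is the summand of T for the child with digit s.\<close>

lemma toP_psi0_up:
  assumes "NF s \<le> 1"
  shows "toP (psi0 (mat2 \<pi> s 0 1) v)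
    = (\<Sum>i\<le>kk. smult (coeff (toP v) i * \<sigma> \<pi> ^ (kk - i)) ([:\<sigma> s, 1:] ^ i))"
proof -
  have "ordF D (det (mat2 \<pi> s 0 1)) = 1" by (intro ordF_eqI) simp
  then have "toP (psi0 (mat2 \<pi> s 0 1) v) = smult (rt ^ kk * rt powi (- int kk)) (act (mat2 \<pi> s 0 1) (toP v))"
    using DC_up[OF assms] by (simp add: psi0_def toP_scale toP_rho)
  also have "rt ^ kk * rt powi (- int kk) = 1" using rt(2) by (simp add: power_int_minus)
  finally have "toP (psi0 (mat2 \<pi> s 0 1) v) = act (mat2 \<pi> s 0 1) (toP v)" by simp
  also have "\<dots> = (\<Sum>i\<le>kk. smult (coeff (toP v) i * \<sigma> \<pi> ^ (kk - i)) ([:\<sigma> s, 1:] ^ i))"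
    unfolding act_def hom_form_def
    by (intro sum.cong refl) (simp add: S.zero S.one poly_const_pow)
  finally show ?thesis .
qed

text \<open>The determinant has order -1, so the scalars multiply to \<sigma>(\<pi>)^k. This clears
  the denominators and leaves the substitution y -> \<omega> y - t.\<close>

lemma toP_psi0_down:
  assumes "NF t \<le> 1"
  shows "toP (psi0 (mat2 (1 / \<pi>) (- t / \<pi>) 0 1) v) = pcompose (toP v) [:- \<sigma> t, \<sigma> \<pi>:]"
proof -
  let ?g = "mat2 (1 / \<pi>) (- t / \<pi>) 0 1"
  have nz: "\<sigma> \<pi> \<noteq> 0" by (rule S.nonzero[OF unif_nz])
  have "ordF D (det ?g) = - 1" by (intro ordF_eqI) (simp add: F.N_divide power_int_minus inverse_eq_divide)
  then have "toP (psi0 ?g v) = smult (rt ^ kk * rt ^ kk) (act ?g (toP v))"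
    using DC_down[OF assms] by (simp add: psi0_def toP_scale toP_rho)
  also have "rt ^ kk * rt ^ kk = \<sigma> \<pi> ^ kk" by (simp add: rt(1) flip: power_mult_distrib)
  also have "smult (\<sigma> \<pi> ^ kk) (act ?g (toP v)) = (\<Sum>i\<le>kk. smult (coeff (toP v) i) ([:- \<sigma> t, \<sigma> \<pi>:] ^ i))"
    unfolding act_def hom_form_def smult_sum_right
  proof (intro sum.cong refl)
    fix i assume "i \<in> {..kk}"
    then have pw: "\<sigma> \<pi> ^ kk = \<sigma> \<pi> ^ i * \<sigma> \<pi> ^ (kk - i)" by (simp flip: power_add)
    have s1: "\<sigma> (1 / \<pi>) = inverse (\<sigma> \<pi>)" "\<sigma> (- t / \<pi>) = - \<sigma> t * inverse (\<sigma> \<pi>)"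
      by (simp_all add: divide_inverse S.mult S.inverse S.minus S.one)
    have lin: "[:- \<sigma> t, \<sigma> \<pi>:] = smult (\<sigma> \<pi>) [:- \<sigma> t * inverse (\<sigma> \<pi>), 1:]" using nz by simp
    have "smult (\<sigma> \<pi> ^ kk) (smult (coeff (toP v) i) ([:inverse (\<sigma> \<pi>), 0:] ^ (kk - i) * [:- \<sigma> t * inverse (\<sigma> \<pi>), 1:] ^ i))
        = smult (coeff (toP v) i) (smult (\<sigma> \<pi> ^ i) ([:- \<sigma> t * inverse (\<sigma> \<pi>), 1:] ^ i))"
      unfolding pw using nz by (simp add: poly_const_pow power_inverse mult.commute mult.left_commute)
    also have "smult (\<sigma> \<pi> ^ i) ([:- \<sigma> t * inverse (\<sigma> \<pi>), 1:] ^ i) = [:- \<sigma> t, \<sigma> \<pi>:] ^ i"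
      unfolding lin smult_power ..
    finally show "smult (\<sigma> \<pi> ^ kk) (smult (coeff (toP v) i)
        ([:\<sigma> (?g $ 1 $ 1), \<sigma> (?g $ 2 $ 1):] ^ (kk - i) * [:\<sigma> (?g $ 1 $ 2), \<sigma> (?g $ 2 $ 2):] ^ i))
        = smult (coeff (toP v) i) ([:- \<sigma> t, \<sigma> \<pi>:] ^ i)"
      unfolding mat2_nth s1 S.zero S.one .
  qed
  also have "\<dots> = pcompose (toP v) [:- \<sigma> t, \<sigma> \<pi>:]" using pcompose_eq_sum[OF degree_toP] by simp
  finally show ?thesis .
qed

section \<open>Expansions as sums over words\<close>

lemma digits_D: "\<mu> \<in> digits D n \<Longrightarrow> \<exists>w\<in>lists R.TT. n = length w \<and> \<mu> = digit_sum w"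
  unfolding digits_eq by blast

text \<open>Evaluation at the inverse of a vertex isolates its coefficient: the \<open>g1\<close>
  terms and the other vertices lie in different cosets.\<close>

lemma expansion_value:
  assumes ex: "is_expansion D k f v0 v1" and w: "w \<in> lists R.TT"
  shows "f (matrix_inv (vertex w)) = v0 (length w) (digit_sum w)"
proof -
  define I where "I = {(n, \<mu>). v0 n \<mu> \<noteq> 0 \<or> v1 n \<mu> \<noteq> 0}"
  define h where "h = matrix_inv (vertex w)"
  have fin: "finite I" and f: "f = (\<Sum>(n, \<mu>)\<in>I. elem D k (g0 D n \<mu>) (v0 n \<mu>) + elem D k (g1 D n \<mu>) (v1 n \<mu>))"
    and wt: "v0 n \<mu> \<in> weight D k" and off: "\<mu> \<notin> digits D n \<Longrightarrow> v0 n \<mu> = 0 \<and> v1 n \<mu> = 0" for n \<mu>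
    using ex unfolding is_expansion_def I_def by blast+
  have dig: "\<exists>z\<in>lists R.TT. n = length z \<and> \<mu> = digit_sum z" if "(n, \<mu>) \<in> I" for n \<mu>
    using that off[of \<mu> n] unfolding I_def by (intro digits_D) auto
  have g1: "elem D k (g1 D n \<mu>) (v1 n \<mu>) h = 0" if i: "(n, \<mu>) \<in> I" for n \<mu>
  proof -
    obtain z where z: "z \<in> lists R.TT" "\<mu> = digit_sum z" using dig[OF i] by blast
    have "h ** g1 D n \<mu> \<notin> KZ D" unfolding h_def vertex_def z(2) by (rule g0_inv_g1[OF digit_sum_le1[OF w] digit_sum_le1[OF z(1)]])
    then show ?thesis by (simp add: elem_def)
  qed
  have g0: "elem D k (g0 D n \<mu>) (v0 n \<mu>) h = 0" if i: "(n, \<mu>) \<in> I" "(n, \<mu>) \<noteq> (length w, digit_sum w)" for n \<mu>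
  proof -
    obtain z where z: "z \<in> lists R.TT" "n = length z" "\<mu> = digit_sum z" using dig[OF i(1)] by blast
    have "h ** vertex z \<notin> KZ D" unfolding h_def using vertex_distinct[OF w z(1)] i(2) z by auto
    then show ?thesis by (simp add: elem_def z vertex_def)
  qed
  have self: "elem D k (vertex w) (v0 (length w) (digit_sum w)) h = v0 (length w) (digit_sum w)"
    using rho_1[OF wt] KZ_1 by (simp add: elem_def h_def matrix_inv_GL2(2)[OF vertex_GL2])
  have "f h = (\<Sum>(n, \<mu>)\<in>I. elem D k (g0 D n \<mu>) (v0 n \<mu>) h + elem D k (g1 D n \<mu>) (v1 n \<mu>) h)"
    unfolding f by (subst sum_fun_apply) (intro sum.cong refl, simp add: case_prod_beta)
  also have "\<dots> = (\<Sum>(n, \<mu>)\<in>I. elem D k (g0 D n \<mu>) (v0 n \<mu>) h)"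
  proof (intro sum.cong refl)
    fix x assume x: "x \<in> I"
    obtain n \<mu> where n: "x = (n, \<mu>)" by (cases x)
    have e: "elem D k (g1 D n \<mu>) (v1 n \<mu>) h = 0" using g1 x unfolding n by blast
    show "(case x of (n, \<mu>) \<Rightarrow> elem D k (g0 D n \<mu>) (v0 n \<mu>) h + elem D k (g1 D n \<mu>) (v1 n \<mu>) h)
        = (case x of (n, \<mu>) \<Rightarrow> elem D k (g0 D n \<mu>) (v0 n \<mu>) h)"
      unfolding n prod.case e by (rule add_0_right)
  qed
  also have "\<dots> = v0 (length w) (digit_sum w)"
  proof (cases "(length w, digit_sum w) \<in> I")
    case True
    then have "(\<Sum>(n, \<mu>)\<in>I. elem D k (g0 D n \<mu>) (v0 n \<mu>) h)
        = (\<Sum>(n, \<mu>)\<in>{(length w, digit_sum w)}. elem D k (g0 D n \<mu>) (v0 n \<mu>) h)"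
      using fin g0 by (intro sum.mono_neutral_right) auto
    then show ?thesis using self by (simp add: vertex_def)
  next
    case False
    then have "(\<Sum>(n, \<mu>)\<in>I. elem D k (g0 D n \<mu>) (v0 n \<mu>) h) = 0"
      using g0 by (intro sum.neutral) auto
    moreover have "v0 (length w) (digit_sum w) = 0" using False by (simp add: I_def)
    ultimately show ?thesis by simp
  qed
  finally show ?thesis unfolding h_def .
qed

lemma word_sum:
  assumes off: "\<And>n \<mu>. \<mu> \<notin> digits D n \<Longrightarrow> v0 n \<mu> = 0"
    and W: "W = {w \<in> lists R.TT. v0 (length w) (digit_sum w) \<noteq> 0}"
  shows "finite {(n, \<mu>). v0 n \<mu> \<noteq> 0} \<longleftrightarrow> finite W"
    and "(\<Sum>(n, \<mu>)\<in>{(n, \<mu>). v0 n \<mu> \<noteq> 0}. elem D k (g0 D n \<mu>) (v0 n \<mu>))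
      = (\<Sum>w\<in>W. elem D k (vertex w) (v0 (length w) (digit_sum w)))"
proof -
  define I where "I = {(n, \<mu>). v0 n \<mu> \<noteq> 0}"
  have inj: "inj_on (\<lambda>w. (length w, digit_sum w)) W"
  proof (rule inj_onI)
    fix w w' assume "w \<in> W" "w' \<in> W" "(length w, digit_sum w) = (length w', digit_sum w')"
    then show "w = w'" using W by (intro digit_sum_inj) auto
  qed
  have img: "I = (\<lambda>w. (length w, digit_sum w)) ` W"
  proof (intro set_eqI iffI)
    fix x assume x: "x \<in> I"
    obtain n \<mu> where n: "x = (n, \<mu>)" by (cases x)
    have nz: "v0 n \<mu> \<noteq> 0" using x unfolding n I_def by simp
    obtain w where w: "w \<in> lists R.TT" "n = length w" "\<mu> = digit_sum w" using digits_D[of \<mu> n] off nz by blast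
    then show "x \<in> (\<lambda>w. (length w, digit_sum w)) ` W" using nz n W by (intro rev_image_eqI[of w]) simp_all
  qed (auto simp: I_def W)
  show "finite {(n, \<mu>). v0 n \<mu> \<noteq> 0} \<longleftrightarrow> finite W"
    unfolding I_def[symmetric] img using finite_image_iff[OF inj] .
  show "(\<Sum>(n, \<mu>)\<in>{(n, \<mu>). v0 n \<mu> \<noteq> 0}. elem D k (g0 D n \<mu>) (v0 n \<mu>))
      = (\<Sum>w\<in>W. elem D k (vertex w) (v0 (length w) (digit_sum w)))"
    unfolding I_def[symmetric] img sum.reindex[OF inj] by (simp add: vertex_def)
qed

lemma zero_supp_words:
  assumes "f \<in> zero_supp D k"
  obtains v0 where "is_expansion D k f v0 (\<lambda>n \<mu>. 0)"
    "finite {w \<in> lists R.TT. v0 (length w) (digit_sum w) \<noteq> 0}"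
    "f = (\<Sum>w\<in>{w \<in> lists R.TT. v0 (length w) (digit_sum w) \<noteq> 0}. elem D k (vertex w) (v0 (length w) (digit_sum w)))"
proof -
  obtain v0 v1 where ex: "is_expansion D k f v0 v1" and v1: "\<forall>n \<mu>. v1 n \<mu> = 0"
    using assms unfolding zero_supp_def by blast
  have v10: "v1 = (\<lambda>n \<mu>. 0)" using v1 by (intro ext) metis
  have idx: "{(n, \<mu>). v0 n \<mu> \<noteq> 0 \<or> v1 n \<mu> \<noteq> 0} = {(n, \<mu>). v0 n \<mu> \<noteq> 0}" using v1 by blast
  have off: "\<And>n \<mu>. \<mu> \<notin> digits D n \<Longrightarrow> v0 n \<mu> = 0" and fin: "finite {(n, \<mu>). v0 n \<mu> \<noteq> 0}"
    and f: "f = (\<Sum>(n, \<mu>)\<in>{(n, \<mu>). v0 n \<mu> \<noteq> 0}. elem D k (g0 D n \<mu>) (v0 n \<mu>) + elem D k (g1 D n \<mu>) (v1 n \<mu>))"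
    using ex unfolding is_expansion_def idx by blast+
  have e: "elem D k (g1 D n \<mu>) (v1 n \<mu>) = 0" for n \<mu> unfolding v1[rule_format] by (rule elem_zero)
  have "f = (\<Sum>(n, \<mu>)\<in>{(n, \<mu>). v0 n \<mu> \<noteq> 0}. elem D k (g0 D n \<mu>) (v0 n \<mu>))"
    unfolding f e add_0_right ..
  then show ?thesis using that[OF ex[unfolded v10]] word_sum[OF off refl] fin by simp
qed

lemma word_sum_ball:
  assumes off: "\<And>n \<mu>. \<mu> \<notin> digits D n \<Longrightarrow> v0 n \<mu> = 0" and wt: "\<And>n \<mu>. v0 n \<mu> \<in> weight D k"
    and fin: "finite W" and W: "W = {w \<in> lists R.TT. v0 (length w) (digit_sum w) \<noteq> 0}"
    and M: "\<And>n \<mu>. M < n \<Longrightarrow> v0 n \<mu> = 0"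
  shows "(\<Sum>w\<in>W. elem D k (vertex w) (v0 (length w) (digit_sum w))) \<in> ball_supp D k M"
proof -
  have zw: "0 \<in> weight D k" using KZ_stable_weight unfolding KZ_stable_def by blast
  have "is_expansion D k (\<Sum>w\<in>W. elem D k (vertex w) (v0 (length w) (digit_sum w))) v0 (\<lambda>n \<mu>. 0)"
    unfolding is_expansion_def elem_zero add_0_right simp_thms
    using word_sum[OF off W] fin wt off zw by simp
  moreover have "(\<Sum>w\<in>W. elem D k (vertex w) (v0 (length w) (digit_sum w))) \<in> c_ind D k (weight D k)"
    using fin wt by (intro elem_sum_c_ind[OF KZ_stable_weight] vertex_GL2) auto
  ultimately show ?thesis unfolding ball_supp_def using M by blast
qed

lemma smul_elem_sum: "smul c (\<Sum>i\<in>I. elem D k (G i) (V i)) = (\<Sum>i\<in>I. elem D k (G i) (\<lambda>j. c * V i j))"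
proof (intro ext)
  fix h j
  have "c * elem D k (G i) (V i) h j = elem D k (G i) (\<lambda>j. c * V i j) h j" for i
    by (simp add: elem_def rho_scale)
  then show "smul c (\<Sum>i\<in>I. elem D k (G i) (V i)) h j = (\<Sum>i\<in>I. elem D k (G i) (\<lambda>j. c * V i j)) h j"
    unfolding smul_def sum_fun_apply sum_distrib_left by simp
qed

text \<open>Only neighbours lie in the double coset, and for f in B^0 those carrying a value are the
  parent \<open>w\<close> and the children \<open>s # t # w\<close>. The hypothesis
  \<open>V0\<close> allows enlarging or shrinking the index set to exactly these.\<close>

lemma hecke_at_vertex:
  assumes W: "finite W" "W \<subseteq> lists R.TT" and V: "\<And>w. V w \<in> weight D k"
    and V0: "\<And>w. w \<in> lists R.TT \<Longrightarrow> V w \<noteq> 0 \<longleftrightarrow> w \<in> W"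
    and w: "w \<in> lists R.TT" and t: "t \<in> R.TT"
  shows "toP (hecke D k (\<Sum>w\<in>W. elem D k (vertex w) (V w)) (matrix_inv (vertex (t # w))))
    = pcompose (toP (V w)) [:- \<sigma> t, \<sigma> \<pi>:]
      + (\<Sum>s\<in>R.TT. \<Sum>i\<le>kk. smult (coeff (toP (V (s # t # w))) i * \<sigma> \<pi> ^ (kk - i)) ([:\<sigma> s, 1:] ^ i))"
proof -
  define z h where "z = t # w" and "h = matrix_inv (vertex z)"
  have z: "z \<in> lists R.TT" using w t by (simp add: z_def)
  define P where "P = insert w ((\<lambda>s. s # z) ` R.TT)"
  have PT: "P \<subseteq> lists R.TT" using w z by (auto simp: P_def)
  have finP: "finite P" using R.finite_TT by (simp add: P_def)
  have "hecke D k (\<Sum>w\<in>W. elem D k (vertex w) (V w)) h = (\<Sum>u\<in>W. psi0 (h ** vertex u) (V u))"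
  proof (rule hecke_elem_sum[OF W(1) vertex_GL2 V])
    show "V u \<noteq> 0" if "u \<in> W" for u using V0[of u] W(2) that by blast
    show "i = j" if "i \<in> W" "j \<in> W" "matrix_inv (vertex i) ** vertex j \<in> KZ D" for i j
      using vertex_distinct[OF _ _ that(3)] that(1,2) W(2) by blast
    show "h \<in> GL2" unfolding h_def by (rule matrix_inv_GL2(3)[OF vertex_GL2])
  qed
  also have "\<dots> = (\<Sum>u\<in>P. psi0 (h ** vertex u) (V u))"
  proof (rule sum.mono_neutral_cong[OF finP W(1)])
    fix u assume u: "u \<in> W - P"
    have uT: "u \<in> lists R.TT" using u W(2) by blast
    have "h ** vertex u \<notin> DC"
    proof
      assume "h ** vertex u \<in> DC"
      from vertex_neighbour[OF z uT this[unfolded h_def]] have "u \<in> P" by (auto simp: P_def z_def)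
      then show False using u by blast
    qed
    then show "psi0 (h ** vertex u) (V u) = 0" by (simp add: psi0_def)
  next
    fix u assume u: "u \<in> P - W"
    then have "V u = 0" using V0[of u] PT by blast
    then show "psi0 (h ** vertex u) (V u) = 0" by (simp only: psi0_zero)
  qed simp
  also have "\<dots> = psi0 (h ** vertex w) (V w) + (\<Sum>s\<in>R.TT. psi0 (h ** vertex (s # z)) (V (s # z)))"
  proof -
    have "w \<notin> (\<lambda>s. s # z) ` R.TT" by (auto simp: z_def dest: arg_cong[of _ _ length])
    then have "(\<Sum>u\<in>P. psi0 (h ** vertex u) (V u))
        = psi0 (h ** vertex w) (V w) + (\<Sum>u\<in>(\<lambda>s. s # z) ` R.TT. psi0 (h ** vertex u) (V u))"
      unfolding P_def using R.finite_TT by (intro sum.insert) simp_all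
    also have "(\<Sum>u\<in>(\<lambda>s. s # z) ` R.TT. psi0 (h ** vertex u) (V u)) = (\<Sum>s\<in>R.TT. psi0 (h ** vertex (s # z)) (V (s # z)))"
      by (subst sum.reindex) (simp_all add: inj_on_def)
    finally show ?thesis .
  qed
  finally have e: "hecke D k (\<Sum>w\<in>W. elem D k (vertex w) (V w)) h
      = psi0 (mat2 (1 / \<pi>) (- t / \<pi>) 0 1) (V w) + (\<Sum>s\<in>R.TT. psi0 (mat2 \<pi> s 0 1) (V (s # z)))"
    unfolding h_def vertex_up unfolding z_def vertex_down .
  have "toP (hecke D k (\<Sum>w\<in>W. elem D k (vertex w) (V w)) h)
    = pcompose (toP (V w)) [:- \<sigma> t, \<sigma> \<pi>:]
      + (\<Sum>s\<in>R.TT. \<Sum>i\<le>kk. smult (coeff (toP (V (s # z))) i * \<sigma> \<pi> ^ (kk - i)) ([:\<sigma> s, 1:] ^ i))"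
    unfolding e toP_add toP_sum toP_psi0_down[OF R.TT_le1[OF t]]
    by (intro arg_cong2[of _ _ _ _ "(+)"] refl sum.cong toP_psi0_up R.TT_le1)
  then show ?thesis unfolding h_def z_def .
qed

text \<open>The tree bound is applied below each word \<open>w0\<close> of length N. The part in B_N
  vanishes at longer words, so there the error is at most |\<pi>|^n. The bound includes
  \<open>w0\<close> itself, which is why only words of length at most N - 1 remain
  uncontrolled.\<close>

lemma separated_of_tree:
  assumes tree: "hecke_tree NC (\<sigma> \<pi>) a (\<sigma> ` R.TT) p (res_card D) d r kk"
    and cond: "NF \<pi> \<le> NC a \<or> NF \<pi> ^ Suc r \<le> NC a * NC a"
  shows "separated D k a"
proof -
  interpret T: hecke_tree NC "\<sigma> \<pi>" a "\<sigma> ` R.TT" p "res_card D" d r kk by (rule tree)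
  have inj: "inj \<sigma>" by (rule injI) (simp add: S.eq_iff)
  obtain C where C: "0 < C" "\<And>f M \<eta>. hecke_solution NC (\<sigma> \<pi>) a (\<sigma> ` R.TT) p (res_card D) d r kk f M \<eta> \<Longrightarrow>
      \<forall>w\<in>lists (\<sigma> ` R.TT). \<forall>j. NC (coeff (f w) j) \<le> C * \<eta>"
    using T.tree_bound cond unfolding absC_emb[OF sig] by blast
  \<comment> \<open>The loss \<epsilon>: a power of |\<pi>|^-1 that absorbs the constant of the tree
    bound, independent of n and f.\<close>
  obtain e :: nat where e: "C < (1 / NF \<pi>) ^ e"
    using real_arch_pow[of "1 / NF \<pi>" C] unif_pos unif_less1 by auto
  have "f \<in> ball_plus_lattice D k (N - 1) (int n - int e)"
    if N: "1 \<le> N" and f0: "f \<in> zero_supp D k"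
      and hf: "hecke D k f - smul a f \<in> ball_plus_lattice D k N (int n)" for N n f
  proof -
    obtain v0 where ex: "is_expansion D k f v0 (\<lambda>n \<mu>. 0)"
      and finW: "finite {w \<in> lists R.TT. v0 (length w) (digit_sum w) \<noteq> 0}"
      and f: "f = (\<Sum>w\<in>{w \<in> lists R.TT. v0 (length w) (digit_sum w) \<noteq> 0}. elem D k (vertex w) (v0 (length w) (digit_sum w)))"
      by (rule zero_supp_words[OF f0])
    define V W where "V w = v0 (length w) (digit_sum w)" and "W = {w \<in> lists R.TT. v0 (length w) (digit_sum w) \<noteq> 0}" for w
    have fW: "f = (\<Sum>w\<in>W. elem D k (vertex w) (V w))" unfolding W_def V_def by (rule f)
    have W: "finite W" "W \<subseteq> lists R.TT" using finW by (auto simp: W_def)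
    have wt: "\<And>n \<mu>. v0 n \<mu> \<in> weight D k" and off: "\<And>n \<mu>. \<mu> \<notin> digits D n \<Longrightarrow> v0 n \<mu> = 0"
      using ex unfolding is_expansion_def by blast+
    have Vwt: "V w \<in> weight D k" for w unfolding V_def by (rule wt)
    have VW: "V w \<noteq> 0 \<longleftrightarrow> w \<in> W" if "w \<in> lists R.TT" for w using that by (simp add: V_def W_def)
    obtain M where M: "\<And>n \<mu>. M < n \<Longrightarrow> v0 n \<mu> = 0"
    proof -
      have "finite {(n, \<mu>). v0 n \<mu> \<noteq> 0}" using word_sum(1)[OF off W_def] W(1) by simp
      then have "finite (fst ` {(n, \<mu>). v0 n \<mu> \<noteq> 0})" by simp
      then obtain M where "\<forall>n\<in>fst ` {(n, \<mu>). v0 n \<mu> \<noteq> 0}. n \<le> M" using finite_nat_set_iff_bounded_le by blast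
      then have "v0 n \<mu> = 0" if "M < n" for n \<mu> using that by force
      then show ?thesis using that by blast
    qed
    define \<eta> where "\<eta> = NF \<pi> powi int n"
    obtain b h where bh: "hecke D k f - smul a f = b + smul (base_emb D \<pi> powi int n) h"
      and b: "b \<in> ball_supp D k N" and h: "h \<in> c_ind D k (weight_lattice D k)"
      using hf unfolding ball_plus_lattice_def by blast
    have Nb: "NC (base_emb D \<pi> powi m) = NF \<pi> powi m" for m
      by (simp add: C.N_power_int absC_emb[OF base_emb])
    have small: "NC ((hecke D k f - smul a f) (matrix_inv (vertex w)) i) \<le> \<eta>"
      if w: "w \<in> lists R.TT" "N < length w" for w i
    proof -
      obtain b0 b1 where "is_expansion D k b b0 b1" "\<forall>n \<mu>. n > N \<longrightarrow> b0 n \<mu> = 0"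
        using b unfolding ball_supp_def by blast
      then have b_0: "b (matrix_inv (vertex w)) = 0" using expansion_value[OF _ w(1)] w(2) by metis
      have "h (matrix_inv (vertex w)) \<in> weight_lattice D k"
        using h matrix_inv_GL2(3)[OF vertex_GL2] unfolding c_ind_def by blast
      then have "NC (h (matrix_inv (vertex w)) i) \<le> 1" by (simp add: weight_lattice_def int_ring_def)
      then have "NC (base_emb D \<pi> powi int n * h (matrix_inv (vertex w)) i) \<le> \<eta> * 1"
        by (intro C.N_mult_le) (simp only: Nb \<eta>_def, simp)
      moreover have "(hecke D k f - smul a f) (matrix_inv (vertex w)) i
          = base_emb D \<pi> powi int n * h (matrix_inv (vertex w)) i"
        unfolding bh using b_0 by (simp add: smul_def)
      ultimately show ?thesis by simp
    qed
    have bound: "NC (coeff (toP (V (u @ w0))) j) \<le> C * \<eta>"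
      if w0: "w0 \<in> lists R.TT" "length w0 = N" and u: "u \<in> lists R.TT" for w0 u j
    proof -
      \<comment> \<open>The tree argument uses words over the image of \<sigma>, hence the inverse
        of \<sigma>; appending \<open>w0\<close> makes it the root of its subtree.\<close>
      define f' where "f' w = toP (V (map (inv \<sigma>) w @ w0))" for w
      have "hecke_solution NC (\<sigma> \<pi>) a (\<sigma> ` R.TT) p (res_card D) d r kk f' M \<eta>"
      proof unfold_locales
        show "degree (f' w) \<le> kk" for w unfolding f'_def by (rule degree_toP)
        show "f' w = 0" if "M < length w" for w
        proof -
          have "V (map (inv \<sigma>) w @ w0) = 0" unfolding V_def using that by (intro M) simp
          then show ?thesis unfolding f'_def by (simp only: toP_zero)
        qed
        fix cw ct j assume cw: "cw \<in> lists (\<sigma> ` R.TT)" and ct: "ct \<in> \<sigma> ` R.TT"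
        obtain t where t: "t \<in> R.TT" "ct = \<sigma> t" using ct by blast
        define w where "w = map (inv \<sigma>) cw @ w0"
        have wT: "w \<in> lists R.TT"
          unfolding w_def using cw w0(1) by (auto simp: in_lists_conv_set inv_f_f[OF inj])
        define x where "x = matrix_inv (vertex (t # w))"
        have fx: "f x = V (t # w)"
          unfolding x_def V_def using wT t by (intro expansion_value[OF ex]) simp
        have "toP (hecke D k f x) = T.Tp ct (f' cw) + (\<Sum>s\<in>R.TT. T.Tm (\<sigma> s) (f' (\<sigma> s # ct # cw)))"
          using hecke_at_vertex[OF W Vwt VW wT t(1)] unfolding fW x_def T.Tp_def T.Tm_def f'_def t(2)
          by (simp add: inv_f_f[OF inj] w_def)
        also have "(\<Sum>s\<in>R.TT. T.Tm (\<sigma> s) (f' (\<sigma> s # ct # cw))) = (\<Sum>s\<in>\<sigma> ` R.TT. T.Tm s (f' (s # ct # cw)))"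
          by (subst sum.reindex) (simp_all add: inj_on_subset[OF inj])
        finally have "T.Tp ct (f' cw) + (\<Sum>s\<in>\<sigma> ` R.TT. T.Tm s (f' (s # ct # cw))) - smult a (f' (ct # cw))
            = toP (hecke D k f x) - smult a (toP (f x))"
          unfolding fx by (simp add: f'_def t(2) inv_f_f[OF inj] w_def)
        moreover have "NC (coeff (toP (hecke D k f x) - smult a (toP (f x))) j) \<le> \<eta>"
        proof (cases "j \<le> kk")
          case True
          have "N < length (t # w)" using w0(2) by (simp add: w_def)
          then have "NC ((hecke D k f - smul a f) x (ee j)) \<le> \<eta>"
            unfolding x_def using wT t by (intro small) simp_all
          then show ?thesis using True by (simp add: coeff_toP smul_def)
        next
          case False
          then show ?thesis using unif_pos by (simp add: coeff_toP \<eta>_def)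
        qed
        ultimately show "NC (coeff (T.Tp ct (f' cw) + (\<Sum>s\<in>\<sigma> ` R.TT. T.Tm s (f' (s # ct # cw)))
            - smult a (f' (ct # cw))) j) \<le> \<eta>" by simp
      qed
      from C(2)[OF this] have "NC (coeff (f' (map \<sigma> u)) j) \<le> C * \<eta>"
        using u by (auto simp: in_lists_conv_set)
      then show ?thesis by (simp add: f'_def o_def inv_f_f[OF inj])
    qed
    define c where "c = base_emb D \<pi> powi (int n - int e)"
    have Nc: "NC c = NF \<pi> powi (int n - int e)" unfolding c_def by (rule Nb)
    have c0: "c \<noteq> 0" using Nc unif_pos by auto
    have Ce: "C * \<eta> \<le> NC c"
    proof -
      have "C * \<eta> \<le> (1 / NF \<pi>) ^ e * \<eta>" using e unif_pos by (intro mult_right_mono) (simp_all add: \<eta>_def)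
      also have "\<dots> = NC c" unfolding Nc \<eta>_def using unif_nz by (simp add: power_int_diff power_divide)
      finally show ?thesis .
    qed
    have big: "NC (V w i) \<le> NC c" if w: "w \<in> lists R.TT" "N \<le> length w" for w i
    proof (cases "i \<in> monomials D k")
      case True
      then obtain j where j: "j \<le> kk" "i = ee j" unfolding monomials_eq by auto
      define u w0 where "u = take (length w - N) w" and "w0 = drop (length w - N) w"
      have uw: "w = u @ w0" "length w0 = N" using w(2) by (simp_all add: u_def w0_def)
      have "u \<in> lists R.TT" "w0 \<in> lists R.TT" using w(1) unfolding uw(1) by simp_all
      then have "NC (coeff (toP (V w)) j) \<le> C * \<eta>" unfolding uw(1) using uw(2) by (intro bound)
      then show ?thesis using j Ce by (simp add: coeff_toP)
    next
      case False
      then show ?thesis using Vwt[of w] by (simp add: weight_def)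
    qed
    define W1 W2 where "W1 = {w \<in> W. length w \<le> N - 1}" and "W2 = {w \<in> W. N \<le> length w}"
    have split: "W = W1 \<union> W2" "W1 \<inter> W2 = {}" using N by (auto simp: W1_def W2_def)
    have fin12: "finite W1" "finite W2" using W(1) by (simp_all add: W1_def W2_def)
    have "(\<Sum>w\<in>W1. elem D k (vertex w) (V w)) \<in> ball_supp D k (N - 1)"
    proof -
      define v' where "v' n \<mu> = (if n \<le> N - 1 then v0 n \<mu> else 0)" for n \<mu>
      have W1': "W1 = {w \<in> lists R.TT. v' (length w) (digit_sum w) \<noteq> 0}" by (auto simp: W1_def W_def v'_def)
      have zw: "0 \<in> weight D k" using KZ_stable_weight unfolding KZ_stable_def by blast
      have "(\<Sum>w\<in>W1. elem D k (vertex w) (v' (length w) (digit_sum w))) \<in> ball_supp D k (N - 1)"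
        using off wt zw fin12(1) by (intro word_sum_ball[OF _ _ _ W1']) (auto simp: v'_def)
      moreover have "(\<Sum>w\<in>W1. elem D k (vertex w) (v' (length w) (digit_sum w))) = (\<Sum>w\<in>W1. elem D k (vertex w) (V w))"
        by (intro sum.cong refl) (simp add: W1_def v'_def V_def)
      ultimately show ?thesis by simp
    qed
    moreover have "(\<Sum>w\<in>W2. elem D k (vertex w) (\<lambda>i. V w i / c)) \<in> c_ind D k (weight_lattice D k)"
    proof (rule elem_sum_c_ind[OF KZ_stable_lattice fin12(2) vertex_GL2])
      fix w assume w: "w \<in> W2"
      have "NC (V w i / c) \<le> 1" for i
        using big[of w i] w W(2) c0 by (auto simp: W2_def C.N_divide)
      then show "(\<lambda>i. V w i / c) \<in> weight_lattice D k"
        using Vwt[of w] by (simp add: weight_lattice_def weight_def int_ring_def)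
    qed
    moreover have "f = (\<Sum>w\<in>W1. elem D k (vertex w) (V w)) + smul c (\<Sum>w\<in>W2. elem D k (vertex w) (\<lambda>i. V w i / c))"
      unfolding smul_elem_sum fW split(1) sum.union_disjoint[OF fin12 split(2)] using c0 by simp
    ultimately show ?thesis unfolding ball_plus_lattice_def c_def by blast
  qed
  then show ?thesis unfolding separated_def by (intro exI[of _ 1]) auto
qed

end

theorem theorem4p19:
  fixes D :: "('k::field_char_0, 'f::field, 'c::field) padic_data"
    and k :: "('f \<Rightarrow> 'c) \<Rightarrow> nat"
    and \<sigma> :: "'f \<Rightarrow> 'c"
    and a :: 'c
    and d r :: nat
  assumes "padic_setting D"
    and "\<sigma> \<in> embeddings D"
    and "\<forall>\<tau>\<in>embeddings D. \<tau> \<noteq> \<sigma> \<longrightarrow> k \<tau> = 0"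
    and "real (k \<sigma>) \<le> (real (res_card D))\<^sup>2 / 2"
    and "k \<sigma> = d * res_card D + r"
    and "int r < int (res_card D) - int d"
    and "a \<in> int_ring (absC D)"
    and "0 < valF D a" and "valF D a \<le> ereal (real (ram_index D))"
    and "(0 < valF D a \<and> valF D a \<le> 1) \<or> 2 * valF D a - 1 \<le> ereal (real r)"
  shows "separated D k a"
proof -
  interpret weight_setting D k \<sigma>
  proof (intro weight_setting.intro weight_setting_axioms.intro)
    show "padic_setting D" "\<sigma> \<in> embeddings D" by fact+
    show "0 < res_card D" using assms(6) by linarith
  qed (use assms(3) in blast)
  note val = valF_facts[OF assms(8,9)]
  have "hecke_tree NC (\<sigma> \<pi>) a (\<sigma> ` R.TT) p (res_card D) d r kk"
  proof unfold_locales
    have inj: "inj_on \<sigma> R.TT" by (rule inj_onI) (simp add: S.eq_iff)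
    show "finite (\<sigma> ` R.TT)" using R.finite_TT by simp
    show "card (\<sigma> ` R.TT) = res_card D" using card_image[OF inj] R.card_TT by simp
    show "2 \<le> res_card D" by (rule R.q_ge2)
    show "t ^ res_card D = t" if "t \<in> \<sigma> ` R.TT" for t
      using that by (auto simp: R.TT_def simp flip: S.power)
    show "NC (s - t) = 1" if st: "s \<in> \<sigma> ` R.TT" "t \<in> \<sigma> ` R.TT" "s \<noteq> t" for s t
    proof -
      obtain x y where "x \<in> R.TT" "y \<in> R.TT" "s = \<sigma> x" "t = \<sigma> y" using st(1,2) by blast
      then show ?thesis using R.TT_sep[of x y] st(3) by (auto simp: absC_emb[OF sig] simp flip: S.diff)
    qed
    show "0 \<in> \<sigma> ` R.TT" using R.TT_0 S.zero by (metis imageI)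
    show "0 < NC (\<sigma> \<pi>)" "NC (\<sigma> \<pi>) < 1" using unif_pos unif_less1 by (simp_all add: absC_emb[OF sig])
    show "0 < NC a" "NC a < 1" using val(1,2) by simp_all
    have "NC (of_nat p) = NF (of_nat p)" using absC_emb[OF sig, of "of_nat p"] by (simp add: S.of_nat)
    then show "NC (of_nat p) \<le> NC a" "NC (of_nat p) \<le> NC (\<sigma> \<pi>)"
      using val(3) NF_less1[OF absF_p(1)] by (simp_all add: absC_emb[OF sig])
    show "p dvd (res_card D choose i)" if "0 < i" "i < res_card D" for i
      by (rule dvd_of_absF_less1[OF R.N_binom_q[OF that]])
    show "kk = d * res_card D + r" by fact
    show "r + d < res_card D" using assms(6) by linarith
  qed
  moreover have "NF \<pi> \<le> NC a \<or> NF \<pi> ^ Suc r \<le> NC a * NC a" using assms(10) val(4,5) by blast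
  ultimately show ?thesis by (rule separated_of_tree)
qed

end
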